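(* Let $p>3$ be a prime and let $u,v$ denote integers. Then: (1) $\left(\frac{-3}p\right)\sum_{n=0}^{p-1}G_n^{(4)}\equiv\left(\frac6p\right)\sum_{n=0}^{p-1}\frac{G_n^{(4)}}{4096^n}\equiv 2u\pmod p$ if $p=u^2+7v^2\equiv1,2,4\pmod7$ with $\left(\frac u7\right)=1$, and $\equiv0\pmod p$ if $p\equiv3,5,6\pmod7$; (2) $\left(\frac6p\right)\sum_{n=0}^{p-1}\frac{G_n^{(4)}}{(-8)^n}\equiv\left(\frac3p\right)\sum_{n=0}^{p-1}\frac{G_n^{(4)}}{(-512)^n}\equiv 2u\pmod p$ if $p=u^2+4v^2\equiv1\pmod4$ with $4\mid u-1$, and $\equiv0\pmod p$ if $p\equiv3\pmod4$; (3) $\sum_{n=0}^{p-1}\frac{G_n^{(4)}}{16^n}\equiv\left(\frac{-2}p\right)\sum_{n=0}^{p-1}\frac{G_n^{(4)}}{256^n}\equiv 2u\pmod p$ if $p=u^2+3v^2\equiv1\pmod3$ with $3\mid u-1$, and $\equiv0\pmod p$ if $p\equiv2\pmod3$; (4) $\sum_{n=0}^{p-1}\frac{G_n^{(4)}}{(-64)^n}\equiv(-1)^{[p/8]+\frac{p-1}2}2u\pmod p$ if $p=u^2+2v^2\equiv1,3\pmod8$ with $4\mid u-1$, and $\equiv0\pmod p$ if $p\equiv5,7\pmod8$.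
   Context: $G_n^{(4)}=\sum_{k=0}^n\binom nk(-1)^k\binom{2k}k\binom{4k}{2k}64^{n-k}$. $\left(\frac{\cdot}{p}\right)$ is the Legendre symbol and $[y]$ the floor of $y$. Congruences are in the ring of rationals with denominator prime to $p$. *)

theory Defs
  imports "HOL-Number_Theory.Number_Theory"
begin

text \<open>The ring of rationals with denominator prime to \<open>p\<close>; \<^const>\<open>quotient_of\<close> returns
  the fraction in lowest terms.\<close>

definition p_integers :: "nat \<Rightarrow> rat set" where
  "p_integers p = {x. coprime (snd (quotient_of x)) (int p)}"

definition pcong :: "nat \<Rightarrow> rat \<Rightarrow> rat \<Rightarrow> bool" where
  "pcong p x y \<longleftrightarrow>
     x \<in> p_integers p \<and> y \<in> p_integers p \<and> (\<exists>z\<in>p_integers p. x - y = of_nat p * z)"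

definition G4 :: "nat \<Rightarrow> int" where
  "G4 n = (\<Sum>k=0..n. int (n choose k) * (- 1) ^ k * int ((2 * k) choose k)
                      * int ((4 * k) choose (2 * k)) * 64 ^ (n - k))"

end

theory Submission
  imports Defs "HOL-Computational_Algebra.Polynomial"
begin

text \<open>Modulo \<open>p\<close> the sum \<open>\<Sum>n<p. G\<^sub>n / m\<^sup>n\<close> collapses to \<open>\<Sum>k. (2k choose k) (4k choose 2k) (64 - m)\<^sup>-\<^sup>k\<close>,
  and this is \<open>- \<chi>(a) S(a, b)\<close> with \<open>S(a, b) = \<Sum>x. \<chi>(x\<^sup>3 + a x\<^sup>2 + b x)\<close> as soon as \<open>b (64 - m) = 16 a\<^sup>2\<close>.
  For the seven values of \<open>m\<close> these cubics have complex multiplication, and the isogeny \<open>t = x + b / x\<close>, shifts and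
  scalings leave only \<open>S(0, -1)\<close>, \<open>S(3, 3)\<close>, \<open>S(4, 2)\<close> and \<open>S(21, 112)\<close>, of discriminants \<open>-4\<close>, \<open>-3\<close>, \<open>-8\<close>, \<open>-7\<close>.

  For inert \<open>p\<close> an endomorphism shows that the sum is its own negative. For split \<open>p\<close> each sum is a value of
  a family of sums that depends only on the class of its parameter modulo powers. The second moment of the family yields
  \<open>p = u\<^sup>2 + d v\<^sup>2\<close> with \<open>u\<close> the wanted value up to sign, such a representation is unique, and the sign is read off
  from orbit counts modulo a small number. For discriminant \<open>-8\<close> and \<open>p\<close> congruent to 3 modulo 8 the parameter ranges over
  \<open>\<int>[i] / p\<close>. For discriminant \<open>-7\<close> the family consists of the twists \<open>tr (g x\<^sup>3 \<sigma> x) = 0\<close> of the Klein quartic,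
  over the cubic algebra \<open>\<int>[\<eta>] / p\<close> with \<open>\<eta> = 2 cos (2 \<pi> / 7)\<close>; a change of coordinates turns the Klein quartic into
  \<open>X\<^sup>4 + Y\<^sup>4 + Z\<^sup>4 + 3 \<alpha> (X\<^sup>2 Y\<^sup>2 + Y\<^sup>2 Z\<^sup>2 + Z\<^sup>2 X\<^sup>2)\<close> with \<open>\<alpha>\<^sup>2 + \<alpha> + 2 = 0\<close>, which has
  \<open>p\<^sup>2 + 3 (p - 1) S(21, 112)\<close> zeros.\<close>

text \<open>Under b (64 - m) = 16 a^2 the isogeny (a, b) -> (-2 a, a^2 - 4 b) is m -> 4096 / m.
  Hence the pairs (1, 4096), (-8, -512), (16, 256), while -64 is paired with itself. The obstacle is
  to evaluate the sums without the theory of complex multiplication. The substitute is a family of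
  sums indexed by a unit g whose second moment is elementary; up to sign it takes one value per
  class of g, so the moment becomes a relation between a few squares. Extra automorphisms provide
  such families of twists for discriminants -4 and -3, and y^2 = x (x^4 + g) does so for -8. When p
  is 3 modulo 8, fourth powers in F_p are just the squares, which leaves too few classes; over
  F_(p^2) there are four. The curve of discriminant -7 has no automorphisms beyond the sign. The
  Klein quartic replaces it: its point count contains S(21, 112) three times, and it has an
  automorphism of order 7, diagonal over the cubic algebra, so that its twists fall into seven
  classes. That algebra is F_p^3 for p = 1 modulo 7 and the field of p^3 elements for p = 2, 4
  modulo 7; both are handled by one locale.\<close>

section \<open>Congruence modulo p in an arbitrary commutative ring\<close>

definition cg :: "nat \<Rightarrow> 'a::comm_ring_1 \<Rightarrow> 'a \<Rightarrow> bool" where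
  "cg p x y \<longleftrightarrow> of_nat p dvd x - y"

lemma cg_refl [simp, intro]: "cg p x x"
  by (simp add: cg_def)

lemma cg_sym: "cg p x y \<Longrightarrow> cg p y x"
  unfolding cg_def by (metis dvd_minus_iff minus_diff_eq)

lemma cg_trans [trans]: "cg p x y \<Longrightarrow> cg p y z \<Longrightarrow> cg p x z"
  unfolding cg_def by (metis diff_add_cancel add_diff_eq dvd_add)

lemma cg_add: "cg p x y \<Longrightarrow> cg p u v \<Longrightarrow> cg p (x + u) (y + v)"
  unfolding cg_def by (metis add_diff_add dvd_add)

lemma cg_minus: "cg p x y \<Longrightarrow> cg p (- x) (- y)"
  unfolding cg_def by (metis cg_def cg_sym minus_diff_minus dvd_minus_iff)

lemma cg_diff: "cg p x y \<Longrightarrow> cg p u v \<Longrightarrow> cg p (x - u) (y - v)"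
  using cg_add[OF _ cg_minus, of p x y u v] by simp

lemma cg_mult: assumes "cg p x y" "cg p u v" shows "cg p (x * u) (y * v)"
proof -
  have "x * u - y * v = (x - y) * u + y * (u - v)" by (simp add: algebra_simps)
  thus ?thesis using assms unfolding cg_def by (metis dvd_add dvd_mult dvd_mult2)
qed

lemma cg_power: "cg p x y \<Longrightarrow> cg p (x ^ k) (y ^ k)"
  by (induction k) (auto intro: cg_mult)

lemma cg_sum: "(\<And>i. i \<in> I \<Longrightarrow> cg p (f i) (g i)) \<Longrightarrow> cg p (sum f I) (sum g I)"
  by (induction I rule: infinite_finite_induct) (auto intro: cg_add)

lemma cg_of_int: "cg p x y \<Longrightarrow> cg p (of_int x) (of_int y)"
  unfolding cg_def by (metis dvdE dvdI of_int_diff of_int_mult of_int_of_nat_eq)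

lemma cg_iff_0: "cg p x y \<longleftrightarrow> cg p (x - y) 0"
  by (simp add: cg_def)

lemma cg_int_iff_cong: "cg p x y \<longleftrightarrow> [x = y] (mod int p)"
  by (simp add: cg_def cong_iff_dvd_diff)

lemmas cg_intros = cg_add cg_diff cg_minus cg_mult cg_power cg_refl

text \<open>The inner binomial coefficients of order p are divisible by p. The general ring matters:
  the p-th power is later computed in \<open>aint\<close>.\<close>

lemma cg_frobenius:
  fixes x y :: "'a::comm_ring_1"
  assumes "prime p"
  shows "cg p ((x + y) ^ p) (x ^ p + y ^ p)"
proof -
  have p: "p > 0" using assms prime_gt_0_nat by blast
  have "(x + y) ^ p = (\<Sum>k\<le>p. of_nat (p choose k) * x ^ k * y ^ (p - k))"
    by (rule binomial_ring)
  also have "cg p \<dots> (\<Sum>k\<le>p. of_bool (k = 0) * y ^ p + of_bool (k = p) * x ^ p)"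
  proof (rule cg_sum)
    fix k assume k: "k \<in> {..p}"
    show "cg p (of_nat (p choose k) * x ^ k * y ^ (p - k)) (of_bool (k = 0) * y ^ p + of_bool (k = p) * x ^ p)"
    proof (cases "k = 0 \<or> k = p")
      case True thus ?thesis using p by auto
    next
      case False
      hence "p dvd (p choose k)" using k assms by (intro dvd_choose_prime) auto
      hence "(of_nat p :: 'a) dvd of_nat (p choose k)" by (metis dvdE dvdI of_nat_mult)
      thus ?thesis using False by (simp add: cg_def dvd_mult2)
    qed
  qed
  also have "(\<Sum>k\<le>p. of_bool (k = 0) * y ^ p + of_bool (k = p) * x ^ p) = x ^ p + y ^ p"
  proof -
    have "(\<Sum>k\<le>p. of_bool (k = a) * z) = (z::'a)" if "a \<le> p" for a z
    proof -
      have "(\<Sum>k\<le>p. of_bool (k = a) * z) = (\<Sum>k\<le>p. if k = a then z else 0)"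
        by (rule sum.cong) auto
      thus ?thesis using that by simp
    qed
    thus ?thesis by (simp add: sum.distrib)
  qed
  finally show ?thesis .
qed

subsection \<open>Residue systems\<close>

text \<open>A finite set of representatives of the ring modulo p. Sums over it stand for sums over
  the finite quotient ring, and summands only have to respect \<open>cg\<close>, so no quotient type
  is formed.\<close>

locale ressys =
  fixes p :: nat and A :: "'a::comm_ring_1 set"
  assumes fin: "finite A"
    and ex: "\<exists>y\<in>A. cg p x y"
    and uniq: "x \<in> A \<Longrightarrow> y \<in> A \<Longrightarrow> cg p x y \<Longrightarrow> x = y"
begin

definition red :: "'a \<Rightarrow> 'a" where "red x = (SOME y. y \<in> A \<and> cg p x y)"

lemma red: "red x \<in> A" "cg p x (red x)" "cg p (red x) x"
proof -
  have "red x \<in> A \<and> cg p x (red x)" unfolding red_def by (rule someI_ex) (use ex[of x] in blast)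
  thus "red x \<in> A" "cg p x (red x)" "cg p (red x) x" using cg_sym by blast+
qed

lemma red_eqI: "y \<in> A \<Longrightarrow> cg p x y \<Longrightarrow> red x = y"
  by (meson cg_trans red uniq)

lemma red_eq_iff: "red x = red y \<longleftrightarrow> cg p x y"
  by (metis cg_trans red red_eqI)

end

text \<open>A substitution need only be invertible up to congruence; \<open>red\<close> brings the
  images back to representatives. Scaling by a unit, shifting, inverting and conjugating are all
  instances.\<close>

lemma ressys_reindex:
  assumes "ressys p A" "ressys p B"
    and f: "\<And>x y. cg p x y \<Longrightarrow> f x = f y"
    and c1: "\<And>x y. cg p x y \<Longrightarrow> cg p (h x) (h y)"
    and c2: "\<And>x y. cg p x y \<Longrightarrow> cg p (k x) (k y)"
    and i1: "\<And>x. cg p (h (k x)) x"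
    and i2: "\<And>x. cg p (k (h x)) x"
  shows "(\<Sum>x\<in>A. f (h x)) = (\<Sum>x\<in>B. f x)"
proof -
  interpret A: ressys p A by fact
  interpret B: ressys p B by fact
  show ?thesis
  proof (rule sum.reindex_bij_witness[where i = "\<lambda>x. A.red (k x)" and j = "\<lambda>x. B.red (h x)"])
    fix a assume a: "a \<in> A"
    show "A.red (k (B.red (h a))) = a"
      by (meson A.red_eqI B.red(3) a c2 cg_trans i2)
    show "B.red (h a) \<in> B" by (rule B.red)
    show "f (B.red (h a)) = f (h a)" by (rule f) (rule B.red)
  next
    fix b assume b: "b \<in> B"
    show "B.red (h (A.red (k b))) = b"
      by (meson B.red_eqI A.red(3) b c1 cg_trans i1)
    show "A.red (k b) \<in> A" by (rule A.red)
  qed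
qed

lemma ressys_unit_mult:
  assumes A: "ressys p A" and f: "\<And>x y. cg p x y \<Longrightarrow> f x = f y" and u: "cg p (u * v) 1"
  shows "(\<Sum>x\<in>A. f (u * x)) = (\<Sum>x\<in>A. f x)"
proof (rule ressys_reindex[OF A A f, where k = "\<lambda>x. v * x"])
  fix x
  have "cg p ((u * v) * x) (1 * x)" using u by (intro cg_mult) auto
  thus "cg p (u * (v * x)) x" "cg p (v * (u * x)) x" by (simp_all add: mult_ac)
qed (auto intro: cg_mult)

lemma ressys_shift:
  assumes A: "ressys p A" and f: "\<And>x y. cg p x y \<Longrightarrow> f x = f y"
  shows "(\<Sum>x\<in>A. f (x + c)) = (\<Sum>x\<in>A. f x)"
  by (rule ressys_reindex[OF A A f, where k = "\<lambda>x. x - c"]) (auto intro: cg_add cg_diff)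

lemma ressys_int: "p > 0 \<Longrightarrow> ressys p {0..<int p}"
proof
  fix x :: int assume "p > 0"
  show "\<exists>y\<in>{0..<int p}. cg p x y"
    by (rule bexI[of _ "x mod int p"]) (use \<open>p > 0\<close> in \<open>auto simp: cg_int_iff_cong cong_def\<close>)
next
  fix x y :: int assume "x \<in> {0..<int p}" "y \<in> {0..<int p}" "cg p x y"
  thus "x = y" by (auto simp: cg_int_iff_cong cong_def)
qed auto

subsection \<open>The quadratic character\<close>

locale big_prime =
  fixes p :: nat
  assumes prime_p: "prime p" and p_gt_3: "p > 3"
begin

abbreviation "R \<equiv> {0..<int p}"
abbreviation \<chi> :: "int \<Rightarrow> int" where "\<chi> a \<equiv> Legendre a (int p)"

lemma odd_p: "odd p" using prime_p p_gt_3 prime_odd_nat by force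

lemma p_pos [simp]: "p > 0" using p_gt_3 by simp

sublocale RS: ressys p R by (rule ressys_int) simp

lemma prime_P: "prime (int p)" using prime_p by simp

lemma dvd_mult_iff: "int p dvd a * b \<longleftrightarrow> int p dvd a \<or> int p dvd b"
  using prime_P by (rule prime_dvd_mult_iff)

lemma dvd_power_iff': "k > 0 \<Longrightarrow> int p dvd a ^ k \<longleftrightarrow> int p dvd a"
  using prime_P prime_dvd_power_iff by blast

lemma not_dvd_small: "0 < \<bar>a\<bar> \<Longrightarrow> \<bar>a\<bar> < int p \<Longrightarrow> \<not> int p dvd a"
  by (metis abs_of_nat dvd_imp_le_int linorder_not_less zero_less_abs_iff)

lemma cg_cong_dvd: "cg p a b \<Longrightarrow> int p dvd a \<longleftrightarrow> int p dvd b"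
  unfolding cg_int_iff_cong by (rule cong_dvd_iff)

lemma cg_0_int: "cg p a 0 \<longleftrightarrow> int p dvd a"
  by (simp add: cg_def)

lemma fermat: "\<not> int p dvd a \<Longrightarrow> cg p (a ^ (p - 1)) 1"
proof -
  assume a: "\<not> int p dvd a"
  define b where "b = nat (a mod int p)"
  have b: "cg p a (int b)" by (simp add: cg_int_iff_cong cong_def b_def)
  have "\<not> p dvd b" using a cg_cong_dvd[OF b] by (simp add: int_dvd_int_iff)
  hence "[b ^ (p - 1) = 1] (mod p)" using fermat_theorem prime_p by blast
  hence "[int (b ^ (p - 1)) = int 1] (mod int p)" using cong_int_iff by blast
  hence "cg p (int b ^ (p - 1)) 1" by (simp add: cg_int_iff_cong)
  thus ?thesis using cg_power[OF b, of "p - 1"] cg_trans by blast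
qed

text \<open>The Fermat inverse. Being a power, it respects congruences and is multiplicative; it
  sends 0 to 0 and is therefore an involution on all residues, zero included.\<close>

definition iv :: "int \<Rightarrow> int" where "iv a = a ^ (p - 2)"

lemma iv: "\<not> int p dvd a \<Longrightarrow> cg p (a * iv a) 1"
  proof -
  assume "\<not> int p dvd a"
  moreover have "p - 1 = Suc (p - 2)" using p_gt_3 by simp
  ultimately show ?thesis using fermat[of a] by (simp add: iv_def)
qed

lemma iv': "\<not> int p dvd a \<Longrightarrow> cg p (iv a * a) 1"
  using iv by (simp add: mult.commute)

lemma iv_cong: "cg p a b \<Longrightarrow> cg p (iv a) (iv b)"
  unfolding iv_def by (rule cg_power)

lemma iv_dvd: "int p dvd iv a \<longleftrightarrow> int p dvd a"
  unfolding iv_def using p_gt_3 by (intro dvd_power_iff') auto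

lemma cg_cancel:
  assumes "cg p (a * x) (a * y)" "\<not> int p dvd a" shows "cg p x (y::int)"
proof -
  have "int p dvd a * (x - y)" using assms(1) by (simp add: cg_def algebra_simps)
  thus ?thesis using assms(2) by (simp add: dvd_mult_iff cg_def)
qed

lemma iv_iv: "cg p (iv (iv a)) a"
proof (cases "int p dvd a")
  case True
  hence "cg p a 0" "cg p (iv (iv a)) 0" by (simp_all add: cg_0_int iv_dvd)
  thus ?thesis using cg_sym cg_trans by blast
next
  case False
  hence ia: "\<not> int p dvd iv a" by (simp add: iv_dvd)
  have "cg p (iv a * iv (iv a)) 1" "cg p (iv a * a) 1"
    using iv[OF ia] iv'[OF False] by auto
  hence "cg p (iv a * iv (iv a)) (iv a * a)" using cg_sym cg_trans by blast
  thus ?thesis using ia by (rule cg_cancel)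
qed

lemma chi_cong: "cg p a b \<Longrightarrow> \<chi> a = \<chi> b"
  unfolding Legendre_def QuadRes_def cg_int_iff_cong cong_def by simp

lemma chi_0_iff: "\<chi> a = 0 \<longleftrightarrow> int p dvd a"
  unfolding Legendre_def by (simp add: cong_0_iff)

lemma chi_values: "\<chi> a = 0 \<or> \<chi> a = 1 \<or> \<chi> a = -1"
  unfolding Legendre_def by auto

lemma chi_1 [simp]: "\<chi> 1 = 1"
proof -
  have "QuadRes (int p) 1" unfolding QuadRes_def by (rule exI[of _ 1]) simp
  thus ?thesis using not_dvd_small[of 1] p_gt_3 by (simp add: Legendre_def cong_0_iff)
qed

lemma euler: "cg p (\<chi> a) (a ^ ((p - 1) div 2))"
  unfolding cg_int_iff_cong using prime_p p_gt_3 by (intro euler_criterion) auto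

lemma small_cg_eq: "cg p x y \<Longrightarrow> \<bar>x - y\<bar> < int p \<Longrightarrow> x = y"
  unfolding cg_def using not_dvd_small[of "x - y"] by force

text \<open>Euler's criterion gives the congruence; two numbers from {-1, 0, 1} that agree modulo p
  > 3 are equal.\<close>

lemma chi_mult [simp]: "\<chi> (a * b) = \<chi> a * \<chi> b"
proof -
  have "cg p (\<chi> (a * b)) (\<chi> a * \<chi> b)"
    using cg_trans[OF euler[of "a * b"] cg_sym[OF cg_mult[OF euler[of a] euler[of b], folded power_mult_distrib]]] .
  moreover have "\<bar>\<chi> (a * b) - \<chi> a * \<chi> b\<bar> < int p"
    using chi_values[of a] chi_values[of b] chi_values[of "a * b"] p_gt_3 by auto
  ultimately show ?thesis by (rule small_cg_eq)
qed

lemma chi_power [simp]: "\<chi> (a ^ k) = \<chi> a ^ k"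
  by (induction k) auto

lemma chi_sq: "\<not> int p dvd a \<Longrightarrow> \<chi> a * \<chi> a = 1"
  using chi_values[of a] chi_0_iff[of a] by auto

lemma chi_sq': "\<not> int p dvd a \<Longrightarrow> (\<chi> a)\<^sup>2 = 1"
  using chi_sq by (simp add: power2_eq_square)

lemma chi_eq_1_iff: "\<not> int p dvd a \<Longrightarrow> \<chi> a = 1 \<longleftrightarrow> (\<exists>y. cg p (y\<^sup>2) a)"
  unfolding Legendre_def QuadRes_def cg_int_iff_cong by (auto simp: cong_0_iff)

lemma chi_iv: "\<chi> (iv a) = \<chi> a"
proof (cases "int p dvd a")
  case True thus ?thesis using iv_dvd chi_0_iff by metis
next
  case False
  have "\<chi> (a * iv a) = 1" using chi_cong[OF iv[OF False]] by simp
  thus ?thesis using chi_values[of a] chi_values[of "iv a"] by auto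
qed

lemma count_sqrt: "(\<Sum>y\<in>R. of_bool (cg p (y\<^sup>2) t)) = 1 + \<chi> t"
proof -
  have eq: "(\<Sum>y\<in>R. of_bool (cg p (y\<^sup>2) t)) = int (card {y\<in>R. cg p (y\<^sup>2) t})"
    by (simp add: Int_def)
  consider "int p dvd t" | "\<chi> t = 1" "\<not> int p dvd t" | "\<chi> t = -1" "\<not> int p dvd t"
    using chi_values[of t] chi_0_iff[of t] by auto
  thus ?thesis
  proof cases
    case 1
    have "{y\<in>R. cg p (y\<^sup>2) t} = {0}"
    proof -
      have "cg p (y\<^sup>2) t \<longleftrightarrow> cg p y 0" for y
      proof -
        have "cg p (y\<^sup>2) t \<longleftrightarrow> cg p (y\<^sup>2) 0" using 1 cg_0_int cg_sym cg_trans by blast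
        thus ?thesis using dvd_power_iff'[of 2 y] by (simp add: cg_0_int)
      qed
      moreover have "y \<in> R \<Longrightarrow> cg p y 0 \<Longrightarrow> y = 0" for y using RS.uniq[of y 0] by simp
      ultimately show ?thesis by auto
    qed
    thus ?thesis using 1 eq chi_0_iff by auto
  next
    case 2
    then obtain z where z: "cg p (z\<^sup>2) t" using chi_eq_1_iff by auto
    have nz: "\<not> int p dvd z" using 2 cg_cong_dvd[OF z] by (simp add: dvd_power_iff')
    have ne: "RS.red z \<noteq> RS.red (- z)"
    proof
      assume "RS.red z = RS.red (- z)"
      hence "int p dvd 2 * z" by (simp add: RS.red_eq_iff cg_def)
      thus False using nz not_dvd_small[of 2] p_gt_3 by (simp add: dvd_mult_iff)
    qed
    have "{y\<in>R. cg p (y\<^sup>2) t} = {RS.red z, RS.red (- z)}"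
    proof (intro equalityI subsetI)
      fix y assume "y \<in> {y\<in>R. cg p (y\<^sup>2) t}"
      hence y: "y \<in> R" "cg p (y\<^sup>2) (z\<^sup>2)" using z cg_sym cg_trans by blast+
      have "int p dvd (y - z) * (y + z)" using y(2) by (simp add: cg_def power2_eq_square algebra_simps)
      hence "int p dvd y - z \<or> int p dvd y - (- z)" by (simp add: dvd_mult_iff)
      hence "cg p y z \<or> cg p y (-z)" by (simp add: cg_def)
      hence "cg p z y \<or> cg p (-z) y" using cg_sym by blast
      thus "y \<in> {RS.red z, RS.red (- z)}" using RS.red_eqI[OF y(1)] by auto
    next
      fix y assume "y \<in> {RS.red z, RS.red (- z)}"
      hence "y \<in> R" "cg p y z \<or> cg p y (-z)" using RS.red by auto
      hence "cg p (y\<^sup>2) (z\<^sup>2)" using cg_power[of p y z 2] cg_power[of p y "-z" 2] by auto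
      thus "y \<in> {y\<in>R. cg p (y\<^sup>2) t}" using \<open>y \<in> R\<close> z cg_trans by blast
    qed
    thus ?thesis using ne eq 2 by simp
  next
    case 3
    hence "{y\<in>R. cg p (y\<^sup>2) t} = {}" using chi_eq_1_iff[of t] by auto
    thus ?thesis using 3 eq by simp
  qed
qed

lemma unit_reindex:
  assumes "\<And>x y. cg p x y \<Longrightarrow> f x = f y" "\<not> int p dvd c"
  shows "(\<Sum>x\<in>R. f (c * x)) = (\<Sum>x\<in>R. f x)"
  using ressys_unit_mult[OF RS.ressys_axioms assms(1) iv[OF assms(2)]] .

lemma shift_reindex:
  assumes "\<And>x y. cg p x y \<Longrightarrow> f x = f y"
  shows "(\<Sum>x\<in>R. f (x + c)) = (\<Sum>x\<in>R. f x)"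
  using ressys_shift[OF RS.ressys_axioms assms] .

lemma iv_reindex:
  assumes "\<And>x y. cg p x y \<Longrightarrow> f x = f y"
  shows "(\<Sum>x\<in>R. f (iv x)) = (\<Sum>x\<in>R. f x)"
  by (rule ressys_reindex[OF RS.ressys_axioms RS.ressys_axioms assms, where k = iv])
    (auto intro: iv_cong iv_iv)

text \<open>Double count of the pairs (y, t) with t = y^2: by y there are p of them, by t there are
  1 + \<chi>(t) for each t.\<close>

lemma sum_chi: "(\<Sum>x\<in>R. \<chi> x) = 0"
proof -
  have "int (card R) = (\<Sum>y\<in>R. \<Sum>t\<in>R. of_bool (cg p (y\<^sup>2) t))"
  proof -
    have "(\<Sum>t\<in>R. of_bool (cg p (y\<^sup>2) t)) = (1::int)" for y
    proof -
      have "(\<Sum>t\<in>R. of_bool (cg p (y\<^sup>2) t)) = (\<Sum>t\<in>R. of_bool (t = RS.red (y\<^sup>2)) :: int)"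
      proof (rule sum.cong)
        fix t assume "t \<in> R"
        hence "cg p (y\<^sup>2) t \<longleftrightarrow> t = RS.red (y\<^sup>2)" using RS.red_eqI RS.red by metis
        thus "of_bool (cg p (y\<^sup>2) t) = (of_bool (t = RS.red (y\<^sup>2)) :: int)" by simp
      qed simp
      thus ?thesis using RS.red(1)[of "y\<^sup>2"] by simp
    qed
    thus ?thesis by simp
  qed
  also have "\<dots> = (\<Sum>t\<in>R. \<Sum>y\<in>R. of_bool (cg p (y\<^sup>2) t))" by (rule sum.swap)
  also have "\<dots> = (\<Sum>t\<in>R. 1 + \<chi> t)" by (simp only: count_sqrt)
  also have "\<dots> = int (card R) + (\<Sum>t\<in>R. \<chi> t)" by (simp add: sum.distrib)
  finally show ?thesis by simp
qed

lemma sum_chi_linear: "\<not> int p dvd c \<Longrightarrow> (\<Sum>x\<in>R. \<chi> (c * x + d)) = 0"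
proof -
  assume c: "\<not> int p dvd c"
  have "(\<Sum>x\<in>R. \<chi> (c * x + d)) = (\<Sum>x\<in>R. \<chi> (x + d))"
    by (rule unit_reindex[OF _ c]) (auto intro!: chi_cong cg_add)
  also have "\<dots> = (\<Sum>x\<in>R. \<chi> x)" by (rule shift_reindex) (rule chi_cong)
  finally show ?thesis using sum_chi by simp
qed

lemma dvd_R_iff: "x \<in> R \<Longrightarrow> int p dvd x \<longleftrightarrow> x = 0"
  using not_dvd_small[of x] by (cases "x = 0") auto

lemma sum_chi_sq: "(\<Sum>x\<in>R. \<chi> x * \<chi> x) = int p - 1"
proof -
  have "(\<Sum>x\<in>R. \<chi> x * \<chi> x) = (\<Sum>x\<in>R. 1 - of_bool (x = 0))"
  proof (rule sum.cong)
    fix x assume "x \<in> R"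
    thus "\<chi> x * \<chi> x = 1 - of_bool (x = 0)"
      using chi_sq[of x] chi_0_iff[of x] dvd_R_iff[of x] by (cases "x = 0") auto
  qed simp
  thus ?thesis by (simp add: sum_subtractf)
qed

text \<open>The orthogonality relation behind every second moment over F_p. After a shift the
  summand is \<chi>(g) \<chi>(g + c), and for g \<noteq> 0 this is \<chi>(1 + c / g), a complete
  linear sum except for one missing argument.\<close>

lemma sum_chi_chi: "(\<Sum>g\<in>R. \<chi> (g + a) * \<chi> (g + b)) = int p * of_bool (cg p a b) - 1"
proof -
  have "(\<Sum>g\<in>R. \<chi> (g + a) * \<chi> (g + b)) = (\<Sum>g\<in>R. \<chi> (g + a) * \<chi> ((g + a) + (b - a)))"
    by simp
  also have "\<dots> = (\<Sum>g\<in>R. \<chi> g * \<chi> (g + (b - a)))"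
    by (rule shift_reindex) (intro arg_cong2[where f="(*)"] chi_cong cg_add cg_refl)
  also have "\<dots> = int p * of_bool (cg p a b) - 1"
  proof (cases "cg p a b")
    case True
    have "\<chi> (g + (b - a)) = \<chi> g" for g
      using cg_add[OF cg_refl[of p g] cg_sym[OF True[unfolded cg_iff_0[of p a b]]]]
        cg_sym[OF True] by (intro chi_cong) (simp add: cg_def)
    thus ?thesis using True sum_chi_sq by simp
  next
    case False
    define c where "c = b - a"
    have c: "\<not> int p dvd c" using False cg_sym[of p b a] by (auto simp: cg_def c_def)
    \<comment> \<open>With g replaced by its inverse the product becomes \<chi>(1 + c g). The term g
      = 0 was 0 before but \<chi>(1) = 1 after, which accounts for the subtracted 1.\<close>
    have "(\<Sum>g\<in>R. \<chi> g * \<chi> (g + c)) = (\<Sum>g\<in>R. \<chi> (iv g) * \<chi> (iv g + c))"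
      by (rule iv_reindex[symmetric]) (intro arg_cong2[where f="(*)"] chi_cong cg_add cg_refl)
    also have "\<dots> = (\<Sum>g\<in>R. \<chi> (c * g + 1) - of_bool (g = 0))"
    proof (rule sum.cong)
      fix g assume g: "g \<in> R"
      show "\<chi> (iv g) * \<chi> (iv g + c) = \<chi> (c * g + 1) - of_bool (g = 0)"
      proof (cases "g = 0")
        case True
        hence "int p dvd iv g" by (simp add: iv_dvd)
        thus ?thesis using True chi_0_iff by auto
      next
        case False
        hence "\<not> int p dvd g" using g dvd_R_iff by auto
        have "\<chi> (iv g) * \<chi> (iv g + c) = \<chi> (g * (iv g + c))" by (simp add: chi_iv)
        also have "\<dots> = \<chi> (c * g + 1)"
        proof (rule chi_cong)
          have "cg p (g * iv g + c * g) (1 + c * g)"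
            using iv[OF \<open>\<not> int p dvd g\<close>] by (intro cg_add) auto
          thus "cg p (g * (iv g + c)) (c * g + 1)" by (simp add: algebra_simps)
        qed
        finally show ?thesis using False by simp
      qed
    qed simp
    also have "\<dots> = -1" using sum_chi_linear[OF c, of 1] by (simp add: sum_subtractf)
    finally show ?thesis using False by (simp add: c_def)
  qed
  finally show ?thesis .
qed

end

subsection \<open>Reduction to a character sum\<close>

definition acoef :: "nat \<Rightarrow> int" where
  "acoef k = (- 1) ^ k * int ((2 * k) choose k) * int ((4 * k) choose (2 * k))"

text \<open>The sum of G_n / m^n multiplied by m^(p-1). It is an integer, and the factor is 1 modulo
  p when p does not divide m.\<close>

definition W4 :: "nat \<Rightarrow> int \<Rightarrow> int" where
  "W4 p m = (\<Sum>n\<le>p - 1. G4 n * m ^ (p - 1 - n))"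

text \<open>The coefficient of X^n in (X^2 + a X + b)^n. For n = (p-1)/2 it is up to sign the Hasse
  invariant of y^2 = x^3 + a x^2 + b x. The ring is general because a and b are later polynomials
  and elements of \<int>[\<alpha>].\<close>

definition htr :: "nat \<Rightarrow> 'a::comm_ring_1 \<Rightarrow> 'a \<Rightarrow> 'a" where
  "htr n a b = (\<Sum>k\<le>n div 2. of_nat ((n choose (2 * k)) * ((2 * k) choose k)) * a ^ (n - 2 * k) * b ^ k)"

text \<open>\<open>G4\<close> is a binomial transform of \<open>acoef\<close> with parameter 64. A
  second transform with parameter -m composes with it by adding the parameters.\<close>

lemma G4_binomial_sum:
  "(\<Sum>n\<le>N. int (N choose n) * (- m) ^ (N - n) * G4 n) =
     (\<Sum>k\<le>N. int (N choose k) * acoef k * (64 - m) ^ (N - k))"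
proof -
  have "(\<Sum>n\<le>N. int (N choose n) * (- m) ^ (N - n) * G4 n) =
      (\<Sum>n\<le>N. \<Sum>k\<le>n. int (N choose n) * int (n choose k) * acoef k * 64 ^ (n - k) * (- m) ^ (N - n))"
    unfolding G4_def acoef_def atLeast0AtMost sum_distrib_left
    by (intro sum.cong refl) (simp add: algebra_simps)
  also have "\<dots> = (\<Sum>k\<le>N. \<Sum>n\<in>{k..N}. int (N choose n) * int (n choose k) * acoef k * 64 ^ (n - k) * (- m) ^ (N - n))"
  proof -
    have "(\<Sum>n\<le>N. \<Sum>k\<le>n. f n k) = (\<Sum>k\<le>N. \<Sum>n\<in>{k..N}. f n k)" for f :: "nat \<Rightarrow> nat \<Rightarrow> int"
    proof -
      have "(\<Sum>n\<le>N. \<Sum>k | k \<in> {..N} \<and> k \<le> n. f n k) = (\<Sum>k\<le>N. \<Sum>n | n \<in> {..N} \<and> k \<le> n. f n k)"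
        by (rule sum.swap_restrict) auto
      moreover have "{k. k \<in> {..N} \<and> k \<le> n} = {..n}" if "n \<le> N" for n using that by auto
      moreover have "{n. n \<in> {..N} \<and> k \<le> n} = {k..N}" for k by auto
      ultimately show ?thesis by simp
    qed
    thus ?thesis .
  qed
  also have "\<dots> = (\<Sum>k\<le>N. int (N choose k) * acoef k * (64 - m) ^ (N - k))"
  proof (rule sum.cong)
    fix k assume "k \<in> {..N}"
    hence k: "k \<le> N" by simp
    have "(\<Sum>n\<in>{k..N}. int (N choose n) * int (n choose k) * acoef k * 64 ^ (n - k) * (- m) ^ (N - n))
      = (\<Sum>j\<le>N - k. int (N choose k) * acoef k * (int ((N - k) choose j) * 64 ^ j * (- m) ^ (N - k - j)))"
    proof (rule sum.reindex_bij_witness[where i = "\<lambda>j. j + k" and j = "\<lambda>n. n - k"])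
      fix n assume n: "n \<in> {k..N}"
      have "int (N choose n) * int (n choose k) = int (N choose k) * int ((N - k) choose (n - k))"
        using choose_mult[of k n N] n by (simp flip: of_nat_mult)
      moreover have "N - k - (n - k) = N - n" using n by auto
      ultimately show "int (N choose k) * acoef k * (int ((N - k) choose (n - k)) * 64 ^ (n - k) * (- m) ^ (N - k - (n - k)))
        = int (N choose n) * int (n choose k) * acoef k * 64 ^ (n - k) * (- m) ^ (N - n)"
        by (simp add: algebra_simps)
    qed (use k in auto)
    also have "\<dots> = int (N choose k) * acoef k * (64 + (- m)) ^ (N - k)"
      unfolding binomial_ring sum_distrib_left by simp
    finally show "(\<Sum>n\<in>{k..N}. int (N choose n) * int (n choose k) * acoef k * 64 ^ (n - k) * (- m) ^ (N - n))
      = int (N choose k) * acoef k * (64 - m) ^ (N - k)" by simp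
  qed simp
  finally show ?thesis .
qed

context big_prime
begin

text \<open>Pascal's rule and p | binom(p, k + 1). It lets the plain sum \<open>W4\<close> be read
  as a binomial transform of order p - 1, up to signs that cancel.\<close>

lemma choose_p_minus_1: "k \<le> p - 1 \<Longrightarrow> cg p (int ((p - 1) choose k)) ((- 1) ^ k)"
proof (induction k)
  case (Suc k)
  have "Suc (p - 1) choose Suc k = ((p - 1) choose k) + ((p - 1) choose Suc k)" by (rule binomial_Suc_Suc)
  moreover have "Suc (p - 1) = p" using p_gt_3 by simp
  ultimately have "int ((p - 1) choose Suc k) = int (p choose Suc k) - int ((p - 1) choose k)"
    by simp
  moreover have "cg p (int (p choose Suc k) - int ((p - 1) choose k)) (0 - (-1) ^ k)"
  proof (rule cg_diff)
    have "p dvd (p choose Suc k)" using Suc.prems prime_p p_gt_3 by (intro dvd_choose_prime) auto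
    thus "cg p (int (p choose Suc k)) 0" by (simp add: cg_0_int)
    show "cg p (int ((p - 1) choose k)) ((-1) ^ k)" using Suc by simp
  qed
  ultimately show ?case by simp
qed simp

lemma even_p1: "even (p - 1)" using odd_p by simp

lemma W4_cg_aux:
  "cg p (W4 p m) (\<Sum>k\<le>p - 1. int ((2 * k) choose k) * int ((4 * k) choose (2 * k)) * (64 - m) ^ (p - 1 - k))"
proof -
  have "cg p (W4 p m) (\<Sum>n\<le>p - 1. int ((p - 1) choose n) * (- m) ^ (p - 1 - n) * G4 n)"
    unfolding W4_def
  proof (rule cg_sum)
    fix n assume "n \<in> {..p - 1}"
    hence n: "n \<le> p - 1" by simp
    have "(- m) ^ (p - 1 - n) = (- 1) ^ (p - 1 - n) * m ^ (p - 1 - n)" by (rule power_minus)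
    moreover have "(- 1 :: int) ^ (p - 1 - n) = (- 1) ^ n"
    proof -
      have "even (p - 1 - n) \<longleftrightarrow> even n" using n even_p1 by (metis dvd_diff_nat even_diff_nat le_add_diff_inverse even_add)
      thus ?thesis by (auto simp: minus_one_power_iff)
    qed
    ultimately have e: "(- 1) ^ n * (- m) ^ (p - 1 - n) * G4 n = G4 n * m ^ (p - 1 - n)"
      by (simp flip: power_add)
    have "cg p ((- 1) ^ n * (- m) ^ (p - 1 - n) * G4 n) (int ((p - 1) choose n) * (- m) ^ (p - 1 - n) * G4 n)"
      by (intro cg_mult cg_refl cg_sym[OF choose_p_minus_1] n)
    thus "cg p (G4 n * m ^ (p - 1 - n)) (int ((p - 1) choose n) * (- m) ^ (p - 1 - n) * G4 n)"
      unfolding e .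
  qed
  also have "(\<Sum>n\<le>p - 1. int ((p - 1) choose n) * (- m) ^ (p - 1 - n) * G4 n) =
      (\<Sum>k\<le>p - 1. int ((p - 1) choose k) * acoef k * (64 - m) ^ (p - 1 - k))"
    by (rule G4_binomial_sum)
  also have "cg p \<dots> (\<Sum>k\<le>p - 1. (- 1) ^ k * acoef k * (64 - m) ^ (p - 1 - k))"
    by (intro cg_sum cg_mult cg_refl choose_p_minus_1) auto
  also have "(\<Sum>k\<le>p - 1. (- 1) ^ k * acoef k * (64 - m) ^ (p - 1 - k)) =
      (\<Sum>k\<le>p - 1. int ((2 * k) choose k) * int ((4 * k) choose (2 * k)) * (64 - m) ^ (p - 1 - k))"
    by (intro sum.cong refl) (simp add: acoef_def flip: power_add mult.assoc)
  finally show ?thesis .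
qed

definition h2 :: nat where "h2 = (p - 1) div 2"

lemma h2: "2 * h2 = p - 1" "int p = 2 * int h2 + 1" "h2 < p" "h2 > 0" "2 * h2 + 1 = p"
proof -
  show a: "2 * h2 = p - 1" using even_p1 by (simp add: h2_def)
  show "2 * h2 + 1 = p" using a p_gt_3 by simp
  thus "int p = 2 * int h2 + 1" by linarith
  show "h2 < p" using a p_gt_3 by simp
  show "h2 > 0" using p_gt_3 by (simp add: h2_def)
qed

text \<open>Modulo p the number \<open>h2\<close> is -1/2, and binom(-1/2, j) (-4)^j = binom(2j, j).
  The induction compares the two recurrences in j, whose factors 2 (2j + 1) - 2p and 2 (2j + 1)
  agree modulo p.\<close>

lemma choose_h2: "j \<le> h2 \<Longrightarrow> cg p (int (h2 choose j) * (- 4) ^ j) (int ((2 * j) choose j))"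
proof (induction j)
  case (Suc j)
  have j: "j < h2" using Suc.prems by simp
  have a: "int (Suc j) * int (h2 choose Suc j) = (int h2 - int j) * int (h2 choose j)"
  proof -
    have "Suc j * (h2 choose Suc j) = (h2 - j) * (h2 choose j)"
      using binomial_absorb_comp[of h2 j] binomial_absorption[of j h2] by (simp add: mult.commute)
    thus ?thesis using j by (metis of_nat_diff of_nat_mult less_imp_le)
  qed
  have b: "int (Suc j) * int ((2 * Suc j) choose Suc j) = 2 * (2 * int j + 1) * int ((2 * j) choose j)"
  proof -
    have "Suc j * (Suc (2 * j + 1) choose Suc j) = Suc (2 * j + 1) * ((2 * j + 1) choose j)"
      by (rule Suc_times_binomial)
    moreover have "Suc j * ((2 * j + 1) choose Suc j) = Suc (2 * j) * ((2 * j) choose j)"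
      using Suc_times_binomial[of j "2 * j"] by simp
    moreover have "(2 * j + 1) choose Suc j = (2 * j + 1) choose j"
      using binomial_symmetric[of "Suc j" "2 * j + 1"] by simp
    ultimately have "Suc j * (Suc j * ((2 * Suc j) choose Suc j)) = Suc j * (2 * (2 * j + 1) * ((2 * j) choose j))"
      by (simp add: algebra_simps)
    hence "Suc j * ((2 * Suc j) choose Suc j) = 2 * (2 * j + 1) * ((2 * j) choose j)"
      by (metis mult_cancel1 nat.distinct(1))
    thus ?thesis by (metis (no_types, lifting) Suc_eq_plus1 of_nat_1 of_nat_add of_nat_mult of_nat_numeral)
  qed
  have "int (Suc j) * (int (h2 choose Suc j) * (-4) ^ Suc j)
      = (int (Suc j) * int (h2 choose Suc j)) * (-4) * (-4) ^ j" by (simp add: mult_ac)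
  also have "\<dots> = (2 * (2 * int j + 1) - 2 * int p) * (int (h2 choose j) * (-4) ^ j)"
    unfolding a using h2(2) by (simp add: algebra_simps)
  also have "cg p \<dots> ((2 * (2 * int j + 1) - 0) * int ((2 * j) choose j))"
    using Suc j by (intro cg_mult cg_diff cg_refl) (auto simp: cg_0_int)
  also have "(2 * (2 * int j + 1) - 0) * int ((2 * j) choose j) = int (Suc j) * int ((2 * Suc j) choose Suc j)"
    unfolding b by simp
  finally have "cg p (int (Suc j) * (int (h2 choose Suc j) * (-4) ^ Suc j)) (int (Suc j) * int ((2 * Suc j) choose Suc j))" .
  moreover have "\<not> int p dvd int (Suc j)" using Suc.prems h2(3) by (intro not_dvd_small) auto
  ultimately show ?case by (rule cg_cancel)
qed simp

lemma central_choose_0: "j < p \<Longrightarrow> p \<le> 2 * j \<Longrightarrow> p dvd ((2 * j) choose j)"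
proof -
  assume j: "j < p" "p \<le> 2 * j"
  have "fact (2 * j) = fact j * fact j * ((2 * j) choose j)"
    using binomial_fact_lemma[of j "2 * j"] by simp
  moreover have "p dvd (fact (2 * j) :: nat)" using j prime_p by (simp add: prime_dvd_fact_iff)
  moreover have "\<not> p dvd (fact j :: nat)" using j prime_p by (simp add: prime_dvd_fact_iff)
  ultimately show ?thesis using prime_p by (metis prime_dvd_multD)
qed

text \<open>One of j = k and j = 2k satisfies p/2 \<le> j < p, where binom(2j, j) is divisible by p.
  This truncates the sum at k = \<open>h2 div 2\<close>, the range of \<open>htr\<close>.\<close>

lemma quartic_choose_0: "k < p \<Longrightarrow> h2 < 2 * k \<Longrightarrow> p dvd ((2 * k) choose k) * ((4 * k) choose (2 * k))"
proof (cases "k \<le> h2")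
  case True
  assume k: "k < p" "h2 < 2 * k"
  have "2 * k < p" using True h2 by linarith
  moreover have "p \<le> 2 * (2 * k)" using k h2(5) by linarith
  ultimately show ?thesis using central_choose_0[of "2 * k"] by simp
next
  case False
  assume k: "k < p"
  have "p \<le> 2 * k" using False h2(5) by linarith
  thus ?thesis using central_choose_0[of k] k by simp
qed

text \<open>With D = 64 - m the hypothesis reads D = 16 a^2 / b, so 16^k D^(-k) = b^k a^(-2k), while
  binom(4k, 2k) is 16^k binom(h2, 2k). Negative powers are expressed by the exponent p - 1 = 2
  \<open>h2\<close>, and a^(-h2) by a^h2.\<close>

lemma W4_htr:
  assumes D: "cg p (b * (64 - m)) (16 * a\<^sup>2)" and a: "\<not> int p dvd a" and b: "\<not> int p dvd b"
  shows "cg p (W4 p m) (a ^ h2 * htr h2 a b)"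
proof -
  define D where "D = 64 - m"
  have D: "cg p (b * D) (16 * a\<^sup>2)" using assms(1) by (simp add: D_def)
  have D0: "\<not> int p dvd D"
  proof
    assume "int p dvd D"
    hence "int p dvd 16 * a\<^sup>2" using cg_cong_dvd[OF D] by simp
    moreover have "\<not> int p dvd 16" using dvd_power_iff'[of 4 2] not_dvd_small[of 2] p_gt_3 by simp
    ultimately show False using a by (simp add: dvd_mult_iff dvd_power_iff')
  qed
  have f: "cg p (x ^ (p - 1)) 1" "cg p (x ^ (2 * h2)) 1" if "\<not> int p dvd x" for x
    using fermat[OF that] by (simp_all add: h2)
  have term1: "cg p (16 ^ k * D ^ (2 * h2 - k)) (a ^ h2 * a ^ (h2 - 2 * k) * b ^ k)" if k: "2 * k \<le> h2" for k
  proof -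
    have e: "h2 + (h2 - 2 * k) = 2 * h2 - 2 * k" using k by linarith
    have "b ^ (2 * h2 - k) * (16 ^ k * D ^ (2 * h2 - k)) = (b * D) ^ (2 * h2 - k) * 16 ^ k"
      by (simp add: power_mult_distrib)
    also have "cg p \<dots> ((16 * a\<^sup>2) ^ (2 * h2 - k) * 16 ^ k)"
      by (intro cg_mult cg_power D cg_refl)
    also have "(16 * a\<^sup>2) ^ (2 * h2 - k) * 16 ^ k = 16 ^ (2 * h2) * (a ^ (2 * (2 * h2 - k)))"
    proof -
      have "(16::int) ^ (2 * h2 - k) * 16 ^ k = 16 ^ (2 * h2)" using k by (simp flip: power_add)
      thus ?thesis by (simp add: power_mult_distrib power_mult mult_ac)
    qed
    also have "2 * (2 * h2 - k) = 2 * h2 + (2 * h2 - 2 * k)" using k by linarith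
    also have "a ^ (2 * h2 + (2 * h2 - 2 * k)) = a ^ (2 * h2) * (a ^ (2 * h2 - 2 * k))" by (rule power_add)
    also have "cg p (16 ^ (2 * h2) * (a ^ (2 * h2) * (a ^ (2 * h2 - 2 * k)))) (1 * (1 * a ^ (2 * h2 - 2 * k)))"
      using dvd_power_iff'[of 4 2] not_dvd_small[of 2] p_gt_3 by (intro cg_mult f a cg_refl) simp
    also have "cg p (1 * (1 * a ^ (2 * h2 - 2 * k))) (b ^ (2 * h2) * (1 * a ^ (2 * h2 - 2 * k)))"
      by (intro cg_mult cg_refl cg_sym[OF f(2)] b)
    also have "b ^ (2 * h2) = b ^ (2 * h2 - k) * b ^ k" using k by (simp flip: power_add)
    also have "b ^ (2 * h2 - k) * b ^ k * (1 * a ^ (2 * h2 - 2 * k)) = b ^ (2 * h2 - k) * (a ^ h2 * a ^ (h2 - 2 * k) * b ^ k)"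
      using e by (simp flip: power_add)
    finally show ?thesis using b by (elim cg_cancel) (metis dvd_power_iff' dvd_refl gr0I power_0 not_dvd_small p_gt_3 of_nat_less_iff abs_one zero_less_one of_nat_1 less_trans one_less_numeral_iff semiring_norm(77))
  qed
  have "cg p (W4 p m) (\<Sum>k\<le>p - 1. int ((2 * k) choose k) * int ((4 * k) choose (2 * k)) * D ^ (p - 1 - k))"
    using W4_cg_aux[of m] by (simp add: D_def)
  also have "cg p \<dots> (\<Sum>k\<le>p - 1. if k \<le> h2 div 2 then int ((2 * k) choose k) * int ((4 * k) choose (2 * k)) * D ^ (p - 1 - k) else 0)"
  proof (rule cg_sum)
    fix k assume "k \<in> {..p - 1}"
    hence k: "k < p" using p_gt_3 by auto
    show "cg p (int ((2 * k) choose k) * int ((4 * k) choose (2 * k)) * D ^ (p - 1 - k))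
      (if k \<le> h2 div 2 then int ((2 * k) choose k) * int ((4 * k) choose (2 * k)) * D ^ (p - 1 - k) else 0)"
    proof (cases "k \<le> h2 div 2")
      case False
      hence "h2 < 2 * k" by linarith
      hence "int p dvd int (((2 * k) choose k) * ((4 * k) choose (2 * k)))"
        using quartic_choose_0[OF k] by (simp add: int_dvd_int_iff del: of_nat_mult)
      thus ?thesis using False by (simp add: cg_0_int)
    qed simp
  qed
  also have "(\<Sum>k\<le>p - 1. if k \<le> h2 div 2 then int ((2 * k) choose k) * int ((4 * k) choose (2 * k)) * D ^ (p - 1 - k) else 0)
    = (\<Sum>k\<le>h2 div 2. int ((2 * k) choose k) * int ((4 * k) choose (2 * k)) * D ^ (2 * h2 - k))"
  proof (rule sum.mono_neutral_cong_right)
    show "{..h2 div 2} \<subseteq> {..p - 1}" using h2(1) by auto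
  qed (auto simp: h2(1))
  also have "cg p \<dots> (\<Sum>k\<le>h2 div 2. a ^ h2 * (int ((h2 choose (2 * k)) * ((2 * k) choose k)) * a ^ (h2 - 2 * k) * b ^ k))"
  proof (rule cg_sum)
    fix k assume "k \<in> {..h2 div 2}"
    hence k: "2 * k \<le> h2" by auto
    have c: "cg p (int ((4 * k) choose (2 * k))) (int (h2 choose (2 * k)) * 16 ^ k)"
      using cg_sym[OF choose_h2[OF k]] by (simp add: power_mult)
    have "cg p (int ((2 * k) choose k) * int ((4 * k) choose (2 * k)) * D ^ (2 * h2 - k))
        (int ((2 * k) choose k) * (int (h2 choose (2 * k)) * 16 ^ k) * D ^ (2 * h2 - k))"
      by (intro cg_mult cg_refl c)
    also have "\<dots> = int ((2 * k) choose k) * int (h2 choose (2 * k)) * (16 ^ k * D ^ (2 * h2 - k))" by simp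
    also have "cg p \<dots> (int ((2 * k) choose k) * int (h2 choose (2 * k)) * (a ^ h2 * a ^ (h2 - 2 * k) * b ^ k))"
      by (intro cg_mult cg_refl term1 k)
    also have "\<dots> = a ^ h2 * (int ((h2 choose (2 * k)) * ((2 * k) choose k)) * a ^ (h2 - 2 * k) * b ^ k)"
      by (simp add: mult_ac)
    finally show "cg p (int ((2 * k) choose k) * int ((4 * k) choose (2 * k)) * D ^ (2 * h2 - k))
      (a ^ h2 * (int ((h2 choose (2 * k)) * ((2 * k) choose k)) * a ^ (h2 - 2 * k) * b ^ k))" .
  qed
  also have "(\<Sum>k\<le>h2 div 2. a ^ h2 * (int ((h2 choose (2 * k)) * ((2 * k) choose k)) * a ^ (h2 - 2 * k) * b ^ k)) = a ^ h2 * htr h2 a b"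
    unfolding htr_def sum_distrib_left of_nat_id by (simp add: mult.assoc)
  finally show ?thesis .
qed

text \<open>For a nonsingular curve y^2 = x^3 + a x^2 + b x this is minus the trace of Frobenius.
  The cubic has the root 0, the kernel point of the isogeny used below.\<close>

definition S :: "int \<Rightarrow> int \<Rightarrow> int" where
  "S a b = (\<Sum>x\<in>R. \<chi> (x ^ 3 + a * x\<^sup>2 + b * x))"

lemma exists_power_ne_1:
  assumes "0 < j" "j < p - 1" shows "\<exists>g. \<not> int p dvd g \<and> \<not> cg p (g ^ j) 1"
proof (rule ccontr)
  assume "\<not> ?thesis"
  hence all: "\<And>g. \<not> int p dvd g \<Longrightarrow> cg p (g ^ j) 1" by blast
  have "{1..<p} \<subseteq> {x\<in>{..<p}. [x ^ j = 1] (mod p)}"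
  proof
    fix x assume x: "x \<in> {1..<p}"
    hence "cg p (int x ^ j) 1" by (intro all not_dvd_small) auto
    hence "[int (x ^ j) = int 1] (mod int p)" by (simp add: cg_int_iff_cong)
    hence "[x ^ j = 1] (mod p)" by (rule cong_int_iff[THEN iffD1])
    thus "x \<in> {x\<in>{..<p}. [x ^ j = 1] (mod p)}" using x by simp
  qed
  hence "card {1..<p} \<le> card {x\<in>{..<p}. [x ^ j = 1] (mod p)}" by (intro card_mono) auto
  also have "\<dots> \<le> j" using roots_mod_prime_bound[OF prime_p assms(1)] .
  finally show False using assms by simp
qed

text \<open>Replacing x by g x multiplies the sum by g^i, and g can be chosen with g^i different
  from 1.\<close>

lemma power_sum_0:
  assumes i: "0 < i" "i < p - 1" shows "cg p (\<Sum>x\<in>R. x ^ i) (0::int)"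
proof -
  obtain g where g: "\<not> int p dvd g" "\<not> cg p (g ^ i) 1" using exists_power_ne_1 i by blast
  \<comment> \<open>The reindexing rule wants equal, not merely congruent, values on congruent
    arguments; reducing the power modulo p provides them.\<close>
  define f where "f = (\<lambda>x::int. x ^ i mod int p)"
  have f: "cg p (x ^ i) (f x)" for x :: int by (simp add: f_def cg_int_iff_cong)
  have "(\<Sum>x\<in>R. f (g * x)) = (\<Sum>x\<in>R. f x)"
  proof (rule unit_reindex[OF _ g(1)])
    fix x y :: int assume "cg p x y"
    hence "cg p (x ^ i) (y ^ i)" by (rule cg_power)
    thus "f x = f y" by (simp add: f_def cg_int_iff_cong cong_def)
  qed
  moreover have "cg p (\<Sum>x\<in>R. x ^ i) (\<Sum>x\<in>R. f x)" by (intro cg_sum f)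
  moreover have "cg p (\<Sum>x\<in>R. (g * x) ^ i) (\<Sum>x\<in>R. f (g * x))" by (intro cg_sum f)
  ultimately have "cg p (\<Sum>x\<in>R. (g * x) ^ i) (\<Sum>x\<in>R. x ^ i)" using cg_sym cg_trans by metis
  hence "cg p (g ^ i * (\<Sum>x\<in>R. x ^ i)) (\<Sum>x\<in>R. x ^ i)"
    by (simp add: power_mult_distrib sum_distrib_left)
  hence "int p dvd (g ^ i - 1) * (\<Sum>x\<in>R. x ^ i)" by (simp add: cg_def algebra_simps)
  thus ?thesis using g(2) by (simp add: dvd_mult_iff cg_def)
qed

lemma power_sum:
  assumes j: "0 < j" "j < 2 * (p - 1)"
  shows "cg p (\<Sum>x\<in>R. x ^ j) (- of_bool (j = p - 1))"
proof -
  consider "j < p - 1" | "j = p - 1" | "p - 1 < j" by linarith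
  thus ?thesis
  proof cases
    case 2
    have "cg p (\<Sum>x\<in>R. x ^ j) (\<Sum>x\<in>R. 1 - of_bool (x = 0))"
    proof (rule cg_sum)
      fix x assume x: "x \<in> R"
      show "cg p (x ^ j) (1 - of_bool (x = 0))"
        using fermat[of x] dvd_R_iff[OF x] 2 p_gt_3 by (cases "x = 0") (auto simp: power_0_left)
    qed
    also have "(\<Sum>x\<in>R. 1 - of_bool (x = 0) :: int) = int p - 1" by (simp add: sum_subtractf)
    also have "cg p \<dots> (- 1)" by (simp add: cg_def)
    finally show ?thesis using 2 by simp
  next
    case 1
    thus ?thesis using j power_sum_0[of j] by simp
  next
    case 3
    have "cg p (\<Sum>x\<in>R. x ^ j) (\<Sum>x\<in>R. x ^ (j - (p - 1)))"
    proof (rule cg_sum)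
      fix x assume x: "x \<in> R"
      have "x ^ j = x ^ (p - 1) * x ^ (j - (p - 1))" using 3 by (simp flip: power_add)
      moreover have "cg p (x ^ (p - 1) * x ^ (j - (p - 1))) (1 * x ^ (j - (p - 1)))" if "x \<noteq> 0"
        using fermat[of x] dvd_R_iff[OF x] that by (intro cg_mult cg_refl) auto
      ultimately show "cg p (x ^ j) (x ^ (j - (p - 1)))"
        using 3 j by (cases "x = 0") (auto simp: power_0_left)
    qed
    also have "cg p \<dots> 0" using 3 j by (intro power_sum_0) auto
    finally show ?thesis using 3 by simp
  qed
qed

text \<open>By Euler's criterion the summand is x^h2 (x^2 + a x + b)^h2. Its exponents lie between
  \<open>h2\<close> and 3 \<open>h2\<close> < 2 (p - 1), so only x^(p-1) has a nonzero power sum,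
  namely -1, and its coefficient is that of x^h2 in the power of the trinomial.\<close>

lemma S_htr: "cg p (S a b) (- htr h2 a b)"
proof -
  have "cg p (S a b) (\<Sum>x\<in>R. (x ^ 3 + a * x\<^sup>2 + b * x) ^ h2)"
    unfolding S_def h2_def by (intro cg_sum euler)
  also have "(\<Sum>x\<in>R. (x ^ 3 + a * x\<^sup>2 + b * x) ^ h2) = (\<Sum>x\<in>R. \<Sum>i\<le>h2. \<Sum>j\<le>i.
      int (h2 choose i) * a ^ (h2 - i) * int (i choose j) * b ^ (i - j) * x ^ (2 * h2 + 2 * j - i))"
  proof (intro sum.cong refl)
    fix x
    have "(x ^ 3 + a * x\<^sup>2 + b * x) ^ h2 = x ^ h2 * ((x\<^sup>2 + b) + a * x) ^ h2"
      by (simp flip: power_mult_distrib add: algebra_simps power2_eq_square power3_eq_cube)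
    also have "((x\<^sup>2 + b) + a * x) ^ h2 = (\<Sum>i\<le>h2. int (h2 choose i) * (x\<^sup>2 + b) ^ i * (a * x) ^ (h2 - i))"
      by (simp add: binomial_ring)
    also have "\<dots> = (\<Sum>i\<le>h2. \<Sum>j\<le>i. int (h2 choose i) * (int (i choose j) * (x\<^sup>2) ^ j * b ^ (i - j)) * (a * x) ^ (h2 - i))"
      by (simp add: binomial_ring sum_distrib_left sum_distrib_right)
    also have "x ^ h2 * \<dots> = (\<Sum>i\<le>h2. \<Sum>j\<le>i.
      int (h2 choose i) * a ^ (h2 - i) * int (i choose j) * b ^ (i - j) * x ^ (2 * h2 + 2 * j - i))"
      unfolding sum_distrib_left
    proof (intro sum.cong refl)
      fix i j assume "i \<in> {..h2}" "j \<in> {..i}"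
      hence "2 * h2 + 2 * j - i = h2 + 2 * j + (h2 - i)" by auto
      thus "x ^ h2 * (int (h2 choose i) * (int (i choose j) * (x\<^sup>2) ^ j * b ^ (i - j)) * (a * x) ^ (h2 - i))
        = int (h2 choose i) * a ^ (h2 - i) * int (i choose j) * b ^ (i - j) * x ^ (2 * h2 + 2 * j - i)"
        by (simp add: power_mult_distrib power_add mult_ac flip: power_mult)
    qed
    finally show "(x ^ 3 + a * x\<^sup>2 + b * x) ^ h2 = (\<Sum>i\<le>h2. \<Sum>j\<le>i.
      int (h2 choose i) * a ^ (h2 - i) * int (i choose j) * b ^ (i - j) * x ^ (2 * h2 + 2 * j - i))" .
  qed
  also have "\<dots> = (\<Sum>i\<le>h2. \<Sum>j\<le>i.
      int (h2 choose i) * a ^ (h2 - i) * int (i choose j) * b ^ (i - j) * (\<Sum>x\<in>R. x ^ (2 * h2 + 2 * j - i)))"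
    by (subst sum.swap, rule sum.cong[OF refl], subst sum.swap, rule sum.cong[OF refl]) (simp add: sum_distrib_left)
  also have "cg p \<dots> (\<Sum>i\<le>h2. \<Sum>j\<le>i.
      int (h2 choose i) * a ^ (h2 - i) * int (i choose j) * b ^ (i - j) * (- of_bool (i = 2 * j)))"
  proof (intro cg_sum cg_mult cg_refl)
    fix i j assume ij: "i \<in> {..h2}" "j \<in> {..i}"
    have "cg p (\<Sum>x\<in>R. x ^ (2 * h2 + 2 * j - i)) (- of_bool (2 * h2 + 2 * j - i = p - 1))"
      using ij h2(4) h2(1) by (intro power_sum) auto
    moreover have "2 * h2 + 2 * j - i = p - 1 \<longleftrightarrow> i = 2 * j" using ij h2(1) by auto
    ultimately show "cg p (\<Sum>x\<in>R. x ^ (2 * h2 + 2 * j - i)) (- of_bool (i = 2 * j))" by simp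
  qed
  also have "(\<Sum>i\<le>h2. \<Sum>j\<le>i.
      int (h2 choose i) * a ^ (h2 - i) * int (i choose j) * b ^ (i - j) * (- of_bool (i = 2 * j))) = - htr h2 a b"
  proof -
    have "(\<Sum>i\<le>h2. \<Sum>j\<le>i. int (h2 choose i) * a ^ (h2 - i) * int (i choose j) * b ^ (i - j) * (- of_bool (i = 2 * j)))
      = (\<Sum>i\<le>h2. \<Sum>j | j \<in> {..h2 div 2} \<and> i = 2 * j. - (int (h2 choose i) * a ^ (h2 - i) * int (i choose j) * b ^ (i - j)))"
      by (intro sum.cong refl sum.mono_neutral_cong) auto
    also have "\<dots> = (\<Sum>j\<le>h2 div 2. \<Sum>i | i \<in> {..h2} \<and> i = 2 * j. - (int (h2 choose i) * a ^ (h2 - i) * int (i choose j) * b ^ (i - j)))"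
      by (rule sum.swap_restrict) auto
    also have "\<dots> = (\<Sum>j\<le>h2 div 2. - (int (h2 choose (2 * j)) * a ^ (h2 - 2 * j) * int ((2 * j) choose j) * b ^ j))"
    proof (intro sum.cong refl)
      fix j assume "j \<in> {..h2 div 2}"
      hence "{i. i \<in> {..h2} \<and> i = 2 * j} = {2 * j}" by auto
      thus "(\<Sum>i | i \<in> {..h2} \<and> i = 2 * j. - (int (h2 choose i) * a ^ (h2 - i) * int (i choose j) * b ^ (i - j)))
        = - (int (h2 choose (2 * j)) * a ^ (h2 - 2 * j) * int ((2 * j) choose j) * b ^ j)" by simp
    qed
    also have "\<dots> = - htr h2 a b" by (simp add: htr_def sum_negf mult_ac)
    finally show ?thesis .
  qed
  finally show ?thesis .
qed

lemma W4_S: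
  assumes "cg p (b * (64 - m)) (16 * a\<^sup>2)" and "\<not> int p dvd a" and "\<not> int p dvd b"
  shows "cg p (W4 p m) (- \<chi> a * S a b)"
proof -
  have "cg p (a ^ h2 * htr h2 a b) (\<chi> a * (- S a b))"
    using cg_minus[OF S_htr[of a b]] euler[of a] unfolding h2_def
    by (intro cg_mult) (auto intro: cg_sym)
  thus ?thesis using W4_htr[OF assms] cg_trans by (metis mult_minus_left mult_minus_right)
qed

subsection \<open>Congruences between rationals\<close>

lemma p_integers_iff: "x \<in> p_integers p \<longleftrightarrow> (\<exists>d c. \<not> int p dvd d \<and> of_int d * x = of_int c)"
proof
  assume x: "x \<in> p_integers p"
  obtain a b where ab: "quotient_of x = (a, b)" by force
  have b: "b > 0" "x = of_int a / of_int b" using quotient_of_denom_pos[OF ab] quotient_of_div[OF ab] by auto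
  have "coprime b (int p)" using x ab by (simp add: p_integers_def)
  hence "\<not> int p dvd b" using prime_P by (metis coprime_absorb_right not_prime_unit)
  thus "\<exists>d c. \<not> int p dvd d \<and> of_int d * x = of_int c" using b by (intro exI[of _ b] exI[of _ a]) auto
next
  assume "\<exists>d c. \<not> int p dvd d \<and> of_int d * x = of_int c"
  then obtain d c where dc: "\<not> int p dvd d" "of_int d * x = of_int c" by blast
  obtain a b where ab: "quotient_of x = (a, b)" by force
  have b: "b > 0" "x = of_int a / of_int b" using quotient_of_denom_pos[OF ab] quotient_of_div[OF ab] by auto
  have "of_int (d * a) = (of_int (c * b) :: rat)" using dc(2) b by (simp add: field_simps)
  hence "d * a = c * b" by (simp only: of_int_eq_iff)
  hence "b dvd d * a" by simp
  hence "b dvd d" using quotient_of_coprime[OF ab] by (simp add: coprime_commute coprime_dvd_mult_left_iff)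
  hence "\<not> int p dvd b" using dc(1) dvd_trans by blast
  hence "coprime b (int p)" using prime_P by (metis coprime_commute prime_imp_coprime)
  thus "x \<in> p_integers p" using ab by (simp add: p_integers_def)
qed

lemma p_integers_of_int [simp]: "of_int c \<in> p_integers p"
  unfolding p_integers_iff using not_dvd_small[of 1] p_gt_3 by (intro exI[of _ 1] exI[of _ c]) auto

lemma p_integers_add: "x \<in> p_integers p \<Longrightarrow> y \<in> p_integers p \<Longrightarrow> x + y \<in> p_integers p"
  unfolding p_integers_iff
proof (elim exE conjE)
  fix d c d' c' assume "\<not> int p dvd d" "\<not> int p dvd d'" "of_int d * x = of_int c" "of_int d' * y = of_int c'"
  thus "\<exists>d c. \<not> int p dvd d \<and> of_int d * (x + y) = of_int c"
    by (intro exI[of _ "d * d'"] exI[of _ "d' * c + d * c'"]) (auto simp: dvd_mult_iff algebra_simps)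
qed

lemma p_integers_uminus: "x \<in> p_integers p \<Longrightarrow> - x \<in> p_integers p"
  unfolding p_integers_iff by (metis mult_minus_right of_int_minus)

lemma pcong_sym: "pcong p x y \<Longrightarrow> pcong p y x"
  unfolding pcong_def using p_integers_uminus by (metis minus_diff_eq mult_minus_right)

lemma pcong_trans: "pcong p x y \<Longrightarrow> pcong p y z \<Longrightarrow> pcong p x z"
  unfolding pcong_def
proof (elim conjE bexE, intro conjI)
  fix u v assume "u \<in> p_integers p" "v \<in> p_integers p" "x - y = of_nat p * u" "y - z = of_nat p * v"
  thus "\<exists>w\<in>p_integers p. x - z = of_nat p * w"
    by (intro bexI[of _ "u + v"] p_integers_add) (auto simp: algebra_simps)
qed auto

lemma pcong_G4_sum:
  assumes m: "\<not> int p dvd m" and W: "cg p (c * W4 p m) r"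
  shows "pcong p (of_int c * (\<Sum>n=0..p-1. rat_of_int (G4 n) / of_int m ^ n)) (of_int r)"
proof -
  define X where "X = of_int c * (\<Sum>n=0..p-1. rat_of_int (G4 n) / of_int m ^ n)"
  have m0: "m \<noteq> 0" using m by auto
  have md: "\<not> int p dvd m ^ (p - 1)" using m p_gt_3 by (simp add: dvd_power_iff')
  have X: "of_int (m ^ (p - 1)) * X = of_int (c * W4 p m)"
  proof -
    have "of_int (m ^ (p - 1)) * (rat_of_int (G4 n) / of_int m ^ n) = of_int (G4 n * m ^ (p - 1 - n))"
      if "n \<le> p - 1" for n
    proof -
      have "(rat_of_int m) ^ (p - 1) = of_int m ^ (p - 1 - n) * of_int m ^ n"
        unfolding power_add[symmetric] using that by (intro arg_cong2[where f="(^)"]) auto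
      thus ?thesis using m0 by (simp add: field_simps)
    qed
    hence "of_int (m ^ (p - 1)) * (\<Sum>n=0..p-1. rat_of_int (G4 n) / of_int m ^ n) = of_int (W4 p m)"
      unfolding W4_def sum_distrib_left of_int_sum atLeast0AtMost by (intro sum.cong) auto
    thus ?thesis by (simp add: X_def mult_ac)
  qed
  have "cg p (c * W4 p m) (m ^ (p - 1) * r)"
    using cg_trans[OF W] cg_mult[OF cg_sym[OF fermat[OF m]] cg_refl[of p r]] by simp
  then obtain z where z: "c * W4 p m - m ^ (p - 1) * r = int p * z" unfolding cg_def by auto
  have "of_int (m ^ (p - 1)) * (X - of_int r) = of_nat p * rat_of_int z"
    using arg_cong[OF z, of rat_of_int] X by (simp add: algebra_simps)
  hence eq: "X - of_int r = of_nat p * (rat_of_int z / of_int (m ^ (p - 1)))"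
    using m0 by (simp add: field_simps)
  have "X \<in> p_integers p" unfolding p_integers_iff using X md by blast
  moreover have "rat_of_int z / of_int (m ^ (p - 1)) \<in> p_integers p"
    unfolding p_integers_iff using md m0 by (intro exI[of _ "m ^ (p - 1)"] exI[of _ z]) auto
  ultimately show ?thesis using eq unfolding pcong_def X_def[symmetric] by (metis p_integers_of_int)
qed

end

section \<open>Counting by orbits and fibres, and uniqueness of p = u^2 + d v^2\<close>

text \<open>Orbits are given by a map that is constant on each of its values, so no group action has
  to be formalised.\<close>

lemma orbit_dvd_card:
  assumes fin: "finite X" and orb: "\<And>x. x \<in> X \<Longrightarrow> x \<in> orb x \<and> orb x \<subseteq> X \<and> card (orb x) = k"
    and eq: "\<And>x y. x \<in> X \<Longrightarrow> y \<in> orb x \<Longrightarrow> orb y = orb x"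
  shows "k dvd card X"
proof -
  have "k * card (orb ` X) = card (\<Union>(orb ` X))"
  proof (rule card_partition)
    show "finite (orb ` X)" using fin by simp
    show "finite (\<Union>(orb ` X))" using orb fin by (meson UN_least finite_subset)
    show "\<And>c. c \<in> orb ` X \<Longrightarrow> card c = k" using orb by auto
    fix c1 c2 assume "c1 \<in> orb ` X" "c2 \<in> orb ` X" "c1 \<noteq> c2"
    then obtain x y where "x \<in> X" "y \<in> X" "c1 = orb x" "c2 = orb y" by auto
    thus "c1 \<inter> c2 = {}" using eq \<open>c1 \<noteq> c2\<close> by (metis disjoint_iff)
  qed
  moreover have "\<Union>(orb ` X) = X" using orb by blast
  ultimately show ?thesis by (metis dvd_triv_left)
qed

text \<open>The fibres have total size r |U| and none exceeds r, so each has exactly r elements. An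
  upper bound on fibres thus yields surjectivity and the weight at once.\<close>

lemma fibre_sum:
  fixes f :: "'u \<Rightarrow> int"
  assumes "finite U" "finite D" and \<Phi>: "\<And>d. d \<in> D \<Longrightarrow> \<Phi> d \<in> U" and c: "card D = r * card U"
    and le: "\<And>u. u \<in> U \<Longrightarrow> card {d\<in>D. \<Phi> d = u} \<le> r"
  shows "(\<Sum>d\<in>D. f (\<Phi> d)) = int r * (\<Sum>u\<in>U. f u)"
    and "\<And>u. u \<in> U \<Longrightarrow> card {d\<in>D. \<Phi> d = u} = r"
proof -
  have sub: "\<Phi> ` D \<subseteq> U" using \<Phi> by auto
  have "(\<Sum>u\<in>U. r - card {d\<in>D. \<Phi> d = u}) = (\<Sum>u\<in>U. r) - (\<Sum>u\<in>U. card {d\<in>D. \<Phi> d = u})"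
    by (rule sum_subtractf_nat) (use le in auto)
  also have "(\<Sum>u\<in>U. card {d\<in>D. \<Phi> d = u}) = (\<Sum>u\<in>U. \<Sum>d | d \<in> D \<and> \<Phi> d = u. 1)" by simp
  also have "\<dots> = (\<Sum>d\<in>D. 1)" by (rule sum.group) (use assms sub in auto)
  finally have "(\<Sum>u\<in>U. r - card {d\<in>D. \<Phi> d = u}) = 0" using c by simp
  hence *: "card {d\<in>D. \<Phi> d = u} = r" if "u \<in> U" for u
  proof -
    have "r - card {d\<in>D. \<Phi> d = u} = 0" using that assms(1) \<open>(\<Sum>u\<in>U. r - card {d\<in>D. \<Phi> d = u}) = 0\<close> by (simp only: sum_eq_0_iff)
    thus ?thesis using le[OF that] by simp
  qed
  thus "\<And>u. u \<in> U \<Longrightarrow> card {d\<in>D. \<Phi> d = u} = r" .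
  have "(\<Sum>d\<in>D. f (\<Phi> d)) = (\<Sum>u\<in>U. \<Sum>d | d \<in> D \<and> \<Phi> d = u. f (\<Phi> d))"
    by (rule sum.group[symmetric]) (use assms sub in auto)
  also have "\<dots> = (\<Sum>u\<in>U. int r * f u)"
  proof (rule sum.cong)
    fix u assume "u \<in> U"
    have "(\<Sum>d | d \<in> D \<and> \<Phi> d = u. f (\<Phi> d)) = (\<Sum>d | d \<in> D \<and> \<Phi> d = u. f u)" by simp
    also have "\<dots> = int (card {d\<in>D. \<Phi> d = u}) * f u" by simp
    finally show "(\<Sum>d | d \<in> D \<and> \<Phi> d = u. f (\<Phi> d)) = int r * f u" using *[OF \<open>u \<in> U\<close>] by simp
  qed simp
  finally show "(\<Sum>d\<in>D. f (\<Phi> d)) = int r * (\<Sum>u\<in>U. f u)" by (simp add: sum_distrib_left)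
qed

text \<open>The product (ub - av)(ub + av) equals p (b^2 - v^2), so p divides a factor. If that
  factor were nonzero, p^2 = (ua + dvb)^2 + d (ub - av)^2, or its analogue with -b, would be at
  least 2 p^2, since d \<ge> 2. Hence it vanishes and b^2 = v^2.\<close>

lemma norm_form_unique:
  fixes u v a b d :: int
  assumes p: "prime p" and d: "d \<ge> 2" and uv: "int p = u\<^sup>2 + d * v\<^sup>2" and ab: "int p = a\<^sup>2 + d * b\<^sup>2"
  shows "a = u \<or> a = - u"
proof -
  have *: "u * b = a * v" if "int p dvd u * b - a * v" "int p = a\<^sup>2 + d * b\<^sup>2" for b
  proof (rule ccontr)
    assume ne: "u * b \<noteq> a * v"
    have "(int p)\<^sup>2 = (u * a + d * v * b)\<^sup>2 + d * (u * b - a * v)\<^sup>2"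
    proof -
      have "(int p)\<^sup>2 = (u\<^sup>2 + d * v\<^sup>2) * (a\<^sup>2 + d * b\<^sup>2)" using uv that(2) by (metis power2_eq_square)
      thus ?thesis by (simp add: power2_eq_square algebra_simps)
    qed
    moreover have "\<bar>int p\<bar> \<le> \<bar>u * b - a * v\<bar>" using that(1) ne by (intro dvd_imp_le_int) auto
    hence "(int p)\<^sup>2 \<le> (u * b - a * v)\<^sup>2" by (simp only: abs_le_square_iff)
    hence "2 * (int p)\<^sup>2 \<le> d * (u * b - a * v)\<^sup>2" using d by (intro mult_mono) auto
    moreover have "(int p)\<^sup>2 > 0" using prime_gt_0_nat[OF p] by simp
    moreover have "(u * a + d * v * b)\<^sup>2 \<ge> 0" by simp
    ultimately show False by linarith
  qed
  have "(u * b - a * v) * (u * b + a * v) = u\<^sup>2 * b\<^sup>2 - a\<^sup>2 * v\<^sup>2" by (simp add: power2_eq_square algebra_simps)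
  also have "\<dots> = (int p - d * v\<^sup>2) * b\<^sup>2 - (int p - d * b\<^sup>2) * v\<^sup>2" using uv ab by simp
  also have "\<dots> = int p * (b\<^sup>2 - v\<^sup>2)" by (simp add: algebra_simps)
  finally have e: "(u * b - a * v) * (u * b + a * v) = int p * (b\<^sup>2 - v\<^sup>2)" .
  hence "int p dvd u * b - a * v \<or> int p dvd u * b + a * v"
    by (metis dvd_triv_left p prime_dvd_mult_iff prime_nat_int_transfer)
  hence "(u * b - a * v) * (u * b + a * v) = 0"
  proof
    assume "int p dvd u * b - a * v"
    thus ?thesis using *[of b] ab by simp
  next
    assume "int p dvd u * b + a * v"
    hence "int p dvd u * (- b) - a * v" by (metis dvd_minus_iff minus_add_distrib mult_minus_right diff_minus_eq_add uminus_add_conv_diff add.commute diff_conv_add_uminus)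
    thus ?thesis using *[of "- b"] ab by simp
  qed
  hence "b\<^sup>2 = v\<^sup>2" using e prime_gt_0_nat[OF p] by simp
  hence "a\<^sup>2 = u\<^sup>2" using uv ab by simp
  thus ?thesis by (simp add: power2_eq_iff)
qed

context big_prime
begin

lemma red_dvd: "int p dvd RS.red x \<longleftrightarrow> int p dvd x"
  using cg_cong_dvd[OF RS.red(2)] by blast

lemma not_dvd_2: "\<not> int p dvd 2" and not_dvd_3: "\<not> int p dvd 3" and not_dvd_1: "\<not> int p dvd 1"
  using not_dvd_small[of 2] not_dvd_small[of 3] not_dvd_small[of 1] p_gt_3 by auto

lemma not_dvd_4: "\<not> int p dvd 4"
  using dvd_mult_iff[of 2 2] not_dvd_2 by simp

text \<open>A nonzero value contributes 1 - 2 [nonresidue]. The residue of a character sum modulo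
  powers of 2 is thus read off from the number of nonresidue values, which orbits control.\<close>

lemma even_count_chi: "2 * int (card {x\<in>R. \<chi> (f x) = -1}) = int (card {x\<in>R. \<not> int p dvd f x}) - (\<Sum>x\<in>R. \<chi> (f x))"
proof -
  have "(\<Sum>x\<in>R. \<chi> (f x)) = (\<Sum>x\<in>R. of_bool (\<not> int p dvd f x) - 2 * of_bool (\<chi> (f x) = -1))"
  proof (rule sum.cong)
    fix x
    show "\<chi> (f x) = of_bool (\<not> int p dvd f x) - 2 * of_bool (\<chi> (f x) = - 1)"
      using chi_values[of "f x"] chi_0_iff[of "f x"] by auto
  qed simp
  also have "\<dots> = int (card {x\<in>R. \<not> int p dvd f x}) - 2 * int (card {x\<in>R. \<chi> (f x) = -1})"
    by (simp add: sum_subtractf Int_def flip: sum_distrib_left)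
  finally show ?thesis by simp
qed

lemma exists_nonresidue: "\<exists>g. \<chi> g = -1"
proof (rule ccontr)
  assume "\<not> ?thesis"
  hence "\<chi> x \<ge> 0" for x using chi_values[of x] by auto
  hence "(\<Sum>x\<in>R. \<chi> x) \<ge> (\<Sum>x\<in>{1}. \<chi> x)" using p_gt_3 by (intro sum_mono2) auto
  thus False using sum_chi by simp
qed

subsection \<open>Supplementary laws\<close>

lemma chi_minus_1: "\<chi> (-1) = (-1) ^ h2"
proof -
  have "\<bar>\<chi> (-1) - (-1) ^ h2\<bar> < int p"
    using chi_values[of "-1"] p_gt_3 by (cases "even h2") auto
  thus ?thesis using euler[of "-1"] unfolding h2_def by (intro small_cg_eq)
qed

lemma h2_mod: "p mod 4 = 1 \<Longrightarrow> even h2" "p mod 4 = 3 \<Longrightarrow> odd h2"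
  unfolding h2_def by presburger+

lemma chi_m1: "p mod 4 = 1 \<Longrightarrow> \<chi> (-1) = 1" "p mod 4 = 3 \<Longrightarrow> \<chi> (-1) = -1"
  using chi_minus_1 h2_mod by auto

lemma chi_uminus: "\<chi> (- a) = \<chi> (-1) * \<chi> a"
  using chi_mult[of "-1" a] by simp

text \<open>Gauss's lemma: among 2, 4, ..., 2 \<open>h2\<close> the multiples exceeding
  \<open>h2\<close> are the 2x with \<open>h2 div 2\<close> < x \<le> \<open>h2\<close>.\<close>

lemma chi_2: "\<chi> 2 = (-1) ^ (h2 - h2 div 2)"
proof -
  interpret G: GAUSS p 2
  proof
    show "prime p" by (rule prime_p)
    show "2 < p" using p_gt_3 by simp
    show "[2 \<noteq> 0] (mod int p)" using not_dvd_2 by (simp add: cong_0_iff)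
    show "(0::int) < 2" by simp
  qed
  have h: "(int p - 1) div 2 = int h2" using h2(2) by simp
  have "G.E = (\<lambda>x. 2 * x) ` {int (h2 div 2) <.. int h2}"
    unfolding G.E_def G.C_def G.B_def G.A_def h
  proof (intro equalityI subsetI)
    fix y assume "y \<in> (\<lambda>x. x mod int p) ` (\<lambda>x. x * 2) ` {0<..int h2} \<inter> {int h2<..}"
    then obtain x where x: "0 < x" "x \<le> int h2" "y = (x * 2) mod int p" "y > int h2" by auto
    hence "y = 2 * x" using h2(2) by simp
    moreover have "int (h2 div 2) < x" using x(4) \<open>y = 2 * x\<close> by (simp add: zdiv_int)
    ultimately show "y \<in> (\<lambda>x. 2 * x) ` {int (h2 div 2) <.. int h2}" using x by auto
  next
    fix y assume "y \<in> (\<lambda>x. 2 * x) ` {int (h2 div 2) <.. int h2}"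
    then obtain x where x: "int (h2 div 2) < x" "x \<le> int h2" "y = 2 * x" by auto
    have "y = (x * 2) mod int p" using x h2(2) by simp
    moreover have "int h2 < y" using x by (simp add: zdiv_int)
    moreover have "0 < x" using x(1) by (meson of_nat_0_le_iff order_le_less_trans)
    ultimately show "y \<in> (\<lambda>x. x mod int p) ` (\<lambda>x. x * 2) ` {0<..int h2} \<inter> {int h2<..}"
      using x(2) by auto
  qed
  hence "card G.E = card {int (h2 div 2) <.. int h2}"
    by (simp add: card_image inj_on_def)
  also have "\<dots> = h2 - h2 div 2" by simp
  finally show ?thesis using G.gauss_lemma by simp
qed

lemma h2_div_parity:
  "p mod 8 = 1 \<Longrightarrow> even (h2 - h2 div 2)" "p mod 8 = 7 \<Longrightarrow> even (h2 - h2 div 2)"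
  "p mod 8 = 3 \<Longrightarrow> odd (h2 - h2 div 2)" "p mod 8 = 5 \<Longrightarrow> odd (h2 - h2 div 2)"
proof -
  have *: "p = 8 * (p div 8) + p mod 8" by simp
  { assume "p mod 8 = 1" hence "h2 = 4 * (p div 8)" using * h2(5) by linarith
    thus "even (h2 - h2 div 2)" by simp }
  { assume "p mod 8 = 7" hence "h2 = 4 * (p div 8) + 3" using * h2(5) by linarith
    hence "h2 - h2 div 2 = 2 * (p div 8) + 2" by simp
    thus "even (h2 - h2 div 2)" by simp }
  { assume "p mod 8 = 3" hence "h2 = 4 * (p div 8) + 1" using * h2(5) by linarith
    hence "h2 - h2 div 2 = 2 * (p div 8) + 1" by simp
    thus "odd (h2 - h2 div 2)" by simp }
  { assume "p mod 8 = 5" hence "h2 = 4 * (p div 8) + 2" using * h2(5) by linarith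
    hence "h2 - h2 div 2 = 2 * (p div 8) + 1" by simp
    thus "odd (h2 - h2 div 2)" by simp }
qed

lemma chi_2_mod: "p mod 8 = 1 \<Longrightarrow> \<chi> 2 = 1" "p mod 8 = 7 \<Longrightarrow> \<chi> 2 = 1"
  "p mod 8 = 3 \<Longrightarrow> \<chi> 2 = -1" "p mod 8 = 5 \<Longrightarrow> \<chi> 2 = -1"
  unfolding chi_2 using h2_div_parity by (simp_all add: minus_one_power_iff)

text \<open>For q = 3 modulo 4 the sign in the reciprocity law is (-1)^h2 = \<chi>(-1), and moving
  it to the argument -q leaves no sign.\<close>

lemma chi_minus_prime:
  assumes q: "prime q" "q mod 4 = 3" "q \<noteq> p"
  shows "\<chi> (- int q) = Legendre (int p) (int q)"
proof -
  have "q > 2" using q prime_ge_2_nat[of q] by (cases "q = 2") auto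
  have *: "Legendre (int p) (int q) * \<chi> (int q) = (-1) ^ (h2 * ((q - 1) div 2))"
    using Quadratic_Reciprocity[OF prime_p _ q(1) \<open>q > 2\<close>] q p_gt_3 by (simp add: h2_def)
  have "odd ((q - 1) div 2)" using q(2) by presburger
  hence "(-1::int) ^ (h2 * ((q - 1) div 2)) = (-1) ^ h2" by (auto simp: minus_one_power_iff)
  hence "Legendre (int p) (int q) * \<chi> (int q) = \<chi> (-1)" using * chi_minus_1 by simp
  hence "Legendre (int p) (int q) * (\<chi> (int q) * \<chi> (int q)) = \<chi> (- int q)"
    using chi_uminus[of "int q"] by (metis mult.assoc mult.commute)
  moreover have "\<not> int p dvd int q" using q prime_p by (simp add: primes_dvd_imp_eq int_dvd_int_iff) (metis primes_dvd_imp_eq)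
  ultimately show ?thesis using chi_sq by simp
qed

lemma Legendre_mod: "Legendre a q = Legendre (a mod q) q"
  unfolding Legendre_def QuadRes_def cong_def by simp

lemma QuadRes_3: "Legendre 1 3 = 1" "Legendre 2 3 = -1"
proof -
  have "\<exists>y::int. [y\<^sup>2 = 1] (mod 3)" by (rule exI[of _ 1]) simp
  thus "Legendre 1 3 = 1" by (auto simp: Legendre_def QuadRes_def cong_def)
  have "\<not> (\<exists>y::int. [y\<^sup>2 = 2] (mod 3))"
  proof
    assume "\<exists>y::int. [y\<^sup>2 = 2] (mod 3)"
    then obtain y :: int where y: "y\<^sup>2 mod 3 = 2" by (auto simp: cong_def)
    have "y mod 3 = 0 \<or> y mod 3 = 1 \<or> y mod 3 = 2" by presburger
    hence "(y mod 3)\<^sup>2 mod 3 \<noteq> 2" by auto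
    thus False using y by (simp add: power_mod)
  qed
  thus "Legendre 2 3 = -1" by (auto simp: Legendre_def QuadRes_def cong_def)
qed

lemma Legendre_7: "Legendre 1 7 = 1" "Legendre 2 7 = 1" "Legendre 4 7 = 1"
  "Legendre 3 7 = -1" "Legendre 5 7 = -1" "Legendre 6 7 = -1"
proof -
  have "\<exists>y::int. y\<^sup>2 mod 7 = 1" "\<exists>y::int. y\<^sup>2 mod 7 = 2" "\<exists>y::int. y\<^sup>2 mod 7 = 4"
    by (rule exI[of _ 1], simp, rule exI[of _ 3], simp, rule exI[of _ 2], simp)
  thus "Legendre 1 7 = 1" "Legendre 2 7 = 1" "Legendre 4 7 = 1"
    by (auto simp: Legendre_def QuadRes_def cong_def)
  have "y\<^sup>2 mod 7 \<notin> {3, 5, 6}" for y :: int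
  proof -
    have "y mod 7 \<in> {0, 1, 2, 3, 4, 5, 6}" by (simp; presburger)
    hence "(y mod 7)\<^sup>2 mod 7 \<notin> {3, 5, 6}" by auto
    thus ?thesis by (simp add: power_mod)
  qed
  thus "Legendre 3 7 = -1" "Legendre 5 7 = -1" "Legendre 6 7 = -1"
    by (auto simp: Legendre_def QuadRes_def cong_def)
qed

lemma chi_m3: "p mod 3 = 1 \<Longrightarrow> \<chi> (-3) = 1"
proof -
  assume "p mod 3 = 1"
  hence "int p mod 3 = 1" by presburger
  thus ?thesis using chi_minus_prime[of 3] p_gt_3 QuadRes_3 Legendre_mod[of "int p" 3] by simp
qed

lemma chi_m7: "p mod 7 \<in> {1, 2, 4} \<Longrightarrow> \<chi> (-7) = 1" "p mod 7 \<in> {3, 5, 6} \<Longrightarrow> \<chi> (-7) = -1"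
proof -
  have *: "\<chi> (-7) = Legendre (int (p mod 7)) 7" if "p mod 7 \<noteq> 0"
    using chi_minus_prime[of 7] that Legendre_mod[of "int p" 7] by (cases "p = 7") (auto simp: zmod_int)
  show "p mod 7 \<in> {1, 2, 4} \<Longrightarrow> \<chi> (-7) = 1" "p mod 7 \<in> {3, 5, 6} \<Longrightarrow> \<chi> (-7) = -1"
    using * Legendre_7 by auto
qed

subsection \<open>The cubic character sums\<close>

lemma S_cong: "cg p a a' \<Longrightarrow> cg p b b' \<Longrightarrow> S a b = S a' b'"
  unfolding S_def by (intro sum.cong refl chi_cong cg_intros)

text \<open>The quadratic twist: substituting l x for x extracts l^3, whose character is that of
  l.\<close>

lemma S_scale: assumes l: "\<not> int p dvd l" shows "S (l * a) (l\<^sup>2 * b) = \<chi> l * S a b"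
proof -
  have "S (l * a) (l\<^sup>2 * b) = (\<Sum>x\<in>R. \<chi> ((l * x) ^ 3 + (l * a) * (l * x)\<^sup>2 + (l\<^sup>2 * b) * (l * x)))"
    unfolding S_def by (rule unit_reindex[OF _ l, symmetric]) (intro chi_cong cg_intros)
  also have "\<dots> = (\<Sum>x\<in>R. \<chi> (l * l\<^sup>2 * (x ^ 3 + a * x\<^sup>2 + b * x)))"
    by (intro sum.cong refl arg_cong[where f = \<chi>]) (simp add: power2_eq_square power3_eq_cube algebra_simps)
  also have "\<dots> = (\<Sum>x\<in>R. \<chi> l * \<chi> (x ^ 3 + a * x\<^sup>2 + b * x))"
    using chi_sq'[OF l] by simp
  finally show ?thesis by (simp add: S_def sum_distrib_left)
qed

text \<open>Since e is another root of the cubic, translating it to the origin again leaves no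
  constant term. A curve with all 2-torsion rational thus has several pairs (a, b).\<close>

lemma S_shift: assumes e: "cg p (e\<^sup>2 + a * e + b) 0" shows "S a b = S (3 * e + a) (3 * e\<^sup>2 + 2 * a * e + b)"
proof -
  have "S a b = (\<Sum>x\<in>R. \<chi> ((x + e) ^ 3 + a * (x + e)\<^sup>2 + b * (x + e)))"
    unfolding S_def by (rule shift_reindex[symmetric]) (intro chi_cong cg_intros)
  also have "\<dots> = S (3 * e + a) (3 * e\<^sup>2 + 2 * a * e + b)"
    unfolding S_def
  proof (intro sum.cong refl chi_cong)
    fix x
    have "(x + e) ^ 3 + a * (x + e)\<^sup>2 + b * (x + e) =
      x ^ 3 + (3 * e + a) * x\<^sup>2 + (3 * e\<^sup>2 + 2 * a * e + b) * x + e * (e\<^sup>2 + a * e + b)"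
      by (simp add: power2_eq_square power3_eq_cube algebra_simps)
    moreover have "cg p (x ^ 3 + (3 * e + a) * x\<^sup>2 + (3 * e\<^sup>2 + 2 * a * e + b) * x + e * (e\<^sup>2 + a * e + b))
      (x ^ 3 + (3 * e + a) * x\<^sup>2 + (3 * e\<^sup>2 + 2 * a * e + b) * x + e * 0)"
      by (intro cg_intros e)
    ultimately show "cg p ((x + e) ^ 3 + a * (x + e)\<^sup>2 + b * (x + e)) (x ^ 3 + (3 * e + a) * x\<^sup>2 + (3 * e\<^sup>2 + 2 * a * e + b) * x)"
      by (simp only: mult_zero_right add_0_right)
  qed
  finally show ?thesis .
qed

lemma cg_left_cong: "cg p x y \<Longrightarrow> cg p x z \<longleftrightarrow> cg p y z"
  by (rule iffI) (erule cg_trans[OF cg_sym], assumption, erule cg_trans)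

lemma of_bool_cg: "cg p x y \<Longrightarrow> of_bool (cg p x z) = of_bool (cg p y z)"
  by (rule arg_cong[where f = of_bool]) (rule cg_left_cong)

lemma count_quadratic: "(\<Sum>x\<in>R. of_bool (cg p (x\<^sup>2 + u * x + v) 0)) = 1 + \<chi> (u\<^sup>2 - 4 * v)"
proof -
  have "(\<Sum>x\<in>R. of_bool (cg p (x\<^sup>2 + u * x + v) 0)) = (\<Sum>x\<in>R. (of_bool (cg p ((2 * x + u)\<^sup>2) (u\<^sup>2 - 4 * v)) :: int))"
  proof (intro sum.cong refl)
    fix x
    have "4 * (x\<^sup>2 + u * x + v) = (2 * x + u)\<^sup>2 - (u\<^sup>2 - 4 * v)" by (simp add: power2_eq_square algebra_simps)
    hence "cg p (x\<^sup>2 + u * x + v) 0 \<longleftrightarrow> cg p ((2 * x + u)\<^sup>2) (u\<^sup>2 - 4 * v)"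
      using dvd_mult_iff[of 4 "x\<^sup>2 + u * x + v"] not_dvd_4 by (metis cg_0_int cg_def of_nat_id)
    thus "of_bool (cg p (x\<^sup>2 + u * x + v) 0) = (of_bool (cg p ((2 * x + u)\<^sup>2) (u\<^sup>2 - 4 * v)) :: int)" by simp
  qed
  also have "\<dots> = (\<Sum>x\<in>R. of_bool (cg p ((x + u)\<^sup>2) (u\<^sup>2 - 4 * v)))"
    by (rule unit_reindex[OF _ not_dvd_2]) (intro of_bool_cg cg_intros)
  also have "\<dots> = (\<Sum>x\<in>R. of_bool (cg p (x\<^sup>2) (u\<^sup>2 - 4 * v)))"
    by (rule shift_reindex) (intro of_bool_cg cg_intros)
  also have "\<dots> = 1 + \<chi> (u\<^sup>2 - 4 * v)" by (rule count_sqrt)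
  finally show ?thesis .
qed

lemma sum_of_bool_unique:
  assumes "\<And>t. t \<in> R \<Longrightarrow> P t \<longleftrightarrow> cg p c t" and "\<And>x y. cg p x y \<Longrightarrow> f x = f y"
  shows "(\<Sum>t\<in>R. of_bool (P t) * f t) = (f c :: int)"
proof -
  have "(\<Sum>t\<in>R. of_bool (P t) * f t) = (\<Sum>t\<in>R. if t = RS.red c then f t else 0)"
  proof (intro sum.cong refl)
    fix t assume t: "t \<in> R"
    have "P t \<longleftrightarrow> t = RS.red c" using assms(1)[OF t] t RS.red_eqI RS.red by metis
    thus "of_bool (P t) * f t = (if t = RS.red c then f t else 0)" by simp
  qed
  also have "\<dots> = f (RS.red c)" using RS.red(1) by simp
  finally show ?thesis using assms(2) RS.red by metis
qed

text \<open>The cubic is x^2 (t + a) with t = x + b / x, and t has 1 + \<chi>(t^2 - 4b) preimages.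
  The summand 1 leaves a vanishing linear sum; the other leaves the isogenous cubic after the shift
  by a.\<close>

lemma S_isogeny: assumes b: "\<not> int p dvd b" shows "S a b = S (- 2 * a) (a\<^sup>2 - 4 * b)"
proof -
  have "S a b = (\<Sum>x\<in>R. \<Sum>t\<in>R. of_bool (cg p (x\<^sup>2 + (- t) * x + b) 0) * \<chi> (t + a))"
    unfolding S_def
  proof (intro sum.cong refl)
    fix x assume x: "x \<in> R"
    show "\<chi> (x ^ 3 + a * x\<^sup>2 + b * x) = (\<Sum>t\<in>R. of_bool (cg p (x\<^sup>2 + (- t) * x + b) 0) * \<chi> (t + a))"
    proof (cases "x = 0")
      case True
      thus ?thesis using b chi_0_iff[of 0] by (simp add: cg_0_int)
    next
      case False
      hence nx: "\<not> int p dvd x" using dvd_R_iff[OF x] by simp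
      have bi: "cg p (x * (b * iv x)) (b * 1)" using cg_mult[OF cg_refl iv[OF nx], of b] by (simp add: mult_ac)
      have "(\<Sum>t\<in>R. of_bool (cg p (x\<^sup>2 + (- t) * x + b) 0) * \<chi> (t + a)) = \<chi> ((x + b * iv x) + a)"
      proof (rule sum_of_bool_unique)
        fix t
        have e: "cg p (x\<^sup>2 + (- t) * x + x * (b * iv x)) (x\<^sup>2 + (- t) * x + b)"
          using bi by (intro cg_intros) simp
        have "cg p (x\<^sup>2 + (- t) * x + b) 0 \<longleftrightarrow> cg p (x\<^sup>2 + (- t) * x + x * (b * iv x)) 0"
          using cg_left_cong[OF e] by simp
        also have "x\<^sup>2 + (- t) * x + x * (b * iv x) = x * (x + b * iv x - t)"
          by (simp add: power2_eq_square algebra_simps)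
        also have "cg p \<dots> 0 \<longleftrightarrow> cg p (x + b * iv x) t" using nx by (simp add: cg_def dvd_mult_iff)
        finally show "cg p (x\<^sup>2 + (- t) * x + b) 0 \<longleftrightarrow> cg p (x + b * iv x) t" .
      qed (intro chi_cong cg_intros)
      also have "\<dots> = \<chi> (x\<^sup>2 * ((x + b * iv x) + a))" using chi_sq'[OF nx] by simp
      also have "\<dots> = \<chi> (x ^ 3 + a * x\<^sup>2 + b * x)"
      proof (rule chi_cong)
        have "x\<^sup>2 * ((x + b * iv x) + a) = x ^ 3 + a * x\<^sup>2 + x * (x * (b * iv x))"
          by (simp add: power2_eq_square power3_eq_cube algebra_simps)
        moreover have "cg p (x ^ 3 + a * x\<^sup>2 + x * (x * (b * iv x))) (x ^ 3 + a * x\<^sup>2 + x * (b * 1))"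
          by (intro cg_intros bi)
        ultimately show "cg p (x\<^sup>2 * ((x + b * iv x) + a)) (x ^ 3 + a * x\<^sup>2 + b * x)" by (simp add: mult.commute)
      qed
      finally show ?thesis by simp
    qed
  qed
  also have "\<dots> = (\<Sum>t\<in>R. (\<Sum>x\<in>R. of_bool (cg p (x\<^sup>2 + (- t) * x + b) 0)) * \<chi> (t + a))"
    by (subst sum.swap) (simp add: sum_distrib_right)
  also have "\<dots> = (\<Sum>t\<in>R. (1 + \<chi> ((- t)\<^sup>2 - 4 * b)) * \<chi> (t + a))" by (simp only: count_quadratic)
  also have "\<dots> = (\<Sum>t\<in>R. \<chi> (t + a)) + (\<Sum>t\<in>R. \<chi> (((t + a) - a)\<^sup>2 - 4 * b) * \<chi> (t + a))"
    by (simp add: algebra_simps sum.distrib)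
  also have "(\<Sum>t\<in>R. \<chi> (t + a)) = 0" using sum_chi_linear[OF not_dvd_1, of a] by simp
  also have "(\<Sum>t\<in>R. \<chi> (((t + a) - a)\<^sup>2 - 4 * b) * \<chi> (t + a)) = (\<Sum>t\<in>R. \<chi> ((t - a)\<^sup>2 - 4 * b) * \<chi> t)"
    by (rule shift_reindex) (intro arg_cong2[where f = "(*)"] chi_cong cg_intros)
  also have "\<dots> = S (- 2 * a) (a\<^sup>2 - 4 * b)"
    unfolding S_def by (intro sum.cong refl, subst chi_mult[symmetric], intro arg_cong[where f = \<chi>])
      (simp add: power2_eq_square power3_eq_cube algebra_simps)
  finally show ?thesis by simp
qed

end

context big_prime
begin

subsection \<open>Roots of unity and power residue classes\<close>

abbreviation "Rs \<equiv> {1..<int p}"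

lemma Rs_iff: "x \<in> Rs \<longleftrightarrow> x \<in> R \<and> \<not> int p dvd x"
  using dvd_R_iff[of x] by auto

lemma Rs_not_dvd: "x \<in> Rs \<Longrightarrow> \<not> int p dvd x"
  using Rs_iff by blast

lemma fin_R: "finite {y\<in>R. Q y}"
  by (rule finite_subset[of _ R]) auto

lemma red_Rs: "\<not> int p dvd x \<Longrightarrow> RS.red x \<in> Rs"
  using Rs_iff RS.red(1) red_dvd by blast

lemma sum_R_Rs: "(\<Sum>x\<in>R. f x) = f 0 + (\<Sum>x\<in>Rs. (f x :: int))"
proof -
  have "R = insert 0 Rs" using p_gt_3 by auto
  thus ?thesis by simp
qed

text \<open>The order of w modulo p is exactly q: a primitive q-th root of unity, not a generator of
  the unit group.\<close>

definition prim_root :: "nat \<Rightarrow> int \<Rightarrow> bool" where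
  "prim_root q w \<longleftrightarrow> q > 0 \<and> cg p (w ^ q) 1 \<and> (\<forall>j. 0 < j \<and> j < q \<longrightarrow> \<not> cg p (w ^ j) 1)"

lemma cg_sym_iff: "cg p x y \<longleftrightarrow> cg p y x"
  using cg_sym by blast

lemma prim_root_not_dvd: "prim_root q w \<Longrightarrow> \<not> int p dvd w"
proof
  assume a: "prim_root q w" "int p dvd w"
  hence "int p dvd w ^ q" by (simp add: prim_root_def dvd_power_iff')
  moreover have "cg p (w ^ q) 1" using a by (simp add: prim_root_def)
  ultimately show False using cg_cong_dvd not_dvd_1 by blast
qed

lemma prim_root_power_mod: "prim_root q w \<Longrightarrow> cg p (w ^ j) (w ^ (j mod q))"
proof -
  assume w: "prim_root q w"
  have "w ^ j = (w ^ q) ^ (j div q) * w ^ (j mod q)" by (simp flip: power_mult power_add)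
  also have "cg p \<dots> (1 ^ (j div q) * w ^ (j mod q))"
    using w by (intro cg_mult cg_power cg_refl) (simp add: prim_root_def)
  finally show ?thesis by simp
qed

lemma prim_root_inj:
  assumes w: "prim_root q w" and ij: "i < q" "j < q" "cg p (w ^ i) (w ^ j)" shows "i = j"
proof -
  have *: False if "i < j" "j < q" "cg p (w ^ i) (w ^ j)" for i j
  proof -
    have "w ^ j = w ^ i * w ^ (j - i)" using that by (simp flip: power_add)
    hence "cg p (w ^ i * 1) (w ^ i * w ^ (j - i))" using that by simp
    hence "cg p 1 (w ^ (j - i))" using prim_root_not_dvd[OF w]
      by (intro cg_cancel[of "w ^ i" 1]) (auto simp: prime_dvd_power_iff dest: prime_dvd_power[OF prime_P])
    hence "cg p (w ^ (j - i)) 1" by (rule cg_sym)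
    moreover have "0 < j - i" "j - i < q" using that by auto
    ultimately show False using w unfolding prim_root_def by blast
  qed
  show ?thesis using *[of i j] *[of j i] ij cg_sym[OF ij(3)] by (cases i j rule: linorder_cases) auto
qed

lemma not_dvd_mult: "\<not> int p dvd a \<Longrightarrow> \<not> int p dvd b \<Longrightarrow> \<not> int p dvd a * b"
  by (simp add: dvd_mult_iff)

lemma not_dvd_pow: "\<not> int p dvd a \<Longrightarrow> \<not> int p dvd a ^ k"
  using prime_P prime_dvd_power by blast

lemma cg_cancel_right: "cg p (x * a) (y * a) \<Longrightarrow> \<not> int p dvd a \<Longrightarrow> cg p x (y::int)"
  using cg_cancel[of a x y] by (simp add: mult.commute)

lemma orbit_card:
  assumes w: "prim_root q w" and x: "\<not> int p dvd x"
  shows "card {y\<in>R. \<exists>j. cg p y (w ^ j * x)} = q"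
    and "{y\<in>R. \<exists>j. cg p y (w ^ j * x)} = (\<lambda>j. RS.red (w ^ j * x)) ` {..<q}"
proof -
  have q: "q > 0" using w by (simp add: prim_root_def)
  show e: "{y\<in>R. \<exists>j. cg p y (w ^ j * x)} = (\<lambda>j. RS.red (w ^ j * x)) ` {..<q}"
  proof (intro equalityI subsetI)
    fix y assume "y \<in> {y\<in>R. \<exists>j. cg p y (w ^ j * x)}"
    then obtain j where y: "y \<in> R" "cg p y (w ^ j * x)" by blast
    have "cg p y (w ^ (j mod q) * x)"
      by (rule cg_trans[OF y(2) cg_mult[OF prim_root_power_mod[OF w] cg_refl]])
    hence "RS.red (w ^ (j mod q) * x) = y" by (rule RS.red_eqI[OF y(1) cg_sym])
    moreover have "j mod q < q" using q by simp
    ultimately show "y \<in> (\<lambda>j. RS.red (w ^ j * x)) ` {..<q}" by blast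
  next
    fix y assume "y \<in> (\<lambda>j. RS.red (w ^ j * x)) ` {..<q}"
    then obtain j where "y = RS.red (w ^ j * x)" by blast
    thus "y \<in> {y\<in>R. \<exists>j. cg p y (w ^ j * x)}" using RS.red by blast
  qed
  have "inj_on (\<lambda>j. RS.red (w ^ j * x)) {..<q}"
  proof (rule inj_onI)
    fix i j assume ij: "i \<in> {..<q}" "j \<in> {..<q}" "RS.red (w ^ i * x) = RS.red (w ^ j * x)"
    hence "cg p (w ^ i * x) (w ^ j * x)" using RS.red_eq_iff by blast
    hence "cg p (w ^ i) (w ^ j)" using x by (rule cg_cancel_right)
    thus "i = j" using prim_root_inj[OF w] ij by blast
  qed
  thus "card {y\<in>R. \<exists>j. cg p y (w ^ j * x)} = q" unfolding e by (simp add: card_image)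
qed

lemma roots_bound: assumes "n > 0" shows "card {y\<in>R. cg p (y ^ n) c} \<le> n"
proof -
  define c' where "c' = nat (c mod int p)"
  have c': "cg p c (int c')" by (simp add: cg_int_iff_cong cong_def c'_def)
  have "card {y\<in>R. cg p (y ^ n) c} \<le> card {x\<in>{..<p}. [x ^ n = c'] (mod p)}"
  proof (rule card_inj_on_le[where f = nat])
    show "inj_on nat {y\<in>R. cg p (y ^ n) c}" by (rule inj_onI) auto
    show "nat ` {y\<in>R. cg p (y ^ n) c} \<subseteq> {x\<in>{..<p}. [x ^ n = c'] (mod p)}"
    proof
      fix x assume "x \<in> nat ` {y\<in>R. cg p (y ^ n) c}"
      then obtain y where y: "y \<in> R" "cg p (y ^ n) c" "x = nat y" by blast
      hence "cg p (int x ^ n) (int c')" using cg_trans[OF y(2) c'] by simp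
      hence "[int (x ^ n) = int c'] (mod int p)" by (simp add: cg_int_iff_cong)
      hence "[x ^ n = c'] (mod p)" by (rule cong_int_iff[THEN iffD1])
      thus "x \<in> {x\<in>{..<p}. [x ^ n = c'] (mod p)}" using y by auto
    qed
  qed auto
  also have "\<dots> \<le> n" using roots_mod_prime_bound[OF prime_p assms] .
  finally show ?thesis .
qed

text \<open>The orbit of x under powers of w already has q elements, and Y^q = x^q has at most q
  solutions.\<close>

lemma power_roots:
  assumes w: "prim_root q w" and x: "\<not> int p dvd x" and y: "cg p (y ^ q) (x ^ q)"
  shows "\<exists>j. cg p y (w ^ j * x)"
proof -
  have q: "q > 0" using w by (simp add: prim_root_def)
  have sub: "{y\<in>R. \<exists>j. cg p y (w ^ j * x)} \<subseteq> {y\<in>R. cg p (y ^ q) (x ^ q)}"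
  proof
    fix y assume "y \<in> {y\<in>R. \<exists>j. cg p y (w ^ j * x)}"
    then obtain j where y: "y \<in> R" "cg p y (w ^ j * x)" by blast
    have "cg p (y ^ q) ((w ^ j * x) ^ q)" using y(2) by (rule cg_power)
    also have "(w ^ j * x) ^ q = (w ^ q) ^ j * x ^ q" by (simp add: power_mult_distrib mult.commute flip: power_mult)
    also have "cg p \<dots> (1 ^ j * x ^ q)" using w by (intro cg_mult cg_power cg_refl) (simp add: prim_root_def)
    finally show "y \<in> {y\<in>R. cg p (y ^ q) (x ^ q)}" using y by simp
  qed
  have "card {y\<in>R. \<exists>j. cg p y (w ^ j * x)} \<ge> card {y\<in>R. cg p (y ^ q) (x ^ q)}"
    using roots_bound[OF q] orbit_card(1)[OF w x] by simp
  hence "{y\<in>R. \<exists>j. cg p y (w ^ j * x)} = {y\<in>R. cg p (y ^ q) (x ^ q)}"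
    by (intro card_seteq sub) (simp_all only: finite_Collect_conjI finite_atLeastLessThan_int fin_R)
  moreover have "RS.red y \<in> {y\<in>R. cg p (y ^ q) (x ^ q)}"
    using RS.red(1) cg_trans[OF cg_power[OF RS.red(3)] y] by simp
  ultimately obtain j where "cg p (RS.red y) (w ^ j * x)" by auto
  thus ?thesis using cg_trans[OF RS.red(2)] by blast
qed

lemma sum_power_roots:
  assumes w: "prim_root q w" and x: "\<not> int p dvd x" and f: "\<And>x y. cg p x y \<Longrightarrow> f x = f y"
  shows "(\<Sum>y\<in>R. of_bool (cg p (x ^ q) (y ^ q)) * f y) = (\<Sum>j<q. (f (w ^ j * x) :: int))"
proof -
  have "(\<Sum>y\<in>R. of_bool (cg p (x ^ q) (y ^ q)) * f y) = (\<Sum>y\<in>{y\<in>R. \<exists>j. cg p y (w ^ j * x)}. f y)"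
  proof (rule sum.mono_neutral_cong_right)
    have *: "cg p (x ^ q) (y ^ q) \<longleftrightarrow> (\<exists>j. cg p y (w ^ j * x))" for y
    proof
      assume "cg p (x ^ q) (y ^ q)"
      thus "\<exists>j. cg p y (w ^ j * x)" using power_roots[OF w x] cg_sym by blast
    next
      assume "\<exists>j. cg p y (w ^ j * x)"
      then obtain j where y: "cg p y (w ^ j * x)" by blast
      have "cg p (y ^ q) ((w ^ j * x) ^ q)" using y by (rule cg_power)
      also have "(w ^ j * x) ^ q = (w ^ q) ^ j * x ^ q" by (simp add: power_mult_distrib mult.commute flip: power_mult)
      also have "cg p \<dots> (1 ^ j * x ^ q)" using w by (intro cg_mult cg_power cg_refl) (simp add: prim_root_def)
      finally show "cg p (x ^ q) (y ^ q)" by (simp add: cg_sym)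
    qed
    show "\<forall>i\<in>R - {y \<in> R. \<exists>j. cg p y (w ^ j * x)}. of_bool (cg p (x ^ q) (i ^ q)) * f i = 0"
      using * by auto
    show "\<And>i. i \<in> {y \<in> R. \<exists>j. cg p y (w ^ j * x)} \<Longrightarrow> of_bool (cg p (x ^ q) (i ^ q)) * f i = f i"
      using * by auto
  qed auto
  also have "\<dots> = (\<Sum>j<q. f (RS.red (w ^ j * x)))"
    unfolding orbit_card(2)[OF w x]
  proof (subst sum.reindex)
    show "inj_on (\<lambda>j. RS.red (w ^ j * x)) {..<q}"
      using orbit_card[OF w x] by (intro eq_card_imp_inj_on) auto
  qed simp
  also have "\<dots> = (\<Sum>j<q. f (w ^ j * x))" by (intro sum.cong refl f RS.red)
  finally show ?thesis .
qed

lemma prim_root_prime: 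
  assumes q: "prime q" and w: "cg p (w ^ q) 1" "\<not> cg p w 1" shows "prim_root q w"
  unfolding prim_root_def
proof (intro conjI allI impI notI)
  show "q > 0" using q prime_gt_0_nat by blast
  show "cg p (w ^ q) 1" by fact
  fix j assume j: "0 < j \<and> j < q" "cg p (w ^ j) 1"
  hence "\<not> q dvd j" using dvd_imp_le by fastforce
  hence "coprime j q" using q by (metis coprime_commute prime_imp_coprime)
  hence "\<exists>x y. j * x = q * y + 1" using bezout_nat[of j q] j by simp
  then obtain x y where xy: "j * x = q * y + 1" by blast
  have "cg p ((w ^ j) ^ x) (1 ^ x)" using j by (intro cg_power) simp
  hence "cg p (w * (w ^ q) ^ y) 1" by (simp add: xy flip: power_mult)
  moreover have "cg p (w * (w ^ q) ^ y) (w * 1 ^ y)" using w by (intro cg_mult cg_power cg_refl)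
  ultimately have "cg p w 1" using cg_trans[OF cg_sym] by (metis mult.right_neutral power_one)
  thus False using w by blast
qed

lemma exists_prim_root: assumes q: "prime q" "q dvd p - 1" shows "\<exists>w. prim_root q w"
proof -
  obtain k where k: "p - 1 = q * k" using q(2) by blast
  have k0: "k > 0" "k < p - 1" using k p_gt_3 prime_gt_1_nat[OF q(1)] by (auto intro: gr0I)
  then obtain g where g: "\<not> int p dvd g" "\<not> cg p (g ^ k) 1" using exists_power_ne_1 by blast
  have "cg p ((g ^ k) ^ q) 1" using fermat[OF g(1)] k by (simp add: mult.commute flip: power_mult)
  thus ?thesis using prim_root_prime[OF q(1) _ g(2)] by blast
qed

lemma prim_root_minus_1: "prim_root 2 (-1)"
  using not_dvd_2 by (intro prim_root_prime) (auto simp: cg_def)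

text \<open>The hypothesis on the powers of g puts g^c, c < q, into distinct classes modulo q-th
  powers. So a fibre of (c, h) -> g^c h^q has a single c and at most q values of h, and the count of
  pairs forces equality. A moment over all units is thereby reduced to one value per class.\<close>

lemma power_class_sum:
  assumes w: "prim_root q w" and g: "\<not> int p dvd g"
    and nres: "\<And>c h. 0 < c \<Longrightarrow> c < q \<Longrightarrow> \<not> cg p (g ^ c) (h ^ q)"
    and F: "\<And>x y. cg p x y \<Longrightarrow> F x = F y"
  shows "(\<Sum>c<q. \<Sum>h\<in>Rs. F (g ^ c * h ^ q)) = int q * (\<Sum>u\<in>Rs. F u)"
proof -
  define \<Phi> where "\<Phi> = (\<lambda>(c, h). RS.red (g ^ c * h ^ q))"
  have aux: False if "c < c'" "c' < q" "\<not> int p dvd h" "\<not> int p dvd h'" "cg p (g ^ c * h ^ q) (g ^ c' * h' ^ q)" for c c' h h'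
  proof -
    have e: "g ^ c' = g ^ c * g ^ (c' - c)" using that by (simp flip: power_add)
    have "cg p (g ^ c * h ^ q) (g ^ c * (g ^ (c' - c) * h' ^ q))"
      using that(5) unfolding e by (simp add: mult_ac)
    hence "cg p (h ^ q) (g ^ (c' - c) * h' ^ q)" using not_dvd_pow[OF g] by (rule cg_cancel)
    hence "cg p (h ^ q * iv h' ^ q) (g ^ (c' - c) * h' ^ q * iv h' ^ q)" by (intro cg_mult cg_refl)
    hence "cg p ((h * iv h') ^ q) (g ^ (c' - c) * (h' * iv h') ^ q)" by (simp add: power_mult_distrib mult_ac)
    also have "cg p \<dots> (g ^ (c' - c) * 1 ^ q)" by (intro cg_mult cg_refl cg_power iv that)
    finally have "cg p (g ^ (c' - c)) ((h * iv h') ^ q)" by (simp add: cg_sym)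
    thus False using nres[of "c' - c"] that by auto
  qed
  have "(\<Sum>d\<in>{..<q} \<times> Rs. F (\<Phi> d)) = int q * (\<Sum>u\<in>Rs. F u)"
  proof (rule fibre_sum)
    show "finite Rs" "finite ({..<q} \<times> Rs)" by auto
    show "\<And>d. d \<in> {..<q} \<times> Rs \<Longrightarrow> \<Phi> d \<in> Rs"
    proof -
      fix d assume "d \<in> {..<q} \<times> Rs"
      then obtain c h where "d = (c, h)" "h \<in> Rs" by auto
      thus "\<Phi> d \<in> Rs" using red_Rs[OF not_dvd_mult[OF not_dvd_pow[OF g] not_dvd_pow[OF Rs_not_dvd]]]
        by (simp add: \<Phi>_def)
    qed
    show "card ({..<q} \<times> Rs) = q * card Rs" by (simp add: card_cartesian_product)
    fix u assume "u \<in> Rs"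
    show "card {d \<in> {..<q} \<times> Rs. \<Phi> d = u} \<le> q"
    proof (cases "{d \<in> {..<q} \<times> Rs. \<Phi> d = u} = {}")
      case False
      then obtain c0 h0 where c0: "c0 < q" "h0 \<in> Rs" "\<Phi> (c0, h0) = u" by auto
      have "{d \<in> {..<q} \<times> Rs. \<Phi> d = u} \<subseteq> (\<lambda>y. (c0, y)) ` {y\<in>R. \<exists>j. cg p y (w ^ j * h0)}"
      proof
        fix d assume "d \<in> {d \<in> {..<q} \<times> Rs. \<Phi> d = u}"
        then obtain c h where d: "d = (c, h)" "c < q" "h \<in> Rs" "\<Phi> (c, h) = \<Phi> (c0, h0)" using c0 by auto
        hence e: "cg p (g ^ c * h ^ q) (g ^ c0 * h0 ^ q)" by (simp add: \<Phi>_def RS.red_eq_iff)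
        have nd: "\<not> int p dvd h" "\<not> int p dvd h0" using d c0 Rs_not_dvd by auto
        have "c = c0" using aux[of c c0 h h0] aux[of c0 c h0 h] e nd d c0 cg_sym[OF e] by (cases c c0 rule: linorder_cases) auto
        hence "cg p (h ^ q) (h0 ^ q)" using cg_cancel[OF _ not_dvd_pow[OF g], of c0] e by simp
        hence "\<exists>j. cg p h (w ^ j * h0)" using power_roots[OF w] nd by blast
        thus "d \<in> (\<lambda>y. (c0, y)) ` {y\<in>R. \<exists>j. cg p y (w ^ j * h0)}" using d \<open>c = c0\<close> Rs_iff by blast
      qed
      hence "card {d \<in> {..<q} \<times> Rs. \<Phi> d = u} \<le> card {y\<in>R. \<exists>j. cg p y (w ^ j * h0)}"
        by (intro surj_card_le fin_R)
      thus ?thesis using orbit_card(1)[OF w] c0 Rs_not_dvd by simp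
    qed (metis card.empty le0)
  qed
  also have "(\<Sum>d\<in>{..<q} \<times> Rs. F (\<Phi> d)) = (\<Sum>c<q. \<Sum>h\<in>Rs. F (g ^ c * h ^ q))"
    unfolding sum.cartesian_product \<Phi>_def using F[OF RS.red(3)] by (simp add: case_prod_unfold)
  finally show ?thesis .
qed

text \<open>Otherwise the q-th power map on the finite set of units would be onto, hence injective,
  although w and 1 have the same q-th power.\<close>

lemma exists_nonpower:
  assumes w: "prim_root q w" and q: "q > 1"
  shows "\<exists>g. \<not> int p dvd g \<and> (\<forall>h. \<not> cg p g (h ^ q))"
proof (rule ccontr)
  assume "\<not> ?thesis"
  hence ex: "\<And>g. \<not> int p dvd g \<Longrightarrow> \<exists>h. cg p g (h ^ q)" by blast
  define f where "f = (\<lambda>h. RS.red (h ^ q))"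
  have "Rs \<subseteq> f ` Rs"
  proof
    fix g assume g: "g \<in> Rs"
    then obtain h where h: "cg p g (h ^ q)" using ex Rs_not_dvd by blast
    have "\<not> int p dvd h" using cg_cong_dvd[OF h] Rs_not_dvd[OF g] q dvd_power_iff'[of q h] by auto
    moreover have "f (RS.red h) = g"
      unfolding f_def using g Rs_iff RS.red_eqI[OF _ cg_sym[OF cg_trans[OF h cg_power[OF RS.red(2)]]]] by blast
    ultimately show "g \<in> f ` Rs" using red_Rs by blast
  qed
  moreover have "f ` Rs \<subseteq> Rs" unfolding f_def using red_Rs not_dvd_pow Rs_not_dvd by blast
  ultimately have "f ` Rs = Rs" by blast
  hence inj: "inj_on f Rs" by (intro eq_card_imp_inj_on) auto
  have w1: "\<not> cg p w 1" using w q unfolding prim_root_def by (metis power_one_right zero_less_one)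
  have "f (RS.red w) = f (RS.red 1)"
    unfolding f_def RS.red_eq_iff
  proof -
    have "cg p (RS.red w ^ q) (w ^ q)" by (intro cg_power RS.red)
    also have "cg p \<dots> 1" using w by (simp add: prim_root_def)
    also have "cg p 1 (RS.red 1 ^ q)" using cg_power[OF RS.red(2)[of 1], of q] by simp
    finally show "cg p (RS.red w ^ q) (RS.red 1 ^ q)" .
  qed
  hence "RS.red w = RS.red 1"
    using inj prim_root_not_dvd[OF w] not_dvd_1 red_Rs by (meson inj_onD)
  thus False using w1 RS.red_eq_iff by blast
qed

lemma unity_closed:
  assumes X: "X \<subseteq> Rs" and cl: "\<And>x y. x \<in> X \<Longrightarrow> y \<in> R \<Longrightarrow> cg p y (w * x) \<Longrightarrow> y \<in> X"
    and x: "x \<in> X" and y: "y \<in> R" "cg p y (w ^ j * x)"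
  shows "y \<in> X"
  using y
proof (induction j arbitrary: y)
  case 0
  have "x \<in> R" using x X Rs_iff by blast
  moreover have "cg p y x" using 0 by simp
  ultimately have "y = x" using RS.uniq[OF 0(1)] by blast
  thus ?case using x by simp
next
  case (Suc j)
  have r: "RS.red (w ^ j * x) \<in> X" using Suc.IH RS.red by blast
  have "cg p (w * (w ^ j * x)) (w * RS.red (w ^ j * x))" by (intro cg_mult cg_refl RS.red)
  hence "cg p y (w * RS.red (w ^ j * x))" using cg_trans[OF Suc.prems(2)] by (simp add: mult_ac)
  thus ?case using cl[OF r Suc.prems(1)] by blast
qed

lemma unity_orbit_dvd:
  assumes w: "prim_root q w" and X: "X \<subseteq> Rs" and cl: "\<And>x y. x \<in> X \<Longrightarrow> y \<in> R \<Longrightarrow> cg p y (w * x) \<Longrightarrow> y \<in> X"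
  shows "q dvd card X"
proof (rule orbit_dvd_card[where orb = "\<lambda>x. {y\<in>R. \<exists>j. cg p y (w ^ j * x)}"])
  show "finite X" using X finite_subset by blast
  have cl': "y \<in> X" if "x \<in> X" "y \<in> R" "cg p y (w ^ j * x)" for x y j
    using unity_closed[OF X cl that] .
  fix x assume x: "x \<in> X"
  show "x \<in> {y\<in>R. \<exists>j. cg p y (w ^ j * x)} \<and> {y\<in>R. \<exists>j. cg p y (w ^ j * x)} \<subseteq> X \<and> card {y\<in>R. \<exists>j. cg p y (w ^ j * x)} = q"
  proof (intro conjI)
    have "cg p x (w ^ 0 * x)" by simp
    thus "x \<in> {y\<in>R. \<exists>j. cg p y (w ^ j * x)}" using x X Rs_iff by blast
    show "{y\<in>R. \<exists>j. cg p y (w ^ j * x)} \<subseteq> X" using cl'[OF x] by blast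
    show "card {y\<in>R. \<exists>j. cg p y (w ^ j * x)} = q" using orbit_card(1)[OF w] x X Rs_not_dvd by blast
  qed
  fix y assume "y \<in> {y\<in>R. \<exists>j. cg p y (w ^ j * x)}"
  then obtain j where j: "cg p y (w ^ j * x)" by blast
  have inv_rel: "cg p x (w ^ ((q - 1) * j) * y)"
  proof -
    have "cg p (w ^ ((q - 1) * j) * y) (w ^ ((q - 1) * j) * (w ^ j * x))" by (intro cg_mult cg_refl j)
    also have "w ^ ((q - 1) * j) * (w ^ j * x) = (w ^ q) ^ j * x"
    proof -
      have "(q - 1) * j + j = q * j" using w by (cases q) (auto simp: prim_root_def)
      thus ?thesis by (simp flip: power_mult power_add mult.assoc)
    qed
    also have "cg p \<dots> (1 ^ j * x)" using w by (intro cg_mult cg_power cg_refl) (simp add: prim_root_def)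
    finally show ?thesis by (simp add: cg_sym)
  qed
  have tr: "cg p z (w ^ (i + k) * b)" if "cg p z (w ^ i * a)" "cg p a (w ^ k * b)" for z a b i k
    using cg_trans[OF that(1) cg_mult[OF cg_refl that(2)]] by (simp add: power_add mult_ac)
  show "{z\<in>R. \<exists>j. cg p z (w ^ j * y)} = {z\<in>R. \<exists>j. cg p z (w ^ j * x)}"
    using tr[OF _ j] tr[OF _ inv_rel] by blast
qed

text \<open>The maps x -> w x and x -> 1 / x generate orbits consisting of the classes of x and of 1
  / x under powers of w. A relation x^2 = w^j is exactly what would make the two classes
  meet.\<close>

lemma dihedral_orbit_dvd:
  assumes w: "prim_root q w" and X: "X \<subseteq> Rs" and cl: "\<And>x y. x \<in> X \<Longrightarrow> y \<in> R \<Longrightarrow> cg p y (w * x) \<Longrightarrow> y \<in> X"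
    and cli: "\<And>x y. x \<in> X \<Longrightarrow> y \<in> R \<Longrightarrow> cg p y (iv x) \<Longrightarrow> y \<in> X"
    and nfix: "\<And>x j. x \<in> X \<Longrightarrow> \<not> cg p (x\<^sup>2) (w ^ j)"
  shows "2 * q dvd card X"
proof (rule orbit_dvd_card[where orb = "\<lambda>x. {y\<in>R. \<exists>j. cg p y (w ^ j * x)} \<union> {y\<in>R. \<exists>j. cg p y (w ^ j * iv x)}"])
  show "finite X" using X finite_subset by blast
  have cl': "y \<in> X" if "x \<in> X" "y \<in> R" "cg p y (w ^ j * x)" for x y j
    using unity_closed[OF X cl that] .
  have tr: "cg p z (w ^ (i + k) * b)" if "cg p z (w ^ i * a)" "cg p a (w ^ k * b)" for z a b i k
    using cg_trans[OF that(1) cg_mult[OF cg_refl that(2)]] by (simp add: power_add mult_ac)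
  have inve: "cg p (w ^ ((q - 1) * j) * w ^ j) 1" for j
  proof -
    have "(q - 1) * j + j = q * j" using w by (cases q) (auto simp: prim_root_def)
    hence "w ^ ((q - 1) * j) * w ^ j = (w ^ q) ^ j" by (simp flip: power_mult power_add)
    moreover have "cg p ((w ^ q) ^ j) (1 ^ j)" using w by (intro cg_power) (simp add: prim_root_def)
    ultimately show ?thesis by simp
  qed
  have inv_rel: "cg p x (w ^ ((q - 1) * j) * y)" if j: "cg p y (w ^ j * x)" for x y j
  proof -
    have "cg p (w ^ ((q - 1) * j) * y) (w ^ ((q - 1) * j) * (w ^ j * x))" by (intro cg_mult cg_refl j)
    also have "w ^ ((q - 1) * j) * (w ^ j * x) = w ^ ((q - 1) * j) * w ^ j * x" by simp
    also have "cg p \<dots> (1 * x)" by (intro cg_mult cg_refl inve)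
    finally show ?thesis by (simp add: cg_sym)
  qed
  have ivm: "cg p (iv (w ^ j * x)) (w ^ ((q - 1) * j) * iv x)" for x j
  proof -
    have "\<not> int p dvd w ^ j" using not_dvd_pow prim_root_not_dvd[OF w] by blast
    have "cg p (iv (w ^ j)) (w ^ ((q - 1) * j))"
    proof (rule cg_cancel[of "w ^ j"])
      show "cg p (w ^ j * iv (w ^ j)) (w ^ j * w ^ ((q - 1) * j))"
        using cg_trans[OF iv cg_sym[OF inve[of j]]] \<open>\<not> int p dvd w ^ j\<close> by (simp add: mult.commute)
    qed fact
    hence "cg p (iv (w ^ j) * iv x) (w ^ ((q - 1) * j) * iv x)" by (intro cg_mult cg_refl)
    thus ?thesis by (simp add: iv_def power_mult_distrib)
  qed
  fix x assume x: "x \<in> X"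
  have nd: "\<not> int p dvd x" using x X Rs_not_dvd by blast
  have ndi: "\<not> int p dvd iv x" using nd iv_dvd by blast
  have xi: "RS.red (iv x) \<in> X" using cli[OF x RS.red(1) RS.red(3)] .
  show "x \<in> {y\<in>R. \<exists>j. cg p y (w ^ j * x)} \<union> {y\<in>R. \<exists>j. cg p y (w ^ j * iv x)} \<and>
    {y\<in>R. \<exists>j. cg p y (w ^ j * x)} \<union> {y\<in>R. \<exists>j. cg p y (w ^ j * iv x)} \<subseteq> X \<and>
    card ({y\<in>R. \<exists>j. cg p y (w ^ j * x)} \<union> {y\<in>R. \<exists>j. cg p y (w ^ j * iv x)}) = 2 * q"
  proof (intro conjI)
    have "cg p x (w ^ 0 * x)" by simp
    thus "x \<in> {y\<in>R. \<exists>j. cg p y (w ^ j * x)} \<union> {y\<in>R. \<exists>j. cg p y (w ^ j * iv x)}" using x X Rs_iff by blast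
    have "y \<in> X" if "y \<in> R" "cg p y (w ^ j * iv x)" for y j
      using cl'[OF xi that(1)] cg_trans[OF that(2) cg_mult[OF cg_refl RS.red(2)]] by blast
    thus "{y\<in>R. \<exists>j. cg p y (w ^ j * x)} \<union> {y\<in>R. \<exists>j. cg p y (w ^ j * iv x)} \<subseteq> X" using cl'[OF x] by blast
    have "{y\<in>R. \<exists>j. cg p y (w ^ j * x)} \<inter> {y\<in>R. \<exists>j. cg p y (w ^ j * iv x)} = {}"
    proof (rule ccontr)
      assume "\<not> ?thesis"
      then obtain y i j where y: "cg p y (w ^ i * x)" "cg p y (w ^ j * iv x)" by blast
      have "cg p x (w ^ ((q - 1) * i + j) * iv x)" using tr[OF inv_rel[OF y(1)] y(2)] .
      hence "cg p (x * x) (w ^ ((q - 1) * i + j) * iv x * x)" by (intro cg_mult cg_refl)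
      also have "w ^ ((q - 1) * i + j) * iv x * x = w ^ ((q - 1) * i + j) * (iv x * x)" by simp
      also have "cg p \<dots> (w ^ ((q - 1) * i + j) * 1)" by (intro cg_mult cg_refl iv' nd)
      finally show False using nfix[OF x] by (simp add: power2_eq_square)
    qed
    thus "card ({y\<in>R. \<exists>j. cg p y (w ^ j * x)} \<union> {y\<in>R. \<exists>j. cg p y (w ^ j * iv x)}) = 2 * q"
      using card_Un_disjoint[OF fin_R fin_R] orbit_card(1)[OF w nd] orbit_card(1)[OF w ndi] by (simp only: mult_2)
  qed
  fix y assume "y \<in> {y\<in>R. \<exists>j. cg p y (w ^ j * x)} \<union> {y\<in>R. \<exists>j. cg p y (w ^ j * iv x)}"
  then consider j where "cg p y (w ^ j * x)" | j where "cg p y (w ^ j * iv x)" by blast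
  thus "{z\<in>R. \<exists>j. cg p z (w ^ j * y)} \<union> {z\<in>R. \<exists>j. cg p z (w ^ j * iv y)} =
    {z\<in>R. \<exists>j. cg p z (w ^ j * x)} \<union> {z\<in>R. \<exists>j. cg p z (w ^ j * iv x)}"
  proof cases
    case 1
    have a: "cg p (iv y) (w ^ ((q - 1) * j) * iv x)" using cg_trans[OF iv_cong[OF 1] ivm] .
    show ?thesis
      using tr[OF _ 1] tr[OF _ inv_rel[OF 1]] tr[OF _ a] tr[OF _ inv_rel[OF a]] by blast
  next
    case 2
    have "cg p (iv y) (w ^ ((q - 1) * j) * iv (iv x))" using cg_trans[OF iv_cong[OF 2] ivm] .
    hence a: "cg p (iv y) (w ^ ((q - 1) * j) * x)" using cg_trans[OF _ cg_mult[OF cg_refl iv_iv]] by blast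
    show ?thesis
      using tr[OF _ 2] tr[OF _ inv_rel[OF 2]] tr[OF _ a] tr[OF _ inv_rel[OF a]] by blast
  qed
qed

text \<open>After expanding the square, the sum over g is done by \<open>sum_chi_chi\<close>, which
  retains only the pairs with q x = q y. The weight f is 1 or \<chi> in the applications.\<close>

lemma second_moment:
  fixes f :: "int \<Rightarrow> int" and q :: "int \<Rightarrow> int"
  shows "(\<Sum>g\<in>R. (\<Sum>x\<in>R. f x * \<chi> (g + q x))\<^sup>2) =
    int p * (\<Sum>x\<in>R. \<Sum>y\<in>R. of_bool (cg p (q x) (q y)) * (f x * f y)) - (\<Sum>x\<in>R. f x)\<^sup>2"
proof -
  have "(\<Sum>g\<in>R. (\<Sum>x\<in>R. f x * \<chi> (g + q x))\<^sup>2) =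
      (\<Sum>g\<in>R. \<Sum>x\<in>R. \<Sum>y\<in>R. f x * f y * (\<chi> (g + q x) * \<chi> (g + q y)))"
    by (simp add: power2_eq_square sum_product mult_ac)
  also have "\<dots> = (\<Sum>x\<in>R. \<Sum>y\<in>R. f x * f y * (\<Sum>g\<in>R. \<chi> (g + q x) * \<chi> (g + q y)))"
    by (subst sum.swap, rule sum.cong[OF refl], subst sum.swap, rule sum.cong[OF refl]) (simp add: sum_distrib_left)
  also have "\<dots> = (\<Sum>x\<in>R. \<Sum>y\<in>R. int p * (of_bool (cg p (q x) (q y)) * (f x * f y)) - f x * f y)"
    unfolding sum_chi_chi by (intro sum.cong refl) (simp add: algebra_simps)
  also have "\<dots> = int p * (\<Sum>x\<in>R. \<Sum>y\<in>R. of_bool (cg p (q x) (q y)) * (f x * f y)) - (\<Sum>x\<in>R. f x)\<^sup>2"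
  proof -
    have "(\<Sum>x\<in>R. f x)\<^sup>2 = (\<Sum>x\<in>R. \<Sum>y\<in>R. f x * f y)" unfolding power2_eq_square by (rule sum_product)
    thus ?thesis by (simp only: sum_subtractf sum_distrib_left)
  qed
  finally show ?thesis .
qed

end

context big_prime
begin

lemma chi_0 [simp]: "\<chi> 0 = 0"
  using chi_0_iff by simp

lemma even_power_chi: "\<not> int p dvd a \<Longrightarrow> even k \<Longrightarrow> \<chi> a ^ k = 1"
  using chi_sq'[of a] by (auto elim!: evenE simp: power_mult)

lemma h2_mult: "(int p - 1) * x = (int p - 1) * y \<Longrightarrow> x = y"
  using p_gt_3 by simp

subsection \<open>Discriminant -4\<close>

lemma S_D4_0: assumes "p mod 4 = 3" shows "S 0 (-1) = 0"
proof -
  have "\<not> int p dvd - 1" using not_dvd_1 by simp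
  from S_scale[OF this, of 0 "-1"] show ?thesis using chi_m1(2)[OF assms] by simp
qed

lemma S_0_eq: "S 0 g = (\<Sum>x\<in>R. \<chi> x * \<chi> (g + x\<^sup>2))"
  unfolding S_def chi_mult[symmetric] by (intro sum.cong refl arg_cong[where f = \<chi>])
    (simp add: power2_eq_square power3_eq_cube algebra_simps)

text \<open>Only y = x and y = -x survive in the second moment, each with weight 1 because
  \<chi>(-1) = 1, which gives 2p (p - 1). By \<open>S_scale\<close> the square of S(0, u) depends
  only on whether u is a square, so the moment is (p - 1)/2 times the sum of the two
  squares.\<close>

lemma S_D4_moment:
  assumes p4: "p mod 4 = 1" and g: "\<chi> g = -1"
  shows "(S 0 (-1))\<^sup>2 + (S 0 g)\<^sup>2 = 4 * int p"
proof -
  have g0: "\<not> int p dvd g" using g chi_0_iff[of g] by auto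
  have "(\<Sum>u\<in>R. (S 0 u)\<^sup>2) = int p * (\<Sum>x\<in>R. \<Sum>y\<in>R. of_bool (cg p (x\<^sup>2) (y\<^sup>2)) * (\<chi> x * \<chi> y)) - (\<Sum>x\<in>R. \<chi> x)\<^sup>2"
    unfolding S_0_eq by (rule second_moment)
  also have "(\<Sum>x\<in>R. \<Sum>y\<in>R. of_bool (cg p (x\<^sup>2) (y\<^sup>2)) * (\<chi> x * \<chi> y)) = (\<Sum>x\<in>Rs. 2)"
  proof -
    have "(\<Sum>y\<in>R. of_bool (cg p (x\<^sup>2) (y\<^sup>2)) * (\<chi> x * \<chi> y)) = 2" if "x \<in> Rs" for x
    proof -
      have nd: "\<not> int p dvd x" using that Rs_not_dvd by blast
      have "(\<Sum>y\<in>R. of_bool (cg p (x\<^sup>2) (y\<^sup>2)) * (\<chi> x * \<chi> y)) = (\<Sum>j<2. \<chi> x * \<chi> ((-1) ^ j * x))"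
        by (rule sum_power_roots[OF prim_root_minus_1 nd]) (intro arg_cong2[where f = "(*)"] chi_cong refl)
      also have "\<dots> = \<chi> x * \<chi> x + \<chi> (-1) * (\<chi> x * \<chi> x)" by (simp add: numeral_2_eq_2 chi_uminus[of x])
      finally show ?thesis using chi_m1(1)[OF p4] chi_sq[OF nd] by simp
    qed
    thus ?thesis by (subst sum_R_Rs) simp
  qed
  also have "(\<Sum>u\<in>R. (S 0 u)\<^sup>2) = (\<Sum>u\<in>Rs. (S 0 u)\<^sup>2)"
  proof -
    have "S 0 0 = (\<Sum>x\<in>R. \<chi> x)"
      unfolding S_def by (intro sum.cong refl) (use chi_values in \<open>force simp: power3_eq_cube\<close>)
    thus ?thesis using sum_chi by (subst sum_R_Rs) simp
  qed
  finally have tot: "(\<Sum>u\<in>Rs. (S 0 u)\<^sup>2) = 2 * int p * (int p - 1)" using sum_chi by simp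
  have "(\<Sum>c<2. \<Sum>h\<in>Rs. (S 0 (g ^ c * h ^ 2))\<^sup>2) = int 2 * (\<Sum>u\<in>Rs. (S 0 u)\<^sup>2)"
  proof (rule power_class_sum[OF prim_root_minus_1 g0])
    fix c h assume "0 < c" "c < (2::nat)"
    hence "c = 1" by simp
    show "\<not> cg p (g ^ c) (h\<^sup>2)"
    proof
      assume "cg p (g ^ c) (h\<^sup>2)"
      hence "\<chi> g = (\<chi> h)\<^sup>2" using chi_cong \<open>c = 1\<close> by fastforce
      thus False using g by (metis zero_le_power2 neg_0_le_iff_le not_one_le_zero)
    qed
  next
    fix x y :: int assume "cg p x y"
    hence "S 0 x = S 0 y" by (intro S_cong cg_refl)
    thus "(S 0 x)\<^sup>2 = (S 0 y)\<^sup>2" by simp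
  qed
  also have "(\<Sum>c<2. \<Sum>h\<in>Rs. (S 0 (g ^ c * h ^ 2))\<^sup>2) = (\<Sum>c<(2::nat). \<Sum>h\<in>Rs. (S 0 (g ^ c))\<^sup>2)"
  proof (intro sum.cong refl)
    fix c h assume "h \<in> Rs"
    hence "\<not> int p dvd h" using Rs_not_dvd by blast
    thus "(S 0 (g ^ c * h\<^sup>2))\<^sup>2 = (S 0 (g ^ c))\<^sup>2"
      using S_scale[of h 0 "g ^ c"] chi_sq'[of h] by (simp add: mult.commute power_mult_distrib)
  qed
  also have "\<dots> = (int p - 1) * ((S 0 1)\<^sup>2 + (S 0 g)\<^sup>2)"
    using p_gt_3 by (simp add: numeral_2_eq_2 algebra_simps of_nat_diff)
  finally have "(int p - 1) * ((S 0 1)\<^sup>2 + (S 0 g)\<^sup>2) = (int p - 1) * (4 * int p)" using tot by simp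
  hence "(S 0 1)\<^sup>2 + (S 0 g)\<^sup>2 = 4 * int p" by (rule h2_mult)
  \<comment> \<open>A square root of -1 puts -1 into the class of 1.\<close>
  moreover obtain i :: int where i: "cg p (i\<^sup>2) (-1)"
  proof -
    have "\<not> int p dvd - 1" using not_dvd_1 by simp
    thus ?thesis using that chi_m1(1)[OF p4] chi_eq_1_iff[of "-1"] by metis
  qed
  have "\<not> int p dvd i" using cg_cong_dvd[OF i] not_dvd_1 by (simp add: dvd_power_iff')
  hence "(S 0 (i\<^sup>2 * 1))\<^sup>2 = (S 0 1)\<^sup>2"
    using S_scale[of i 0 1] chi_sq'[of i] by (simp add: power_mult_distrib)
  moreover have "S 0 (i\<^sup>2 * 1) = S 0 (-1)" using i by (intro S_cong) auto
  ultimately show ?thesis by simp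
qed

text \<open>The arguments with nonresidue value are permuted by x -> -x and x -> 1 / x, since
  \<chi>(-1) = 1. Points with x^2 = 1 or x^2 = -1 are not among them, so their number is divisible
  by 4, and the cubic has three zeros.\<close>

lemma S_D4_mod8: 
  assumes p4: "p mod 4 = 1" shows "\<exists>m. S 0 (-1) = int p - 3 - 8 * m"
proof -
  define f where "f = (\<lambda>x::int. x ^ 3 - x)"
  have fc: "cg p x y \<Longrightarrow> \<chi> (f x) = \<chi> (f y)" for x y unfolding f_def by (intro chi_cong cg_intros)
  define X where "X = {x\<in>R. \<chi> (f x) = -1}"
  have X0: "\<not> int p dvd f x" if "x \<in> X" for x using that chi_0_iff[of "f x"] by (auto simp: X_def)
  have Xd: "\<not> int p dvd x" if "x \<in> X" for x
    using X0[OF that] by (auto simp: f_def power3_eq_cube)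
  have m1: "\<chi> (-1) = 1" using chi_m1(1)[OF p4] .
  have "2 * 2 dvd card X"
  proof (rule dihedral_orbit_dvd[OF prim_root_minus_1])
    show "X \<subseteq> Rs" using Xd Rs_iff by (auto simp: X_def simp del: atLeastLessThan_iff atLeastAtMost_iff)
    fix x y assume x: "x \<in> X" and y: "y \<in> R"
    {
      assume "cg p y (-1 * x)"
      hence "\<chi> (f y) = \<chi> (f (- x))" using fc by simp
      also have "f (- x) = - f x" by (simp add: f_def)
      also have "\<chi> (- f x) = \<chi> (f x)" using chi_uminus[of "f x"] m1 by simp
      finally show "y \<in> X" using x y by (simp add: X_def)
    }
    {
      assume "cg p y (iv x)"
      hence "\<chi> (f y) = \<chi> (f (iv x))" by (rule fc)
      also have "\<dots> = \<chi> (x ^ 4 * f (iv x))" using even_power_chi[OF Xd[OF x], of 4] by simp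
      also have "\<dots> = \<chi> (- f x)"
      proof (rule chi_cong)
        have "x ^ 4 * f (iv x) = x * (x * iv x) ^ 3 - x ^ 3 * (x * iv x)"
          by (simp add: f_def power_mult_distrib power3_eq_cube power4_eq_xxxx algebra_simps)
        also have "cg p \<dots> (x * 1 ^ 3 - x ^ 3 * 1)" by (intro cg_intros iv Xd x)
        finally show "cg p (x ^ 4 * f (iv x)) (- f x)" by (simp add: f_def)
      qed
      also have "\<dots> = \<chi> (f x)" using chi_uminus[of "f x"] m1 by simp
      finally show "y \<in> X" using x y by (simp add: X_def)
    }
  next
    fix x j assume x: "x \<in> X"
    show "\<not> cg p (x\<^sup>2) ((-1) ^ j)"
    proof
      assume a: "cg p (x\<^sup>2) ((-1) ^ j)"
      show False
      proof (cases "even j")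
        case True
        hence "int p dvd x\<^sup>2 - 1" using a by (simp add: cg_def)
        hence "int p dvd x * (x\<^sup>2 - 1)" by simp
        hence "int p dvd f x" by (simp add: f_def power2_eq_square power3_eq_cube algebra_simps)
        thus False using X0[OF x] by blast
      next
        case False
        hence d: "int p dvd x\<^sup>2 + 1" using a by (simp add: cg_def)
        \<comment> \<open>When x^2 = -1 the value is -2x = -(x + 1)^2, a residue.\<close>
        have "f x - (- ((x + 1)\<^sup>2)) = (x\<^sup>2 + 1) * (x + 1)" by (simp add: f_def power2_eq_square power3_eq_cube algebra_simps)
        hence "cg p (f x) (- ((x + 1)\<^sup>2))" using d by (simp add: cg_def)
        hence "\<chi> (f x) = (\<chi> (x + 1))\<^sup>2" using chi_cong chi_uminus[of "(x + 1)\<^sup>2"] m1 by simp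
        hence "\<chi> (f x) \<ge> 0" by simp
        thus False using x by (simp add: X_def)
      qed
    qed
  qed
  then obtain m where m: "card X = 4 * m" by auto
  have "{x\<in>R. \<not> int p dvd f x} = R - {0, 1, int p - 1}"
  proof -
    have "int p dvd f x \<longleftrightarrow> x = 0 \<or> x = 1 \<or> x = int p - 1" if "x \<in> R" for x
    proof -
      have "f x = x * ((x - 1) * (x + 1))" by (simp add: f_def power3_eq_cube algebra_simps)
      hence "int p dvd f x \<longleftrightarrow> int p dvd x \<or> int p dvd x - 1 \<or> int p dvd x + 1" by (simp add: dvd_mult_iff)
      moreover have "int p dvd x \<longleftrightarrow> x = 0" using dvd_R_iff[OF that] .
      moreover have "int p dvd x - 1 \<longleftrightarrow> x = 1" using RS.uniq[of x 1] that p_gt_3 by (auto simp: cg_def)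
      moreover have "int p dvd x + 1 \<longleftrightarrow> x = int p - 1"
      proof
        assume "int p dvd x + 1"
        hence "cg p x (int p - 1)" by (simp add: cg_def dvd_diff_right_iff algebra_simps)
        thus "x = int p - 1" using RS.uniq[of x "int p - 1"] that p_gt_3 by auto
      qed simp
      ultimately show ?thesis by blast
    qed
    thus ?thesis by blast
  qed
  moreover have "card (R - {0, 1, int p - 1}) = p - 3" using p_gt_3 by (subst card_Diff_subset) auto
  ultimately have c: "int (card {x\<in>R. \<not> int p dvd f x}) = int p - 3" using p_gt_3 by simp
  have "S 0 (-1) = (\<Sum>x\<in>R. \<chi> (f x))" unfolding S_def f_def by simp
  hence "S 0 (-1) = int p - 3 - 8 * int m"
    using even_count_chi[of f] c m by (simp add: X_def)
  thus ?thesis by blast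
qed

text \<open>With p = 4t + 1 the half a of the sum is 2t - 1 modulo 4, while u is 1 modulo 4. The
  parity of t decides both whether a = u or a = -u and the value of \<chi>(2), so the signs
  cancel.\<close>

lemma S_D4:
  assumes p4: "p mod 4 = 1" and uv: "int p = u\<^sup>2 + 4 * v\<^sup>2" and u: "4 dvd u - 1"
  shows "- (\<chi> 2 * S 0 (-1)) = 2 * u"
proof -
  obtain g where g: "\<chi> g = -1" using exists_nonresidue by blast
  have e: "(S 0 (-1))\<^sup>2 + (S 0 g)\<^sup>2 = 4 * int p" using S_D4_moment[OF p4 g] .
  obtain m where m: "S 0 (-1) = int p - 3 - 8 * m" using S_D4_mod8[OF p4] by blast
  define t where "t = int p div 4"
  have t: "int p = 4 * t + 1" using p4 unfolding t_def by presburger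
  define a where "a = 2 * t - 1 - 4 * m"
  have a: "S 0 (-1) = 2 * a" using m t by (simp add: a_def)
  have "even ((S 0 g)\<^sup>2)" using e a by (metis dvd_add_right_iff even_mult_iff even_numeral power2_eq_square dvd_triv_left mult.assoc numeral_Bit0 even_add)
  hence "even (S 0 g)" by simp
  then obtain b where b: "S 0 g = 2 * b" by blast
  have ab: "int p = a\<^sup>2 + b\<^sup>2" using e a b by (simp add: power2_eq_square)
  have "odd a" by (simp add: a_def)
  moreover have "odd (int p)" using odd_p by simp
  ultimately have "even (b\<^sup>2)" unfolding ab by simp
  hence "even b" by simp
  then obtain b' where "b = 2 * b'" by blast
  hence "int p = a\<^sup>2 + 4 * b'\<^sup>2" using ab by (simp add: power2_eq_square)
  hence au: "a = u \<or> a = - u" using norm_form_unique[OF prime_p _ uv, of a b'] by simp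
  obtain k where k: "u = 4 * k + 1" using u by (metis dvd_def diff_eq_eq)
  have "p mod 8 = 1 \<or> p mod 8 = 5" using p4 by presburger
  thus ?thesis
  proof
    assume p8: "p mod 8 = 1"
    hence "even t" using t by presburger
    hence "a = - u" using au k unfolding a_def by presburger
    thus ?thesis using a chi_2_mod(1)[OF p8] by simp
  next
    assume p8: "p mod 8 = 5"
    hence "odd t" using t by presburger
    hence "a = u" using au k unfolding a_def by presburger
    thus ?thesis using a chi_2_mod(4)[OF p8] by simp
  qed
qed

subsection \<open>Discriminant -3\<close>

text \<open>The family y^2 = x^3 + g. The factor 1 is the weight expected by
  \<open>second_moment\<close>.\<close>

definition K3 :: "int \<Rightarrow> int" where "K3 g = (\<Sum>x\<in>R. 1 * \<chi> (g + x ^ 3))"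

lemma K3_cong: "cg p x y \<Longrightarrow> K3 x = K3 y"
  unfolding K3_def by (intro sum.cong refl arg_cong2[where f = "(*)"] chi_cong cg_intros)

lemma chi_cube: "\<chi> a ^ 3 = \<chi> a"
  using chi_values[of a] by auto

lemma K3_scale: assumes h: "\<not> int p dvd h" shows "K3 (g * h ^ 3) = \<chi> h * K3 g"
proof -
  have "K3 (g * h ^ 3) = (\<Sum>x\<in>R. 1 * \<chi> (g * h ^ 3 + (h * x) ^ 3))"
    unfolding K3_def by (rule unit_reindex[OF _ h, symmetric]) (intro arg_cong2[where f = "(*)"] refl chi_cong cg_intros)
  also have "\<dots> = (\<Sum>x\<in>R. \<chi> (h ^ 3 * (g + x ^ 3)))"
    by (intro sum.cong refl) (simp add: power_mult_distrib algebra_simps)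
  finally show ?thesis by (simp add: K3_def sum_distrib_left chi_cube)
qed

lemma S_3_3: "S 3 3 = \<chi> (-1) * K3 1"
proof -
  have "S 3 3 = (\<Sum>x\<in>R. \<chi> ((x + 1) ^ 3 - 1))"
    unfolding S_def by (intro sum.cong refl arg_cong[where f = \<chi>]) (simp add: power2_eq_square power3_eq_cube algebra_simps)
  also have "\<dots> = (\<Sum>x\<in>R. \<chi> (x ^ 3 - 1))" by (rule shift_reindex) (intro chi_cong cg_intros)
  also have "\<dots> = K3 (1 * (-1) ^ 3)" by (simp add: K3_def)
  also have "\<dots> = \<chi> (-1) * K3 1" using not_dvd_1 by (intro K3_scale) simp
  finally show ?thesis .
qed

lemma S_D3_0: assumes "p mod 3 = 2" shows "S 3 3 = 0"
proof -
  define m where "m = p div 3"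
  have m: "p = 3 * m + 2" using assms unfolding m_def by presburger
  \<comment> \<open>With p = 3m + 2 one has 3 (2m + 1) = 2 (p - 1) + 1, so x -> x^(2m+1) inverts
    cubing, and the sum over cubes becomes a linear one.\<close>
  have *: "cg p (x ^ (3 * (2 * m + 1))) x" for x :: int
  proof (cases "int p dvd x")
    case True
    hence "cg p x 0" "cg p (x ^ (3 * (2 * m + 1))) 0" using dvd_power_iff'[of "3 * (2 * m + 1)" x] by (simp_all add: cg_0_int)
    thus ?thesis by (metis cg_sym cg_trans)
  next
    case False
    have "3 * (2 * m + 1) = (p - 1) * 2 + 1" using m by simp
    hence "x ^ (3 * (2 * m + 1)) = (x ^ (p - 1)) ^ 2 * x" by (simp only: power_add power_mult power_one_right)
    also have "cg p \<dots> (1 ^ 2 * x)" by (intro cg_intros fermat False)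
    finally show ?thesis by simp
  qed
  have "K3 1 = (\<Sum>x\<in>R. (\<lambda>y. \<chi> (1 + y)) (x ^ 3))" by (simp add: K3_def)
  also have "\<dots> = (\<Sum>x\<in>R. (\<lambda>y. \<chi> (1 + y)) x)"
  proof (rule ressys_reindex[OF RS.ressys_axioms RS.ressys_axioms, where k = "\<lambda>x. x ^ (2 * m + 1)"])
    fix x :: int
    show "cg p ((x ^ (2 * m + 1)) ^ 3) x" "cg p ((x ^ 3) ^ (2 * m + 1)) x"
      using *[of x] unfolding power_mult[symmetric] by (simp_all add: mult.commute)
  qed (intro chi_cong cg_intros; assumption)+
  also have "\<dots> = 0" using sum_chi_linear[OF not_dvd_1, of 1] by (simp add: add.commute)
  finally show ?thesis using S_3_3 by simp
qed

lemma sum_of_bool_0: "n > 0 \<Longrightarrow> (\<Sum>y\<in>R. of_bool (cg p 0 (y ^ n))) = (1::int)"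
proof -
  assume n: "n > 0"
  have "(\<Sum>y\<in>R. of_bool (cg p 0 (y ^ n)) * 1) = (1::int)"
  proof (rule sum_of_bool_unique[where c = 0])
    fix t
    have "cg p 0 (t ^ n) \<longleftrightarrow> int p dvd t" using dvd_power_iff'[OF n, of t] by (simp add: cg_def)
    thus "cg p 0 (t ^ n) \<longleftrightarrow> cg p 0 t" by (simp add: cg_def)
  qed simp
  thus ?thesis by simp
qed

text \<open>Three classes modulo cubes give K(1)^2 + K(g)^2 + K(g^2)^2 = 6p. A linear relation
  between the three values, up to the sign \<chi>(g), eliminates one of them and leaves a form of
  discriminant -3.\<close>

lemma K3_moment:
  assumes p3: "p mod 3 = 1"
  shows "\<exists>w. (K3 1)\<^sup>2 + 3 * w\<^sup>2 = 4 * int p"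
proof -
  have "3 dvd p - 1" using p3 by presburger
  then obtain w where w: "prim_root 3 w" using exists_prim_root[of 3] by auto
  obtain g where g: "\<not> int p dvd g" "\<And>h. \<not> cg p g (h ^ 3)" using exists_nonpower[OF w] by auto
  have nres: "\<not> cg p (g ^ c) (h ^ 3)" if "0 < c" "c < (3::nat)" for c h
  proof
    assume a: "cg p (g ^ c) (h ^ 3)"
    have "c = 1 \<or> c = 2" using that by linarith
    thus False
    proof
      assume "c = 1" thus False using a g(2) by simp
    next
      assume c: "c = 2"
      have h0: "\<not> int p dvd h" using cg_cong_dvd[OF a] not_dvd_pow[OF g(1), of c] dvd_power_iff'[of 3 h] by auto
      have "cg p (g ^ c * (g * iv h ^ 3)) (h ^ 3 * (g * iv h ^ 3))" using a by (intro cg_intros)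
      moreover have "g ^ c * (g * iv h ^ 3) = (g * iv h) ^ 3" using c by (simp add: power2_eq_square power3_eq_cube)
      moreover have "h ^ 3 * (g * iv h ^ 3) = g * (h * iv h) ^ 3" by (simp add: power_mult_distrib mult_ac)
      moreover have "cg p (g * (h * iv h) ^ 3) (g * 1 ^ 3)" by (intro cg_intros iv h0)
      ultimately have "cg p ((g * iv h) ^ 3) g" using cg_trans by simp
      thus False using g(2) cg_sym by blast
    qed
  qed
  define s where "s = \<chi> g"
  have s: "s * s = 1" using chi_sq[OF g(1)] by (simp add: s_def)
  have K0: "K3 0 = 0" using sum_chi by (simp add: K3_def chi_cube)
  have tot: "(\<Sum>u\<in>Rs. (K3 u)\<^sup>2) = 2 * int p * (int p - 1)"
  proof -
    have "(\<Sum>u\<in>R. (K3 u)\<^sup>2) = int p * (\<Sum>x\<in>R. \<Sum>y\<in>R. of_bool (cg p (x ^ 3) (y ^ 3)) * (1 * 1)) - (\<Sum>x\<in>R. 1)\<^sup>2"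
      unfolding K3_def by (rule second_moment)
    also have "(\<Sum>x\<in>R. \<Sum>y\<in>R. of_bool (cg p (x ^ 3) (y ^ 3)) * (1 * 1)) = (1 + (\<Sum>x\<in>Rs. 3) :: int)"
    proof (subst sum_R_Rs, intro arg_cong2[where f = "(+)"] sum.cong refl)
      show "(\<Sum>y\<in>R. of_bool (cg p (0 ^ 3) (y ^ 3)) * (1 * 1)) = (1::int)"
        using sum_of_bool_0[of 3] by simp
      fix x assume "x \<in> Rs"
      hence "(\<Sum>y\<in>R. of_bool (cg p (x ^ 3) (y ^ 3)) * (1 * 1 :: int)) = (\<Sum>j<(3::nat). 1 * 1)"
        using Rs_not_dvd by (intro sum_power_roots[OF w]) auto
      thus "(\<Sum>y\<in>R. of_bool (cg p (x ^ 3) (y ^ 3)) * (1 * 1)) = (3::int)" by simp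
    qed
    finally have "(\<Sum>u\<in>R. (K3 u)\<^sup>2) = int p * (1 + 3 * (int p - 1)) - (int p)\<^sup>2" using p_gt_3 by (simp add: of_nat_diff)
    thus ?thesis using K0 by (subst (asm) sum_R_Rs) (simp add: power2_eq_square algebra_simps)
  qed
  have p1: "(\<Sum>h\<in>Rs. c) = (int p - 1) * c" for c using p_gt_3 by (simp add: of_nat_diff)
  have lt3: "(\<Sum>c<3. f c) = f 0 + f 1 + (f 2 :: int)" for f :: "nat \<Rightarrow> int" by (simp add: numeral_3_eq_3 numeral_2_eq_2)
  have "(\<Sum>c<3. \<Sum>h\<in>Rs. (K3 (g ^ c * h ^ 3))\<^sup>2) = int 3 * (\<Sum>u\<in>Rs. (K3 u)\<^sup>2)"
    by (rule power_class_sum[OF w g(1) nres]) (use K3_cong in auto)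
  also have "(\<Sum>c<3. \<Sum>h\<in>Rs. (K3 (g ^ c * h ^ 3))\<^sup>2) = (\<Sum>c<(3::nat). \<Sum>h\<in>Rs. (K3 (g ^ c))\<^sup>2)"
    by (intro sum.cong refl) (simp add: K3_scale Rs_not_dvd power_mult_distrib chi_sq')
  finally have "(int p - 1) * ((K3 1)\<^sup>2 + (K3 g)\<^sup>2 + (K3 (g\<^sup>2))\<^sup>2) = (int p - 1) * (6 * int p)"
    unfolding lt3 p1 using tot by (simp add: algebra_simps)
  hence sq: "(K3 1)\<^sup>2 + (K3 g)\<^sup>2 + (K3 (g\<^sup>2))\<^sup>2 = 6 * int p" by (rule h2_mult)
  \<comment> \<open>Summing \<chi>(u) \<chi>(u + x^3) over u gives p - 1 for x = 0 and -1 for every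
    other x, in total 0.\<close>
  have lin0: "(\<Sum>u\<in>Rs. \<chi> u * K3 u) = 0"
  proof -
    have "(\<Sum>u\<in>R. \<chi> u * K3 u) = (\<Sum>u\<in>R. \<Sum>x\<in>R. \<chi> (u + 0) * \<chi> (u + x ^ 3))"
      by (simp add: K3_def sum_distrib_left)
    also have "\<dots> = (\<Sum>x\<in>R. \<Sum>u\<in>R. \<chi> (u + 0) * \<chi> (u + x ^ 3))" by (rule sum.swap)
    also have "\<dots> = (\<Sum>x\<in>R. int p * of_bool (cg p 0 (x ^ 3)) - 1)" by (simp only: sum_chi_chi)
    also have "\<dots> = int p * (\<Sum>x\<in>R. of_bool (cg p 0 (x ^ 3))) - int p"
      unfolding sum_subtractf sum_distrib_left by simp
    also have "\<dots> = 0" using sum_of_bool_0[of 3] by simp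
    finally show ?thesis by (subst (asm) sum_R_Rs) simp
  qed
  have "(\<Sum>c<3. \<Sum>h\<in>Rs. \<chi> (g ^ c * h ^ 3) * K3 (g ^ c * h ^ 3)) = int 3 * (\<Sum>u\<in>Rs. \<chi> u * K3 u)"
    by (rule power_class_sum[OF w g(1) nres]) (simp_all add: K3_cong[of _ _] chi_cong)
  also have "(\<Sum>c<3. \<Sum>h\<in>Rs. \<chi> (g ^ c * h ^ 3) * K3 (g ^ c * h ^ 3)) = (\<Sum>c<(3::nat). \<Sum>h\<in>Rs. s ^ c * K3 (g ^ c))"
  proof (intro sum.cong refl)
    fix c h assume "h \<in> Rs"
    thus "\<chi> (g ^ c * h ^ 3) * K3 (g ^ c * h ^ 3) = s ^ c * K3 (g ^ c)"
      using K3_scale[of h "g ^ c"] chi_sq[of h] Rs_not_dvd[of h] by (simp add: chi_cube s_def algebra_simps)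
  qed
  finally have "(int p - 1) * (K3 1 + s * K3 g + K3 (g\<^sup>2)) = (int p - 1) * 0"
    unfolding lt3 p1 using lin0 s by (simp add: algebra_simps power2_eq_square)
  hence lin: "K3 1 + s * K3 g + K3 (g\<^sup>2) = 0" by (rule h2_mult)
  define k where "k = s * K3 g"
  have kk: "k\<^sup>2 = (K3 g)\<^sup>2" using s by (simp add: k_def power_mult_distrib power2_eq_square)
  have "K3 (g\<^sup>2) = - (K3 1 + k)" using lin by (simp add: k_def)
  hence "(K3 (g\<^sup>2))\<^sup>2 = (K3 1 + k)\<^sup>2" by (simp only: power2_minus)
  hence "(K3 1)\<^sup>2 + k\<^sup>2 + (K3 1 + k)\<^sup>2 = 6 * int p" using sq kk by simp
  \<comment> \<open>Completing the square in k = \<chi>(g) K(g). The equation shows that 3 divides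
    K(1) + 2k, and the factor 3 cancels.\<close>
  hence e: "3 * (K3 1)\<^sup>2 + (K3 1 + 2 * k)\<^sup>2 = 12 * int p" by (simp add: power2_eq_square algebra_simps)
  have "3 dvd (K3 1 + 2 * k)\<^sup>2"
  proof -
    have "(K3 1 + 2 * k)\<^sup>2 = 3 * (4 * int p - (K3 1)\<^sup>2)" using e by simp
    thus ?thesis by simp
  qed
  hence "3 dvd K3 1 + 2 * k" using prime_dvd_power[of "3::int"] by simp
  then obtain w' where "K3 1 + 2 * k = 3 * w'" by blast
  hence "3 * (K3 1)\<^sup>2 + 9 * w'\<^sup>2 = 12 * int p" using e by (simp add: power_mult_distrib)
  hence "(K3 1)\<^sup>2 + 3 * w'\<^sup>2 = 4 * int p" by simp
  thus ?thesis by blast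
qed

text \<open>Parity: 1 + x^3 has three zeros and p - 3 is even. Modulo 3: the nonzero arguments with
  a given value of \<chi> form orbits under the cube roots of unity, and x = 0 contributes
  1.\<close>

lemma K3_residues:
  assumes p3: "p mod 3 = 1" shows "even (K3 1)" "3 dvd K3 1 - 1"
proof -
  have "3 dvd p - 1" using p3 by presburger
  then obtain w where w: "prim_root 3 w" using exists_prim_root[of 3] by auto
  define f where "f = (\<lambda>x::int. 1 + x ^ 3)"
  have fc: "cg p x y \<Longrightarrow> \<chi> (f x) = \<chi> (f y)" for x y unfolding f_def by (intro chi_cong cg_intros)
  have K: "K3 1 = (\<Sum>x\<in>R. \<chi> (f x))" by (simp add: K3_def f_def)
  have "(\<Sum>y\<in>R. of_bool (cg p ((-1) ^ 3) (y ^ 3)) * 1) = (\<Sum>j<(3::nat). 1 :: int)"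
    using not_dvd_1 by (intro sum_power_roots[OF w]) auto
  hence "int (card {x\<in>R. int p dvd f x}) = 3"
    by (simp add: f_def cg_def Int_def dvd_minus_iff[of _ "_ + _", symmetric] add.commute)
  moreover have "card {x\<in>R. \<not> int p dvd f x} = card R - card {x\<in>R. int p dvd f x}"
    by (subst card_Diff_subset[OF fin_R, symmetric]) (auto intro: arg_cong[where f = card])
  ultimately have "int (card {x\<in>R. \<not> int p dvd f x}) = int p - 3" using p_gt_3 by simp
  hence "K3 1 = int p - 3 - 2 * int (card {x\<in>R. \<chi> (f x) = -1})" using even_count_chi[of f] K by simp
  thus "even (K3 1)" using odd_p by simp
  have orb: "3 dvd card {x\<in>Rs. \<chi> (f x) = c}" for c
  proof (rule unity_orbit_dvd[OF w])
    fix x y assume x: "x \<in> {x\<in>Rs. \<chi> (f x) = c}" and y: "y \<in> R" "cg p y (w * x)"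
    have "cg p (y ^ 3) ((w * x) ^ 3)" using y by (intro cg_power)
    also have "(w * x) ^ 3 = w ^ 3 * x ^ 3" by (rule power_mult_distrib)
    also have "cg p \<dots> (1 * x ^ 3)" using w by (intro cg_mult cg_refl) (simp add: prim_root_def)
    finally have "\<chi> (f y) = \<chi> (f x)" unfolding f_def by (intro chi_cong cg_add cg_refl) simp
    moreover have "\<not> int p dvd y"
      using x cg_cong_dvd[OF y(2)] prim_root_not_dvd[OF w] Rs_not_dvd by (auto simp: dvd_mult_iff)
    ultimately show "y \<in> {x\<in>Rs. \<chi> (f x) = c}" using x y(1) Rs_iff by blast
  qed auto
  have "K3 1 - 1 = (\<Sum>x\<in>Rs. \<chi> (f x))" unfolding K by (subst sum_R_Rs) (simp add: f_def)
  also have "\<dots> = (\<Sum>x\<in>Rs. of_bool (\<chi> (f x) = 1) - of_bool (\<chi> (f x) = -1))"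
    by (intro sum.cong refl) (use chi_values in force)
  also have "\<dots> = int (card {x\<in>Rs. \<chi> (f x) = 1}) - int (card {x\<in>Rs. \<chi> (f x) = -1})"
    by (simp add: sum_subtractf Int_def)
  finally show "3 dvd K3 1 - 1" using orb[of 1] orb[of "-1"] by (simp add: dvd_diff int_dvd_int_iff[symmetric])
qed

lemma S_D3:
  assumes p3: "p mod 3 = 1" and uv: "int p = u\<^sup>2 + 3 * v\<^sup>2" and u: "3 dvd u - 1"
  shows "S 3 3 = - (\<chi> (-1) * (2 * u))"
proof -
  obtain w where w: "(K3 1)\<^sup>2 + 3 * w\<^sup>2 = 4 * int p" using K3_moment[OF p3] by blast
  obtain a where a: "K3 1 = 2 * a" using K3_residues(1)[OF p3] by blast
  have "even (3 * w\<^sup>2)" using w a by (metis dvd_add_right_iff dvd_triv_left even_mult_iff even_numeral power2_eq_square)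
  hence "even w" by simp
  then obtain b where b: "w = 2 * b" by blast
  have "int p = a\<^sup>2 + 3 * b\<^sup>2" using w a b by (simp add: power_mult_distrib)
  hence au: "a = u \<or> a = - u" using norm_form_unique[OF prime_p _ uv, of a b] by simp
  have "3 dvd 2 * a - 1" using K3_residues(2)[OF p3] a by simp
  hence "a = - u" using au u by presburger
  thus ?thesis using S_3_3 a by simp
qed

end

context big_prime
begin

subsection \<open>Discriminant -8\<close>

lemma sum_x_plus_inverse:
  assumes b: "\<not> int p dvd b" and G: "\<And>x y. cg p x y \<Longrightarrow> G x = G y"
  shows "(\<Sum>y\<in>Rs. G (y + b * iv y)) = (\<Sum>t\<in>R. (1 + \<chi> (t\<^sup>2 - 4 * b)) * (G t :: int))"
proof -
  have key: "cg p (x\<^sup>2 + (- t) * x + b) 0 \<longleftrightarrow> cg p (x + b * iv x) t" if nx: "\<not> int p dvd x" for x t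
  proof -
    have bi: "cg p (x * (b * iv x)) (b * 1)" using cg_mult[OF cg_refl iv[OF nx], of b] by (simp add: mult_ac)
    have e: "cg p (x\<^sup>2 + (- t) * x + x * (b * iv x)) (x\<^sup>2 + (- t) * x + b)"
      using bi by (intro cg_intros) simp
    have "cg p (x\<^sup>2 + (- t) * x + b) 0 \<longleftrightarrow> cg p (x\<^sup>2 + (- t) * x + x * (b * iv x)) 0"
      using cg_left_cong[OF e] by simp
    also have "x\<^sup>2 + (- t) * x + x * (b * iv x) = x * (x + b * iv x - t)"
      by (simp add: power2_eq_square algebra_simps)
    also have "cg p \<dots> 0 \<longleftrightarrow> cg p (x + b * iv x) t" using nx by (simp add: cg_def dvd_mult_iff)
    finally show ?thesis .
  qed
  have "(\<Sum>t\<in>R. (1 + \<chi> (t\<^sup>2 - 4 * b)) * G t) = (\<Sum>t\<in>R. (\<Sum>x\<in>R. of_bool (cg p (x\<^sup>2 + (- t) * x + b) 0)) * G t)"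
    unfolding count_quadratic by simp
  also have "\<dots> = (\<Sum>x\<in>R. \<Sum>t\<in>R. of_bool (cg p (x\<^sup>2 + (- t) * x + b) 0) * G t)"
    unfolding sum_distrib_right by (rule sum.swap)
  also have "\<dots> = (\<Sum>x\<in>Rs. \<Sum>t\<in>R. of_bool (cg p (x\<^sup>2 + (- t) * x + b) 0) * G t)"
    using b by (subst sum_R_Rs) (simp add: cg_0_int)
  also have "\<dots> = (\<Sum>x\<in>Rs. G (x + b * iv x))"
  proof (rule sum.cong)
    fix x assume "x \<in> Rs"
    hence nx: "\<not> int p dvd x" by (rule Rs_not_dvd)
    show "(\<Sum>t\<in>R. of_bool (cg p (x\<^sup>2 + (- t) * x + b) 0) * G t) = G (x + b * iv x)"
      by (rule sum_of_bool_unique[OF key[OF nx] G])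
  qed simp
  finally show ?thesis by simp
qed

text \<open>Brewer's sum. For r = y + 1/y the product (r + 2)(r^2 - 2) is y (1 + y^4) up to the
  square of (y + 1) / y^2.\<close>

definition Br :: int where "Br = (\<Sum>r\<in>R. \<chi> (r + 2) * \<chi> (r\<^sup>2 - 2))"

text \<open>The isogenous cubic t^3 - 8 t^2 + 8 t becomes 8 (r + 2)(r^2 - 2) at t = 2r + 4.\<close>

lemma S_4_2: "S 4 2 = \<chi> 2 * Br"
proof -
  have "S 4 2 = S (- 2 * 4) (4\<^sup>2 - 4 * 2)" by (rule S_isogeny[OF not_dvd_2])
  also have "\<dots> = (\<Sum>t\<in>R. \<chi> (t ^ 3 - 8 * t\<^sup>2 + 8 * t))" by (simp add: S_def)
  also have "\<dots> = (\<Sum>t\<in>R. \<chi> ((t + 4) ^ 3 - 8 * (t + 4)\<^sup>2 + 8 * (t + 4)))"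
    by (rule shift_reindex[symmetric]) (intro chi_cong cg_intros)
  also have "\<dots> = (\<Sum>t\<in>R. \<chi> ((2 * t + 4) ^ 3 - 8 * (2 * t + 4)\<^sup>2 + 8 * (2 * t + 4)))"
    by (rule unit_reindex[OF _ not_dvd_2, symmetric]) (intro chi_cong cg_intros)
  also have "\<dots> = (\<Sum>t\<in>R. \<chi> (2\<^sup>2 * (2 * ((t + 2) * (t\<^sup>2 - 2)))))"
    by (intro sum.cong refl arg_cong[where f = \<chi>]) (simp add: power2_eq_square power3_eq_cube algebra_simps)
  also have "\<dots> = \<chi> 2 * Br" unfolding chi_mult chi_power using chi_sq'[OF not_dvd_2] by (simp add: Br_def sum_distrib_left)
  finally show ?thesis .
qed

text \<open>The isogeny leads from (4, 2) to (-8, 8), its twist by -2. This is the endomorphism with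
  square -2, and \<chi>(-2) = -1 here.\<close>

lemma S_D8_0: assumes "p mod 8 = 5 \<or> p mod 8 = 7" shows "S 4 2 = 0"
proof -
  have "S 4 2 = S (- 2 * 4) (4\<^sup>2 - 4 * 2)" by (rule S_isogeny[OF not_dvd_2])
  also have "\<dots> = S ((-2) * 4) ((-2)\<^sup>2 * 2)" by simp
  also have "\<dots> = \<chi> (-2) * S 4 2" using not_dvd_2 by (intro S_scale) simp
  also have "\<chi> (-2) = -1"
  proof -
    have "\<chi> (-2) = \<chi> (-1) * \<chi> 2" using chi_uminus[of 2] by simp
    moreover have "p mod 8 = 5 \<Longrightarrow> p mod 4 = 1" "p mod 8 = 7 \<Longrightarrow> p mod 4 = 3" by presburger+
    ultimately show ?thesis using assms chi_m1 chi_2_mod by auto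
  qed
  finally show ?thesis by simp
qed

text \<open>The character sum of the genus 2 curve y^2 = x (x^4 + g). It depends on g modulo fourth
  powers up to sign.\<close>

definition K4 :: "int \<Rightarrow> int" where "K4 g = (\<Sum>x\<in>R. \<chi> x * \<chi> (g + x ^ 4))"

text \<open>Summing over r = y + 1/y brings in the weight 1 + \<chi>(r^2 - 4). Its first part gives
  Brewer's sum; the second exchanges r + 2 for r - 2, and r -> -r turns the result into \<chi>(-1)
  times Brewer's sum. The terms lost where r = -2 and y = -1, because a square factor vanishes
  there, are equal and cancel.\<close>

lemma K4_1_Br: "K4 1 = (1 + \<chi> (-1)) * Br"
proof -
  define G where "G = (\<lambda>r. \<chi> (r + 2) * \<chi> (r\<^sup>2 - 2))"
  have G: "cg p x y \<Longrightarrow> G x = G y" for x y unfolding G_def by (intro arg_cong2[where f = "(*)"] chi_cong cg_intros)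
  have Gm2: "\<chi> (-2 - 2) * \<chi> ((-2)\<^sup>2 - 2) = \<chi> (-1) * \<chi> 2"
    using chi_uminus[of 4] chi_mult[of 2 2] chi_sq[OF not_dvd_2] by simp
  have "(\<Sum>y\<in>Rs. G (y + 1 * iv y)) = (\<Sum>t\<in>R. (1 + \<chi> (t\<^sup>2 - 4 * 1)) * G t)"
    by (rule sum_x_plus_inverse[OF not_dvd_1 G])
  also have "\<dots> = (\<Sum>t\<in>R. G t + (\<chi> (t - 2) * \<chi> (t\<^sup>2 - 2) - of_bool (cg p (-2) t) * (\<chi> (t - 2) * \<chi> (t\<^sup>2 - 2))))"
  proof (intro sum.cong refl)
    fix t
    have "\<chi> (t\<^sup>2 - 4 * 1) * G t = (\<chi> (t + 2) * \<chi> (t + 2)) * (\<chi> (t - 2) * \<chi> (t\<^sup>2 - 2))"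
    proof -
      have "t\<^sup>2 - 4 * 1 = (t + 2) * (t - 2)" by (simp add: power2_eq_square algebra_simps)
      thus ?thesis by (simp only: G_def chi_mult mult_ac)
    qed
    moreover have "\<chi> (t + 2) * \<chi> (t + 2) = 1 - of_bool (cg p (-2) t)"
    proof (cases "int p dvd t + 2")
      case True
      hence "cg p (-2) t" using cg_sym[of p t "-2"] by (simp add: cg_def)
      thus ?thesis using True chi_0_iff by simp
    next
      case False
      hence "\<not> cg p (-2) t" using cg_sym[of p "-2" t] by (auto simp: cg_def)
      thus ?thesis using chi_sq[OF False] by simp
    qed
    ultimately show "(1 + \<chi> (t\<^sup>2 - 4 * 1)) * G t = G t + (\<chi> (t - 2) * \<chi> (t\<^sup>2 - 2) - of_bool (cg p (-2) t) * (\<chi> (t - 2) * \<chi> (t\<^sup>2 - 2)))"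
      by (simp add: algebra_simps)
  qed
  also have "\<dots> = Br + ((\<Sum>t\<in>R. \<chi> (t - 2) * \<chi> (t\<^sup>2 - 2)) - (\<Sum>t\<in>R. of_bool (cg p (-2) t) * (\<chi> (t - 2) * \<chi> (t\<^sup>2 - 2))))"
    unfolding sum.distrib sum_subtractf Br_def G_def by simp
  also have "(\<Sum>t\<in>R. of_bool (cg p (-2) t) * (\<chi> (t - 2) * \<chi> (t\<^sup>2 - 2))) = \<chi> (-2 - 2) * \<chi> ((-2)\<^sup>2 - 2)"
    by (rule sum_of_bool_unique) (rule refl, intro arg_cong2[where f = "(*)"] chi_cong cg_intros)
  also have "(\<Sum>t\<in>R. \<chi> (t - 2) * \<chi> (t\<^sup>2 - 2)) = (\<Sum>t\<in>R. \<chi> ((-1) * t - 2) * \<chi> (((-1) * t)\<^sup>2 - 2))"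
    using not_dvd_1 by (intro unit_reindex[symmetric] arg_cong2[where f = "(*)"] chi_cong cg_intros) auto
  also have "\<dots> = \<chi> (-1) * Br"
    unfolding Br_def sum_distrib_left
  proof (intro sum.cong refl)
    fix t :: int
    have "(-1) * t - 2 = - (t + 2)" by simp
    thus "\<chi> ((-1) * t - 2) * \<chi> (((-1) * t)\<^sup>2 - 2) = \<chi> (-1) * (\<chi> (t + 2) * \<chi> (t\<^sup>2 - 2))"
      using chi_uminus[of "t + 2"] by simp
  qed
  finally have 1: "(\<Sum>y\<in>Rs. G (y + 1 * iv y)) = (1 + \<chi> (-1)) * Br - \<chi> (-1) * \<chi> 2"
    unfolding Gm2 by (simp add: algebra_simps)
  have "(\<Sum>y\<in>Rs. G (y + 1 * iv y)) = (\<Sum>y\<in>Rs. \<chi> y * \<chi> (1 + y ^ 4) - of_bool (cg p (-1) y) * (\<chi> y * \<chi> (1 + y ^ 4)))"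
  proof (rule sum.cong)
    fix y assume "y \<in> Rs"
    hence y: "\<not> int p dvd y" by (rule Rs_not_dvd)
    have a: "cg p (y * (y * (y + 1 * iv y + 2))) (y * (y + 1)\<^sup>2)"
    proof -
      have "y * (y * (y + 1 * iv y + 2)) = y * (y\<^sup>2 + y * iv y + 2 * y)" by (simp add: power2_eq_square algebra_simps)
      also have "cg p \<dots> (y * (y\<^sup>2 + 1 + 2 * y))" by (intro cg_intros iv y)
      finally show ?thesis by (simp add: power2_eq_square algebra_simps)
    qed
    have b: "cg p (y\<^sup>2 * ((y + 1 * iv y)\<^sup>2 - 2)) (1 + y ^ 4)"
    proof -
      have "y\<^sup>2 * ((y + 1 * iv y)\<^sup>2 - 2) = y ^ 4 + 2 * y\<^sup>2 * (y * iv y) + (y * iv y)\<^sup>2 - 2 * y\<^sup>2"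
        by (simp add: power2_eq_square power4_eq_xxxx algebra_simps)
      also have "cg p \<dots> (y ^ 4 + 2 * y\<^sup>2 * 1 + 1\<^sup>2 - 2 * y\<^sup>2)" by (intro cg_intros iv y)
      finally show ?thesis by (simp add: add.commute)
    qed
    have "G (y + 1 * iv y) = \<chi> (y * (y * (y + 1 * iv y + 2))) * \<chi> (y\<^sup>2 * ((y + 1 * iv y)\<^sup>2 - 2))"
      using chi_sq[OF y] chi_sq'[OF y] by (simp add: G_def mult.assoc[symmetric])
    also have "\<dots> = \<chi> (y * (y + 1)\<^sup>2) * \<chi> (1 + y ^ 4)" by (simp only: chi_cong[OF a] chi_cong[OF b])
    also have "\<dots> = \<chi> y * \<chi> (1 + y ^ 4) - of_bool (cg p (-1) y) * (\<chi> y * \<chi> (1 + y ^ 4))"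
    proof (cases "int p dvd y + 1")
      case True
      hence "cg p (-1) y" using cg_sym[of p y "-1"] by (simp add: cg_def)
      thus ?thesis using True chi_0_iff by (simp add: power2_eq_square)
    next
      case False
      hence "\<not> cg p (-1) y" using cg_sym[of p "-1" y] by (auto simp: cg_def)
      thus ?thesis using chi_sq'[OF False] by simp
    qed
    finally show "G (y + 1 * iv y) = \<chi> y * \<chi> (1 + y ^ 4) - of_bool (cg p (-1) y) * (\<chi> y * \<chi> (1 + y ^ 4))" .
  qed simp
  also have "\<dots> = (\<Sum>y\<in>R. \<chi> y * \<chi> (1 + y ^ 4)) - (\<Sum>y\<in>R. of_bool (cg p (-1) y) * (\<chi> y * \<chi> (1 + y ^ 4)))"
    unfolding sum_R_Rs sum_subtractf by simp
  also have "(\<Sum>y\<in>R. of_bool (cg p (-1) y) * (\<chi> y * \<chi> (1 + y ^ 4))) = \<chi> (-1) * \<chi> (1 + (-1) ^ 4)"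
    by (rule sum_of_bool_unique) (rule refl, intro arg_cong2[where f = "(*)"] chi_cong cg_intros)
  also have "(\<Sum>y\<in>R. \<chi> y * \<chi> (1 + y ^ 4)) = K4 1" by (simp add: K4_def)
  finally show ?thesis using 1 by simp
qed

lemma K4_cong: "cg p x y \<Longrightarrow> K4 x = K4 y"
  unfolding K4_def by (intro sum.cong refl arg_cong2[where f = "(*)"] chi_cong cg_intros)

lemma K4_scale: assumes h: "\<not> int p dvd h" shows "K4 (g * h ^ 4) = \<chi> h * K4 g"
proof -
  have "K4 (g * h ^ 4) = (\<Sum>x\<in>R. \<chi> (h * x) * \<chi> (g * h ^ 4 + (h * x) ^ 4))"
    unfolding K4_def by (rule unit_reindex[OF _ h, symmetric]) (intro arg_cong2[where f = "(*)"] chi_cong cg_intros)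
  also have "\<dots> = (\<Sum>x\<in>R. \<chi> (h * x) * \<chi> (h ^ 4 * (g + x ^ 4)))"
    by (intro sum.cong refl arg_cong2[where f = "(*)"] arg_cong[where f = \<chi>]) (simp add: power_mult_distrib algebra_simps)
  also have "\<dots> = (\<Sum>x\<in>R. \<chi> h * (\<chi> x * \<chi> (g + x ^ 4)))"
    unfolding chi_mult chi_power using even_power_chi[OF h, of 4] by (simp add: mult_ac)
  finally show ?thesis by (simp add: K4_def sum_distrib_left)
qed

text \<open>Inverting x as well, by g x^4 (1/g + 1/x^4) = x^4 + g.\<close>

lemma K4_inv: assumes g: "\<not> int p dvd g" shows "K4 (iv g) = \<chi> g * K4 g"
proof -
  have "K4 (iv g) = (\<Sum>x\<in>R. \<chi> (iv x) * \<chi> (iv g + iv x ^ 4))"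
    unfolding K4_def by (rule iv_reindex[symmetric]) (intro arg_cong2[where f = "(*)"] chi_cong cg_intros)
  also have "\<dots> = (\<Sum>x\<in>R. \<chi> g * (\<chi> x * \<chi> (g + x ^ 4)))"
  proof (rule sum.cong)
    fix x assume x: "x \<in> R"
    show "\<chi> (iv x) * \<chi> (iv g + iv x ^ 4) = \<chi> g * (\<chi> x * \<chi> (g + x ^ 4))"
    proof (cases "x = 0")
      case True thus ?thesis by (simp add: chi_iv)
    next
      case False
      hence nx: "\<not> int p dvd x" using dvd_R_iff[OF x] by simp
      have "g * x ^ 4 * (iv g + iv x ^ 4) = (g * iv g) * x ^ 4 + g * (x * iv x) ^ 4"
        by (simp add: power_mult_distrib algebra_simps)
      also have "cg p \<dots> (1 * x ^ 4 + g * 1 ^ 4)" by (intro cg_intros iv nx g)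
      finally have "cg p (g * x ^ 4 * (iv g + iv x ^ 4)) (g + x ^ 4)" by (simp add: add.commute)
      hence "\<chi> g * \<chi> (iv g + iv x ^ 4) = \<chi> (g + x ^ 4)"
        using chi_cong even_power_chi[OF nx, of 4] by fastforce
      hence "(\<chi> g * \<chi> g) * \<chi> (iv g + iv x ^ 4) = \<chi> g * \<chi> (g + x ^ 4)" by (simp add: mult.assoc)
      thus ?thesis using chi_sq[OF g] by (simp add: chi_iv)
    qed
  qed simp
  finally show ?thesis by (simp add: K4_def sum_distrib_left)
qed

text \<open>A root of unity i of order 4 gives four classes 1, g, g^2, g^3 modulo fourth powers,
  with squares summing to 16p. \<open>K4_inv\<close> makes the value at g^2 vanish and those at g
  and g^3 agree, so K(1)^2 + 2 K(g)^2 = 16p. Dihedral orbits of size 8 fix K(1) modulo 16 and hence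
  the sign of u.\<close>

lemma S_D8_1:
  assumes p8: "p mod 8 = 1" and uv: "int p = u\<^sup>2 + 2 * v\<^sup>2" and u: "4 dvd u - 1"
  shows "- S 4 2 = (-1) ^ (p div 8) * 2 * u"
proof -
  have p4: "p mod 4 = 1" using p8 by presburger
  have m1: "\<chi> (-1) = 1" using chi_m1(1)[OF p4] .
  have c2: "\<chi> 2 = 1" using chi_2_mod(1)[OF p8] .
  have nm1: "\<not> int p dvd -1" using not_dvd_1 by simp
  obtain i :: int where i: "cg p (i\<^sup>2) (-1)" using chi_eq_1_iff[OF nm1] m1 by auto
  have nm1': "\<not> cg p (-1) (1::int)" using not_dvd_2 by (simp add: cg_def)
  have i4: "cg p (i ^ 4) 1"
  proof -
    have "i ^ 4 = (i\<^sup>2)\<^sup>2" by (simp flip: power_mult)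
    also have "cg p \<dots> ((-1)\<^sup>2)" using i by (rule cg_power)
    finally show ?thesis by simp
  qed
  have i2: "\<not> cg p (i\<^sup>2) 1" using i nm1' cg_left_cong[OF i] by blast
  have pri: "prim_root 4 i"
    unfolding prim_root_def
  proof (intro conjI allI impI)
    fix j :: nat assume "0 < j \<and> j < 4"
    hence "j = 1 \<or> j = 2 \<or> j = 3" by auto
    moreover have "\<not> cg p (i ^ 1) 1"
    proof
      assume "cg p (i ^ 1) 1"
      hence "cg p (i\<^sup>2) (1\<^sup>2)" by (intro cg_power) simp
      thus False using i2 by simp
    qed
    moreover have "\<not> cg p (i ^ 3) 1"
    proof
      assume "cg p (i ^ 3) 1"
      hence "cg p ((i ^ 3)\<^sup>2) (1\<^sup>2)" by (intro cg_power)
      moreover have "(i ^ 3)\<^sup>2 = i ^ 4 * i\<^sup>2" by (simp flip: power_mult power_add)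
      moreover have "cg p (i ^ 4 * i\<^sup>2) (1 * i\<^sup>2)" by (intro cg_intros i4)
      ultimately have "cg p (1 * i\<^sup>2) 1" using cg_sym cg_trans by (metis one_power2)
      thus False using i2 by simp
    qed
    ultimately show "\<not> cg p (i ^ j) 1" using i2 by auto
  qed (use i4 in auto)
  have i0: "\<not> int p dvd i" using prim_root_not_dvd[OF pri] .
  have ci: "\<chi> i = 1"
  proof -
    have "h2 = 4 * (p div 8)" using h2(5) p8 by presburger
    hence "cg p (\<chi> i) ((i ^ 4) ^ (p div 8))" using euler[of i] by (simp add: h2_def power_mult)
    also have "cg p \<dots> (1 ^ (p div 8))" using i4 by (rule cg_power)
    finally have "cg p (\<chi> i) 1" by simp
    thus ?thesis using chi_values[of i] p_gt_3 by (intro small_cg_eq) auto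
  qed
  obtain g where g: "\<chi> g = -1" using exists_nonresidue by blast
  have g0: "\<not> int p dvd g" using g chi_0_iff[of g] by auto
  have ig0: "\<not> int p dvd iv g" using g0 iv_dvd by blast
  have sq_nonneg: "\<chi> (a\<^sup>2) \<ge> 0" for a by simp
  have nres: "\<not> cg p (g ^ c) (h ^ 4)" if "0 < c" "c < (4::nat)" for c h
  proof
    assume a: "cg p (g ^ c) (h ^ 4)"
    show False
    proof (cases "c = 2")
      case True
      have "int p dvd (g - h\<^sup>2) * (g + h\<^sup>2)"
        using a True by (simp add: cg_def power2_eq_square power4_eq_xxxx algebra_simps)
      hence "cg p g (h\<^sup>2) \<or> cg p g (- h\<^sup>2)" by (simp add: dvd_mult_iff cg_def)
      hence "\<chi> g = \<chi> (h\<^sup>2)" using chi_cong[of g "h\<^sup>2"] chi_cong[of g "-(h\<^sup>2)"] chi_uminus[of "h\<^sup>2"] m1 by auto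
      thus False using sq_nonneg[of h] g by linarith
    next
      case False
      hence "odd c" using that by presburger
      hence "\<chi> (g ^ c) = -1" using g by simp
      moreover have "\<chi> (g ^ c) = \<chi> ((h\<^sup>2)\<^sup>2)" using chi_cong[OF a] by (simp flip: power_mult)
      ultimately show False using sq_nonneg[of "h\<^sup>2"] by linarith
    qed
  qed
  have tot: "(\<Sum>x\<in>Rs. (K4 x)\<^sup>2) = 4 * int p * (int p - 1)"
  proof -
    have "(\<Sum>x\<in>R. (K4 x)\<^sup>2) = int p * (\<Sum>x\<in>R. \<Sum>y\<in>R. of_bool (cg p (x ^ 4) (y ^ 4)) * (\<chi> x * \<chi> y)) - (\<Sum>x\<in>R. \<chi> x)\<^sup>2"
      unfolding K4_def by (rule second_moment)
    also have "(\<Sum>x\<in>R. \<Sum>y\<in>R. of_bool (cg p (x ^ 4) (y ^ 4)) * (\<chi> x * \<chi> y)) = (\<Sum>x\<in>Rs. 4)"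
    proof -
      have "(\<Sum>y\<in>R. of_bool (cg p (x ^ 4) (y ^ 4)) * (\<chi> x * \<chi> y)) = 4" if "x \<in> Rs" for x
      proof -
      have nd: "\<not> int p dvd x" using that by (rule Rs_not_dvd)
      have "(\<Sum>y\<in>R. of_bool (cg p (x ^ 4) (y ^ 4)) * (\<chi> x * \<chi> y)) = (\<Sum>j<4. \<chi> x * \<chi> (i ^ j * x))"
        by (rule sum_power_roots[OF pri nd]) (intro arg_cong2[where f = "(*)"] chi_cong refl)
      also have "\<dots> = 4" using ci chi_sq[OF nd] by simp
      finally show ?thesis .
      qed
      thus ?thesis by (subst sum_R_Rs) simp
    qed
    finally have "(\<Sum>x\<in>R. (K4 x)\<^sup>2) = 4 * int p * (int p - 1)" using sum_chi p_gt_3 by (simp add: of_nat_diff)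
    moreover have "K4 0 = 0"
    proof -
      have "\<chi> x * \<chi> (0 + x ^ 4) = \<chi> x" for x using chi_values[of x] by auto
      thus ?thesis unfolding K4_def using sum_chi by (simp only:)
    qed
    ultimately show ?thesis by (subst (asm) sum_R_Rs) simp
  qed
  have "(\<Sum>c<4. \<Sum>h\<in>Rs. (K4 (g ^ c * h ^ 4))\<^sup>2) = int 4 * (\<Sum>x\<in>Rs. (K4 x)\<^sup>2)"
    by (rule power_class_sum[OF pri g0 nres]) (use K4_cong in auto)
  also have "(\<Sum>c<4. \<Sum>h\<in>Rs. (K4 (g ^ c * h ^ 4))\<^sup>2) = (\<Sum>c<(4::nat). \<Sum>h\<in>Rs. (K4 (g ^ c))\<^sup>2)"
    by (intro sum.cong refl) (simp add: K4_scale Rs_not_dvd power_mult_distrib chi_sq')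
  also have "\<dots> = (int p - 1) * ((K4 1)\<^sup>2 + (K4 g)\<^sup>2 + (K4 (g\<^sup>2))\<^sup>2 + (K4 (g ^ 3))\<^sup>2)"
    using p_gt_3 by (simp add: eval_nat_numeral algebra_simps of_nat_diff)
  finally have "(int p - 1) * ((K4 1)\<^sup>2 + (K4 g)\<^sup>2 + (K4 (g\<^sup>2))\<^sup>2 + (K4 (g ^ 3))\<^sup>2) = (int p - 1) * (16 * int p)"
    using tot by simp
  hence sq: "(K4 1)\<^sup>2 + (K4 g)\<^sup>2 + (K4 (g\<^sup>2))\<^sup>2 + (K4 (g ^ 3))\<^sup>2 = 16 * int p" by (rule h2_mult)
  have gi: "cg p (g ^ k * iv g ^ k) 1" for k
    using cg_power[OF iv[OF g0], of k] by (simp add: power_mult_distrib)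
  \<comment> \<open>The inverse of g^2 is g^2 times the fourth power of 1/g. So the value is fixed
    by \<open>K4_inv\<close>, as \<chi>(g^2) = 1, and negated by \<open>K4_scale\<close>, as
    \<chi>(1/g) = -1.\<close>
  have K2: "K4 (g\<^sup>2) = 0"
  proof -
    have "\<not> int p dvd g\<^sup>2" using not_dvd_pow[OF g0] by blast
    hence "K4 (iv (g\<^sup>2)) = K4 (g\<^sup>2)" using K4_inv[of "g\<^sup>2"] g by simp
    moreover have "cg p (iv (g\<^sup>2)) (g\<^sup>2 * iv g ^ 4)"
    proof -
      have "g\<^sup>2 * iv g ^ 4 = (g\<^sup>2 * iv g ^ 2) * iv g ^ 2" by (simp add: power2_eq_square power4_eq_xxxx)
      also have "cg p \<dots> (1 * iv g ^ 2)" by (intro cg_intros gi)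
      also have "1 * iv g ^ 2 = iv (g\<^sup>2)" by (simp add: iv_def flip: power_mult) (simp add: mult.commute)
      finally show ?thesis by (rule cg_sym)
    qed
    hence "K4 (iv (g\<^sup>2)) = \<chi> (iv g) * K4 (g\<^sup>2)" using K4_cong K4_scale[OF ig0] by simp
    ultimately show ?thesis using g by (simp add: chi_iv)
  qed
  have K13: "K4 (g ^ 3) = K4 g"
  proof -
    have "cg p (iv g) (g ^ 3 * iv g ^ 4)"
    proof -
      have "g ^ 3 * iv g ^ 4 = (g ^ 3 * iv g ^ 3) * iv g" by (simp add: power3_eq_cube power4_eq_xxxx)
      also have "cg p \<dots> (1 * iv g)" by (intro cg_intros gi)
      finally show ?thesis by (simp add: cg_sym)
    qed
    hence "K4 (iv g) = \<chi> (iv g) * K4 (g ^ 3)" using K4_cong K4_scale[OF ig0] by simp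
    thus ?thesis using K4_inv[OF g0] g by (simp add: chi_iv)
  qed
  have e: "(K4 1)\<^sup>2 + 2 * (K4 g)\<^sup>2 = 16 * int p" using sq K2 K13 by simp
  define f where "f = (\<lambda>x::int. x * (1 + x ^ 4))"
  have fc: "cg p x y \<Longrightarrow> \<chi> (f x) = \<chi> (f y)" for x y unfolding f_def by (intro chi_cong cg_intros)
  define X where "X = {x\<in>R. \<chi> (f x) = -1}"
  have X0: "\<not> int p dvd f x" if "x \<in> X" for x using that chi_0_iff[of "f x"] by (auto simp: X_def)
  have Xd: "\<not> int p dvd x" if "x \<in> X" for x using X0[OF that] by (auto simp: f_def)
  have "2 * 4 dvd card X"
  proof (rule dihedral_orbit_dvd[OF pri])
    show "X \<subseteq> Rs" using Xd Rs_iff by (auto simp: X_def simp del: atLeastLessThan_iff atLeastAtMost_iff)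
    fix x y assume x: "x \<in> X" and y: "y \<in> R"
    {
      assume "cg p y (i * x)"
      hence "\<chi> (f y) = \<chi> (f (i * x))" by (rule fc)
      also have "\<dots> = \<chi> i * (\<chi> x * \<chi> (1 + i ^ 4 * x ^ 4))" by (simp add: f_def power_mult_distrib)
      also have "\<chi> (1 + i ^ 4 * x ^ 4) = \<chi> (1 + 1 * x ^ 4)" by (intro chi_cong cg_add cg_mult cg_refl i4)
      finally show "y \<in> X" using x y ci by (simp add: X_def f_def)
    }
    {
      assume "cg p y (iv x)"
      hence "\<chi> (f y) = \<chi> (f (iv x))" by (rule fc)
      also have "\<dots> = \<chi> x * (\<chi> (x ^ 4) * \<chi> (1 + iv x ^ 4))"
        using even_power_chi[OF Xd[OF x], of 4] by (simp add: f_def chi_iv)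
      also have "\<chi> (x ^ 4) * \<chi> (1 + iv x ^ 4) = \<chi> (x ^ 4 + (x * iv x) ^ 4)"
      proof -
        have "x ^ 4 + (x * iv x) ^ 4 = x ^ 4 * (1 + iv x ^ 4)" by (simp add: power_mult_distrib algebra_simps)
        thus ?thesis by (simp only: chi_mult)
      qed
      also have "\<dots> = \<chi> (x ^ 4 + 1 ^ 4)" by (intro chi_cong cg_intros iv Xd x)
      finally show "y \<in> X" using x y by (simp add: X_def f_def add.commute)
    }
  next
    fix x j assume x: "x \<in> X"
    show "\<not> cg p (x\<^sup>2) (i ^ j)"
    proof
      assume a: "cg p (x\<^sup>2) (i ^ j)"
      have x4: "cg p (x ^ 4) ((i\<^sup>2) ^ j)"
        using cg_power[OF a, of 2] by (simp flip: power_mult add: mult.commute)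
      have "cg p ((i\<^sup>2) ^ j) ((-1) ^ j)" using i by (rule cg_power)
      hence x4: "cg p (x ^ 4) ((-1) ^ j)" using cg_trans[OF x4] by blast
      show False
      proof (cases "even j")
        case True
        hence x1: "cg p (x ^ 4) (1 ^ 4)" using x4 by simp
        then obtain k where k: "cg p x (i ^ k * 1)" using power_roots[OF pri not_dvd_1] by blast
        have "\<chi> (f x) = \<chi> x * \<chi> (1 + x ^ 4)" by (simp add: f_def)
        also have "\<chi> x = 1" using chi_cong[OF k] ci by simp
        also have "\<chi> (1 + x ^ 4) = \<chi> (1 + 1 ^ 4)" by (intro chi_cong cg_add cg_refl x1)
        finally show False using x c2 by (simp add: X_def)
      next
        case False
        hence "int p dvd 1 + x ^ 4" using x4 by (simp add: cg_def add.commute)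
        thus False using X0[OF x] by (simp add: f_def)
      qed
    qed
  qed
  then obtain m where m: "card X = 8 * m" by auto
  \<comment> \<open>A square root of i has order 8; its fourth power -1 shows that 1 + x^4 has
    exactly four zeros.\<close>
  obtain th :: int where th: "cg p (th\<^sup>2) i" using chi_eq_1_iff[OF i0] ci by auto
  have th4: "cg p (th ^ 4) (-1)"
    using cg_trans[OF cg_power[OF th, of 2] i] by (simp flip: power_mult)
  have th0: "\<not> int p dvd th" using cg_cong_dvd[OF th] i0 by (simp add: dvd_power_iff')
  have "(\<Sum>y\<in>R. of_bool (cg p (th ^ 4) (y ^ 4)) * 1) = (\<Sum>j<(4::nat). 1 :: int)"
    by (intro sum_power_roots[OF pri th0]) auto
  hence c4: "int (card {x\<in>R. cg p (th ^ 4) (x ^ 4)}) = 4" by (simp add: Int_def)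
  have "{x\<in>R. \<not> int p dvd f x} = R - insert 0 {x\<in>R. cg p (th ^ 4) (x ^ 4)}"
  proof -
    have "int p dvd f x \<longleftrightarrow> x = 0 \<or> cg p (th ^ 4) (x ^ 4)" if "x \<in> R" for x
    proof -
      have "cg p (th ^ 4) (x ^ 4) \<longleftrightarrow> cg p (-1) (x ^ 4)" by (rule cg_left_cong[OF th4])
      also have "\<dots> \<longleftrightarrow> int p dvd 1 + x ^ 4" using cg_sym_iff[of "-1" "x ^ 4"] by (simp add: cg_def add.commute)
      finally show ?thesis using dvd_R_iff[OF that] by (simp add: f_def dvd_mult_iff)
    qed
    thus ?thesis by blast
  qed
  moreover have "card (R - insert 0 {x\<in>R. cg p (th ^ 4) (x ^ 4)}) = p - 5"
  proof -
    have "0 \<notin> {x\<in>R. cg p (th ^ 4) (x ^ 4)}" using th0 by (simp add: cg_0_int dvd_power_iff')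
    hence "card (insert 0 {x\<in>R. cg p (th ^ 4) (x ^ 4)}) = 5" using c4 fin_R by (subst card_insert_disjoint) auto
    thus ?thesis using fin_R by (subst card_Diff_subset) auto
  qed
  moreover have "p \<ge> 5" using p_gt_3 p8 by presburger
  ultimately have c: "int (card {x\<in>R. \<not> int p dvd f x}) = int p - 5" by simp
  have "K4 1 = (\<Sum>x\<in>R. \<chi> (f x))" by (simp add: K4_def f_def)
  hence K: "K4 1 = int p - 5 - 16 * int m" using even_count_chi[of f] c m by (simp add: X_def)
  define k where "k = int (p div 8)"
  have k: "int p = 8 * k + 1" using p8 unfolding k_def by presburger
  define a where "a = 2 * k - 1 - 4 * int m"
  have a: "K4 1 = 4 * a" using K k by (simp add: a_def)
  have "(K4 g)\<^sup>2 = 8 * (int p - a\<^sup>2)" using e a by (simp add: power_mult_distrib)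
  hence "even ((K4 g)\<^sup>2)" by simp
  hence "even (K4 g)" by simp
  then obtain b1 where b1: "K4 g = 2 * b1" by blast
  hence "b1\<^sup>2 = 2 * (int p - a\<^sup>2)" using \<open>(K4 g)\<^sup>2 = 8 * (int p - a\<^sup>2)\<close> by (simp add: power_mult_distrib)
  hence "even (b1\<^sup>2)" by simp
  hence "even b1" by simp
  then obtain b where "b1 = 2 * b" by blast
  hence "int p = a\<^sup>2 + 2 * b\<^sup>2" using \<open>b1\<^sup>2 = 2 * (int p - a\<^sup>2)\<close> by (simp add: power_mult_distrib)
  hence au: "a = u \<or> a = - u" using norm_form_unique[OF prime_p _ uv, of a b] by simp
  have "2 * Br = 4 * a" using K4_1_Br m1 a by simp
  hence S: "S 4 2 = 2 * a" using S_4_2 c2 by simp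
  show ?thesis
  proof (cases "even (p div 8)")
    case True
    hence "even k" by (simp add: k_def)
    hence "a = - u" using au u unfolding a_def by presburger
    thus ?thesis using S True by simp
  next
    case False
    hence "odd k" by (simp add: k_def)
    hence "a = u" using au u unfolding a_def by presburger
    thus ?thesis using S False by simp
  qed
qed

end

subsection \<open>Gaussian integers\<close>

text \<open>Modulo a prime p = 3 modulo 4 this ring is the field with p^2 elements;
  \<open>gre\<close> and \<open>gim\<close> are its coordinates over F_p.\<close>

datatype gint = GI (gre: int) (gim: int)

instantiation gint :: comm_ring_1
begin
definition "0 = GI 0 0"
definition "1 = GI 1 0"
fun plus_gint where "GI a b + GI c d = GI (a + c) (b + d)"
fun uminus_gint where "- GI a b = GI (- a) (- b)"
fun minus_gint where "GI a b - GI c d = GI (a - c) (b - d)"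
fun times_gint where "GI a b * GI c d = GI (a * c - b * d) (a * d + b * c)"
instance
proof
  fix x y z :: gint
  show "x * y * z = x * (y * z)" by (cases x; cases y; cases z) (simp add: algebra_simps)
  show "(x + y) * z = x * z + y * z" by (cases x; cases y; cases z) (simp add: algebra_simps)
  show "x * y = y * x" by (cases x; cases y) (simp add: algebra_simps)
  show "x + y + z = x + (y + z)" by (cases x; cases y; cases z) simp
  show "x + y = y + x" by (cases x; cases y) simp
  show "x - y = x + - y" by (cases x; cases y) simp
  show "0 + x = x" "- x + x = 0" "1 * x = x" by (cases x; simp add: zero_gint_def one_gint_def)+
  show "(0::gint) \<noteq> 1" by (simp add: zero_gint_def one_gint_def)
qed
end

lemma of_nat_gint: "of_nat n = GI (int n) 0"
  by (induction n) (auto simp: zero_gint_def one_gint_def)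

lemma cg_gint: "cg p x y \<longleftrightarrow> cg p (gre x) (gre y) \<and> cg p (gim x) (gim y)"
proof (cases x; cases y)
  fix a b c d assume xy: "x = GI a b" "y = GI c d"
  have "GI (int p) 0 dvd GI e f \<longleftrightarrow> int p dvd e \<and> int p dvd f" for e f
  proof
    assume "GI (int p) 0 dvd GI e f"
    then obtain w where w: "GI e f = GI (int p) 0 * w" by (elim dvdE)
    thus "int p dvd e \<and> int p dvd f" by (cases w) auto
  next
    assume "int p dvd e \<and> int p dvd f"
    then obtain e' f' where "e = int p * e'" "f = int p * f'" by (elim conjE dvdE)
    hence "GI e f = GI (int p) 0 * GI e' f'" by simp
    thus "GI (int p) 0 dvd GI e f" by (rule dvdI)
  qed
  thus ?thesis using xy by (simp add: cg_def of_nat_gint)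
qed

fun gcnj :: "gint \<Rightarrow> gint" where "gcnj (GI a b) = GI a (- b)"
fun gN :: "gint \<Rightarrow> int" where "gN (GI a b) = a\<^sup>2 + b\<^sup>2"

lemma gN_mult: "gN (x * y) = gN x * gN y"
  by (cases x; cases y) (simp add: power2_eq_square algebra_simps)

lemma gN_power: "gN (x ^ k) = gN x ^ k"
  by (induction k) (auto simp: gN_mult one_gint_def)

lemma gcnj_mult: "gcnj (x * y) = gcnj x * gcnj y"
  by (cases x; cases y) (simp add: algebra_simps)

lemma gcnj_power: "gcnj (x ^ k) = gcnj x ^ k"
  by (induction k) (auto simp: gcnj_mult one_gint_def)

lemma gcnj_gcnj [simp]: "gcnj (gcnj x) = x" by (cases x) simp
lemma gre_gcnj [simp]: "gre (gcnj x) = gre x" by (cases x) simp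
lemma gN_gcnj [simp]: "gN (gcnj x) = gN x" by (cases x) simp
lemma mult_gcnj: "x * gcnj x = GI (gN x) 0" by (cases x) (simp add: power2_eq_square)

lemma gre_real_mult: "gre (GI c 0 * w) = c * gre w" "gre (g * (GI c 0 * w)) = c * gre (g * w)"
  by (cases w; simp) (cases w; cases g; simp add: algebra_simps)

lemma GI_power: "GI c 0 ^ k = GI (c ^ k) 0"
  by (induction k) (auto simp: one_gint_def)

lemma gint_power4: "GI a b ^ 4 = GI (a ^ 4 - 6 * a\<^sup>2 * b\<^sup>2 + b ^ 4) (4 * (a * b * (a - b) * (a + b)))"
  by (simp add: power4_eq_xxxx power2_eq_square algebra_simps)

lemma cg_gre: "cg p x y \<Longrightarrow> cg p (gre x) (gre y)"
  by (simp add: cg_gint)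

lemma cg_gcnj: "cg p x y \<Longrightarrow> cg p (gcnj x) (gcnj y)"
  by (cases x; cases y) (simp add: cg_gint cg_minus)

lemma cg_gN: "cg p x y \<Longrightarrow> cg p (gN x) (gN y)"
  by (cases x; cases y) (auto simp: cg_gint intro!: cg_add cg_power)

context big_prime
begin

definition AG :: "gint set" where "AG = (\<lambda>(a, b). GI a b) ` (R \<times> R)"

lemma ressys_AG: "ressys p AG"
proof
  show "finite AG" by (simp add: AG_def)
  show "\<exists>y\<in>AG. cg p x y" for x
  proof (rule bexI)
    show "cg p x (GI (RS.red (gre x)) (RS.red (gim x)))" by (simp add: cg_gint RS.red)
    show "GI (RS.red (gre x)) (RS.red (gim x)) \<in> AG" unfolding AG_def using RS.red(1) by (intro rev_image_eqI[of "(_, _)"]) auto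
  qed
  fix x y assume "x \<in> AG" "y \<in> AG" "cg p x y"
  thus "x = y" unfolding AG_def using RS.uniq by (auto simp: cg_gint simp del: atLeastLessThan_iff)
qed

sublocale AG: ressys p AG by (rule ressys_AG)

lemma sum_AG: "(\<Sum>x\<in>AG. f x) = (\<Sum>a\<in>R. \<Sum>b\<in>R. (f (GI a b) :: int))"
proof -
  have "(\<Sum>x\<in>AG. f x) = (\<Sum>(a, b)\<in>R \<times> R. f (GI a b))"
    unfolding AG_def by (subst sum.reindex) (auto simp: inj_on_def case_prod_unfold)
  thus ?thesis by (simp add: sum.cartesian_product)
qed

lemma gunit: "\<not> int p dvd gN v \<Longrightarrow> cg p (v * (gcnj v * GI (iv (gN v)) 0)) 1"
proof -
  assume "\<not> int p dvd gN v"
  hence "cg p (gN v * iv (gN v)) 1" by (rule iv)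
  thus ?thesis by (simp add: mult.assoc[symmetric] mult_gcnj cg_gint one_gint_def)
qed

text \<open>The analogue of \<open>K4\<close> for p = 3 modulo 4. With x = v / \<open>gcnj\<close> v
  the product N(v) Re(g v^4) is, up to constants and squares over the larger field, x (g x^4 +
  \<open>gcnj\<close> g), so x runs through elements of norm 1 instead of F_p.\<close>

definition KG :: "gint \<Rightarrow> int" where
  "KG g = (\<Sum>v\<in>AG. \<chi> (gN v) * \<chi> (gre (g * v ^ 4)))"

lemma KG_cong: "cg p x y \<Longrightarrow> KG x = KG y"
  unfolding KG_def by (intro sum.cong refl arg_cong2[where f = "(*)"] chi_cong cg_gre cg_mult cg_refl)

lemma KG_term_cong: "cg p v w \<Longrightarrow> \<chi> (gN v) * \<chi> (gre (g * v ^ 4)) = \<chi> (gN w) * \<chi> (gre (g * w ^ 4))"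
  by (intro arg_cong2[where f = "(*)"] chi_cong cg_gre cg_gN cg_mult cg_power cg_refl)

lemma KG_scale: assumes h: "\<not> int p dvd gN h" shows "KG (g * h ^ 4) = \<chi> (gN h) * KG g"
proof -
  have "KG g = (\<Sum>v\<in>AG. \<chi> (gN (h * v)) * \<chi> (gre (g * (h * v) ^ 4)))"
    unfolding KG_def by (rule ressys_unit_mult[OF ressys_AG KG_term_cong gunit[OF h], symmetric])
  also have "\<dots> = (\<Sum>v\<in>AG. \<chi> (gN h) * (\<chi> (gN v) * \<chi> (gre (g * h ^ 4 * v ^ 4))))"
    by (simp add: gN_mult power_mult_distrib mult_ac)
  finally have "KG g = \<chi> (gN h) * KG (g * h ^ 4)" by (simp add: KG_def sum_distrib_left)
  hence "\<chi> (gN h) * KG g = (\<chi> (gN h) * \<chi> (gN h)) * KG (g * h ^ 4)" by simp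
  thus ?thesis using chi_sq[OF h] by simp
qed

lemma KG_real: "KG (GI c 0 * g) = \<chi> c * KG g"
  unfolding KG_def sum_distrib_left by (intro sum.cong refl) (simp add: mult.assoc gre_real_mult(1))

lemma KG_cnj: "KG (gcnj g) = KG g"
proof -
  have "KG (gcnj g) = (\<Sum>v\<in>AG. \<chi> (gN (gcnj v)) * \<chi> (gre (gcnj g * gcnj v ^ 4)))"
    unfolding KG_def by (rule ressys_reindex[OF ressys_AG ressys_AG KG_term_cong, where k = gcnj, symmetric]) (auto intro: cg_gcnj)
  also have "\<dots> = KG g"
    unfolding KG_def gcnj_power[symmetric] gcnj_mult[symmetric] by simp
  finally show ?thesis .
qed

text \<open>\<open>KG\<close> per line through the origin. N(v) Re(g v^4) has even degree 6 over
  F_p, so the p - 1 nonzero points of a line contribute equally; the last summand belongs to the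
  real line, the point at infinity for t.\<close>

definition kap :: "gint \<Rightarrow> int" where
  "kap g = (\<Sum>t\<in>R. \<chi> (t\<^sup>2 + 1) * \<chi> (gre (g * GI t 1 ^ 4))) + \<chi> (gre g)"

lemma KG_kap: "KG g = (int p - 1) * kap g"
proof -
  have "KG g = (\<Sum>b\<in>R. \<Sum>a\<in>R. \<chi> (gN (GI a b)) * \<chi> (gre (g * GI a b ^ 4)))"
    unfolding KG_def sum_AG by (rule sum.swap)
  also have "\<dots> = (\<Sum>a\<in>R. \<chi> (a\<^sup>2) * \<chi> (a ^ 4 * gre g)) + (\<Sum>b\<in>Rs. \<Sum>t\<in>R. \<chi> (t\<^sup>2 + 1) * \<chi> (gre (g * GI t 1 ^ 4)))"
    unfolding sum_R_Rs[of "\<lambda>b. \<Sum>a\<in>R. \<chi> (gN (GI a b)) * \<chi> (gre (g * GI a b ^ 4))"]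
  proof (rule arg_cong2[where f = "(+)"], rule sum.cong[OF refl], rule_tac [2] sum.cong[OF refl])
    fix a
    have "GI a 0 ^ 4 = GI (a ^ 4) 0 * 1" by (simp add: GI_power)
    hence "gre (g * GI a 0 ^ 4) = a ^ 4 * gre g" using gre_real_mult(2)[of g "a ^ 4" 1] by simp
    thus "\<chi> (gN (GI a 0)) * \<chi> (gre (g * GI a 0 ^ 4)) = \<chi> (a\<^sup>2) * \<chi> (a ^ 4 * gre g)" by simp
  next
    fix b assume "b \<in> Rs"
    hence b: "\<not> int p dvd b" by (rule Rs_not_dvd)
    have "(\<Sum>a\<in>R. \<chi> (gN (GI a b)) * \<chi> (gre (g * GI a b ^ 4)))
      = (\<Sum>t\<in>R. \<chi> (gN (GI (b * t) b)) * \<chi> (gre (g * GI (b * t) b ^ 4)))"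
    proof (rule unit_reindex[OF _ b, symmetric])
      fix x y :: int assume "cg p x y"
      hence "cg p (GI x b) (GI y b)" by (simp add: cg_gint)
      thus "\<chi> (gN (GI x b)) * \<chi> (gre (g * GI x b ^ 4)) = \<chi> (gN (GI y b)) * \<chi> (gre (g * GI y b ^ 4))"
        by (rule KG_term_cong)
    qed
    also have "\<dots> = (\<Sum>t\<in>R. \<chi> (t\<^sup>2 + 1) * \<chi> (gre (g * GI t 1 ^ 4)))"
    proof (intro sum.cong refl)
      fix t
      have e: "GI (b * t) b = GI b 0 * GI t 1" by simp
      have e4: "GI (b * t) b ^ 4 = GI (b ^ 4) 0 * GI t 1 ^ 4"
        unfolding e power_mult_distrib GI_power by (rule refl)
      have "\<chi> (gre (g * GI (b * t) b ^ 4)) = \<chi> (gre (g * GI t 1 ^ 4))"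
        unfolding e4 gre_real_mult chi_mult chi_power using even_power_chi[OF b, of 4] by simp
      moreover have "\<chi> (gN (GI (b * t) b)) = \<chi> (t\<^sup>2 + 1)"
        unfolding e gN_mult chi_mult using chi_sq'[OF b] by simp
      ultimately show "\<chi> (gN (GI (b * t) b)) * \<chi> (gre (g * GI (b * t) b ^ 4)) = \<chi> (t\<^sup>2 + 1) * \<chi> (gre (g * GI t 1 ^ 4))"
        by simp
    qed
    finally show "(\<Sum>a\<in>R. \<chi> (gN (GI a b)) * \<chi> (gre (g * GI a b ^ 4))) = (\<Sum>t\<in>R. \<chi> (t\<^sup>2 + 1) * \<chi> (gre (g * GI t 1 ^ 4)))" .
  qed
  also have "(\<Sum>a\<in>R. \<chi> (a\<^sup>2) * \<chi> (a ^ 4 * gre g)) = (\<Sum>a\<in>R. \<chi> a * \<chi> a * \<chi> (gre g))"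
  proof (intro sum.cong refl)
    fix a
    show "\<chi> (a\<^sup>2) * \<chi> (a ^ 4 * gre g) = \<chi> a * \<chi> a * \<chi> (gre g)" using chi_values[of a] by auto
  qed
  also have "\<dots> = (int p - 1) * \<chi> (gre g)" by (simp only: sum_distrib_right[symmetric] sum_chi_sq)
  finally show ?thesis using p_gt_3 by (simp add: kap_def algebra_simps of_nat_diff)
qed

text \<open>The orthogonality relation on \<int>[i] / p. The forms Re g and Re(g z) are independent,
  and the sum vanishes, unless z is real modulo p.\<close>

lemma sum_two_forms:
  "(\<Sum>g\<in>AG. \<chi> (gre g) * \<chi> (gre (g * z))) = of_bool (int p dvd gim z) * (\<chi> (gre z) * (int p * (int p - 1)))"
proof -
  obtain c d where z: "z = GI c d" by (cases z)
  have "(\<Sum>g\<in>AG. \<chi> (gre g) * \<chi> (gre (g * z))) = (\<Sum>a\<in>R. \<Sum>b\<in>R. \<chi> a * \<chi> ((- d) * b + a * c))"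
    unfolding sum_AG z by (simp add: algebra_simps)
  also have "\<dots> = of_bool (int p dvd d) * (\<chi> c * (int p * (int p - 1)))"
  proof (cases "int p dvd d")
    case False
    hence "(\<Sum>b\<in>R. \<chi> ((- d) * b + a * c)) = 0" for a by (intro sum_chi_linear) simp
    thus ?thesis using False by (simp add: sum_distrib_left[symmetric])
  next
    case True
    have "(\<Sum>a\<in>R. \<Sum>b\<in>R. \<chi> a * \<chi> ((- d) * b + a * c)) = (\<Sum>a\<in>R. \<Sum>b\<in>R. \<chi> a * \<chi> a * \<chi> c)"
    proof (intro sum.cong refl)
      fix a b
      have "cg p ((- d) * b + a * c) (0 + a * c)" using True by (intro cg_add cg_refl) (simp add: cg_0_int)
      thus "\<chi> a * \<chi> ((- d) * b + a * c) = \<chi> a * \<chi> a * \<chi> c" using chi_cong by fastforce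
    qed
    also have "\<dots> = \<chi> c * int p * (\<Sum>a\<in>R. \<chi> a * \<chi> a)" by (simp add: sum_distrib_left mult_ac)
    finally show ?thesis using True sum_chi_sq by simp
  qed
  finally show ?thesis by (simp add: z)
qed

end

section \<open>Discriminant -8, primes congruent to 3 modulo 8\<close>

locale prime_3_mod_8 = big_prime +
  assumes p8: "p mod 8 = 3"
begin

lemma m1: "\<chi> (-1) = -1" using p8 by (intro chi_m1) presburger
lemma c2: "\<chi> 2 = -1" using p8 by (rule chi_2_mod)

lemma sum_sq_dvd: "int p dvd a\<^sup>2 + b\<^sup>2 \<longleftrightarrow> int p dvd a \<and> int p dvd b"
proof
  assume d: "int p dvd a\<^sup>2 + b\<^sup>2"
  have "int p dvd b"
  proof (rule ccontr)
    assume b: "\<not> int p dvd b"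
    have "cg p (a\<^sup>2) (- (b\<^sup>2))" using d by (simp add: cg_def)
    hence "\<chi> a * \<chi> a = - 1"
      using chi_cong chi_uminus[of "b\<^sup>2"] m1 chi_sq'[OF b] by (fastforce simp: power2_eq_square)
    thus False using chi_values[of a] by auto
  qed
  moreover have "int p dvd a\<^sup>2" using d \<open>int p dvd b\<close> by (metis dvd_add_left_iff dvd_power_iff' pos2)
  ultimately show "int p dvd a \<and> int p dvd b" using dvd_power_iff'[of 2 a] by simp
qed (auto simp: power2_eq_square)

lemma gN_dvd: "int p dvd gN v \<longleftrightarrow> cg p v 0"
  by (cases v) (simp add: sum_sq_dvd cg_gint zero_gint_def cg_0_int)

definition U where "U = AG - {0}"

lemma U_not_dvd: "v \<in> U \<Longrightarrow> \<not> int p dvd gN v"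
proof
  assume v: "v \<in> U" "int p dvd gN v"
  have "0 \<in> AG" unfolding AG_def zero_gint_def by (intro rev_image_eqI[of "(0,0)"]) auto
  thus False using v AG.uniq[of v 0] by (auto simp: gN_dvd U_def)
qed

lemma red_U: "\<not> int p dvd gN v \<Longrightarrow> AG.red v \<in> U"
  unfolding U_def using AG.red[of v] gN_dvd[of v] cg_sym[of p "AG.red v" v] by auto

lemma card_U: "int (card U) = (int p)\<^sup>2 - 1"
proof -
  have "0 \<in> AG" unfolding AG_def zero_gint_def by (intro rev_image_eqI[of "(0,0)"]) auto
  moreover have "card AG = p * p"
    unfolding AG_def by (subst card_image) (auto simp: inj_on_def card_cartesian_product)
  ultimately have "card U = p * p - 1" unfolding U_def by simp
  thus ?thesis using p_gt_3 by (simp add: of_nat_diff power2_eq_square)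
qed

lemma sum_AG_U: "f 0 = 0 \<Longrightarrow> (\<Sum>v\<in>AG. f v) = (\<Sum>v\<in>U. (f v :: int))"
  unfolding U_def using AG.fin by (intro sum.mono_neutral_right) auto

text \<open>The imaginary part of (a + bi)^4 is 4ab (a - b)(a + b), so u^4 is real on four lines.
  Each nonzero point contributes 1; on a = b and a = -b the norm 2 a^2 gives -1 and the fourth power
  -4 a^4 gives -1.\<close>

lemma fourth_powers_real:
  "(\<Sum>u\<in>AG. \<chi> (gN u) * (of_bool (int p dvd gim (u ^ 4)) * \<chi> (gre (u ^ 4)))) = 4 * (int p - 1)"
proof -
  define F where "F = (\<lambda>a b. \<chi> (a\<^sup>2 + b\<^sup>2) * \<chi> (a ^ 4 - 6 * a\<^sup>2 * b\<^sup>2 + b ^ 4))"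
  have Fc: "cg p x y \<Longrightarrow> F a x = F a y" for a x y unfolding F_def by (intro arg_cong2[where f = "(*)"] chi_cong cg_intros)
  have "(\<Sum>u\<in>AG. \<chi> (gN u) * (of_bool (int p dvd gim (u ^ 4)) * \<chi> (gre (u ^ 4))))
    = (\<Sum>a\<in>R. \<Sum>b\<in>R. of_bool (int p dvd 4 * (a * b * (a - b) * (a + b))) * F a b)"
    unfolding sum_AG gint_power4 by (simp add: F_def mult_ac)
  also have "\<dots> = (\<Sum>b\<in>R. F 0 b) + (\<Sum>a\<in>Rs. 3)"
  proof (subst sum_R_Rs, intro arg_cong2[where f = "(+)"] sum.cong refl)
    fix a assume "a \<in> Rs"
    hence a: "\<not> int p dvd a" by (rule Rs_not_dvd)
    have "(\<Sum>b\<in>R. of_bool (int p dvd 4 * (a * b * (a - b) * (a + b))) * F a b) =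
      (\<Sum>b\<in>R. of_bool (cg p 0 b) * F a b + (of_bool (cg p a b) * F a b + of_bool (cg p (- a) b) * F a b))"
    proof (intro sum.cong refl)
      fix b
      have "int p dvd 4 * (a * b * (a - b) * (a + b)) \<longleftrightarrow> cg p 0 b \<or> cg p a b \<or> cg p (- a) b"
      proof -
        have "cg p (- a) b \<longleftrightarrow> int p dvd a + b" by (simp add: cg_def dvd_diff_commute add.commute)
        thus ?thesis using a not_dvd_4 by (auto simp: dvd_mult_iff cg_def)
      qed
      moreover have "\<not> (cg p 0 b \<and> cg p a b)"
      proof
        assume "cg p 0 b \<and> cg p a b"
        hence "cg p a 0" using cg_sym cg_trans by blast
        thus False using a by (simp add: cg_0_int)
      qed
      moreover have "\<not> (cg p 0 b \<and> cg p (- a) b)"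
      proof
        assume "cg p 0 b \<and> cg p (- a) b"
        hence "cg p (- a) 0" using cg_sym cg_trans by blast
        thus False using a by (simp add: cg_0_int)
      qed
      moreover have "\<not> (cg p a b \<and> cg p (- a) b)"
      proof
        assume "cg p a b \<and> cg p (- a) b"
        hence "cg p a (- a)" using cg_sym cg_trans by blast
        hence "int p dvd 2 * a" by (simp add: cg_def)
        thus False using a not_dvd_2 by (simp add: dvd_mult_iff)
      qed
      ultimately show "of_bool (int p dvd 4 * (a * b * (a - b) * (a + b))) * F a b =
        of_bool (cg p 0 b) * F a b + (of_bool (cg p a b) * F a b + of_bool (cg p (- a) b) * F a b)"
        by auto
    qed
    also have "\<dots> = F a 0 + (F a a + F a (- a))"
      unfolding sum.distrib by (intro arg_cong2[where f = "(+)"] sum_of_bool_unique Fc) auto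
    also have "F a 0 = 1" using even_power_chi[OF a] by (simp add: F_def)
    also have "F a a = 1"
    proof -
      have e: "a\<^sup>2 + a\<^sup>2 = 2 * a\<^sup>2" "a ^ 4 - 6 * a\<^sup>2 * a\<^sup>2 + a ^ 4 = - ((2 * a\<^sup>2)\<^sup>2)"
        by (simp_all add: power2_eq_square power4_eq_xxxx)
      show ?thesis unfolding F_def e chi_uminus[of "(2 * a\<^sup>2)\<^sup>2"] chi_mult chi_power m1 c2
        using even_power_chi[OF a] by simp
    qed
    also have "F a (- a) = F a a" by (simp add: F_def)
    also have "F a a = 1" by fact
    finally show "(\<Sum>b\<in>R. of_bool (int p dvd 4 * (a * b * (a - b) * (a + b))) * F a b) = 3" by simp
  qed (simp)
  also have "(\<Sum>b\<in>R. F 0 b) = (\<Sum>b\<in>R. \<chi> b * \<chi> b)"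
  proof (intro sum.cong refl)
    fix b show "F 0 b = \<chi> b * \<chi> b" using chi_values[of b] by (auto simp: F_def)
  qed
  finally show ?thesis using sum_chi_sq p_gt_3 by (simp add: of_nat_diff)
qed

text \<open>With w = v u the factor v^4 is absorbed into g, so by \<open>sum_two_forms\<close> only
  those u count whose fourth power is real.\<close>

lemma KG_moment: "(\<Sum>g\<in>U. (KG g)\<^sup>2) = 4 * int p * (int p - 1)\<^sup>2 * ((int p)\<^sup>2 - 1)"
proof -
  define H where "H = (\<lambda>v w. \<Sum>g\<in>AG. \<chi> (gre (g * v ^ 4)) * \<chi> (gre (g * w ^ 4)))"
  have "(\<Sum>g\<in>AG. (KG g)\<^sup>2) = (\<Sum>g\<in>AG. \<Sum>v\<in>AG. \<Sum>w\<in>AG. \<chi> (gN v) * \<chi> (gN w) * (\<chi> (gre (g * v ^ 4)) * \<chi> (gre (g * w ^ 4))))"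
    by (simp add: KG_def power2_eq_square sum_product mult_ac)
  also have "\<dots> = (\<Sum>v\<in>AG. \<Sum>w\<in>AG. \<chi> (gN v) * \<chi> (gN w) * H v w)"
    unfolding H_def by (subst sum.swap, rule sum.cong[OF refl], subst sum.swap, rule sum.cong[OF refl]) (simp add: sum_distrib_left)
  also have "\<dots> = (\<Sum>v\<in>U. \<Sum>w\<in>AG. \<chi> (gN v) * \<chi> (gN w) * H v w)"
    by (rule sum_AG_U) (simp add: zero_gint_def)
  also have "\<dots> = (\<Sum>v\<in>U. 4 * int p * (int p - 1)\<^sup>2)"
  proof (rule sum.cong)
    fix v assume "v \<in> U"
    hence v: "\<not> int p dvd gN v" by (rule U_not_dvd)
    have v4: "\<not> int p dvd gN (v ^ 4)" using v not_dvd_pow by (simp add: gN_power)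
    have Hc: "cg p x y \<Longrightarrow> \<chi> (gN v) * \<chi> (gN x) * H v x = \<chi> (gN v) * \<chi> (gN y) * H v y" for x y
      unfolding H_def by (intro arg_cong2[where f = "(*)"] sum.cong refl chi_cong cg_gre cg_gN cg_mult cg_power cg_refl)
    have "(\<Sum>w\<in>AG. \<chi> (gN v) * \<chi> (gN w) * H v w) = (\<Sum>u\<in>AG. \<chi> (gN v) * \<chi> (gN (v * u)) * H v (v * u))"
      by (rule ressys_unit_mult[OF ressys_AG Hc gunit[OF v], symmetric])
    also have "\<dots> = (\<Sum>u\<in>AG. (int p * (int p - 1)) * (\<chi> (gN u) * (of_bool (int p dvd gim (u ^ 4)) * \<chi> (gre (u ^ 4)))))"
    proof (intro sum.cong refl)
      fix u
      have "H v (v * u) = (\<Sum>g\<in>AG. (\<lambda>g. \<chi> (gre g) * \<chi> (gre (g * u ^ 4))) (v ^ 4 * g))"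
        unfolding H_def by (simp add: power_mult_distrib mult_ac)
      also have "\<dots> = (\<Sum>g\<in>AG. (\<lambda>g. \<chi> (gre g) * \<chi> (gre (g * u ^ 4))) g)"
        by (rule ressys_unit_mult[OF ressys_AG _ gunit[OF v4]])
          (intro arg_cong2[where f = "(*)"] chi_cong cg_gre cg_mult cg_refl; assumption)
      finally have "H v (v * u) = of_bool (int p dvd gim (u ^ 4)) * (\<chi> (gre (u ^ 4)) * (int p * (int p - 1)))"
        by (simp only: sum_two_forms)
      thus "\<chi> (gN v) * \<chi> (gN (v * u)) * H v (v * u) = (int p * (int p - 1)) * (\<chi> (gN u) * (of_bool (int p dvd gim (u ^ 4)) * \<chi> (gre (u ^ 4))))"
        using chi_sq[OF v] by (simp add: gN_mult)
    qed
    also have "\<dots> = (int p * (int p - 1)) * (4 * (int p - 1))"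
      by (simp only: sum_distrib_left[symmetric] fourth_powers_real)
    finally show "(\<Sum>w\<in>AG. \<chi> (gN v) * \<chi> (gN w) * H v w) = 4 * int p * (int p - 1)\<^sup>2"
      by (simp add: power2_eq_square mult_ac)
  qed simp
  also have "\<dots> = 4 * int p * (int p - 1)\<^sup>2 * ((int p)\<^sup>2 - 1)" by (simp add: card_U mult.commute)
  finally have "(\<Sum>g\<in>AG. (KG g)\<^sup>2) = 4 * int p * (int p - 1)\<^sup>2 * ((int p)\<^sup>2 - 1)" .
  moreover have "gre (0 * v ^ 4) = 0" for v by (simp only: mult_zero_left) (simp add: zero_gint_def)
  hence "KG 0 = 0" by (simp add: KG_def)
  ultimately show ?thesis using sum_AG_U[of "\<lambda>g. (KG g)\<^sup>2"] by simp
qed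

lemma gint_cancel:
  assumes "cg p (a * x) (a * y)" and a: "\<not> int p dvd gN a" shows "cg p x y"
proof -
  have "cg p ((gcnj a * GI (iv (gN a)) 0) * (a * x)) ((gcnj a * GI (iv (gN a)) 0) * (a * y))" by (intro cg_mult cg_refl assms(1))
  hence "cg p ((a * (gcnj a * GI (iv (gN a)) 0)) * x) ((a * (gcnj a * GI (iv (gN a)) 0)) * y)" by (simp add: mult_ac)
  moreover have "cg p ((a * (gcnj a * GI (iv (gN a)) 0)) * z) (1 * z)" for z by (intro cg_mult cg_refl gunit a)
  ultimately have "cg p (1 * x) (1 * y)" by (metis cg_sym cg_trans)
  thus ?thesis by simp
qed

lemma gint_no_zero_div:
  fixes x y :: gint
  assumes "cg p (x * y) 0" shows "cg p x 0 \<or> cg p y 0"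
proof -
  from assms have "int p dvd gN x * gN y" by (simp add: gN_mult[symmetric] gN_dvd)
  thus ?thesis by (simp add: dvd_mult_iff gN_dvd)
qed

abbreviation "gam \<equiv> GI 1 1"

lemma gam: "gN gam = 2" "\<not> int p dvd gN gam" "gam\<^sup>2 = GI 0 2" "gam ^ 3 = GI (-2) 2"
  using not_dvd_2 by (simp_all add: power2_eq_square power3_eq_cube)

text \<open>For odd c the norm 2^c is a nonresidue. For c = 2 one would get h^2 = 1 + i up to sign,
  hence N(h)^2 = 2, but 2 is a nonresidue.\<close>

lemma gam_not_fourth_power: "0 < c \<Longrightarrow> c < (4::nat) \<Longrightarrow> \<not> cg p (gam ^ c) (h ^ 4)"
proof
  assume c: "0 < c" "c < 4" and a: "cg p (gam ^ c) (h ^ 4)"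
  show False
  proof (cases "c = 2")
    case True
    have "(h\<^sup>2 - gam) * (h\<^sup>2 + gam) = h ^ 4 - gam\<^sup>2" by (simp add: power2_eq_square power4_eq_xxxx algebra_simps)
    moreover have "cg p (h ^ 4 - gam\<^sup>2) 0" using cg_sym[OF a] True cg_iff_0 by blast
    ultimately have "cg p (h\<^sup>2 - gam) 0 \<or> cg p (h\<^sup>2 + gam) 0" using gint_no_zero_div[of "h\<^sup>2 - gam" "h\<^sup>2 + gam"] by simp
    hence "cg p (h\<^sup>2) gam \<or> cg p (h\<^sup>2) (- gam)" unfolding cg_iff_0[of p "h\<^sup>2" gam] cg_iff_0[of p "h\<^sup>2" "- gam"] diff_minus_eq_add .
    hence "cg p (gN (h\<^sup>2)) 2" using cg_gN[of p "h\<^sup>2"] by fastforce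
    hence "\<chi> ((gN h)\<^sup>2) = -1" using chi_cong[of "gN (h\<^sup>2)" 2] c2 by (simp add: gN_power)
    thus False using chi_values[of "gN h"] by auto
  next
    case False
    hence "odd c" using c by presburger
    moreover have "\<chi> (gN (gam ^ c)) = \<chi> (gN (h ^ 4))" by (intro chi_cong cg_gN a)
    hence "\<chi> 2 ^ c = \<chi> (gN h) ^ 4" by (simp only: gN_power gam chi_power)
    moreover have "\<chi> (gN h) ^ 4 \<ge> 0" by simp
    ultimately show False using c2 by simp
  qed
qed

lemma gint_fourth_roots: "cg p (u ^ 4) 1 \<Longrightarrow> \<exists>j<(4::nat). cg p u (GI 0 1 ^ j)"
proof -
  assume a: "cg p (u ^ 4) 1"
  have "(u - GI 1 0) * ((u - GI (-1) 0) * ((u - GI 0 1) * (u - GI 0 (-1)))) = u ^ 4 - 1"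
    by (cases u) (simp add: power4_eq_xxxx one_gint_def algebra_simps)
  hence "cg p ((u - GI 1 0) * ((u - GI (-1) 0) * ((u - GI 0 1) * (u - GI 0 (-1))))) 0"
    using a by (simp add: cg_def)
  hence "cg p u (GI 1 0) \<or> cg p u (GI (-1) 0) \<or> cg p u (GI 0 1) \<or> cg p u (GI 0 (-1))"
    using gint_no_zero_div cg_iff_0 by metis
  moreover have "GI 0 1 ^ 0 = GI 1 0" "GI 0 1 ^ 1 = GI 0 1" "GI 0 1 ^ 2 = GI (-1) 0" "GI 0 1 ^ 3 = GI 0 (-1)"
    by (simp_all add: power2_eq_square power3_eq_cube one_gint_def)
  moreover have "(0::nat) < 4" "(1::nat) < 4" "(2::nat) < 4" "(3::nat) < 4" by auto
  ultimately show ?thesis by metis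
qed

text \<open>The count of \<open>power_class_sum\<close> in the field of p^2 elements: it contains
  the fourth roots of unity, and 1 + i represents a generator of the units modulo fourth
  powers.\<close>

lemma KG_classes: "(\<Sum>c<(4::nat). \<Sum>h\<in>U. (KG (gam ^ c * h ^ 4))\<^sup>2) = int 4 * (\<Sum>u\<in>U. (KG u)\<^sup>2)"
proof -
  define \<Phi> where "\<Phi> = (\<lambda>(c, h). AG.red (gam ^ c * h ^ 4))"
  have nd: "\<not> int p dvd gN (gam ^ c * h ^ 4)" if "h \<in> U" for c h
    using U_not_dvd[OF that] gam(2) unfolding gN_mult gN_power by (intro not_dvd_mult not_dvd_pow)
  have aux: False if "c < c'" "c' < (4::nat)" "\<not> int p dvd gN h" "\<not> int p dvd gN h'"
      "cg p (gam ^ c * h ^ 4) (gam ^ c' * h' ^ 4)" for c c' h h'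
  proof -
    define k where "k = gcnj h' * GI (iv (gN h')) 0"
    have k: "cg p (h' * k) 1" unfolding k_def using that(4) by (rule gunit)
    have e: "gam ^ c' = gam ^ c * gam ^ (c' - c)" using that by (simp flip: power_add)
    have "cg p (gam ^ c * h ^ 4) (gam ^ c * (gam ^ (c' - c) * h' ^ 4))"
      using that(5) unfolding e by (simp only: mult.assoc)
    hence "cg p (h ^ 4) (gam ^ (c' - c) * h' ^ 4)"
      using gam(2) by (elim gint_cancel) (simp only: gN_power not_dvd_pow not_False_eq_True)
    hence "cg p (h ^ 4 * k ^ 4) (gam ^ (c' - c) * h' ^ 4 * k ^ 4)" by (intro cg_mult cg_refl)
    hence "cg p ((h * k) ^ 4) (gam ^ (c' - c) * (h' * k) ^ 4)" by (simp only: power_mult_distrib mult.assoc)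
    also have "cg p (gam ^ (c' - c) * (h' * k) ^ 4) (gam ^ (c' - c) * 1 ^ 4)" by (intro cg_mult cg_refl cg_power k)
    finally have "cg p (gam ^ (c' - c)) ((h * k) ^ 4)" by (simp add: cg_sym)
    thus False using gam_not_fourth_power[of "c' - c"] that by auto
  qed
  have "(\<Sum>d\<in>{..<4::nat} \<times> U. (KG (\<Phi> d))\<^sup>2) = int 4 * (\<Sum>u\<in>U. (KG u)\<^sup>2)"
  proof (rule fibre_sum)
    show "finite U" unfolding U_def using AG.fin by simp
    thus "finite ({..<4::nat} \<times> U)" by simp
    show "\<Phi> d \<in> U" if "d \<in> {..<4} \<times> U" for d
      using that red_U[OF nd] by (auto simp: \<Phi>_def)
    show "card ({..<4::nat} \<times> U) = 4 * card U" by (simp add: card_cartesian_product)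
    fix u assume "u \<in> U"
    show "card {d \<in> {..<4::nat} \<times> U. \<Phi> d = u} \<le> 4"
    proof (cases "{d \<in> {..<4::nat} \<times> U. \<Phi> d = u} = {}")
      case False
      then obtain c0 h0 where c0: "c0 < 4" "h0 \<in> U" "\<Phi> (c0, h0) = u" by auto
      define k where "k = gcnj h0 * GI (iv (gN h0)) 0"
      have k: "cg p (h0 * k) 1" unfolding k_def using U_not_dvd[OF c0(2)] by (rule gunit)
      have "{d \<in> {..<4::nat} \<times> U. \<Phi> d = u} \<subseteq> (\<lambda>j. (c0, AG.red (GI 0 1 ^ j * h0))) ` {..<4::nat}"
      proof
        fix d assume "d \<in> {d \<in> {..<4::nat} \<times> U. \<Phi> d = u}"
        then obtain c h where d: "d = (c, h)" "c < 4" "h \<in> U" "\<Phi> (c, h) = \<Phi> (c0, h0)" using c0 by auto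
        hence e: "cg p (gam ^ c * h ^ 4) (gam ^ c0 * h0 ^ 4)" by (simp add: \<Phi>_def AG.red_eq_iff)
        have "c = c0" using aux[of c c0 h h0] aux[of c0 c h0 h] e cg_sym[OF e] U_not_dvd d c0
          by (cases c c0 rule: linorder_cases) auto
        hence e4: "cg p (h ^ 4) (h0 ^ 4)"
          using gint_cancel[of "gam ^ c0"] e gam(2) by (simp only: gN_power not_dvd_pow not_False_eq_True)
        hence "cg p (h ^ 4 * k ^ 4) (h0 ^ 4 * k ^ 4)" by (intro cg_mult cg_refl)
        hence "cg p ((h * k) ^ 4) ((h0 * k) ^ 4)" by (simp only: power_mult_distrib)
        hence "cg p ((h * k) ^ 4) (1 ^ 4)" using cg_trans[OF _ cg_power[OF k]] by blast
        then obtain j where j: "j < 4" "cg p (h * k) (GI 0 1 ^ j)" using gint_fourth_roots[of "h * k"] by auto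
        have "cg p (h * (h0 * k)) (h * 1)" by (intro cg_mult cg_refl k)
        hence "cg p h (h * k * h0)" by (simp add: mult_ac cg_sym)
        also have "cg p (h * k * h0) (GI 0 1 ^ j * h0)" by (intro cg_mult cg_refl j)
        finally have "AG.red (GI 0 1 ^ j * h0) = h" using d(3) by (intro AG.red_eqI) (auto simp: U_def intro: cg_sym)
        thus "d \<in> (\<lambda>j. (c0, AG.red (GI 0 1 ^ j * h0))) ` {..<4::nat}" using d \<open>c = c0\<close> j by auto
      qed
      hence "card {d \<in> {..<4::nat} \<times> U. \<Phi> d = u} \<le> card {..<4::nat}" by (rule surj_card_le[rotated]) simp
      thus ?thesis by simp
    qed (metis card.empty le0)
  qed
  also have "(\<Sum>d\<in>{..<4::nat} \<times> U. (KG (\<Phi> d))\<^sup>2) = (\<Sum>c<(4::nat). \<Sum>h\<in>U. (KG (gam ^ c * h ^ 4))\<^sup>2)"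
    unfolding sum.cartesian_product \<Phi>_def using KG_cong[OF AG.red(3)] by (simp add: case_prod_unfold)
  finally show ?thesis .
qed

text \<open>Conjugation sends (1 + i)^2 = 2i to its negative, so that class has value 0 because
  \<chi>(-1) = -1. As (1 + i)^3 is -2 times the conjugate of 1 + i and \<chi>(-2) = 1, the odd
  classes agree.\<close>

lemma kap_norm: "(kap 1)\<^sup>2 + 2 * (kap gam)\<^sup>2 = 16 * int p"
proof -
  have "(\<Sum>c<(4::nat). \<Sum>h\<in>U. (KG (gam ^ c * h ^ 4))\<^sup>2) = (\<Sum>c<(4::nat). \<Sum>h\<in>U. (KG (gam ^ c))\<^sup>2)"
    using U_not_dvd by (intro sum.cong refl) (simp add: KG_scale power_mult_distrib chi_sq')
  also have "\<dots> = ((int p)\<^sup>2 - 1) * ((KG 1)\<^sup>2 + (KG gam)\<^sup>2 + (KG (gam\<^sup>2))\<^sup>2 + (KG (gam ^ 3))\<^sup>2)"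
    by (simp add: card_U eval_nat_numeral(2-) distrib_left)
  also have "KG (gam\<^sup>2) = 0"
  proof -
    have "KG (gcnj (gam\<^sup>2)) = KG (GI (-1) 0 * gam\<^sup>2)" by (simp add: gam)
    thus ?thesis using KG_cnj[of "gam\<^sup>2"] KG_real[of "-1" "gam\<^sup>2"] m1 by simp
  qed
  also have "KG (gam ^ 3) = KG gam"
  proof -
    have "gam ^ 3 = GI (-2) 0 * gcnj gam" by (simp add: gam)
    moreover have "\<chi> (-2) = 1" using chi_uminus[of 2] m1 c2 by simp
    ultimately show ?thesis using KG_real[of "-2" "gcnj gam"] KG_cnj[of gam] by simp
  qed
  finally have "((int p)\<^sup>2 - 1) * ((KG 1)\<^sup>2 + 2 * (KG gam)\<^sup>2) = ((int p)\<^sup>2 - 1) * (16 * int p * (int p - 1)\<^sup>2)"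
    using KG_classes KG_moment by (simp add: algebra_simps)
  moreover have "(int p)\<^sup>2 - 1 \<noteq> 0" using p_gt_3 by (simp add: power2_eq_1_iff)
  ultimately have "(KG 1)\<^sup>2 + 2 * (KG gam)\<^sup>2 = 16 * int p * (int p - 1)\<^sup>2" by simp
  hence "(int p - 1)\<^sup>2 * ((kap 1)\<^sup>2 + 2 * (kap gam)\<^sup>2) = (int p - 1)\<^sup>2 * (16 * int p)"
    unfolding KG_kap power_mult_distrib by (simp add: algebra_simps)
  thus ?thesis using p_gt_3 by simp
qed

text \<open>The real part of (t + i)^4.\<close>

definition q4 :: "int \<Rightarrow> int" where "q4 t = t ^ 4 - 6 * t\<^sup>2 + 1"

lemma q4_cong: "cg p x y \<Longrightarrow> cg p (q4 x) (q4 y)"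
  unfolding q4_def by (intro cg_intros)

lemma kap_1: "kap 1 = (\<Sum>t\<in>R. \<chi> (t\<^sup>2 + 1) * \<chi> (q4 t)) + 1"
  unfolding kap_def gint_power4 by (simp add: one_gint_def q4_def)

lemma norm_1_not_dvd: "\<not> int p dvd t\<^sup>2 + 1"
  using sum_sq_dvd[of t 1] not_dvd_1 by simp

lemma q4_not_dvd: "\<not> int p dvd q4 t"
proof
  assume "int p dvd q4 t"
  moreover have "q4 t = (t\<^sup>2 - 3)\<^sup>2 - 2\<^sup>2 * 2" by (simp add: q4_def power2_eq_square power4_eq_xxxx algebra_simps)
  ultimately have "cg p ((t\<^sup>2 - 3)\<^sup>2) (2\<^sup>2 * 2)" by (simp add: cg_def)
  hence "\<chi> (t\<^sup>2 - 3) ^ 2 = \<chi> 2 ^ 2 * \<chi> 2" using chi_cong by (metis chi_mult chi_power)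
  hence "\<chi> (t\<^sup>2 - 3) ^ 2 = -1" using c2 by simp
  thus False using zero_le_power2[of "\<chi> (t\<^sup>2 - 3)"] by linarith
qed

text \<open>The comparison of \<open>K4_1_Br\<close> on the norm-one circle: r + 2, 2 - r and r^2 -
  2 are 4 t^2, 4 and 2 \<open>q4\<close> t up to powers of t^2 + 1. The exceptional terms t = 0 and
  t = infinity on one side match r = -2 and r = 2 on the other.\<close>

lemma kap_1_Br: "\<chi> 2 * kap 1 = 2 * Br"
proof -
  define G where "G = (\<lambda>r. \<chi> (r + 2) * \<chi> (r\<^sup>2 - 2))"
  have G: "cg p x y \<Longrightarrow> G x = G y" for x y unfolding G_def by (intro arg_cong2[where f = "(*)"] chi_cong cg_intros)
  \<comment> \<open>This is y + 1/y for y = (t + i) / (t - i).\<close>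
  define r where "r = (\<lambda>t. 2 * (t\<^sup>2 - 1) * iv (t\<^sup>2 + 1))"
  have r: "cg p (r t * (t\<^sup>2 + 1)) (2 * (t\<^sup>2 - 1))" for t
  proof -
    have "cg p (2 * (t\<^sup>2 - 1) * (iv (t\<^sup>2 + 1) * (t\<^sup>2 + 1))) (2 * (t\<^sup>2 - 1) * 1)" by (intro cg_mult cg_refl iv' norm_1_not_dvd)
    thus ?thesis by (simp add: r_def mult_ac)
  qed
  have Gr: "G (r t) = \<chi> 2 * (\<chi> (t\<^sup>2 + 1) * \<chi> (q4 t)) - of_bool (cg p 0 t) * (\<chi> 2 * (\<chi> (t\<^sup>2 + 1) * \<chi> (q4 t)))" for t
  proof -
    define n where "n = t\<^sup>2 + 1"
    have n0: "\<not> int p dvd n" unfolding n_def by (rule norm_1_not_dvd)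
    have rn: "cg p (r t * n) (2 * (t\<^sup>2 - 1))" unfolding n_def by (rule r)
    have "cg p (n * (r t * n + 2 * n)) (n * (2 * (t\<^sup>2 - 1) + 2 * n))" by (intro cg_intros rn)
    also have "n * (2 * (t\<^sup>2 - 1) + 2 * n) = (2 * t)\<^sup>2 * n" by (simp add: n_def power2_eq_square algebra_simps)
    finally have 1: "\<chi> (n * (r t * n + 2 * n)) = \<chi> (2 * t) ^ 2 * \<chi> n" using chi_cong by (metis chi_mult chi_power)
    have "cg p ((r t * n)\<^sup>2 - 2 * n\<^sup>2) ((2 * (t\<^sup>2 - 1))\<^sup>2 - 2 * n\<^sup>2)" by (intro cg_intros rn)
    also have "(2 * (t\<^sup>2 - 1))\<^sup>2 - 2 * n\<^sup>2 = 2 * q4 t" by (simp add: n_def q4_def power2_eq_square power4_eq_xxxx algebra_simps)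
    finally have 2: "\<chi> ((r t * n)\<^sup>2 - 2 * n\<^sup>2) = \<chi> 2 * \<chi> (q4 t)" using chi_cong by (metis chi_mult)
    have e: "n * (r t * n + 2 * n) = n\<^sup>2 * (r t + 2)" "(r t * n)\<^sup>2 - 2 * n\<^sup>2 = n\<^sup>2 * ((r t)\<^sup>2 - 2)"
      by (simp_all add: power2_eq_square algebra_simps)
    have X: "\<chi> (r t + 2) = (\<chi> 2 * \<chi> t) ^ 2 * \<chi> n" using 1 chi_sq'[OF n0] unfolding e chi_mult chi_power by simp
    have Y: "\<chi> ((r t)\<^sup>2 - 2) = \<chi> 2 * \<chi> (q4 t)" using 2 chi_sq'[OF n0] unfolding e chi_mult chi_power by simp
    have "G (r t) = (\<chi> 2 * \<chi> 2) * (\<chi> t * \<chi> t) * (\<chi> 2 * (\<chi> n * \<chi> (q4 t)))"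
      unfolding G_def X Y by (simp add: power2_eq_square)
    also have "\<chi> t * \<chi> t = 1 - of_bool (cg p 0 t)"
      using chi_sq[of t] chi_0_iff[of t] by (cases "int p dvd t") (auto simp: cg_def)
    finally show ?thesis using chi_sq[OF not_dvd_2] by (simp add: n_def algebra_simps)
  qed
  have "(\<Sum>t\<in>R. G (r t)) = \<chi> 2 * (\<Sum>t\<in>R. \<chi> (t\<^sup>2 + 1) * \<chi> (q4 t))
      - (\<Sum>t\<in>R. of_bool (cg p 0 t) * (\<chi> 2 * (\<chi> (t\<^sup>2 + 1) * \<chi> (q4 t))))"
    unfolding Gr sum_subtractf sum_distrib_left ..
  also have "(\<Sum>t\<in>R. of_bool (cg p 0 t) * (\<chi> 2 * (\<chi> (t\<^sup>2 + 1) * \<chi> (q4 t)))) = \<chi> 2 * (\<chi> (0\<^sup>2 + 1) * \<chi> (q4 0))"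
    by (rule sum_of_bool_unique) (rule refl, intro arg_cong2[where f = "(*)"] refl chi_cong q4_cong cg_intros)
  finally have lhs: "(\<Sum>t\<in>R. G (r t)) = \<chi> 2 * (kap 1 - 2)" by (simp add: kap_1 q4_def algebra_simps)
  have "(\<Sum>t\<in>R. G (r t)) = (\<Sum>t\<in>R. \<Sum>x\<in>R. of_bool (cg p (r t) x) * G x)"
    by (intro sum.cong refl sum_of_bool_unique[symmetric] G) auto
  also have "\<dots> = (\<Sum>x\<in>R. (\<Sum>t\<in>R. of_bool (cg p (r t) x)) * G x)"
    unfolding sum_distrib_right by (rule sum.swap)
  also have "\<dots> = (\<Sum>x\<in>R. (G x + (\<chi> (2 - x) * \<chi> (x\<^sup>2 - 2)) - of_bool (cg p (-2) x) * (\<chi> (2 - x) * \<chi> (x\<^sup>2 - 2))) - of_bool (cg p 2 x) * G x)"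
  proof (intro sum.cong refl)
    fix x
    have cnt: "(\<Sum>t\<in>R. of_bool (cg p (r t) x)) = (\<Sum>t\<in>R. (of_bool (cg p (((2 - x) * t)\<^sup>2) ((2 - x) * (2 + x)) \<and> \<not> cg p 2 x) :: int))"
    proof (intro sum.cong refl arg_cong[where f = of_bool])
      fix t
      have "cg p (r t) x \<longleftrightarrow> cg p (r t * (t\<^sup>2 + 1)) (x * (t\<^sup>2 + 1))"
        using norm_1_not_dvd[of t] cg_cancel_right cg_mult[OF _ cg_refl] by blast
      also have "\<dots> \<longleftrightarrow> cg p (2 * (t\<^sup>2 - 1)) (x * (t\<^sup>2 + 1))" by (rule cg_left_cong[OF r])
      also have "\<dots> \<longleftrightarrow> int p dvd (2 - x) * t\<^sup>2 - (2 + x)" by (simp add: cg_def algebra_simps)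
      also have "\<dots> \<longleftrightarrow> cg p (((2 - x) * t)\<^sup>2) ((2 - x) * (2 + x)) \<and> \<not> cg p 2 x"
      proof (cases "cg p 2 x")
        case True
        hence d: "int p dvd 2 - x" by (simp add: cg_def)
        have "\<not> int p dvd (2 - x) * t\<^sup>2 - (2 + x)"
        proof
          assume "int p dvd (2 - x) * t\<^sup>2 - (2 + x)"
          hence "int p dvd (2 - x) * t\<^sup>2 - ((2 - x) * t\<^sup>2 - (2 + x)) + (2 - x)"
            by (rule dvd_add[OF dvd_diff[OF dvd_mult2[OF d]] d])
          thus False using not_dvd_4 by simp
        qed
        thus ?thesis using True by simp
      next
        case False
        have "((2 - x) * t)\<^sup>2 - (2 - x) * (2 + x) = (2 - x) * ((2 - x) * t\<^sup>2 - (2 + x))"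
          by (simp add: power2_eq_square algebra_simps)
        thus ?thesis using False by (simp add: cg_def dvd_mult_iff)
      qed
      finally show "cg p (r t) x \<longleftrightarrow> cg p (((2 - x) * t)\<^sup>2) ((2 - x) * (2 + x)) \<and> \<not> cg p 2 x" .
    qed
    show "(\<Sum>t\<in>R. of_bool (cg p (r t) x)) * G x = (G x + (\<chi> (2 - x) * \<chi> (x\<^sup>2 - 2)) - of_bool (cg p (-2) x) * (\<chi> (2 - x) * \<chi> (x\<^sup>2 - 2))) - of_bool (cg p 2 x) * G x"
    proof (cases "cg p 2 x")
      case True
      have "\<chi> (2 - x) = 0" using True chi_0_iff by (simp add: cg_def)
      thus ?thesis unfolding cnt using True by simp
    next
      case False
      hence nd: "\<not> int p dvd 2 - x" by (simp add: cg_def)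
      have "(\<Sum>t\<in>R. (of_bool (cg p (((2 - x) * t)\<^sup>2) ((2 - x) * (2 + x)) \<and> \<not> cg p 2 x) :: int))
        = (\<Sum>t\<in>R. of_bool (cg p (((2 - x) * t)\<^sup>2) ((2 - x) * (2 + x))))" using False by simp
      also have "\<dots> = (\<Sum>t\<in>R. of_bool (cg p (t\<^sup>2) ((2 - x) * (2 + x))))"
        by (rule unit_reindex[OF _ nd]) (intro of_bool_cg cg_intros)
      also have "\<dots> = 1 + \<chi> (2 - x) * \<chi> (2 + x)" by (simp add: count_sqrt)
      also have "\<dots> * G x = G x + (\<chi> (x + 2) * \<chi> (x + 2)) * (\<chi> (2 - x) * \<chi> (x\<^sup>2 - 2))"
        by (simp add: G_def algebra_simps)
      also have "\<chi> (x + 2) * \<chi> (x + 2) = 1 - of_bool (cg p (-2) x)"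
      proof (cases "int p dvd x + 2")
        case True
        hence "cg p (-2) x" using cg_sym[of p x "-2"] by (simp add: cg_def)
        thus ?thesis using True chi_0_iff by simp
      next
        case False
        hence "\<not> cg p (-2) x" using cg_sym[of p "-2" x] by (auto simp: cg_def)
        thus ?thesis using chi_sq[OF False] by simp
      qed
      finally show ?thesis unfolding cnt using False by (simp add: algebra_simps)
    qed
  qed
  also have "\<dots> = (Br + (\<Sum>x\<in>R. \<chi> (2 - x) * \<chi> (x\<^sup>2 - 2))
      - (\<Sum>x\<in>R. of_bool (cg p (-2) x) * (\<chi> (2 - x) * \<chi> (x\<^sup>2 - 2)))) - (\<Sum>x\<in>R. of_bool (cg p 2 x) * G x)"
    unfolding sum_subtractf sum.distrib Br_def G_def ..
  also have "(\<Sum>x\<in>R. of_bool (cg p (-2) x) * (\<chi> (2 - x) * \<chi> (x\<^sup>2 - 2))) = \<chi> (2 - (-2)) * \<chi> ((-2)\<^sup>2 - 2)"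
    by (rule sum_of_bool_unique) (rule refl, intro arg_cong2[where f = "(*)"] chi_cong cg_intros)
  also have "(\<Sum>x\<in>R. of_bool (cg p 2 x) * G x) = G 2" by (rule sum_of_bool_unique[OF refl G])
  also have "(\<Sum>x\<in>R. \<chi> (2 - x) * \<chi> (x\<^sup>2 - 2)) = (\<Sum>x\<in>R. \<chi> (2 - (-1) * x) * \<chi> (((-1) * x)\<^sup>2 - 2))"
    using not_dvd_1 by (intro unit_reindex[symmetric] arg_cong2[where f = "(*)"] chi_cong cg_intros) auto
  also have "\<dots> = Br" by (simp add: Br_def add.commute)
  also have "\<chi> (2 - (-2)) * \<chi> ((-2)\<^sup>2 - 2) = \<chi> 2" using chi_mult[of 2 2] chi_sq[OF not_dvd_2] by simp
  also have "G 2 = \<chi> 2" using chi_mult[of 2 2] chi_sq[OF not_dvd_2] by (simp add: G_def)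
  finally have "(\<Sum>t\<in>R. G (r t)) = 2 * Br - 2 * \<chi> 2" by simp
  thus ?thesis using lhs by (simp add: algebra_simps)
qed

text \<open>For y = (1 + x)/(1 - x), the tangent addition by an eighth of a turn, y + i = (1 - i)(x
  + i)/(1 - x). The norm of 1 - i is 2 and its fourth power is -4.\<close>

lemma q4_rotate: 
  assumes "cg p (y * (1 - x)) (1 + x)"
  shows "cg p ((1 - x)\<^sup>2 * (y\<^sup>2 + 1)) (2 * (x\<^sup>2 + 1))" "cg p ((1 - x) ^ 4 * q4 y) (- (2\<^sup>2 * q4 x))"
proof -
  have "(1 - x)\<^sup>2 * (y\<^sup>2 + 1) = (y * (1 - x))\<^sup>2 + (1 - x)\<^sup>2" by (simp add: power2_eq_square algebra_simps)
  also have "cg p \<dots> ((1 + x)\<^sup>2 + (1 - x)\<^sup>2)" by (intro cg_intros assms)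
  also have "(1 + x)\<^sup>2 + (1 - x)\<^sup>2 = 2 * (x\<^sup>2 + 1)" by (simp add: power2_eq_square algebra_simps)
  finally show "cg p ((1 - x)\<^sup>2 * (y\<^sup>2 + 1)) (2 * (x\<^sup>2 + 1))" .
  have "(1 - x) ^ 4 * q4 y = (y * (1 - x)) ^ 4 - 6 * (y * (1 - x))\<^sup>2 * (1 - x)\<^sup>2 + (1 - x) ^ 4"
    by (simp add: q4_def power2_eq_square power4_eq_xxxx algebra_simps)
  also have "cg p \<dots> ((1 + x) ^ 4 - 6 * (1 + x)\<^sup>2 * (1 - x)\<^sup>2 + (1 - x) ^ 4)" by (intro cg_intros assms)
  also have "(1 + x) ^ 4 - 6 * (1 + x)\<^sup>2 * (1 - x)\<^sup>2 + (1 - x) ^ 4 = - (2\<^sup>2 * q4 x)"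
    by (simp add: q4_def power2_eq_square power4_eq_xxxx algebra_simps)
  finally show "cg p ((1 - x) ^ 4 * q4 y) (- (2\<^sup>2 * q4 x))" .
qed

lemma chi_q4_rotate:
  assumes "cg p (y * (1 - x)) (1 + x)" "\<not> int p dvd 1 - x"
  shows "\<chi> (y\<^sup>2 + 1) = - \<chi> (x\<^sup>2 + 1)" "\<chi> (q4 y) = - \<chi> (q4 x)"
proof -
  have "\<chi> (1 - x) ^ 2 * \<chi> (y\<^sup>2 + 1) = \<chi> 2 * \<chi> (x\<^sup>2 + 1)"
    using chi_cong[OF q4_rotate(1)[OF assms(1)]] unfolding chi_mult chi_power .
  thus "\<chi> (y\<^sup>2 + 1) = - \<chi> (x\<^sup>2 + 1)" using chi_sq'[OF assms(2)] c2 by simp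
  have "\<chi> (1 - x) ^ 4 * \<chi> (q4 y) = \<chi> (-1) * (\<chi> 2 ^ 2 * \<chi> (q4 x))"
    using chi_cong[OF q4_rotate(2)[OF assms(1)]] unfolding chi_uminus[of "2\<^sup>2 * q4 x"] chi_mult chi_power .
  thus "\<chi> (q4 y) = - \<chi> (q4 x)" using even_power_chi[OF assms(2), of 4] m1 c2 by simp
qed

text \<open>The parameters whose term in \<open>kap 1\<close> is -1, separated by the character of
  t^2 + 1.\<close>

definition Yset where "Yset e = {t\<in>R. \<chi> (t\<^sup>2 + 1) = e \<and> \<chi> (q4 t) = - e}"

text \<open>At 0, 1 and -1 the two characters agree: they are 1 and 1, or \<chi>(2) = -1 and
  \<chi>(-4) = -1.\<close>

lemma Yset_not_special:
  assumes e: "e = 1 \<or> e = -1" and x: "x \<in> Yset e"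
  shows "\<not> int p dvd x" "\<not> int p dvd 1 - x" "\<not> int p dvd 1 + x"
proof -
  have nx: False if "cg p x y" "\<chi> (y\<^sup>2 + 1) * \<chi> (q4 y) = 1" for y
  proof -
    have "\<chi> (x\<^sup>2 + 1) = \<chi> (y\<^sup>2 + 1)" "\<chi> (q4 x) = \<chi> (q4 y)"
      using that by (auto intro!: chi_cong cg_intros q4_cong)
    hence "e * (- e) = 1" using x that(2) by (simp add: Yset_def)
    thus False using e by auto
  qed
  show "\<not> int p dvd x" using nx[of 0] by (auto simp: q4_def cg_0_int)
  have m4: "\<chi> (-4) = -1" using chi_uminus[of 4] chi_mult[of 2 2] m1 c2 by simp
  show "\<not> int p dvd 1 - x" using nx[of 1] cg_sym[of p 1 x] m4 c2 by (auto simp: q4_def cg_def)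
  show "\<not> int p dvd 1 + x" using nx[of "-1"] m4 c2 by (auto simp: q4_def cg_def add.commute)
qed

text \<open>The rotation negates both characters, since 2 and -4 are nonresidues; it therefore
  exchanges the two sets.\<close>

lemma card_Yset: "card (Yset 1) = card (Yset (-1))"
proof -
  define f where "f = (\<lambda>x. RS.red ((1 + x) * iv (1 - x)))"
  define g where "g = (\<lambda>x. RS.red ((x - 1) * iv (1 + x)))"
  have fin: "finite (Yset e)" for e unfolding Yset_def by (rule fin_R)
  have f: "cg p (f x * (1 - x)) (1 + x)" if "\<not> int p dvd 1 - x" for x
  proof -
    have "cg p (f x * (1 - x)) ((1 + x) * iv (1 - x) * (1 - x))" unfolding f_def by (intro cg_mult cg_refl RS.red)
    also have "(1 + x) * iv (1 - x) * (1 - x) = (1 + x) * (iv (1 - x) * (1 - x))" by simp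
    also have "cg p \<dots> ((1 + x) * 1)" by (intro cg_mult cg_refl iv' that)
    finally show ?thesis by simp
  qed
  have g: "cg p (g x * (1 + x)) (x - 1)" if "\<not> int p dvd 1 + x" for x
  proof -
    have "cg p (g x * (1 + x)) ((x - 1) * iv (1 + x) * (1 + x))" unfolding g_def by (intro cg_mult cg_refl RS.red)
    also have "(x - 1) * iv (1 + x) * (1 + x) = (x - 1) * (iv (1 + x) * (1 + x))" by simp
    also have "cg p \<dots> ((x - 1) * 1)" by (intro cg_mult cg_refl iv' that)
    finally show ?thesis by simp
  qed
  have fY: "f x \<in> Yset (- e)" if e: "e = 1 \<or> e = -1" and x: "x \<in> Yset e" for x e
  proof -
    note nd = Yset_not_special[OF e x]
    have "\<chi> ((f x)\<^sup>2 + 1) = - e" "\<chi> (q4 (f x)) = e"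
      using chi_q4_rotate[OF f[OF nd(2)] nd(2)] x by (simp_all add: Yset_def)
    moreover have "f x \<in> R" unfolding f_def by (rule RS.red)
    ultimately show ?thesis unfolding Yset_def by simp
  qed
  have inj: "inj_on f (Yset e)" if e: "e = 1 \<or> e = -1" for e
  proof (rule inj_onI)
    fix x y assume x: "x \<in> Yset e" and y: "y \<in> Yset e" and eq: "f x = f y"
    note nx = Yset_not_special[OF e x] and ny = Yset_not_special[OF e y]
    have "cg p (f x * (1 - x) * (1 - y)) ((1 + x) * (1 - y))" by (intro cg_mult cg_refl f nx)
    moreover have "cg p (f x * (1 - y) * (1 - x)) ((1 + y) * (1 - x))" unfolding eq by (intro cg_mult cg_refl f ny)
    moreover have "f x * (1 - x) * (1 - y) = f x * (1 - y) * (1 - x)" by simp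
    ultimately have "cg p ((1 + x) * (1 - y)) ((1 + y) * (1 - x))" by (metis cg_sym cg_trans)
    hence "int p dvd 2 * (x - y)" by (simp add: cg_def algebra_simps)
    hence "int p dvd x - y" using not_dvd_2 dvd_mult_iff[of 2 "x - y"] by blast
    hence "cg p x y" by (simp add: cg_def)
    thus "x = y" using x y RS.uniq unfolding Yset_def by blast
  qed
  have "card (Yset 1) \<le> card (Yset (-1))" using fY[of 1] inj[of 1] fin by (intro card_inj_on_le[of f]) auto
  moreover have "card (Yset (-1)) \<le> card (Yset 1)" using fY[of "-1"] inj[of "-1"] fin by (intro card_inj_on_le[of f]) auto
  ultimately show ?thesis by simp
qed

text \<open>Both t -> -t and t -> 1/t preserve the two characters. Orbits shorter than 4 would need
  t^2 = 1, excluded by \<open>Yset_not_special\<close>, or t^2 = -1, impossible as -1 is a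
  nonresidue.\<close>

lemma four_dvd_Yset: "4 dvd card (Yset 1)"
proof -
  have "2 * 2 dvd card (Yset 1)"
  proof (rule dihedral_orbit_dvd[OF prim_root_minus_1])
    show "Yset 1 \<subseteq> Rs" using Yset_not_special(1)[of 1] Rs_iff unfolding Yset_def by blast
    fix x y assume x: "x \<in> Yset 1" and y: "y \<in> R"
    note nd = Yset_not_special[of 1, OF _ x, simplified]
    {
      assume "cg p y (-1 * x)"
      hence y': "cg p y (- x)" by simp
      have "\<chi> (y\<^sup>2 + 1) = \<chi> ((- x)\<^sup>2 + 1)" "\<chi> (q4 y) = \<chi> (q4 (- x))"
        using chi_cong[OF cg_add[OF cg_power[OF y'] cg_refl]] chi_cong[OF q4_cong[OF y']] by blast+
      thus "y \<in> Yset 1" using x y unfolding Yset_def by (simp add: q4_def)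
    }
    {
      assume y': "cg p y (iv x)"
      have xy: "cg p (x * y) 1" using cg_trans[OF cg_mult[OF cg_refl y'] iv[OF nd(1)]] .
      have "x\<^sup>2 * (y\<^sup>2 + 1) = (x * y)\<^sup>2 + x\<^sup>2" by (simp add: power_mult_distrib algebra_simps)
      also have "cg p \<dots> (1\<^sup>2 + x\<^sup>2)" by (intro cg_intros xy)
      finally have "cg p (x\<^sup>2 * (y\<^sup>2 + 1)) (x\<^sup>2 + 1)" by (simp add: add.commute)
      hence 1: "\<chi> (y\<^sup>2 + 1) = \<chi> (x\<^sup>2 + 1)" using chi_cong[of "x\<^sup>2 * (y\<^sup>2 + 1)"] chi_sq'[OF nd(1)] by simp
      have "x ^ 4 * q4 y = (x * y) ^ 4 - 6 * (x * y)\<^sup>2 * x\<^sup>2 + x ^ 4"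
        by (simp add: q4_def power2_eq_square power4_eq_xxxx algebra_simps)
      also have "cg p \<dots> (1 ^ 4 - 6 * 1\<^sup>2 * x\<^sup>2 + x ^ 4)" by (intro cg_intros xy)
      also have "1 ^ 4 - 6 * 1\<^sup>2 * x\<^sup>2 + x ^ 4 = q4 x" by (simp add: q4_def)
      finally have "cg p (x ^ 4 * q4 y) (q4 x)" .
      hence 2: "\<chi> (q4 y) = \<chi> (q4 x)" using chi_cong[of "x ^ 4 * q4 y"] even_power_chi[OF nd(1), of 4] by simp
      show "y \<in> Yset 1" using 1 2 x y unfolding Yset_def by simp
    }
  next
    fix x j assume x: "x \<in> Yset 1"
    note nd = Yset_not_special[of 1, OF _ x, simplified]
    show "\<not> cg p (x\<^sup>2) ((-1) ^ j)"
    proof (cases "even j")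
      case True
      have "x\<^sup>2 - 1 = - ((1 - x) * (1 + x))" by (simp add: power2_eq_square algebra_simps)
      hence "\<not> int p dvd x\<^sup>2 - 1" using nd by (simp add: dvd_mult_iff)
      thus ?thesis using True by (simp add: cg_def)
    next
      case False
      thus ?thesis using norm_1_not_dvd[of x] by (simp add: cg_def)
    qed
  qed
  thus ?thesis by simp
qed

text \<open>The two sets have equal size divisible by 4, so the number of terms -1 is a multiple of
  8, and each of them lowers the sum by 2.\<close>

lemma kap_1_mod: "\<exists>m. kap 1 = int p + 1 - 16 * m"
proof -
  have fin: "finite (Yset e)" for e unfolding Yset_def by (rule fin_R)
  have "(\<Sum>t\<in>R. \<chi> (t\<^sup>2 + 1) * \<chi> (q4 t)) = (\<Sum>t\<in>R. 1 - 2 * of_bool (t \<in> Yset 1 \<union> Yset (-1)))"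
  proof (rule sum.cong)
    fix t assume t: "t \<in> R"
    have "\<chi> (t\<^sup>2 + 1) = 1 \<or> \<chi> (t\<^sup>2 + 1) = -1" "\<chi> (q4 t) = 1 \<or> \<chi> (q4 t) = -1"
      using chi_values[of "t\<^sup>2 + 1"] chi_0_iff[of "t\<^sup>2 + 1"] norm_1_not_dvd[of t]
        chi_values[of "q4 t"] chi_0_iff[of "q4 t"] q4_not_dvd[of t] by auto
    thus "\<chi> (t\<^sup>2 + 1) * \<chi> (q4 t) = 1 - 2 * of_bool (t \<in> Yset 1 \<union> Yset (-1))"
      using t unfolding Yset_def by auto
  qed simp
  also have "\<dots> = int p - 2 * int (card (Yset 1 \<union> Yset (-1)))"
  proof -
    have "R \<inter> (Yset 1 \<union> Yset (-1)) = Yset 1 \<union> Yset (-1)" unfolding Yset_def by blast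
    hence "(\<Sum>t\<in>R. of_bool (t \<in> Yset 1 \<union> Yset (-1))) = int (card (Yset 1 \<union> Yset (-1)))"
      using sum_of_bool_eq[of R "\<lambda>t. t \<in> Yset 1 \<union> Yset (-1)", where ?'a = int]
      by (simp only: Collect_mem_eq finite_atLeastLessThan_int simp_thms)
    thus ?thesis by (simp only: sum_subtractf sum_distrib_left[symmetric]) simp
  qed
  also have "card (Yset 1 \<union> Yset (-1)) = 2 * card (Yset 1)"
  proof -
    have "Yset 1 \<inter> Yset (-1) = {}" unfolding Yset_def by auto
    thus ?thesis using card_Un_disjoint[OF fin fin] card_Yset by simp
  qed
  finally have "kap 1 = int p + 1 - 4 * int (card (Yset 1))" by (simp add: kap_1)
  moreover obtain m where "card (Yset 1) = 4 * m" using four_dvd_Yset by blast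
  ultimately have "kap 1 = int p + 1 - 16 * int m" by simp
  thus ?thesis by blast
qed

lemma S_D8_3:
  assumes uv: "int p = u\<^sup>2 + 2 * v\<^sup>2" and u: "4 dvd u - 1"
  shows "- S 4 2 = - ((-1) ^ (p div 8) * 2 * u)"
proof -
  obtain m where m: "kap 1 = int p + 1 - 16 * m" using kap_1_mod by blast
  define k where "k = int (p div 8)"
  have k: "int p = 8 * k + 3" using p8 unfolding k_def by presburger
  define a where "a = 2 * k + 1 - 4 * m"
  have a: "kap 1 = 4 * a" using m k by (simp add: a_def)
  have e: "(kap gam)\<^sup>2 = 8 * (int p - a\<^sup>2)" using kap_norm a by (simp add: power_mult_distrib)
  hence "even ((kap gam)\<^sup>2)" by simp
  hence "even (kap gam)" by simp
  then obtain b1 where b1: "kap gam = 2 * b1" by blast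
  hence b2: "b1\<^sup>2 = 2 * (int p - a\<^sup>2)" using e by (simp add: power_mult_distrib)
  hence "even (b1\<^sup>2)" by simp
  hence "even b1" by simp
  then obtain b where "b1 = 2 * b" by blast
  hence "int p = a\<^sup>2 + 2 * b\<^sup>2" using b2 by (simp add: power_mult_distrib)
  hence au: "a = u \<or> a = - u" using norm_form_unique[OF prime_p _ uv, of a b] by simp
  have "S 4 2 = 2 * a" using S_4_2 kap_1_Br a c2 by simp
  moreover have "a = (-1) ^ (p div 8) * u"
  proof (cases "even (p div 8)")
    case True
    hence "even k" by (simp add: k_def)
    hence "a = u" using au u unfolding a_def by presburger
    thus ?thesis using True by simp
  next
    case False
    hence "odd k" by (simp add: k_def)
    hence "a = - u" using au u unfolding a_def by presburger
    thus ?thesis using False by simp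
  qed
  ultimately show ?thesis by simp
qed

end

subsection \<open>Evaluation of integer polynomials in a commutative ring\<close>

definition evp :: "int poly \<Rightarrow> 'a::comm_ring_1 \<Rightarrow> 'a" where
  "evp F r = poly (map_poly of_int F) r"

lemma evp_0 [simp]: "evp 0 r = 0"
  by (simp add: evp_def)

lemma evp_pCons [simp]: "evp (pCons a F) r = of_int a + r * evp F r"
  by (simp add: evp_def map_poly_pCons)

lemma evp_add: "evp (F + G) r = evp F r + evp G r"
  by (induction F G rule: poly_induct2) (auto simp: algebra_simps)

lemma evp_smult: "evp (smult a F) r = of_int a * evp F r"
  by (induction F) (auto simp: algebra_simps)

lemma evp_mult: "evp (F * G) r = evp F r * evp G r"
  by (induction F) (auto simp: evp_add evp_smult algebra_simps)

lemma evp_1 [simp]: "evp 1 r = 1"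
  by (simp add: one_pCons)

lemma evp_power: "evp (F ^ k) r = evp F r ^ k"
  by (induction k) (auto simp: evp_mult)

lemma evp_sum: "evp (sum f I) r = (\<Sum>i\<in>I. evp (f i) r)"
  by (induction I rule: infinite_finite_induct) (auto simp: evp_add)

lemma evp_of_nat: "evp (of_nat n) r = of_nat n"
  by (induction n) (auto simp: evp_add)

lemma evp_htr: "evp (htr n A B) r = htr n (evp A r) (evp B r)"
  unfolding htr_def evp_sum by (simp add: evp_mult evp_power evp_of_nat del: of_nat_mult)

lemma evp_int: "evp F (x::int) = poly F x"
  by (induction F) auto

lemma cg_evp_0: "(\<And>i. int p dvd coeff F i) \<Longrightarrow> cg p (evp F r) 0"
proof (induction F)
  case (pCons a F)
  have "int p dvd coeff F i" for i using pCons.prems[of "Suc i"] by simp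
  hence F: "cg p (evp F r) 0" by (rule pCons.IH)
  have "cg p a 0" using pCons.prems[of 0] by (simp add: cg_def)
  hence "cg p (of_int a + r * evp F r) (of_int 0 + r * 0)" using F by (intro cg_add cg_mult cg_refl cg_of_int)
  thus ?case by simp
qed simp

lemma htr_homogeneous: "htr n (l * a) (l\<^sup>2 * b) = l ^ n * htr n a b"
proof -
  have "(l * a) ^ (n - 2 * k) * (l\<^sup>2 * b) ^ k = l ^ n * (a ^ (n - 2 * k) * b ^ k)" if "k \<le> n div 2" for k
  proof -
    have "n = (n - 2 * k) + 2 * k" using that by auto
    hence "l ^ n = l ^ (n - 2 * k) * (l\<^sup>2) ^ k" by (metis power_add power_mult)
    thus ?thesis by (simp add: power_mult_distrib mult_ac)
  qed
  thus ?thesis unfolding htr_def sum_distrib_left by (intro sum.cong refl) (simp add: mult_ac)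
qed

lemma htr_cong: "cg p a a' \<Longrightarrow> cg p b b' \<Longrightarrow> cg p (htr n a b) (htr n a' b')"
  unfolding htr_def by (intro cg_sum cg_mult cg_power cg_refl)

lemma htr_of_int: "htr n (of_int a) (of_int b) = of_int (htr n a b)"
  unfolding htr_def by simp

lemma degree_htr: assumes "degree A \<le> 1" "degree B \<le> 2" shows "degree (htr n A B) \<le> n"
  unfolding htr_def
proof (rule degree_sum_le)
  fix k assume "k \<in> {..n div 2}"
  hence k: "2 * k \<le> n" by auto
  have "degree (of_nat ((n choose (2 * k)) * ((2 * k) choose k)) * A ^ (n - 2 * k) * B ^ k)
    \<le> degree (of_nat ((n choose (2 * k)) * ((2 * k) choose k)) * A ^ (n - 2 * k)) + degree (B ^ k)"
    by (rule degree_mult_le)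
  also have "\<dots> \<le> degree (of_nat ((n choose (2 * k)) * ((2 * k) choose k)) :: 'a poly) + degree (A ^ (n - 2 * k)) + degree (B ^ k)"
    using degree_mult_le add_right_mono by blast
  also have "\<dots> \<le> 0 + (n - 2 * k) + 2 * k"
  proof (intro add_mono)
    have "degree (A ^ (n - 2 * k)) \<le> degree A * (n - 2 * k)" by (rule degree_power_le)
    also have "\<dots> \<le> 1 * (n - 2 * k)" using assms by (intro mult_right_mono) auto
    finally show "degree (A ^ (n - 2 * k)) \<le> n - 2 * k" by simp
    have "degree (B ^ k) \<le> degree B * k" by (rule degree_power_le)
    also have "\<dots> \<le> 2 * k" using assms by (intro mult_right_mono) auto
    finally show "degree (B ^ k) \<le> 2 * k" .
    show "degree (of_nat ((n choose (2 * k)) * ((2 * k) choose k)) :: 'a poly) \<le> 0" by (simp only: degree_of_nat order_refl)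
  qed
  also have "\<dots> = n" using k by simp
  finally show "degree (of_nat ((n choose (2 * k)) * ((2 * k) choose k)) * A ^ (n - 2 * k) * B ^ k) \<le> n" .
qed simp

context big_prime
begin

text \<open>Dividing out X - n lowers the degree; at the remaining points the factor x - n is prime
  to p because n < p.\<close>

lemma poly_vanishing:
  assumes "degree F \<le> n" "n < p" "\<And>x. 0 \<le> x \<Longrightarrow> x \<le> int n \<Longrightarrow> int p dvd poly F x"
  shows "int p dvd coeff F i"
  using assms
proof (induction n arbitrary: F i)
  case 0
  then obtain c where F: "F = [:c:]" by (metis degree_eq_zeroE le_zero_eq)
  have "int p dvd poly F 0" using 0 by simp
  thus ?case unfolding F by (cases i) auto
next
  case (Suc n)
  define c where "c = int (Suc n)"
  define Q where "Q = synthetic_div F c"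
  have FQ: "F + smult c Q = pCons (poly F c) Q" unfolding Q_def by (rule synthetic_div_correct)
  have val: "poly F x = (x - c) * poly Q x + poly F c" for x
    using arg_cong[OF FQ, of "\<lambda>P. poly P x"] by (simp add: algebra_simps)
  have pc: "int p dvd poly F c" using Suc.prems(3)[of c] by (simp add: c_def)
  have dQ: "degree Q \<le> n" unfolding Q_def using Suc.prems(1) by (simp add: degree_synthetic_div)
  have Q: "int p dvd coeff Q i" for i
  proof (rule Suc.IH[OF dQ])
    fix x assume x: "0 \<le> x" "x \<le> int n"
    have "int p dvd poly F x" using Suc.prems(3)[of x] x by simp
    hence "int p dvd (x - c) * poly Q x" using val[of x] pc by (metis dvd_add_left_iff)
    moreover have "\<not> int p dvd x - c" using x Suc.prems(2) by (intro not_dvd_small) (auto simp: c_def)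
    ultimately show "int p dvd poly Q x" by (simp add: dvd_mult_iff)
  qed (use Suc.prems in simp)
  have "coeff F i = coeff (pCons (poly F c) Q) i - c * coeff Q i"
    using arg_cong[OF FQ, of "\<lambda>P. coeff P i"] by simp
  moreover have "int p dvd coeff (pCons (poly F c) Q) i" using Q pc by (cases i) auto
  ultimately show ?case using Q by simp
qed

text \<open>A congruence that holds at more integers than the degree holds for the coefficients. This carries the isogeny over
  to parameters in \<open>\<int>[\<alpha>]\<close>, where \<open>S\<close> itself is not defined.\<close>

lemma htr_poly_cong:
  assumes "degree A \<le> 1" "degree B \<le> 2" "degree A' \<le> 1" "degree B' \<le> 2"
    and "\<And>x. S (poly A x) (poly B x) = S (poly A' x) (poly B' x)"
  shows "cg p (htr h2 (evp A r) (evp B r)) (htr h2 (evp A' r) (evp B' r))"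
proof -
  define F where "F = htr h2 A B - htr h2 A' B'"
  have poly_htr: "poly (htr h2 A B) x = htr h2 (poly A x) (poly B x)" for A B :: "int poly" and x :: int
    using evp_htr[of h2 A B x] by (simp add: evp_int)
  have "int p dvd coeff F i" for i
  proof (rule poly_vanishing)
    show "degree F \<le> h2" unfolding F_def using degree_htr assms by (intro degree_diff_le) auto
    show "h2 < p" by (rule h2)
    fix x :: int
    have "cg p (htr h2 (poly A x) (poly B x)) (- S (poly A x) (poly B x))"
      "cg p (htr h2 (poly A' x) (poly B' x)) (- S (poly A' x) (poly B' x))"
      using cg_minus[OF cg_sym[OF S_htr]] by (metis minus_minus)+
    hence "cg p (htr h2 (poly A x) (poly B x)) (htr h2 (poly A' x) (poly B' x))"
      using assms(5)[of x] by (metis cg_sym cg_trans)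
    thus "int p dvd poly F x" by (simp add: F_def poly_htr cg_def)
  qed
  hence "cg p (evp F r) 0" by (rule cg_evp_0)
  moreover have "evp F r = htr h2 (evp A r) (evp B r) - htr h2 (evp A' r) (evp B' r)"
  proof -
    have "htr h2 A B = F + htr h2 A' B'" by (simp add: F_def)
    hence "evp (htr h2 A B) r = evp F r + evp (htr h2 A' B') r" by (simp add: evp_add)
    thus ?thesis by (simp add: evp_htr)
  qed
  ultimately show ?thesis using cg_iff_0 by metis
qed

text \<open>For b = 0 modulo p both sums degenerate to -\<chi>(a). The case is needed because
  agreement of polynomials is tested at 0 and 1 as well, where x^2 - x vanishes.\<close>

lemma S_isogeny': "S a b = S (- 2 * a) (a\<^sup>2 - 4 * b)"
proof (cases "int p dvd b")
  case False thus ?thesis by (rule S_isogeny)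
next
  case True
  have "S a b = S a 0" using True by (intro S_cong) (auto simp: cg_0_int)
  also have "S a 0 = (\<Sum>x\<in>R. \<chi> (1 * x + a) - of_bool (cg p 0 x) * \<chi> (x + a))"
    unfolding S_def
  proof (intro sum.cong refl)
    fix x
    have "x ^ 3 + a * x\<^sup>2 + 0 * x = x\<^sup>2 * (x + a)" by (simp add: power2_eq_square power3_eq_cube algebra_simps)
    thus "\<chi> (x ^ 3 + a * x\<^sup>2 + 0 * x) = \<chi> (1 * x + a) - of_bool (cg p 0 x) * \<chi> (x + a)"
      using chi_sq'[of x] chi_0_iff[of x] cg_sym_iff[of 0 x] by (cases "int p dvd x") (auto simp: cg_0_int)
  qed
  also have "\<dots> = - \<chi> (0 + a)"
    unfolding sum_subtractf sum_chi_linear[OF not_dvd_1]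
    by (subst sum_of_bool_unique[where c = 0 and f = "\<lambda>x. \<chi> (x + a)"]) (auto intro: chi_cong cg_add)
  finally have 1: "S a b = - \<chi> a" by simp
  have "S (- 2 * a) (a\<^sup>2 - 4 * b) = S (- 2 * a) (a\<^sup>2 - 4 * 0)" using True by (intro S_cong cg_intros) (auto simp: cg_0_int)
  also have "\<dots> = (\<Sum>x\<in>R. \<chi> x - of_bool (cg p a x) * \<chi> x)"
    unfolding S_def
  proof (intro sum.cong refl)
    fix x
    have "x ^ 3 + - 2 * a * x\<^sup>2 + (a\<^sup>2 - 4 * 0) * x = x * (x - a)\<^sup>2" by (simp add: power2_eq_square power3_eq_cube algebra_simps)
    moreover have "\<chi> (x - a) ^ 2 = 1 - of_bool (cg p a x)"
      using chi_sq'[of "x - a"] chi_0_iff[of "x - a"] cg_sym_iff[of a x] by (cases "int p dvd x - a") (auto simp: cg_def)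
    ultimately show "\<chi> (x ^ 3 + - 2 * a * x\<^sup>2 + (a\<^sup>2 - 4 * 0) * x) = \<chi> x - of_bool (cg p a x) * \<chi> x"
      by (simp only: chi_mult chi_power right_diff_distrib mult_1_right mult.commute)
  qed
  also have "\<dots> = - \<chi> a"
    unfolding sum_subtractf sum_chi by (subst sum_of_bool_unique[where c = a and f = \<chi>]) (auto intro: chi_cong)
  finally show ?thesis using 1 by simp
qed

text \<open>The Legendre form X (X - 1)(X - x), recentred at the root x.\<close>

lemma S_shift_root: "S (- (x + 1)) x = S (2 * x - 1) (x\<^sup>2 - x)"
proof -
  have "S (- (x + 1)) x = S (3 * x + (- (x + 1))) (3 * x\<^sup>2 + 2 * (- (x + 1)) * x + x)"
    by (rule S_shift) (simp add: power2_eq_square algebra_simps)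
  also have "\<dots> = S (2 * x - 1) (x\<^sup>2 - x)"
    by (intro S_cong) (auto simp: cg_def power2_eq_square algebra_simps)
  finally show ?thesis .
qed

text \<open>For the cubic X (X - e1)(X - e2): part one recentres it at e1, part two follows this by
  the isogeny. Both are homogeneous in e1 and e2, so with e2 invertible they reduce to the single
  parameter r = e1 / e2, in which they are polynomial congruences of low degree.\<close>

lemma htr_shift:
  assumes u: "cg p (e2 * v) 1"
  shows "cg p (htr h2 (- (e1 + e2)) (e1 * e2)) (htr h2 (2 * e1 - e2) (e1\<^sup>2 - e1 * e2))"
    and "cg p (htr h2 (- (e1 + e2)) (e1 * e2)) (htr h2 (2 * e2 - 4 * e1) (e2\<^sup>2))"
proof -
  define r where "r = e1 * v"
  have e1: "cg p (e2 * r) e1" using cg_mult[OF u cg_refl[of p e1]] by (simp add: r_def mult_ac)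
  have pol: "poly [:-1, -1:] x = - (x + 1)" "poly [:0, 1:] x = x" "poly [:-1, 2:] x = 2 * x - 1"
    "poly [:0, -1, 1:] x = x\<^sup>2 - x" "poly [:2, -4:] x = 2 - 4 * x" "poly [:1:] x = 1" for x :: int
    by (simp_all add: power2_eq_square algebra_simps)
  have ev: "evp [:-1, -1:] r = - (r + 1)" "evp [:0, 1:] r = r" "evp [:-1, 2:] r = 2 * r - 1"
    "evp [:0, -1, 1:] r = r\<^sup>2 - r" "evp [:2, -4:] r = 2 - 4 * r" "evp [:1:] r = 1"
    by (simp_all add: power2_eq_square algebra_simps)
  have h1: "cg p (htr h2 (- (r + 1)) r) (htr h2 (2 * r - 1) (r\<^sup>2 - r))"
    using htr_poly_cong[of "[:-1,-1:]" "[:0,1:]" "[:-1,2:]" "[:0,-1,1:]" r] S_shift_root unfolding ev pol by simp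
  have h3: "S (- (x + 1)) x = S (2 - 4 * x) 1" for x
  proof -
    have "S (- (x + 1)) x = S (- 2 * (2 * x - 1)) ((2 * x - 1)\<^sup>2 - 4 * (x\<^sup>2 - x))"
      using S_shift_root[of x] S_isogeny'[of "2 * x - 1" "x\<^sup>2 - x"] by simp
    also have "\<dots> = S (2 - 4 * x) 1" by (intro S_cong) (auto simp: cg_def power2_eq_square algebra_simps)
    finally show ?thesis .
  qed
  have h2': "cg p (htr h2 (- (r + 1)) r) (htr h2 (2 - 4 * r) 1)"
    using htr_poly_cong[of "[:-1,-1:]" "[:0,1:]" "[:2,-4:]" "[:1:]" r] h3 unfolding ev pol by simp
  have "cg p (htr h2 (- (e1 + e2)) (e1 * e2)) (htr h2 (e2 * (- (r + 1))) (e2\<^sup>2 * r))"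
  proof (rule htr_cong)
    have "cg p (- (e2 * r + e2)) (- (e1 + e2))" by (intro cg_intros e1)
    thus "cg p (- (e1 + e2)) (e2 * (- (r + 1)))" by (simp add: algebra_simps cg_sym)
    have "cg p (e2 * r * e2) (e1 * e2)" by (intro cg_intros e1)
    thus "cg p (e1 * e2) (e2\<^sup>2 * r)" by (simp add: power2_eq_square mult_ac cg_sym)
  qed
  hence a: "cg p (htr h2 (- (e1 + e2)) (e1 * e2)) (e2 ^ h2 * htr h2 (- (r + 1)) r)" by (simp only: htr_homogeneous)
  have "cg p (e2 ^ h2 * htr h2 (- (r + 1)) r) (e2 ^ h2 * htr h2 (2 * r - 1) (r\<^sup>2 - r))" by (intro cg_mult cg_refl h1)
  also have "e2 ^ h2 * htr h2 (2 * r - 1) (r\<^sup>2 - r) = htr h2 (e2 * (2 * r - 1)) (e2\<^sup>2 * (r\<^sup>2 - r))" by (simp only: htr_homogeneous)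
  also have "cg p \<dots> (htr h2 (2 * e1 - e2) (e1\<^sup>2 - e1 * e2))"
  proof (rule htr_cong)
    have "cg p (2 * (e2 * r) - e2) (2 * e1 - e2)" by (intro cg_intros e1)
    thus "cg p (e2 * (2 * r - 1)) (2 * e1 - e2)" by (simp add: algebra_simps)
    have "cg p ((e2 * r)\<^sup>2 - (e2 * r) * e2) (e1\<^sup>2 - e1 * e2)" by (intro cg_intros e1)
    thus "cg p (e2\<^sup>2 * (r\<^sup>2 - r)) (e1\<^sup>2 - e1 * e2)" by (simp add: power2_eq_square algebra_simps)
  qed
  finally show "cg p (htr h2 (- (e1 + e2)) (e1 * e2)) (htr h2 (2 * e1 - e2) (e1\<^sup>2 - e1 * e2))" by (rule cg_trans[OF a])
  have "cg p (e2 ^ h2 * htr h2 (- (r + 1)) r) (e2 ^ h2 * htr h2 (2 - 4 * r) 1)" by (intro cg_mult cg_refl h2')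
  also have "e2 ^ h2 * htr h2 (2 - 4 * r) 1 = htr h2 (e2 * (2 - 4 * r)) (e2\<^sup>2 * 1)" by (simp only: htr_homogeneous)
  also have "cg p \<dots> (htr h2 (2 * e2 - 4 * e1) (e2\<^sup>2))"
  proof (rule htr_cong)
    have "cg p (2 * e2 - 4 * (e2 * r)) (2 * e2 - 4 * e1)" by (intro cg_intros e1)
    thus "cg p (e2 * (2 - 4 * r)) (2 * e2 - 4 * e1)" by (simp add: algebra_simps)
  qed simp
  finally show "cg p (htr h2 (- (e1 + e2)) (e1 * e2)) (htr h2 (2 * e2 - 4 * e1) (e2\<^sup>2))" by (rule cg_trans[OF a])
qed

end

subsection \<open>Discriminant -7, inert primes\<close>

text \<open>\<open>Al x y\<close> stands for \<open>x + y \<alpha>\<close> with \<open>\<alpha>\<^sup>2 + \<alpha> + 2 = 0\<close>.\<close>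

datatype aint = Al (are: int) (aim: int)

instantiation aint :: comm_ring_1
begin
definition "0 = Al 0 0"
definition "1 = Al 1 0"
fun plus_aint where "Al a b + Al c d = Al (a + c) (b + d)"
fun uminus_aint where "- Al a b = Al (- a) (- b)"
fun minus_aint where "Al a b - Al c d = Al (a - c) (b - d)"
fun times_aint where "Al a b * Al c d = Al (a * c - 2 * (b * d)) (a * d + b * c - b * d)"
instance
proof
  fix x y z :: aint
  show "x * y * z = x * (y * z)" by (cases x; cases y; cases z) (simp add: algebra_simps)
  show "(x + y) * z = x * z + y * z" by (cases x; cases y; cases z) (simp add: algebra_simps)
  show "x * y = y * x" by (cases x; cases y) (simp add: algebra_simps)
  show "x + y + z = x + (y + z)" by (cases x; cases y; cases z) simp
  show "x + y = y + x" by (cases x; cases y) simp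
  show "x - y = x + - y" by (cases x; cases y) simp
  show "0 + x = x" "- x + x = 0" "1 * x = x" by (cases x; simp add: zero_aint_def one_aint_def)+
  show "(0::aint) \<noteq> 1" by (simp add: zero_aint_def one_aint_def)
qed
end

lemma of_nat_aint: "of_nat n = Al (int n) 0"
  by (induction n) (auto simp: zero_aint_def one_aint_def)

lemma of_int_aint: "of_int n = Al n 0"
  by (cases n) (auto simp: of_nat_aint one_aint_def)

lemma numeral_aint: "numeral k = Al (numeral k) 0"
  using of_int_aint[of "numeral k"] by simp

lemma cg_aint: "cg p x y \<longleftrightarrow> cg p (are x) (are y) \<and> cg p (aim x) (aim y)"
proof (cases x; cases y)
  fix a b c d assume xy: "x = Al a b" "y = Al c d"
  have "Al (int p) 0 dvd Al e f \<longleftrightarrow> int p dvd e \<and> int p dvd f" for e f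
  proof
    assume "Al (int p) 0 dvd Al e f"
    then obtain w where w: "Al e f = Al (int p) 0 * w" by (elim dvdE)
    thus "int p dvd e \<and> int p dvd f" by (cases w) auto
  next
    assume "int p dvd e \<and> int p dvd f"
    then obtain e' f' where "e = int p * e'" "f = int p * f'" by (elim conjE dvdE)
    hence "Al e f = Al (int p) 0 * Al e' f'" by simp
    thus "Al (int p) 0 dvd Al e f" by (rule dvdI)
  qed
  thus ?thesis using xy by (simp add: cg_def of_nat_aint)
qed

context big_prime
begin

text \<open>X^2 + 21 X + 112 has the conjugate roots -10 + \<alpha> and -11 - \<alpha>. An isogeny
  followed by a shift returns to the same cubic scaled by \<lambda> = \<alpha> - 1, so
  \<open>htr\<close> is multiplied by \<lambda>^h2. Now \<lambda> = \<beta>^2 for \<beta> = -1 -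
  \<alpha>, of norm 2, hence the value h satisfies \<beta> h = \<beta>^p h. Frobenius conjugates
  \<beta> to \<alpha> for inert p, which forces h to vanish.\<close>

lemma S_D7_inert:
  assumes p7: "p mod 7 \<in> {3, 5, 6}"
  shows "cg p (S 21 112) 0"
proof -
  have m7: "\<chi> (-7) = -1" using chi_m7(2)[OF p7] .
  have d7: "\<not> int p dvd 7"
  proof
    assume "int p dvd 7"
    hence "\<chi> (-7) = 0" using chi_0_iff[of "-7"] by simp
    thus False using m7 by simp
  qed
  have d112: "\<not> int p dvd 112" "\<not> int p dvd 28"
    using d7 not_dvd_2 dvd_mult_iff[of 16 7] dvd_mult_iff[of 4 7] not_dvd_4 dvd_mult_iff[of 4 4] by auto
  define h where "h = htr h2 (21::int) 112"
  define lam where "lam = Al (-1) 1"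
  have H: "htr h2 (21::aint) 112 = of_int h"
    unfolding h_def using htr_of_int[of h2 21 112, where ?'a = aint] by simp
  \<comment> \<open>The inverses come from conjugates: (-11 - \<alpha>)(-10 + \<alpha>) = 112 and
    (-5 - 3\<alpha>)(-2 + 3\<alpha>) = 28.\<close>
  have u1: "cg p (Al (-11) (-1) * (Al (-10) 1 * Al (iv 112) 0)) 1"
    using iv[OF d112(1)] by (simp add: cg_aint one_aint_def)
  have u2: "cg p (Al (-5) (-3) * (Al (-2) 3 * Al (iv 28) 0)) 1"
    using iv[OF d112(2)] by (simp add: cg_aint one_aint_def)
  have "cg p (htr h2 (- (Al (-10) 1 + Al (-11) (-1))) (Al (-10) 1 * Al (-11) (-1)))
      (htr h2 (2 * Al (-11) (-1) - 4 * Al (-10) 1) ((Al (-11) (-1))\<^sup>2))"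
    by (rule htr_shift(2)[OF u1])
  \<comment> \<open>The isogenous quadratic splits again, with roots -13 + 9\<alpha> and -5 -
    3\<alpha>. Recentring at the former gives back 21 and 112 times \<lambda> and
    \<lambda>^2.\<close>
  also have "2 * Al (-11) (-1) - 4 * Al (-10) 1 = - (Al (-13) 9 + Al (-5) (-3))" by (simp add: numeral_aint)
  also have "(Al (-11) (-1))\<^sup>2 = Al (-13) 9 * Al (-5) (-3)" by (simp add: power2_eq_square)
  also have "cg p (htr h2 (- (Al (-13) 9 + Al (-5) (-3))) (Al (-13) 9 * Al (-5) (-3)))
     (htr h2 (2 * Al (-13) 9 - Al (-5) (-3)) ((Al (-13) 9)\<^sup>2 - Al (-13) 9 * Al (-5) (-3)))"
    by (rule htr_shift(1)[OF u2])
  also have "2 * Al (-13) 9 - Al (-5) (-3) = lam * 21" by (simp add: numeral_aint lam_def)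
  also have "(Al (-13) 9)\<^sup>2 - Al (-13) 9 * Al (-5) (-3) = lam\<^sup>2 * 112" by (simp add: numeral_aint lam_def power2_eq_square)
  also have "htr h2 (lam * 21) (lam\<^sup>2 * 112) = lam ^ h2 * htr h2 21 112" by (rule htr_homogeneous)
  also have "- (Al (-10) 1 + Al (-11) (-1)) = 21" by (simp add: numeral_aint)
  also have "Al (-10) 1 * Al (-11) (-1) = 112" by (simp add: numeral_aint)
  finally have e: "cg p (of_int h) (lam ^ h2 * of_int h)" unfolding H .
  define be where "be = Al (-1) (-1)"
  have lam: "lam = be\<^sup>2" by (simp add: lam_def be_def power2_eq_square)
  have "cg p (be * of_int h) (be * (lam ^ h2 * of_int h))" by (intro cg_mult cg_refl e)
  also have "be * (lam ^ h2 * of_int h) = be ^ p * of_int h"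
  proof -
    have "be * lam ^ h2 = be ^ Suc (2 * h2)" by (simp only: lam power_mult[symmetric] power_Suc)
    also have "Suc (2 * h2) = p" using h2(5) by simp
    finally show ?thesis by (simp add: mult.assoc[symmetric])
  qed
  finally have e2: "cg p (be * of_int h) (be ^ p * of_int h)" .
  \<comment> \<open>Since 2\<beta> = -1 - s with s^2 = -7, and s^p = \<chi>(-7) s = -s, the p-th
    power of 2\<beta> is -1 + s = 2\<alpha>.\<close>
  have frob: "cg p (2 * be ^ p) (2 * Al 0 1)"
  proof -
    define s where "s = Al 1 2"
    have s2: "s\<^sup>2 = of_int (-7)" by (simp add: s_def power2_eq_square of_int_aint)
    have sp: "cg p (s ^ p) (- s)"
    proof -
      have "s ^ p = s ^ (2 * h2 + 1)" by (simp only: h2(5))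
      also have "\<dots> = of_int ((-7) ^ h2) * s" by (simp only: power_add power_mult s2 power_one_right of_int_power)
      also have "cg p \<dots> (of_int (-1) * s)"
        using euler[of "-7"] m7 by (intro cg_mult cg_refl cg_of_int) (simp add: h2_def cg_sym)
      finally show ?thesis by simp
    qed
    have two: "cg p (2 ^ p) (2::aint)"
    proof -
      have "cg p (2 * 2 ^ (p - 1)) (2 * 1 :: int)" by (intro cg_mult cg_refl fermat not_dvd_2)
      moreover have "2 * 2 ^ (p - 1) = (2::int) ^ p" using p_gt_3 by (simp add: power_eq_if)
      ultimately have "cg p (of_int (2 ^ p)) (of_int 2 :: aint)" by (intro cg_of_int) simp
      thus ?thesis by simp
    qed
    have "cg p (2 * be ^ p) (2 ^ p * be ^ p)" by (intro cg_mult cg_refl cg_sym[OF two])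
    also have "2 ^ p * be ^ p = (- 1 + - s) ^ p"
    proof -
      have "2 * be = - 1 + - s" by (simp add: be_def s_def one_aint_def numeral_aint)
      thus ?thesis by (simp add: power_mult_distrib[symmetric])
    qed
    also have "cg p \<dots> ((- 1) ^ p + (- s) ^ p)" by (rule cg_frobenius[OF prime_p])
    also have "(- 1) ^ p + (- s) ^ p = - 1 - s ^ p" using odd_p by simp
    also have "cg p \<dots> (- 1 - (- s))" by (intro cg_diff cg_refl sp)
    also have "- 1 - (- s) = 2 * Al 0 1" by (simp add: s_def one_aint_def numeral_aint)
    finally show ?thesis .
  qed
  have "cg p (2 * (be * of_int h)) (2 * (be ^ p * of_int h))" by (intro cg_mult cg_refl e2)
  also have "2 * (be ^ p * of_int h) = (2 * be ^ p) * of_int h" by (simp add: mult.assoc)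
  also have "cg p \<dots> ((2 * Al 0 1) * of_int h)" by (intro cg_mult cg_refl frob)
  finally have "cg p (- (2 * h)) 0" by (simp add: cg_aint be_def of_int_aint numeral_aint)
  hence "int p dvd h" using not_dvd_2 by (simp add: cg_0_int dvd_mult_iff)
  hence "cg p (- h) 0" by (simp add: cg_0_int)
  thus ?thesis using cg_trans[OF S_htr[of 21 112]] unfolding h_def by blast
qed

end

context big_prime
begin

subsection \<open>Point count of a quartic with octahedral symmetry\<close>

text \<open>A unit criterion for elements of \<int>[\<alpha>] mapped to F_p: y is, up to sign, the
  conjugate of x, P is \<alpha>^2 + \<alpha> + 2 and m is the norm up to sign.\<close>

lemma not_dvd_cofactor:
  assumes "int p dvd P" "x * y = k * P + m" "\<not> int p dvd m"
  shows "\<not> int p dvd x"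
proof
  assume "int p dvd x"
  hence "int p dvd k * P + m" using assms(2) by (metis dvd_mult2)
  moreover have "int p dvd k * P" using assms(1) by simp
  ultimately show False using assms(3) by (simp only: dvd_add_right_iff)
qed

lemma sum_over_squares:
  assumes f: "\<And>x y. cg p x y \<Longrightarrow> f x = f y"
  shows "(\<Sum>x\<in>R. f (x\<^sup>2)) = (\<Sum>u\<in>R. (1 + \<chi> u) * (f u :: int))"
proof -
  have "(\<Sum>x\<in>R. f (x\<^sup>2)) = (\<Sum>x\<in>R. \<Sum>u\<in>R. of_bool (cg p (x\<^sup>2) u) * f u)"
    by (intro sum.cong refl sum_of_bool_unique[symmetric] f)
  also have "\<dots> = (\<Sum>u\<in>R. (\<Sum>x\<in>R. of_bool (cg p (x\<^sup>2) u)) * f u)"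
    unfolding sum_distrib_right by (rule sum.swap)
  finally show ?thesis by (simp only: count_sqrt)
qed

lemma sum_chi_quadratic:
  assumes a: "\<not> int p dvd a" and d: "\<not> int p dvd b\<^sup>2 - 4 * a * c"
  shows "(\<Sum>t\<in>R. \<chi> (a * t\<^sup>2 + b * t + c)) = - \<chi> a"
proof -
  define D where "D = b\<^sup>2 - 4 * a * c"
  have a2: "\<not> int p dvd 2 * a" using a not_dvd_2 by (simp add: dvd_mult_iff)
  have c4: "\<chi> 4 = 1" using chi_mult[of 2 2] chi_sq[OF not_dvd_2] by simp
  have "\<chi> a * (\<Sum>t\<in>R. \<chi> (a * t\<^sup>2 + b * t + c)) = (\<Sum>t\<in>R. \<chi> (4 * (a * (a * t\<^sup>2 + b * t + c))))"
    unfolding chi_mult c4 by (simp add: sum_distrib_left)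
  also have "\<dots> = (\<Sum>t\<in>R. \<chi> ((2 * a * t + b)\<^sup>2 - D))"
    by (intro sum.cong refl arg_cong[where f = \<chi>]) (simp add: D_def power2_eq_square algebra_simps)
  also have "\<dots> = (\<Sum>t\<in>R. \<chi> ((t + b)\<^sup>2 - D))"
    by (rule unit_reindex[OF _ a2]) (intro chi_cong cg_intros)
  also have "\<dots> = (\<Sum>t\<in>R. \<chi> (t\<^sup>2 - D))" by (rule shift_reindex) (intro chi_cong cg_intros)
  also have "\<dots> = (\<Sum>u\<in>R. (1 + \<chi> u) * \<chi> (u - D))" by (rule sum_over_squares) (intro chi_cong cg_intros)
  also have "\<dots> = (\<Sum>u\<in>R. \<chi> (1 * u + (- D))) + (\<Sum>u\<in>R. \<chi> (u + 0) * \<chi> (u + (- D)))"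
    by (simp add: sum.distrib algebra_simps)
  also have "\<dots> = - 1" using d unfolding sum_chi_linear[OF not_dvd_1] sum_chi_chi by (simp add: cg_def D_def)
  finally have "\<chi> a * \<chi> a * (\<Sum>t\<in>R. \<chi> (a * t\<^sup>2 + b * t + c)) = \<chi> a * (- 1)" by (simp only: mult.assoc)
  thus ?thesis using chi_sq[OF a] by simp
qed

text \<open>The plane is split into the axis \<open>V = 0\<close> and the lines \<open>U = t V\<close>.\<close>

lemma sum_homogeneous_plane:
  assumes f: "\<And>x x' y. cg p x x' \<Longrightarrow> f x y = f x' y"
    and h: "\<And>t y. \<not> int p dvd y \<Longrightarrow> f (y * t) y = f t 1"
  shows "(\<Sum>x\<in>R. \<Sum>y\<in>R. f x y) = (\<Sum>x\<in>R. f x 0) + (int p - 1) * (\<Sum>t\<in>R. (f t 1 :: int))"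
proof -
  have "(\<Sum>x\<in>R. \<Sum>y\<in>R. f x y) = (\<Sum>y\<in>R. \<Sum>x\<in>R. f x y)" by (rule sum.swap)
  also have "\<dots> = (\<Sum>x\<in>R. f x 0) + (\<Sum>y\<in>Rs. \<Sum>x\<in>R. f x y)" by (rule sum_R_Rs)
  also have "(\<Sum>y\<in>Rs. \<Sum>x\<in>R. f x y) = (\<Sum>y\<in>Rs. \<Sum>t\<in>R. f t 1)"
  proof (rule sum.cong[OF refl])
    fix y assume "y \<in> Rs"
    hence y: "\<not> int p dvd y" by (rule Rs_not_dvd)
    have "(\<Sum>x\<in>R. f x y) = (\<Sum>t\<in>R. f (y * t) y)" by (rule unit_reindex[OF f y, symmetric])
    thus "(\<Sum>x\<in>R. f x y) = (\<Sum>t\<in>R. f t 1)" using h[OF y] by simp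
  qed
  finally show ?thesis using p_gt_3 by (simp add: of_nat_diff)
qed

definition quartic :: "'a::comm_ring_1 \<Rightarrow> 'a \<Rightarrow> 'a \<Rightarrow> 'a \<Rightarrow> 'a" where
  "quartic al X Y Z = X ^ 4 + Y ^ 4 + Z ^ 4 + 3 * al * (X\<^sup>2 * Y\<^sup>2 + Y\<^sup>2 * Z\<^sup>2 + Z\<^sup>2 * X\<^sup>2)"

end

text \<open>Here \<open>al\<close> is an integer representing (-1 + s)/2 for some s with s^2 = -7
  modulo p.\<close>

locale prime_split_7 = big_prime +
  fixes al :: int
  assumes al: "int p dvd al\<^sup>2 + al + 2" and p_ne_7: "p \<noteq> 7"
begin

lemma not_dvd_7: "\<not> int p dvd 7"
  using p_ne_7 prime_p primes_dvd_imp_eq[of p 7] int_dvd_int_iff[of p 7] by auto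

lemma not_dvd_28: "\<not> int p dvd 28" "\<not> int p dvd 448"
  using not_dvd_7 not_dvd_4 dvd_mult_iff[of 4 7] dvd_mult_iff[of 4 28] dvd_mult_iff[of 4 112] by auto

lemma al_not_dvd: "\<not> int p dvd al"
proof (rule not_dvd_cofactor[OF al])
  show "al * (al + 1) = 1 * (al\<^sup>2 + al + 2) + (-2)" by (simp add: power2_eq_square algebra_simps)
qed (use not_dvd_2 in simp)

text \<open>Reducing the discriminant of the conic with respect to W by \<alpha>^2 = -\<alpha> - 2
  gives \<open>Aq\<close> U^2 + \<open>Bq\<close> U V + \<open>Aq\<close> V^2.\<close>

definition Aq where "Aq = - 9 * al - 22"
definition Bq where "Bq = - 30 * al - 36"

lemma Aq_not_dvd: "\<not> int p dvd Aq"
proof (rule not_dvd_cofactor[OF al])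
  show "Aq * (9 * al - 13) = - 81 * (al\<^sup>2 + al + 2) + 448" by (simp add: Aq_def power2_eq_square algebra_simps)
qed (rule not_dvd_28)

lemma disc_not_dvd: "\<not> int p dvd Bq\<^sup>2 - 4 * Aq * Aq"
proof -
  have "\<not> int p dvd 3 * al - 2"
  proof (rule not_dvd_cofactor[OF al])
    show "(3 * al - 2) * (- 3 * al - 5) = - 9 * (al\<^sup>2 + al + 2) + 28" by (simp add: power2_eq_square algebra_simps)
  qed (rule not_dvd_28)
  moreover have "\<not> int p dvd 3 * al + 5"
  proof (rule not_dvd_cofactor[OF al])
    show "(3 * al + 5) * (- 3 * al + 2) = - 9 * (al\<^sup>2 + al + 2) + 28" by (simp add: power2_eq_square algebra_simps)
  qed (rule not_dvd_28)
  moreover have "\<not> int p dvd 4 * (4 * 4)" using not_dvd_4 by (metis dvd_mult_iff)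
  ultimately have "\<not> int p dvd 4 * (4 * 4) * ((3 * al - 2) * (3 * al + 5))" by (metis not_dvd_mult)
  also have "4 * (4 * 4) * ((3 * al - 2) * (3 * al + 5)) = Bq\<^sup>2 - 4 * Aq * Aq"
    by (simp add: Aq_def Bq_def power2_eq_square algebra_simps)
  finally show ?thesis .
qed

definition conic :: "int \<Rightarrow> int \<Rightarrow> int \<Rightarrow> int" where
  "conic U V W = U\<^sup>2 + V\<^sup>2 + W\<^sup>2 + 3 * al * (U * V + V * W + W * U)"

definition oncon :: "int \<Rightarrow> int \<Rightarrow> int \<Rightarrow> int" where
  "oncon U V W = of_bool (cg p (conic U V W) 0)"

lemma oncon_cong: "cg p U U' \<Longrightarrow> cg p V V' \<Longrightarrow> cg p W W' \<Longrightarrow> oncon U V W = oncon U' V' W'"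
  unfolding oncon_def conic_def by (intro of_bool_cg cg_intros)

lemma oncon_perm: "oncon U V W = oncon V U W" "oncon U V W = oncon U W V"
proof -
  have "conic U V W = conic V U W" "conic U V W = conic U W V" by (simp_all add: conic_def algebra_simps)
  thus "oncon U V W = oncon V U W" "oncon U V W = oncon U W V" by (simp_all add: oncon_def)
qed

lemma oncon_scale: "\<not> int p dvd g \<Longrightarrow> oncon (g * U) (g * V) (g * W) = oncon U V W"
proof -
  assume g: "\<not> int p dvd g"
  have "conic (g * U) (g * V) (g * W) = g\<^sup>2 * conic U V W" by (simp add: conic_def power2_eq_square algebra_simps)
  thus ?thesis using g by (simp add: oncon_def cg_0_int dvd_mult_iff dvd_power_iff')
qed

lemma sum_oncon: "(\<Sum>W\<in>R. oncon U V W) = 1 + \<chi> (Aq * U\<^sup>2 + Bq * U * V + Aq * V\<^sup>2)"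
proof -
  have "(\<Sum>W\<in>R. oncon U V W) = (\<Sum>W\<in>R. of_bool (cg p (W\<^sup>2 + (3 * al * (U + V)) * W + (U\<^sup>2 + V\<^sup>2 + 3 * al * (U * V))) 0))"
    unfolding oncon_def conic_def by (intro sum.cong refl arg_cong[where f = of_bool] arg_cong2[where f = "cg p"]) (simp add: algebra_simps)
  also have "\<dots> = 1 + \<chi> ((3 * al * (U + V))\<^sup>2 - 4 * (U\<^sup>2 + V\<^sup>2 + 3 * al * (U * V)))" by (rule count_quadratic)
  also have "\<chi> ((3 * al * (U + V))\<^sup>2 - 4 * (U\<^sup>2 + V\<^sup>2 + 3 * al * (U * V))) = \<chi> (Aq * U\<^sup>2 + Bq * U * V + Aq * V\<^sup>2)"
  proof (rule chi_cong)
    have "(3 * al * (U + V))\<^sup>2 - 4 * (U\<^sup>2 + V\<^sup>2 + 3 * al * (U * V)) - (Aq * U\<^sup>2 + Bq * U * V + Aq * V\<^sup>2)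
      = (al\<^sup>2 + al + 2) * (9 * (U + V)\<^sup>2)" by (simp add: Aq_def Bq_def power2_eq_square algebra_simps)
    thus "cg p ((3 * al * (U + V))\<^sup>2 - 4 * (U\<^sup>2 + V\<^sup>2 + 3 * al * (U * V))) (Aq * U\<^sup>2 + Bq * U * V + Aq * V\<^sup>2)"
      using al by (simp add: cg_def)
  qed
  finally show ?thesis .
qed

text \<open>Recentring at the root \<alpha> - 10 of X^2 + 21 X + 112 gives (3\<alpha> - 9,
  -21\<alpha> - 14). Scaling by 3\<alpha> + 2 = \<alpha>^4, a square, leads to \<open>Bq\<close> and
  the square of \<open>Aq\<close> without a sign.\<close>

lemma S_Bq_Aq: "S Bq (Aq\<^sup>2) = S 21 112"
proof -
  let ?P = "al\<^sup>2 + al + 2"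
  have P: "cg p (x + ?P * y) x" for x y using al by (simp add: cg_def)
  have "S 21 112 = S (3 * (al - 10) + 21) (3 * (al - 10)\<^sup>2 + 2 * 21 * (al - 10) + 112)"
  proof (rule S_shift)
    have e: "(al - 10)\<^sup>2 + 21 * (al - 10) + 112 = 0 + ?P * 1" by (simp add: power2_eq_square algebra_simps)
    show "cg p ((al - 10)\<^sup>2 + 21 * (al - 10) + 112) 0" unfolding e by (rule P)
  qed
  also have "\<dots> = S (3 * al - 9) (- 21 * al - 14)"
  proof (rule S_cong)
    have e: "3 * (al - 10)\<^sup>2 + 2 * 21 * (al - 10) + 112 = (- 21 * al - 14) + ?P * 3" by (simp add: power2_eq_square algebra_simps)
    show "cg p (3 * (al - 10)\<^sup>2 + 2 * 21 * (al - 10) + 112) (- 21 * al - 14)" unfolding e by (rule P)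
  qed simp
  also have "\<dots> = \<chi> (al ^ 4) * \<dots>" using even_power_chi[OF al_not_dvd, of 4] by simp
  also have "\<dots> = S (al ^ 4 * (3 * al - 9)) ((al ^ 4)\<^sup>2 * (- 21 * al - 14))"
    by (rule S_scale[symmetric]) (rule not_dvd_pow[OF al_not_dvd])
  also have "\<dots> = S Bq (Aq\<^sup>2)"
  proof (rule S_cong)
    have e: "al ^ 4 = (3 * al + 2) + ?P * (al\<^sup>2 - al - 1)" by (simp add: power2_eq_square power4_eq_xxxx algebra_simps)
    have mu: "cg p (al ^ 4) (3 * al + 2)" unfolding e by (rule P)
    have "cg p (al ^ 4 * (3 * al - 9)) ((3 * al + 2) * (3 * al - 9))" by (intro cg_mult cg_refl mu)
    also have "(3 * al + 2) * (3 * al - 9) = Bq + ?P * 9" by (simp add: Bq_def power2_eq_square algebra_simps)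
    also have "cg p \<dots> Bq" by (rule P)
    finally show "cg p (al ^ 4 * (3 * al - 9)) Bq" .
    have "cg p ((al ^ 4)\<^sup>2 * (- 21 * al - 14)) ((3 * al + 2)\<^sup>2 * (- 21 * al - 14))" by (intro cg_mult cg_refl cg_power mu)
    also have "(3 * al + 2)\<^sup>2 * (- 21 * al - 14) = Aq\<^sup>2 + ?P * (- 189 * al - 270)" by (simp add: Aq_def power2_eq_square algebra_simps)
    also have "cg p \<dots> (Aq\<^sup>2)" by (rule P)
    finally show "cg p ((al ^ 4)\<^sup>2 * (- 21 * al - 14)) (Aq\<^sup>2)" .
  qed
  finally show ?thesis by simp
qed

definition Qf :: "int \<Rightarrow> int \<Rightarrow> int" where "Qf U V = Aq * U\<^sup>2 + Bq * U * V + Aq * V\<^sup>2"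

lemma chi_Qf_scale: "\<not> int p dvd y \<Longrightarrow> \<chi> (Qf (y * t) y) = \<chi> (Qf t 1)"
proof -
  assume y: "\<not> int p dvd y"
  have "Qf (y * t) y = y\<^sup>2 * Qf t 1" by (simp add: Qf_def power2_eq_square algebra_simps)
  thus ?thesis using chi_sq'[OF y] by simp
qed

lemma Qf_cong: "cg p x x' \<Longrightarrow> \<chi> (Qf x y) = \<chi> (Qf x' y)"
  unfolding Qf_def by (intro chi_cong cg_intros)

lemma conic_count: "(\<Sum>U\<in>R. \<Sum>V\<in>R. \<Sum>W\<in>R. oncon U V W) = (int p)\<^sup>2"
proof -
  have "(\<Sum>U\<in>R. \<Sum>V\<in>R. \<chi> (Qf U V)) = (\<Sum>U\<in>R. \<chi> (Qf U 0)) + (int p - 1) * (\<Sum>t\<in>R. \<chi> (Qf t 1))"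
    by (rule sum_homogeneous_plane) (rule Qf_cong, assumption, rule chi_Qf_scale)
  also have "(\<Sum>t\<in>R. \<chi> (Qf t 1)) = - \<chi> Aq"
    using sum_chi_quadratic[OF Aq_not_dvd disc_not_dvd] by (simp add: Qf_def)
  also have "(\<Sum>U\<in>R. \<chi> (Qf U 0)) = \<chi> Aq * (\<Sum>U\<in>R. \<chi> U * \<chi> U)"
    by (simp add: Qf_def sum_distrib_left power2_eq_square)
  finally have "(\<Sum>U\<in>R. \<Sum>V\<in>R. \<chi> (Qf U V)) = 0" by (simp add: sum_chi_sq)
  thus ?thesis unfolding sum_oncon Qf_def by (simp add: sum.distrib power2_eq_square)
qed

text \<open>The number of W is 1 plus the character of a quadratic form in U, V. With t = U / V
  there remains the sum of \<chi>(t (\<open>Aq\<close> t^2 + \<open>Bq\<close> t +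
  \<open>Aq\<close>)), and replacing the variable by \<open>Aq\<close> t makes the cubic
  monic.\<close>

lemma conic_chi_chi: "(\<Sum>U\<in>R. \<Sum>V\<in>R. \<Sum>W\<in>R. \<chi> U * \<chi> V * oncon U V W) = (int p - 1) * S 21 112"
proof -
  have "(\<Sum>U\<in>R. \<Sum>V\<in>R. \<Sum>W\<in>R. \<chi> U * \<chi> V * oncon U V W) = (\<Sum>U\<in>R. \<Sum>V\<in>R. \<chi> U * \<chi> V * (1 + \<chi> (Qf U V)))"
    unfolding sum_distrib_left[symmetric] sum_oncon Qf_def ..
  also have "\<dots> = (\<Sum>U\<in>R. \<Sum>V\<in>R. \<chi> U * \<chi> V) + (\<Sum>U\<in>R. \<Sum>V\<in>R. \<chi> U * \<chi> V * \<chi> (Qf U V))"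
    by (simp add: sum.distrib distrib_left)
  also have "(\<Sum>U\<in>R. \<Sum>V\<in>R. \<chi> U * \<chi> V) = 0" using sum_chi by (simp add: sum_distrib_left[symmetric])
  also have "(\<Sum>U\<in>R. \<Sum>V\<in>R. \<chi> U * \<chi> V * \<chi> (Qf U V)) =
    (\<Sum>U\<in>R. \<chi> U * \<chi> 0 * \<chi> (Qf U 0)) + (int p - 1) * (\<Sum>t\<in>R. \<chi> t * \<chi> 1 * \<chi> (Qf t 1))"
  proof (rule sum_homogeneous_plane)
    fix x x' y :: int assume "cg p x x'"
    thus "\<chi> x * \<chi> y * \<chi> (Qf x y) = \<chi> x' * \<chi> y * \<chi> (Qf x' y)" using chi_cong[of x x'] Qf_cong[of x x' y] by simp
  next
    fix t y :: int assume y: "\<not> int p dvd y"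
    have "\<chi> (y * t) * \<chi> y * \<chi> (Qf (y * t) y) = (\<chi> y * \<chi> y) * (\<chi> t * \<chi> (Qf t 1))"
      unfolding chi_Qf_scale[OF y] by simp
    thus "\<chi> (y * t) * \<chi> y * \<chi> (Qf (y * t) y) = \<chi> t * \<chi> 1 * \<chi> (Qf t 1)" using chi_sq[OF y] by simp
  qed
  also have "(\<Sum>t\<in>R. \<chi> t * \<chi> 1 * \<chi> (Qf t 1)) = S Bq (Aq\<^sup>2)"
  proof -
    have "S Bq (Aq\<^sup>2) = (\<Sum>t\<in>R. \<chi> ((Aq * t) ^ 3 + Bq * (Aq * t)\<^sup>2 + Aq\<^sup>2 * (Aq * t)))"
      unfolding S_def by (rule unit_reindex[OF _ Aq_not_dvd, symmetric]) (intro chi_cong cg_intros)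
    also have "\<dots> = (\<Sum>t\<in>R. \<chi> (Aq\<^sup>2 * (t * Qf t 1)))"
      by (intro sum.cong refl arg_cong[where f = \<chi>]) (simp add: Qf_def power2_eq_square power3_eq_cube algebra_simps)
    also have "\<dots> = (\<Sum>t\<in>R. \<chi> t * \<chi> 1 * \<chi> (Qf t 1))" using chi_sq'[OF Aq_not_dvd] by simp
    finally show ?thesis by simp
  qed
  finally show ?thesis using S_Bq_Aq by simp
qed

text \<open>Scaling all coordinates by a nonresidue preserves the conic and negates the
  weight.\<close>

lemma conic_odd_0:
  assumes psi: "\<And>g U V W. \<psi> (g * U) (g * V) (g * W) = \<chi> g * \<psi> U V W"
    and c: "\<And>U U' V V' W W'. cg p U U' \<Longrightarrow> cg p V V' \<Longrightarrow> cg p W W' \<Longrightarrow> \<psi> U V W = \<psi> U' V' W'"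
  shows "(\<Sum>U\<in>R. \<Sum>V\<in>R. \<Sum>W\<in>R. \<psi> U V W * oncon U V W) = 0"
proof -
  obtain g where g: "\<chi> g = -1" using exists_nonresidue by blast
  hence g0: "\<not> int p dvd g" using chi_0_iff[of g] by auto
  define T where "T = (\<Sum>U\<in>R. \<Sum>V\<in>R. \<Sum>W\<in>R. \<psi> U V W * oncon U V W)"
  have "T = (\<Sum>U\<in>R. \<Sum>V\<in>R. \<Sum>W\<in>R. \<psi> (g * U) V W * oncon (g * U) V W)" unfolding T_def
    by (rule unit_reindex[OF _ g0, symmetric]) (intro sum.cong refl arg_cong2[where f = "(*)"] c oncon_cong cg_refl; assumption)
  also have "\<dots> = (\<Sum>U\<in>R. \<Sum>V\<in>R. \<Sum>W\<in>R. \<psi> (g * U) (g * V) W * oncon (g * U) (g * V) W)"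
    by (rule sum.cong[OF refl], rule unit_reindex[OF _ g0, symmetric]) (intro sum.cong refl arg_cong2[where f = "(*)"] c oncon_cong cg_refl; assumption)
  also have "\<dots> = (\<Sum>U\<in>R. \<Sum>V\<in>R. \<Sum>W\<in>R. \<psi> (g * U) (g * V) (g * W) * oncon (g * U) (g * V) (g * W))"
    by (rule sum.cong[OF refl], rule sum.cong[OF refl], rule unit_reindex[OF _ g0, symmetric]) (intro arg_cong2[where f = "(*)"] c oncon_cong cg_refl; assumption)
  also have "\<dots> = - T" unfolding psi g oncon_scale[OF g0] T_def by (simp add: sum_negf)
  finally show ?thesis unfolding T_def by simp
qed

text \<open>The quartic is a conic in the squares of its variables, so points are counted with
  weight (1 + \<chi> U)(1 + \<chi> V)(1 + \<chi> W). The constant term gives p^2, each of the three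
  products of two characters gives (p - 1) S(21, 112), and the terms of odd degree vanish.\<close>

lemma quartic_count:
  "(\<Sum>X\<in>R. \<Sum>Y\<in>R. \<Sum>Z\<in>R. of_bool (cg p (quartic al X Y Z) 0)) = (int p)\<^sup>2 + 3 * (int p - 1) * S 21 112"
proof -
  have "(\<Sum>X\<in>R. \<Sum>Y\<in>R. \<Sum>Z\<in>R. of_bool (cg p (quartic al X Y Z) 0)) = (\<Sum>X\<in>R. \<Sum>Y\<in>R. \<Sum>Z\<in>R. oncon (X\<^sup>2) (Y\<^sup>2) (Z\<^sup>2))"
    unfolding quartic_def oncon_def conic_def by (simp flip: power_mult)
  also have "\<dots> = (\<Sum>X\<in>R. \<Sum>Y\<in>R. \<Sum>W\<in>R. (1 + \<chi> W) * oncon (X\<^sup>2) (Y\<^sup>2) W)"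
    by (rule sum.cong[OF refl], rule sum.cong[OF refl], rule sum_over_squares) (intro oncon_cong cg_refl)
  also have "\<dots> = (\<Sum>X\<in>R. \<Sum>V\<in>R. (1 + \<chi> V) * (\<Sum>W\<in>R. (1 + \<chi> W) * oncon (X\<^sup>2) V W))"
    by (rule sum.cong[OF refl], rule sum_over_squares) (intro sum.cong refl arg_cong2[where f = "(*)"] oncon_cong cg_refl)
  also have "\<dots> = (\<Sum>U\<in>R. (1 + \<chi> U) * (\<Sum>V\<in>R. (1 + \<chi> V) * (\<Sum>W\<in>R. (1 + \<chi> W) * oncon U V W)))"
    by (rule sum_over_squares) (intro sum.cong refl arg_cong2[where f = "(*)"] oncon_cong cg_refl)
  also have "\<dots> = (\<Sum>U\<in>R. \<Sum>V\<in>R. \<Sum>W\<in>R. oncon U V W + \<chi> U * \<chi> V * oncon U V W + \<chi> U * \<chi> W * oncon U V W + \<chi> V * \<chi> W * oncon U V W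
      + \<chi> U * oncon U V W + \<chi> V * oncon U V W + \<chi> W * oncon U V W + \<chi> U * \<chi> V * \<chi> W * oncon U V W)"
    unfolding sum_distrib_left by (intro sum.cong refl) (simp add: algebra_simps)
  also have "\<dots> = (\<Sum>U\<in>R. \<Sum>V\<in>R. \<Sum>W\<in>R. oncon U V W) + (\<Sum>U\<in>R. \<Sum>V\<in>R. \<Sum>W\<in>R. \<chi> U * \<chi> V * oncon U V W)
      + (\<Sum>U\<in>R. \<Sum>V\<in>R. \<Sum>W\<in>R. \<chi> U * \<chi> W * oncon U V W) + (\<Sum>U\<in>R. \<Sum>V\<in>R. \<Sum>W\<in>R. \<chi> V * \<chi> W * oncon U V W)
      + (\<Sum>U\<in>R. \<Sum>V\<in>R. \<Sum>W\<in>R. \<chi> U * oncon U V W) + (\<Sum>U\<in>R. \<Sum>V\<in>R. \<Sum>W\<in>R. \<chi> V * oncon U V W)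
      + (\<Sum>U\<in>R. \<Sum>V\<in>R. \<Sum>W\<in>R. \<chi> W * oncon U V W) + (\<Sum>U\<in>R. \<Sum>V\<in>R. \<Sum>W\<in>R. \<chi> U * \<chi> V * \<chi> W * oncon U V W)"
    by (simp only: sum.distrib)
  also have "(\<Sum>U\<in>R. \<Sum>V\<in>R. \<Sum>W\<in>R. \<chi> U * oncon U V W) = 0"
    by (rule conic_odd_0) (simp_all add: chi_cong)
  also have "(\<Sum>U\<in>R. \<Sum>V\<in>R. \<Sum>W\<in>R. \<chi> V * oncon U V W) = 0"
    by (rule conic_odd_0) (simp_all add: chi_cong)
  also have "(\<Sum>U\<in>R. \<Sum>V\<in>R. \<Sum>W\<in>R. \<chi> W * oncon U V W) = 0"
    by (rule conic_odd_0) (simp_all add: chi_cong)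
  also have "(\<Sum>U\<in>R. \<Sum>V\<in>R. \<Sum>W\<in>R. \<chi> U * \<chi> V * \<chi> W * oncon U V W) = 0"
  proof (rule conic_odd_0)
    fix g U V W
    have g3: "\<chi> g * \<chi> g * \<chi> g = \<chi> g" using chi_cube[of g] by (simp add: power3_eq_cube)
    have "\<chi> (g * U) * \<chi> (g * V) * \<chi> (g * W) = \<chi> g * \<chi> g * \<chi> g * (\<chi> U * \<chi> V * \<chi> W)"
      unfolding chi_mult by (simp only: mult_ac)
    thus "\<chi> (g * U) * \<chi> (g * V) * \<chi> (g * W) = \<chi> g * (\<chi> U * \<chi> V * \<chi> W)" unfolding g3 .
  next
    fix U U' V V' W W' :: int assume "cg p U U'" "cg p V V'" "cg p W W'"
    thus "\<chi> U * \<chi> V * \<chi> W = \<chi> U' * \<chi> V' * \<chi> W'" using chi_cong[of U U'] chi_cong[of V V'] chi_cong[of W W'] by simp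
  qed
  also have UW: "(\<Sum>U\<in>R. \<Sum>V\<in>R. \<Sum>W\<in>R. \<chi> U * \<chi> W * oncon U V W) = (int p - 1) * S 21 112"
  proof -
    have "(\<Sum>U\<in>R. \<Sum>V\<in>R. \<Sum>W\<in>R. \<chi> U * \<chi> W * oncon U V W) = (\<Sum>U\<in>R. \<Sum>W\<in>R. \<Sum>V\<in>R. \<chi> U * \<chi> W * oncon U W V)"
      by (subst oncon_perm(2), rule sum.cong[OF refl], rule sum.swap)
    thus ?thesis using conic_chi_chi by simp
  qed
  also have "(\<Sum>U\<in>R. \<Sum>V\<in>R. \<Sum>W\<in>R. \<chi> V * \<chi> W * oncon U V W) = (int p - 1) * S 21 112"
  proof -
    have "(\<Sum>U\<in>R. \<Sum>V\<in>R. \<Sum>W\<in>R. \<chi> V * \<chi> W * oncon U V W) = (\<Sum>V\<in>R. \<Sum>U\<in>R. \<Sum>W\<in>R. \<chi> V * \<chi> W * oncon V U W)"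
      by (subst oncon_perm(1), rule sum.swap)
    thus ?thesis using UW by simp
  qed
  finally show ?thesis by (simp add: conic_count conic_chi_chi)
qed

end

subsection \<open>Sevenfold covers attached to a cyclic cubic algebra\<close>

text \<open>Common ground of F_p^3 and \<int>[\<eta>] / p, where \<open>sg\<close> generates the
  Galois action. \<open>ze_theta\<close> says that \<open>sg\<close> raises the seventh root of
  unity \<open>ze\<close> to the fourth power. \<open>two_tr\<close> says that the linear forms tr g
  and tr(g z) are proportional only for scalar z, and \<open>ker\<close> that x^3 \<sigma>(x) is
  scalar only on scalars times powers of \<open>ze\<close>.\<close>

locale cubic_alg = big_prime p + AE: ressys p AE
  for p :: nat and AE :: "'a::comm_ring_1 set" +
  fixes sg :: "'a \<Rightarrow> 'a" and tr nm :: "'a \<Rightarrow> int" and ze :: 'a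
  assumes sg_mult: "sg (x * y) = sg x * sg y"
    and sg3: "sg (sg (sg x)) = x"
    and sg_of_int: "sg (of_int c) = of_int c"
    and cg_sg: "cg p x y \<Longrightarrow> cg p (sg x) (sg y)"
    and cg_tr: "cg p x y \<Longrightarrow> cg p (tr x) (tr y)"
    and cg_nm: "cg p x y \<Longrightarrow> cg p (nm x) (nm y)"
    and tr_of_int: "tr (of_int c * x) = c * tr x"
    and tr_sg: "tr (sg x) = tr x"
    and nm_eq: "of_int (nm x) = x * sg x * sg (sg x)"
    and nm_mult: "nm (x * y) = nm x * nm y"
    and nm_sg: "nm (sg x) = nm x"
    and nm_of_int: "nm (of_int c) = c ^ 3"
    and of_int_inj: "cg p (of_int c :: 'a) (of_int d) \<Longrightarrow> cg p c d"
    and two_tr: "\<not> int p dvd nm z \<Longrightarrow>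
      (\<Sum>g\<in>AE. of_bool (int p dvd tr g) * of_bool (int p dvd tr (g * z))) =
        (if \<exists>c. cg p z (of_int c) then (int p)\<^sup>2 else int p)"
    and ze7: "cg p (ze ^ 7) 1"
    and ze_theta: "cg p (ze ^ 3 * sg ze) 1"
    and ker: "\<not> int p dvd nm u \<Longrightarrow> cg p (u ^ 3 * sg u) (of_int c) \<Longrightarrow> \<exists>d j. cg p u (of_int d * ze ^ j)"
    and ze_indep: "\<not> int p dvd c \<Longrightarrow> i < 7 \<Longrightarrow> j < 7 \<Longrightarrow> cg p (of_int c * ze ^ i) (of_int d * ze ^ j) \<Longrightarrow> i = j"
begin

text \<open>With X, Y, Z the conjugates of x, the trace of this is X^3 Y + Y^3 Z + Z^3 X, the Klein
  quartic. Multiplicativity in x is what makes the twists tr(g \<open>th\<close> x) depend only on a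
  class of g.\<close>

definition th :: "'a \<Rightarrow> 'a" where "th x = x ^ 3 * sg x"
definition UA :: "'a set" where "UA = {x\<in>AE. \<not> int p dvd nm x}"
definition M :: "'a \<Rightarrow> int" where "M g = (\<Sum>x\<in>UA. of_bool (int p dvd tr (g * th x)))"

lemma nm_1: "nm 1 = 1" using nm_of_int[of 1] by simp

lemma nm_power: "nm (x ^ k) = nm x ^ k"
  by (induction k) (auto simp: nm_1 nm_mult)

lemma sg_power: "sg (x ^ k) = sg x ^ k"
  using sg_of_int[of 1] by (induction k) (auto simp: sg_mult)

lemma th_mult: "th (x * y) = th x * th y"
  by (simp add: th_def sg_mult power_mult_distrib mult_ac)

lemma th_sg: "th (sg x) = sg (th x)"
  by (simp add: th_def sg_mult sg_power)

lemma th_of_int: "th (of_int c) = of_int (c ^ 4)"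
  by (simp add: th_def sg_of_int power3_eq_cube power4_eq_xxxx)

lemma th_cong: "cg p x y \<Longrightarrow> cg p (th x) (th y)"
  unfolding th_def by (intro cg_mult cg_power cg_sg)

lemma th_power: "th (x ^ k) = th x ^ k"
  using th_of_int[of 1] by (induction k) (auto simp: th_mult)

lemma nm_th: "nm (th x) = nm x ^ 4"
  by (simp add: th_def nm_mult nm_power nm_sg power3_eq_cube power4_eq_xxxx)

lemma finite_UA: "finite UA" using AE.fin by (simp add: UA_def)

lemma nm_dvd_cong: "cg p x y \<Longrightarrow> int p dvd nm x \<longleftrightarrow> int p dvd nm y"
  using cg_cong_dvd[OF cg_nm] .

lemma red_UA: "\<not> int p dvd nm x \<Longrightarrow> AE.red x \<in> UA"
  using AE.red(1) nm_dvd_cong[OF AE.red(3)] by (simp add: UA_def)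

lemma UA_nm: "x \<in> UA \<Longrightarrow> \<not> int p dvd nm x" by (simp add: UA_def)

lemma not_dvd_nm_of_int: "\<not> int p dvd c \<Longrightarrow> \<not> int p dvd nm (of_int c)"
  unfolding nm_of_int by (rule not_dvd_pow)

lemma not_dvd_nm_ze: "\<not> int p dvd nm ze"
proof
  assume "int p dvd nm ze"
  hence "int p dvd nm (ze ^ 7)" by (simp add: nm_power dvd_power_iff')
  thus False using nm_dvd_cong[OF ze7] nm_1 not_dvd_1 by simp
qed

definition ui :: "'a \<Rightarrow> 'a" where "ui u = sg u * sg (sg u) * of_int (iv (nm u))"

lemma ui: "\<not> int p dvd nm u \<Longrightarrow> cg p (u * ui u) 1"
proof -
  assume u: "\<not> int p dvd nm u"
  have "u * ui u = of_int (nm u * iv (nm u))" by (simp add: ui_def nm_eq mult_ac)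
  also have "cg p \<dots> (of_int 1)" by (rule cg_of_int[OF iv[OF u]])
  finally show ?thesis by simp
qed

lemma not_dvd_nm_ui: "\<not> int p dvd nm u \<Longrightarrow> \<not> int p dvd nm (ui u)"
proof
  assume u: "\<not> int p dvd nm u" "int p dvd nm (ui u)"
  hence "int p dvd nm (u * ui u)" by (simp add: nm_mult)
  thus False using nm_dvd_cong[OF ui[OF u(1)]] nm_1 not_dvd_1 by simp
qed

lemma cancel: assumes "cg p (u * x) (u * y)" "\<not> int p dvd nm u" shows "cg p x y"
proof -
  have *: "cg p (ui u * (u * z)) z" for z
  proof -
    have "cg p ((u * ui u) * z) (1 * z)" by (intro cg_mult cg_refl ui assms)
    thus ?thesis by (simp add: mult_ac)
  qed
  have "cg p (ui u * (u * x)) (ui u * (u * y))" by (intro cg_mult cg_refl assms)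
  thus ?thesis using *[of x] *[of y] by (metis cg_sym cg_trans)
qed

lemma sum_UA: "(\<Sum>x\<in>UA. f x) = (\<Sum>x\<in>AE. of_bool (\<not> int p dvd nm x) * (f x :: int))"
  unfolding UA_def by (rule sum.mono_neutral_cong_left) (auto simp: AE.fin)

lemma UA_reindex:
  assumes f: "\<And>x y. cg p x y \<Longrightarrow> f x = f y" and u: "\<not> int p dvd nm u"
  shows "(\<Sum>x\<in>UA. f (u * x)) = (\<Sum>x\<in>UA. (f x :: int))"
proof -
  have "(\<Sum>x\<in>AE. (\<lambda>x. of_bool (\<not> int p dvd nm x) * f x) (u * x)) = (\<Sum>x\<in>AE. (\<lambda>x. of_bool (\<not> int p dvd nm x) * f x) x)"
    by (rule ressys_unit_mult[OF AE.ressys_axioms _ ui[OF u]]) (simp add: nm_dvd_cong f cong: if_cong)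
  thus ?thesis using u unfolding sum_UA by (simp add: nm_mult dvd_mult_iff)
qed

lemma UA_sg_reindex:
  assumes f: "\<And>x y. cg p x y \<Longrightarrow> f x = f y"
  shows "(\<Sum>x\<in>UA. f (sg x)) = (\<Sum>x\<in>UA. (f x :: int))"
proof -
  have "(\<Sum>x\<in>AE. (\<lambda>x. of_bool (\<not> int p dvd nm x) * f x) (sg x)) = (\<Sum>x\<in>AE. (\<lambda>x. of_bool (\<not> int p dvd nm x) * f x) x)"
    by (rule ressys_reindex[OF AE.ressys_axioms AE.ressys_axioms, where k = "\<lambda>x. sg (sg x)"])
      (auto simp: sg3 nm_dvd_cong f intro: cg_sg)
  thus ?thesis unfolding sum_UA by (simp add: nm_sg)
qed

lemma tr_dvd_cong: "cg p x y \<Longrightarrow> int p dvd tr x \<longleftrightarrow> int p dvd tr y"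
  using cg_cong_dvd[OF cg_tr] .

lemma M_term_cong: "cg p x y \<Longrightarrow> (of_bool (int p dvd tr (g * th x)) :: int) = of_bool (int p dvd tr (g * th y))"
  using tr_dvd_cong[OF cg_mult[OF cg_refl th_cong]] by simp

lemma M_cong: "cg p g g' \<Longrightarrow> M g = M g'"
  unfolding M_def using tr_dvd_cong[OF cg_mult[OF _ cg_refl]] by simp

lemma M_th: assumes h: "\<not> int p dvd nm h" shows "M (g * th h) = M g"
proof -
  have "M g = (\<Sum>x\<in>UA. of_bool (int p dvd tr (g * th (h * x))))"
    unfolding M_def by (rule UA_reindex[OF M_term_cong h, symmetric])
  thus ?thesis by (simp add: M_def th_mult mult.assoc)
qed

lemma M_of_int: "\<not> int p dvd c \<Longrightarrow> M (of_int c * g) = M g"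
  unfolding M_def by (simp add: mult.assoc tr_of_int dvd_mult_iff)

lemma M_sg: "M (sg g) = M g"
proof -
  have "M (sg g) = (\<Sum>x\<in>UA. of_bool (int p dvd tr (sg g * th (sg x))))"
    unfolding M_def by (rule UA_sg_reindex[OF M_term_cong, symmetric])
  thus ?thesis by (simp add: M_def th_sg tr_sg flip: sg_mult)
qed

lemma of_bool_tr_cong: "cg p x y \<Longrightarrow> (of_bool (int p dvd tr x) :: int) = of_bool (int p dvd tr y)"
  using tr_dvd_cong by simp

lemma two_tr_unit:
  assumes w: "\<not> int p dvd nm w" and z: "\<not> int p dvd nm z"
  shows "(\<Sum>g\<in>AE. of_bool (int p dvd tr (g * w)) * of_bool (int p dvd tr (g * (w * z)))) =
        (if \<exists>c. cg p z (of_int c) then (int p)\<^sup>2 else int p)"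
proof -
  have "(\<Sum>g\<in>AE. (\<lambda>g. of_bool (int p dvd tr g) * of_bool (int p dvd tr (g * z))) (w * g)) =
    (\<Sum>g\<in>AE. (\<lambda>g. of_bool (int p dvd tr g) * of_bool (int p dvd tr (g * z)) :: int) g)"
    by (rule ressys_unit_mult[OF AE.ressys_axioms _ ui[OF w]])
      (intro arg_cong2[where f = "(*)"] of_bool_tr_cong cg_mult cg_refl; assumption)
  thus ?thesis using two_tr[OF z] by (simp add: mult_ac)
qed

text \<open>For a fixed unit x the condition tr(g \<open>th\<close> x) = 0 cuts out a plane of p^2
  elements g.\<close>

lemma first_moment: "(\<Sum>g\<in>AE. M g) = int (card UA) * (int p)\<^sup>2"
proof -
  have "(\<Sum>g\<in>AE. M g) = (\<Sum>x\<in>UA. \<Sum>g\<in>AE. of_bool (int p dvd tr (g * th x)))"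
    unfolding M_def by (rule sum.swap)
  also have "\<dots> = (\<Sum>x\<in>UA. (int p)\<^sup>2)"
  proof (rule sum.cong[OF refl])
    fix x assume "x \<in> UA"
    hence x: "\<not> int p dvd nm (th x)" using UA_nm not_dvd_pow by (simp add: nm_th)
    have n1: "\<not> int p dvd nm 1" using nm_1 not_dvd_1 by simp
    have "\<exists>c. cg p (1::'a) (of_int c)" by (rule exI[of _ 1]) simp
    hence "(\<Sum>g\<in>AE. of_bool (int p dvd tr (g * th x)) * of_bool (int p dvd tr (g * (th x * 1)))) = (int p)\<^sup>2"
      using two_tr_unit[OF x n1] by (simp only: if_True)
    thus "(\<Sum>g\<in>AE. of_bool (int p dvd tr (g * th x))) = (int p)\<^sup>2" by (simp flip: of_bool_conj)
  qed
  finally show ?thesis by simp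
qed

lemma ze_red: "\<exists>i<7. cg p (ze ^ j) (ze ^ i)"
proof (intro exI conjI)
  have "ze ^ j = (ze ^ 7) ^ (j div 7) * ze ^ (j mod 7)" by (simp flip: power_mult power_add)
  also have "cg p \<dots> (1 ^ (j div 7) * ze ^ (j mod 7))" by (intro cg_mult cg_power cg_refl ze7)
  finally show "cg p (ze ^ j) (ze ^ (j mod 7))" by simp
qed simp

lemma th_ze: "cg p (th (of_int d * ze ^ j)) (of_int (d ^ 4))"
proof -
  have "th (of_int d * ze ^ j) = of_int (d ^ 4) * th ze ^ j" by (simp only: th_mult th_of_int th_power)
  also have "cg p \<dots> (of_int (d ^ 4) * 1 ^ j)" unfolding th_def by (intro cg_mult cg_power cg_refl ze_theta)
  finally show ?thesis by simp
qed

lemma not_dvd_nm_ze_mult: "\<not> int p dvd d \<Longrightarrow> \<not> int p dvd nm (of_int d * ze ^ j)"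
  unfolding nm_mult nm_power by (intro not_dvd_mult not_dvd_pow not_dvd_nm_of_int not_dvd_nm_ze)

lemma ze_orbit_inj:
  assumes x: "\<not> int p dvd nm x"
  shows "inj_on (\<lambda>(d, j). AE.red (of_int d * ze ^ j * x)) (Rs \<times> {..<7})"
proof (rule inj_onI)
  fix a b assume ab: "a \<in> Rs \<times> {..<7::nat}" "b \<in> Rs \<times> {..<7::nat}"
    and e': "(case a of (d, j) \<Rightarrow> AE.red (of_int d * ze ^ j * x)) = (case b of (d, j) \<Rightarrow> AE.red (of_int d * ze ^ j * x))"
  obtain d i d' j where dd: "a = (d, i)" "b = (d', j)" by (cases a; cases b)
  have d: "d \<in> Rs" "d' \<in> Rs" "i \<in> {..<7::nat}" "j \<in> {..<7::nat}" using ab unfolding dd by auto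
  have e: "AE.red (of_int d * ze ^ i * x) = AE.red (of_int d' * ze ^ j * x)" using e' unfolding dd by simp
  hence "cg p (x * (of_int d * ze ^ i)) (x * (of_int d' * ze ^ j))" by (simp add: AE.red_eq_iff mult_ac)
  hence c: "cg p (of_int d * ze ^ i) (of_int d' * ze ^ j)" using x by (rule cancel)
  hence ij: "i = j" using ze_indep[of d i j d'] d Rs_not_dvd by auto
  have "\<not> int p dvd nm (ze ^ j)" unfolding nm_power by (intro not_dvd_pow not_dvd_nm_ze)
  hence "cg p (of_int d :: 'a) (of_int d')" using cancel[of "ze ^ j"] c ij by (simp add: mult.commute)
  hence "cg p d d'" by (rule of_int_inj)
  thus "a = b" using d RS.uniq[of d d'] ij Rs_iff unfolding dd by blast
qed

definition orb :: "'a \<Rightarrow> 'a set" where "orb x = (\<lambda>(d, j). AE.red (of_int d * ze ^ j * x)) ` (Rs \<times> {..<7})"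

lemma card_orb: "\<not> int p dvd nm x \<Longrightarrow> card (orb x) = 7 * (p - 1)"
  unfolding orb_def by (subst card_image[OF ze_orbit_inj]) (auto simp: card_cartesian_product)

lemma orb_iff: "y \<in> orb x \<longleftrightarrow> y \<in> AE \<and> (\<exists>d j. \<not> int p dvd d \<and> cg p y (of_int d * ze ^ j * x))"
proof
  assume "y \<in> orb x"
  then obtain d j where "d \<in> Rs" "y = AE.red (of_int d * ze ^ j * x)" unfolding orb_def by auto
  thus "y \<in> AE \<and> (\<exists>d j. \<not> int p dvd d \<and> cg p y (of_int d * ze ^ j * x))" using AE.red Rs_not_dvd by blast
next
  assume "y \<in> AE \<and> (\<exists>d j. \<not> int p dvd d \<and> cg p y (of_int d * ze ^ j * x))"
  then obtain d j where y: "y \<in> AE" "\<not> int p dvd d" "cg p y (of_int d * ze ^ j * x)" by blast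
  obtain i where i: "i < 7" "cg p (ze ^ j) (ze ^ i)" using ze_red by blast
  have "cg p (of_int d * ze ^ j * x) (of_int (RS.red d) * ze ^ i * x)"
    by (intro cg_mult cg_refl i cg_of_int RS.red)
  hence "AE.red (of_int (RS.red d) * ze ^ i * x) = y"
    using y(1) by (intro AE.red_eqI cg_sym[OF cg_trans[OF y(3)]])
  thus "y \<in> orb x" unfolding orb_def using i(1) red_Rs[OF y(2)] by force
qed

lemma orbE:
  assumes "y \<in> orb x"
  obtains d j where "y \<in> AE" "\<not> int p dvd d" "cg p y (of_int d * ze ^ j * x)"
  using assms unfolding orb_iff by blast

lemma orbI: "y \<in> AE \<Longrightarrow> \<not> int p dvd d \<Longrightarrow> cg p y (of_int d * ze ^ j * x) \<Longrightarrow> y \<in> orb x"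
  unfolding orb_iff by blast

text \<open>Scalars d and powers of \<zeta> act freely on the units, and \<open>th\<close> is only
  multiplied by d^4. The solution set is a union of orbits of size 7 (p - 1).\<close>

lemma M_dvd: "7 * (int p - 1) dvd M g"
proof -
  define X where "X = {x\<in>UA. int p dvd tr (g * th x)}"
  have fX: "finite X" using finite_UA by (simp add: X_def)
  have "7 * (p - 1) dvd card X"
  proof (rule orbit_dvd_card[OF fX, where orb = orb])
    have sym: "x \<in> orb y" if a: "x \<in> AE" "y \<in> orb x" for x y
    proof -
      obtain d j where y: "\<not> int p dvd d" "cg p y (of_int d * ze ^ j * x)" by (rule orbE[OF a(2)])
      have "cg p (of_int (iv d) * ze ^ (6 * j) * y) (of_int (iv d) * ze ^ (6 * j) * (of_int d * ze ^ j * x))" by (intro cg_mult cg_refl y)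
      also have "of_int (iv d) * ze ^ (6 * j) * (of_int d * ze ^ j * x) = of_int (d * iv d) * (ze ^ 7) ^ j * x"
      proof -
        have "ze ^ (6 * j) * ze ^ j = (ze ^ 7) ^ j" by (simp flip: power_add power_mult)
        thus ?thesis by (simp add: mult_ac)
      qed
      also have "cg p \<dots> (of_int 1 * 1 ^ j * x)" by (intro cg_mult cg_refl cg_power ze7 cg_of_int iv y)
      finally have "cg p x (of_int (iv d) * ze ^ (6 * j) * y)" by (simp add: cg_sym)
      thus ?thesis using y(1) by (intro orbI[OF a(1)]) (simp_all add: iv_dvd)
    qed
    have trans: "z \<in> orb x" if a: "z \<in> orb y" "y \<in> orb x" for x y z
    proof -
      obtain d j where y: "\<not> int p dvd d" "cg p y (of_int d * ze ^ j * x)" by (rule orbE[OF a(2)])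
      obtain e k where z: "z \<in> AE" "\<not> int p dvd e" "cg p z (of_int e * ze ^ k * y)" by (rule orbE[OF a(1)])
      have "cg p z (of_int e * ze ^ k * (of_int d * ze ^ j * x))" by (rule cg_trans[OF z(3)]) (intro cg_mult cg_refl y)
      hence "cg p z (of_int (e * d) * ze ^ (k + j) * x)" by (simp add: power_add mult_ac)
      thus ?thesis by (rule orbI[OF z(1) not_dvd_mult[OF z(2) y(1)]])
    qed
    have inX: "y \<in> X" if x: "x \<in> X" and yo: "y \<in> orb x" for x y
    proof -
      obtain d j where y: "y \<in> AE" "\<not> int p dvd d" "cg p y (of_int d * ze ^ j * x)" by (rule orbE[OF yo])
      have "\<not> int p dvd nm (of_int d * ze ^ j * x)"
        using x UA_nm unfolding nm_mult[of _ x] X_def by (intro not_dvd_mult not_dvd_nm_ze_mult y) auto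
      hence "y \<in> UA" using y(1) nm_dvd_cong[OF y(3)] by (simp add: UA_def)
      moreover have "int p dvd tr (g * th y)"
      proof -
        have "cg p (g * th y) (g * (th (of_int d * ze ^ j) * th x))"
          unfolding th_mult[symmetric] by (intro cg_mult cg_refl th_cong y)
        also have "cg p \<dots> (g * (of_int (d ^ 4) * th x))" by (intro cg_mult cg_refl th_ze)
        also have "g * (of_int (d ^ 4) * th x) = of_int (d ^ 4) * (g * th x)" by (simp add: mult_ac)
        finally have "int p dvd tr (g * th y) \<longleftrightarrow> int p dvd tr (of_int (d ^ 4) * (g * th x))" by (rule tr_dvd_cong)
        moreover have "int p dvd tr (of_int (d ^ 4) * (g * th x))" unfolding tr_of_int using x by (simp add: X_def)
        ultimately show ?thesis by blast
      qed
      ultimately show ?thesis by (simp add: X_def)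
    qed
    fix x assume x: "x \<in> X"
    have xA: "x \<in> AE" using x by (simp add: X_def UA_def)
    have "cg p x (of_int 1 * ze ^ 0 * x)" by simp
    hence "x \<in> orb x" by (rule orbI[OF xA not_dvd_1])
    thus "x \<in> orb x \<and> orb x \<subseteq> X \<and> card (orb x) = 7 * (p - 1)"
      using inX[OF x] card_orb UA_nm x by (auto simp: X_def)
    fix y assume y: "y \<in> orb x"
    show "orb y = orb x" using trans y sym[OF xA y] by blast
  qed
  hence "int (7 * (p - 1)) dvd int (card X)" by (simp only: int_dvd_int_iff)
  moreover have "M g = int (card X)" unfolding M_def X_def using finite_UA by (simp add: Int_def)
  ultimately show ?thesis using p_gt_3 by (simp add: of_nat_diff)
qed

lemma one_UA: "AE.red 1 \<in> UA" using red_UA[of 1] nm_1 not_dvd_1 by simp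

lemma card_theta_real: "card {u\<in>UA. \<exists>c. cg p (th u) (of_int c)} = 7 * (p - 1)"
proof -
  have "{u\<in>UA. \<exists>c. cg p (th u) (of_int c)} = orb 1"
  proof (intro equalityI subsetI)
    fix u assume "u \<in> {u\<in>UA. \<exists>c. cg p (th u) (of_int c)}"
    then obtain c where u: "u \<in> UA" "cg p (th u) (of_int c)" by blast
    obtain d j where dj: "cg p u (of_int d * ze ^ j)" using ker[OF UA_nm[OF u(1)]] u(2) unfolding th_def by blast
    have "\<not> int p dvd d"
    proof
      assume "int p dvd d"
      hence "int p dvd nm (of_int d * ze ^ j)" by (simp add: nm_mult nm_of_int power3_eq_cube)
      thus False using nm_dvd_cong[OF dj] UA_nm[OF u(1)] by blast
    qed
    moreover have "cg p u (of_int d * ze ^ j * 1)" using dj by simp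
    ultimately show "u \<in> orb 1" using u(1) orbI unfolding UA_def by simp
  next
    fix u assume "u \<in> orb 1"
    then obtain d j where u: "u \<in> AE" "\<not> int p dvd d" "cg p u (of_int d * ze ^ j)" by (rule orbE) simp
    have "u \<in> UA" using u(1) nm_dvd_cong[OF u(3)] not_dvd_nm_ze_mult[OF u(2)] by (simp add: UA_def)
    moreover have "cg p (th u) (of_int (d ^ 4))" by (rule cg_trans[OF th_cong[OF u(3)] th_ze])
    ultimately show "u \<in> {u\<in>UA. \<exists>c. cg p (th u) (of_int c)}" by blast
  qed
  thus ?thesis using card_orb[of 1] nm_1 not_dvd_1 by simp
qed

text \<open>For a pair (x, x u) the two planes of g coincide when \<open>th\<close> u is scalar and
  otherwise meet in a line; \<open>card_theta_real\<close> counts the exceptional u.\<close>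

lemma second_moment_M:
  "(\<Sum>g\<in>AE. (M g)\<^sup>2) = int (card UA) * (int (card UA) * int p + 7 * (int p - 1) * ((int p)\<^sup>2 - int p))"
proof -
  define H where "H = (\<lambda>x y. \<Sum>g\<in>AE. of_bool (int p dvd tr (g * th x)) * (of_bool (int p dvd tr (g * th y)) :: int))"
  have Hc: "cg p y y' \<Longrightarrow> H x y = H x y'" for x y y'
    unfolding H_def using M_term_cong by simp
  have "(\<Sum>g\<in>AE. (M g)\<^sup>2) = (\<Sum>g\<in>AE. \<Sum>x\<in>UA. \<Sum>y\<in>UA. of_bool (int p dvd tr (g * th x)) * of_bool (int p dvd tr (g * th y)))"
    by (simp only: M_def power2_eq_square sum_product)
  also have "\<dots> = (\<Sum>x\<in>UA. \<Sum>y\<in>UA. H x y)"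
    unfolding H_def by (subst sum.swap, rule sum.cong[OF refl], rule sum.swap)
  also have "\<dots> = (\<Sum>x\<in>UA. int (card UA) * int p + 7 * (int p - 1) * ((int p)\<^sup>2 - int p))"
  proof (rule sum.cong[OF refl])
    fix x assume "x \<in> UA"
    hence x: "\<not> int p dvd nm x" "\<not> int p dvd nm (th x)" using UA_nm not_dvd_pow by (auto simp: nm_th)
    have "(\<Sum>y\<in>UA. H x y) = (\<Sum>u\<in>UA. H x (x * u))" by (rule UA_reindex[OF Hc x(1), symmetric])
    also have "\<dots> = (\<Sum>u\<in>UA. int p + ((int p)\<^sup>2 - int p) * of_bool (\<exists>c. cg p (th u) (of_int c)))"
    proof (rule sum.cong[OF refl])
      fix u assume "u \<in> UA"
      hence u: "\<not> int p dvd nm (th u)" using UA_nm not_dvd_pow by (auto simp: nm_th)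
      show "H x (x * u) = int p + ((int p)\<^sup>2 - int p) * of_bool (\<exists>c. cg p (th u) (of_int c))"
        unfolding H_def th_mult two_tr_unit[OF x(2) u] by simp
    qed
    also have "\<dots> = int (card UA) * int p + ((int p)\<^sup>2 - int p) * int (card {u\<in>UA. \<exists>c. cg p (th u) (of_int c)})"
      using finite_UA by (simp add: sum.distrib Int_def flip: sum_distrib_left)
    finally show "(\<Sum>y\<in>UA. H x y) = int (card UA) * int p + 7 * (int p - 1) * ((int p)\<^sup>2 - int p)"
      unfolding card_theta_real using p_gt_3 by (simp add: of_nat_diff)
  qed
  finally show ?thesis by simp
qed

text \<open>Membership in the subgroup of scalars times values of \<open>th\<close> on units, on
  whose cosets \<open>M\<close> is constant.\<close>

definition inTh :: "'a \<Rightarrow> bool" where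
  "inTh x \<longleftrightarrow> (\<exists>c h. \<not> int p dvd c \<and> \<not> int p dvd nm h \<and> cg p x (of_int c * th h))"

lemma inTh_mult: "inTh x \<Longrightarrow> inTh y \<Longrightarrow> inTh (x * y)"
  unfolding inTh_def
proof (elim exE conjE)
  fix c h c' h' assume a: "\<not> int p dvd c" "\<not> int p dvd nm h" "cg p x (of_int c * th h)"
    "\<not> int p dvd c'" "\<not> int p dvd nm h'" "cg p y (of_int c' * th h')"
  have "cg p (x * y) (of_int c * th h * (of_int c' * th h'))" by (intro cg_mult a)
  hence "cg p (x * y) (of_int (c * c') * th (h * h'))" by (simp add: th_mult mult_ac)
  moreover have "\<not> int p dvd c * c'" "\<not> int p dvd nm (h * h')" using a by (simp_all add: dvd_mult_iff nm_mult)
  ultimately show "\<exists>c h. \<not> int p dvd c \<and> \<not> int p dvd nm h \<and> cg p (x * y) (of_int c * th h)" by blast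
qed

lemma inTh_cong: "cg p x y \<Longrightarrow> inTh y \<Longrightarrow> inTh x"
  unfolding inTh_def using cg_trans by blast

lemma inTh_1: "inTh 1"
  unfolding inTh_def using not_dvd_1 nm_1 th_of_int[of 1] by (intro exI[of _ 1]) auto

lemma inTh_power: "inTh x \<Longrightarrow> inTh (x ^ k)"
  by (induction k) (auto intro: inTh_mult inTh_1)

lemma inTh_cancel: assumes "inTh x" "inTh (x * y)" shows "inTh y"
proof -
  obtain c h where x: "\<not> int p dvd c" "\<not> int p dvd nm h" "cg p x (of_int c * th h)" using assms(1) inTh_def by blast
  have i: "inTh (of_int (iv c) * th (ui h))" unfolding inTh_def using x iv_dvd not_dvd_nm_ui by blast
  have "cg p (of_int (iv c) * th (ui h) * x) (of_int (iv c) * th (ui h) * (of_int c * th h))" by (intro cg_mult cg_refl x)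
  also have "of_int (iv c) * th (ui h) * (of_int c * th h) = of_int (c * iv c) * th (h * ui h)" by (simp add: th_mult mult_ac)
  also have "cg p \<dots> (of_int 1 * th 1)" by (intro cg_mult cg_of_int iv x th_cong ui)
  also have "of_int 1 * th 1 = 1" using th_of_int[of 1] by simp
  finally have "cg p (of_int (iv c) * th (ui h) * x * y) (1 * y)" by (intro cg_mult cg_refl)
  hence "cg p y (of_int (iv c) * th (ui h) * (x * y))" by (simp add: mult.assoc cg_sym)
  thus ?thesis using inTh_cong inTh_mult[OF i assms(2)] by blast
qed

text \<open>A partner of \<open>th\<close>: their composition is the seventh power times a power of
  the norm. Hence the quotient of the units by \<open>inTh\<close> has exponent dividing 7.\<close>

definition th' :: "'a \<Rightarrow> 'a" where "th' x = x ^ 3 * sg (sg x)"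

lemma th_th': "th (th' x) = of_int (nm x ^ 3) * x ^ 7"
proof -
  have "(a ^ 3 * c) ^ 3 * (b ^ 3 * a) = (a * b * c) ^ 3 * a ^ 7" for a b c :: 'a
    by (simp add: eval_nat_numeral mult_ac)
  hence "th (th' x) = (x * sg x * sg (sg x)) ^ 3 * x ^ 7"
    unfolding th_def th'_def sg_mult sg_power sg3 by simp
  thus ?thesis by (simp add: nm_eq)
qed

lemma nm_th': "nm (th' x) = nm x ^ 4"
  by (simp add: th'_def nm_mult nm_power nm_sg power3_eq_cube power4_eq_xxxx)

lemma inTh_7: assumes "\<not> int p dvd nm x" shows "inTh (x ^ 7)"
proof -
  define c where "c = nm x ^ 3"
  have c: "\<not> int p dvd c" unfolding c_def using assms by (rule not_dvd_pow)
  have "cg p (of_int (iv c) * th (th' x)) (of_int (c * iv c) * x ^ 7)" by (simp add: th_th' c_def mult_ac)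
  also have "cg p \<dots> (of_int 1 * x ^ 7)" by (intro cg_mult cg_refl cg_of_int iv c)
  finally have "cg p (x ^ 7) (of_int (iv c) * th (th' x))" by (simp add: cg_sym)
  moreover have "\<not> int p dvd nm (th' x)" unfolding nm_th' using assms by (rule not_dvd_pow)
  ultimately show ?thesis unfolding inTh_def using c iv_dvd by blast
qed

text \<open>The map (c, h) -> c \<open>th\<close> h has p - 1 times as many arguments as there are
  units, but each nonempty fibre contains a copy of an orbit of 7 (p - 1) elements. So it cannot be
  onto.\<close>

lemma exists_nonTh: "\<exists>g. \<not> int p dvd nm g \<and> \<not> inTh g"
proof (rule ccontr)
  assume "\<not> ?thesis"
  hence all: "\<And>g. \<not> int p dvd nm g \<Longrightarrow> inTh g" by blast
  define D where "D = Rs \<times> UA"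
  define \<Phi> where "\<Phi> = (\<lambda>(c, h). AE.red (of_int c * th h))"
  have fD: "finite D" using finite_UA by (simp add: D_def)
  have nd: "\<not> int p dvd nm (of_int c * th h)" if "\<not> int p dvd c" "\<not> int p dvd nm h" for c h
    unfolding nm_mult nm_th by (intro not_dvd_mult not_dvd_pow not_dvd_nm_of_int that)
  have \<Phi>D: "\<Phi> d \<in> UA" if "d \<in> D" for d
    using that red_UA[OF nd] Rs_not_dvd UA_nm by (auto simp: D_def \<Phi>_def)
  have ge: "7 * (p - 1) \<le> card {d\<in>D. \<Phi> d = u}" if u: "u \<in> UA" for u
  proof -
    obtain c h where ch: "\<not> int p dvd c" "\<not> int p dvd nm h" "cg p u (of_int c * th h)"
      using all[OF UA_nm[OF u]] inTh_def by blast
    have "(\<lambda>y. snd y) ` {d\<in>D. \<Phi> d = u} \<supseteq> orb h"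
    proof
      fix y assume "y \<in> orb h"
      then obtain d j where y: "y \<in> AE" "\<not> int p dvd d" "cg p y (of_int d * ze ^ j * h)" by (rule orbE)
      define e where "e = RS.red (c * iv d ^ 4)"
      have e0: "\<not> int p dvd c * iv d ^ 4" using ch y iv_dvd by (intro not_dvd_mult not_dvd_pow) auto
      have "\<not> int p dvd nm y" using nm_dvd_cong[OF y(3)] not_dvd_nm_ze_mult[OF y(2)] ch(2)
        unfolding nm_mult[of _ h] by (simp only: dvd_mult_iff simp_thms)
      hence yU: "y \<in> UA" using y(1) by (simp add: UA_def)
      have "cg p (of_int e * th y) (of_int (c * iv d ^ 4) * (th (of_int d * ze ^ j) * th h))"
        unfolding e_def th_mult[symmetric] by (intro cg_mult cg_of_int RS.red th_cong y)
      also have "cg p \<dots> (of_int (c * iv d ^ 4) * (of_int (d ^ 4) * th h))" by (intro cg_mult cg_refl th_ze)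
      also have "of_int (c * iv d ^ 4) * (of_int (d ^ 4) * th h) = of_int (c * (d * iv d) ^ 4) * th h"
        by (simp add: power_mult_distrib mult_ac)
      also have "cg p \<dots> (of_int (c * 1 ^ 4) * th h)" by (intro cg_mult cg_refl cg_of_int cg_power iv y)
      finally have "cg p (of_int e * th y) (of_int c * th h)" by simp
      hence "AE.red (of_int e * th y) = u" using u unfolding UA_def
        by (intro AE.red_eqI cg_trans[OF _ cg_sym[OF ch(3)]]) auto
      hence "(e, y) \<in> {d\<in>D. \<Phi> d = u}" using yU red_Rs[OF e0] by (simp add: D_def \<Phi>_def e_def)
      thus "y \<in> (\<lambda>y. snd y) ` {d\<in>D. \<Phi> d = u}" by force
    qed
    hence "card (orb h) \<le> card {d\<in>D. \<Phi> d = u}" using fD by (intro surj_card_le) auto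
    thus ?thesis using card_orb[OF ch(2)] by simp
  qed
  have "card D = (\<Sum>u\<in>UA. card {d\<in>D. \<Phi> d = u})"
  proof -
    have "card D = (\<Sum>d\<in>D. 1)" by simp
    also have "\<dots> = (\<Sum>u\<in>UA. \<Sum>d | d \<in> D \<and> \<Phi> d = u. 1)" by (rule sum.group[symmetric]) (use fD finite_UA \<Phi>D in auto)
    finally show ?thesis by simp
  qed
  also have "\<dots> \<ge> (\<Sum>u\<in>UA. 7 * (p - 1))" by (rule sum_mono) (rule ge)
  finally have "card UA * (7 * (p - 1)) \<le> card UA * (p - 1)"
    using p_gt_3 by (simp add: D_def card_cartesian_product mult.commute nat_diff_distrib)
  moreover have "card UA > 0" using one_UA finite_UA by (auto simp: card_gt_0_iff)
  ultimately show False using p_gt_3 by simp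
qed

lemma nonTh_power:
  assumes g: "\<not> int p dvd nm g" "\<not> inTh g" and k: "0 < k" "k < (7::nat)"
  shows "\<not> inTh (g ^ k)"
proof
  assume a: "inTh (g ^ k)"
  have "k = 1 \<or> k = 2 \<or> k = 3 \<or> k = 4 \<or> k = 5 \<or> k = 6" using k by auto
  moreover have "(1::nat) * 1 = 7 * 0 + 1" "(2::nat) * 4 = 7 * 1 + 1" "(3::nat) * 5 = 7 * 2 + 1" "(4::nat) * 2 = 7 * 1 + 1"
    "(5::nat) * 3 = 7 * 2 + 1" "(6::nat) * 6 = 7 * 5 + 1" by simp_all
  ultimately have "\<exists>x y. k * x = 7 * y + 1" by metis
  then obtain x y where xy: "k * x = 7 * y + 1" by blast
  have "inTh ((g ^ k) ^ x)" by (rule inTh_power[OF a])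
  hence "inTh ((g ^ 7) ^ y * g)" by (simp add: xy mult.commute flip: power_mult)
  hence "inTh g" using inTh_cancel[OF inTh_power[OF inTh_7[OF g(1)]]] by blast
  thus False using g by blast
qed

text \<open>The seven powers of g represent distinct cosets of \<open>inTh\<close>. In (j, c, h) ->
  g^j c \<open>th\<close> h a fibre fixes j, is determined by h, and lies in one orbit of h, hence
  has at most 7 (p - 1) elements; the total count makes this exact, so the quotient has order
  7.\<close>

lemma theta_classes:
  assumes g: "\<not> int p dvd nm g" "\<not> inTh g" and F: "\<And>x y. cg p x y \<Longrightarrow> F x = (F y :: int)"
    and Fth: "\<And>c h x. \<not> int p dvd c \<Longrightarrow> \<not> int p dvd nm h \<Longrightarrow> F (x * (of_int c * th h)) = F x"
  shows "int (card UA) * (\<Sum>j<7. F (g ^ j)) = 7 * (\<Sum>u\<in>UA. F u)"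
proof -
  define \<Phi> where "\<Phi> = (\<lambda>(j::nat, c, h). AE.red (g ^ j * (of_int c * th h)))"
  define D where "D = {..<7::nat} \<times> Rs \<times> UA"
  have fD: "finite D" using finite_UA by (simp add: D_def)
  have nd: "\<not> int p dvd nm (g ^ j * (of_int c * th h))" if "\<not> int p dvd c" "\<not> int p dvd nm h" for j c h
    unfolding nm_mult nm_th nm_power by (intro not_dvd_mult not_dvd_pow not_dvd_nm_of_int that g)
  have aux: False if "j < j'" "j' < 7" "\<not> int p dvd c" "\<not> int p dvd c'" "\<not> int p dvd nm h" "\<not> int p dvd nm h'"
    "cg p (g ^ j * (of_int c * th h)) (g ^ j' * (of_int c' * th h'))" for j j' c c' h h'
  proof -
    have e: "g ^ j' = g ^ j * g ^ (j' - j)" using that by (simp flip: power_add)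
    have "cg p (g ^ j * (of_int c * th h)) (g ^ j * (of_int c' * th h' * g ^ (j' - j)))"
      using that(7) unfolding e by (simp add: mult_ac)
    hence "cg p (of_int c * th h) (of_int c' * th h' * g ^ (j' - j))"
      using g(1) not_dvd_pow by (elim cancel) (simp add: nm_power)
    moreover have "inTh (of_int c * th h)" "inTh (of_int c' * th h')" unfolding inTh_def using that by blast+
    ultimately have "inTh (g ^ (j' - j))" using inTh_cancel inTh_cong cg_sym by blast
    thus False using nonTh_power[OF g, of "j' - j"] that by simp
  qed
  have "(\<Sum>d\<in>D. F (\<Phi> d)) = int (7 * (p - 1)) * (\<Sum>u\<in>UA. F u)"
  proof (rule fibre_sum[OF finite_UA fD])
    fix d assume "d \<in> D"
    then obtain j c h where d: "d = (j, c, h)" "c \<in> Rs" "h \<in> UA" unfolding D_def by auto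
    show "\<Phi> d \<in> UA" unfolding d \<Phi>_def using red_UA[OF nd] Rs_not_dvd[OF d(2)] UA_nm[OF d(3)] by simp
  next
    show "card D = 7 * (p - 1) * card UA" using p_gt_3 by (auto simp: D_def card_cartesian_product nat_diff_distrib)
    fix u assume "u \<in> UA"
    show "card {d\<in>D. \<Phi> d = u} \<le> 7 * (p - 1)"
    proof (cases "{d\<in>D. \<Phi> d = u} = {}")
      case False
      then obtain j0 c0 h0 where d0: "j0 < 7" "c0 \<in> Rs" "h0 \<in> UA" "\<Phi> (j0, c0, h0) = u" unfolding D_def by auto
      note nd0 = Rs_not_dvd[OF d0(2)] UA_nm[OF d0(3)]
      have "inj_on (\<lambda>(j, c, h). h) {d\<in>D. \<Phi> d = u} \<and> (\<lambda>(j, c, h). h) ` {d\<in>D. \<Phi> d = u} \<subseteq> orb h0"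
      proof
        have main: "j = j' \<and> cg p (of_int c * th h) (of_int c' * th h')"
          if "(j, c, h) \<in> {d\<in>D. \<Phi> d = u}" "(j', c', h') \<in> {d\<in>D. \<Phi> d = u}" for j c h j' c' h'
        proof -
          have n: "\<not> int p dvd c" "\<not> int p dvd c'" "\<not> int p dvd nm h" "\<not> int p dvd nm h'" "j < 7" "j' < 7"
            using that Rs_not_dvd UA_nm by (auto simp: D_def)
          have e: "cg p (g ^ j * (of_int c * th h)) (g ^ j' * (of_int c' * th h'))"
            using that by (simp add: \<Phi>_def flip: AE.red_eq_iff)
          have "j = j'" using aux[of j j' c c' h h'] aux[of j' j c' c h' h] n e cg_sym[OF e]
            by (cases j j' rule: linorder_cases) auto
          thus ?thesis using e g(1) not_dvd_pow cancel[of "g ^ j"] by (simp add: nm_power)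
        qed
        show "inj_on (\<lambda>(j, c, h). h) {d\<in>D. \<Phi> d = u}"
        proof (rule inj_onI)
          fix d d' assume dd: "d \<in> {d\<in>D. \<Phi> d = u}" "d' \<in> {d\<in>D. \<Phi> d = u}" "(case d of (j, c, h) \<Rightarrow> h) = (case d' of (j, c, h) \<Rightarrow> h)"
          obtain j c h j' c' where d: "d = (j, c, h)" "d' = (j', c', h)" using dd(3) by (cases d; cases d') auto
          have m: "j = j'" "cg p (of_int c * th h) (of_int c' * th h)" using main dd unfolding d by blast+
          have h: "h \<in> UA" "c \<in> Rs" "c' \<in> Rs" using dd unfolding d D_def by auto
          have "cg p (of_int c :: 'a) (of_int c')"
            using m(2) cancel[of "th h" "of_int c" "of_int c'"] UA_nm[OF h(1)] not_dvd_pow by (simp add: nm_th mult.commute)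
          hence "cg p c c'" by (rule of_int_inj)
          thus "d = d'" using m(1) RS.uniq[of c c'] h(2,3) Rs_iff unfolding d by blast
        qed
        show "(\<lambda>(j, c, h). h) ` {d\<in>D. \<Phi> d = u} \<subseteq> orb h0"
        proof
          fix h assume "h \<in> (\<lambda>(j, c, h). h) ` {d\<in>D. \<Phi> d = u}"
          then obtain j c where jc: "(j, c, h) \<in> {d\<in>D. \<Phi> d = u}" by auto
          have h: "h \<in> UA" "c \<in> Rs" using jc by (auto simp: D_def)
          have "(j0, c0, h0) \<in> {d\<in>D. \<Phi> d = u}" using d0 by (simp add: D_def)
          hence e: "cg p (of_int c * th h) (of_int c0 * th h0)" using main[OF jc] by blast
          have i0: "cg p (h0 * ui h0) 1" by (rule ui[OF nd0(2)])
          have "cg p (of_int (iv c) * (of_int c * th h) * th (ui h0)) (of_int (iv c) * (of_int c0 * th h0) * th (ui h0))"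
            by (intro cg_mult cg_refl e)
          hence "cg p (of_int (c * iv c) * th (h * ui h0)) (of_int (iv c * c0) * th (h0 * ui h0))"
            by (simp add: th_mult mult_ac)
          moreover have "cg p (of_int (c * iv c) * th (h * ui h0)) (of_int 1 * th (h * ui h0))"
            by (intro cg_mult cg_refl cg_of_int iv Rs_not_dvd h)
          moreover have "cg p (of_int (iv c * c0) * th (h0 * ui h0)) (of_int (iv c * c0) * th 1)"
            by (intro cg_mult cg_refl th_cong i0)
          ultimately have "cg p (of_int 1 * th (h * ui h0)) (of_int (iv c * c0) * th 1)" by (metis cg_sym cg_trans)
          hence "cg p ((h * ui h0) ^ 3 * sg (h * ui h0)) (of_int (iv c * c0))"
            using th_of_int[of 1] by (simp add: th_def)
          moreover have nh: "\<not> int p dvd nm (h * ui h0)"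
            using UA_nm[OF h(1)] not_dvd_nm_ui[OF nd0(2)] by (simp add: nm_mult dvd_mult_iff)
          ultimately obtain d j where dj: "cg p (h * ui h0) (of_int d * ze ^ j)" using ker by blast
          have "\<not> int p dvd d"
          proof
            assume "int p dvd d"
            hence "int p dvd nm (of_int d * ze ^ j)" by (simp add: nm_mult nm_of_int power3_eq_cube)
            thus False using nm_dvd_cong[OF dj] nh by blast
          qed
          moreover have "cg p h (of_int d * ze ^ j * h0)"
          proof -
            have "cg p (h * (h0 * ui h0)) (h * 1)" by (intro cg_mult cg_refl i0)
            hence "cg p h (h * ui h0 * h0)" by (simp add: mult_ac cg_sym)
            also have "cg p \<dots> (of_int d * ze ^ j * h0)" by (intro cg_mult cg_refl dj)
            finally show ?thesis .
          qed
          ultimately show "h \<in> orb h0" using h(1) orbI unfolding UA_def by simp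
        qed
      qed
      moreover have "finite (orb h0)" by (simp add: orb_def)
      ultimately have "card {d\<in>D. \<Phi> d = u} \<le> card (orb h0)" using card_inj_on_le by blast
      thus ?thesis using card_orb[OF nd0(2)] by simp
    qed (metis card.empty le0)
  qed
  also have "(\<Sum>d\<in>D. F (\<Phi> d)) = (\<Sum>j<7. \<Sum>c\<in>Rs. \<Sum>h\<in>UA. F (g ^ j))"
  proof -
    have "(\<Sum>d\<in>D. F (\<Phi> d)) = (\<Sum>(j, c, h)\<in>D. F (g ^ j))"
    proof (rule sum.cong[OF refl])
      fix d assume "d \<in> D"
      then obtain j c h where d: "d = (j, c, h)" "c \<in> Rs" "h \<in> UA" unfolding D_def by auto
      show "F (\<Phi> d) = (case d of (j, c, h) \<Rightarrow> F (g ^ j))"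
        unfolding d \<Phi>_def using F[OF AE.red(3)] Fth[OF Rs_not_dvd[OF d(2)] UA_nm[OF d(3)]] by simp
    qed
    thus ?thesis unfolding D_def by (simp only: sum.cartesian_product)
  qed
  also have "\<dots> = (int p - 1) * (int (card UA) * (\<Sum>j<7. F (g ^ j)))"
    using p_gt_3 by (simp add: sum_distrib_left of_nat_diff mult_ac)
  also have "int (7 * (p - 1)) * (\<Sum>u\<in>UA. F u) = (int p - 1) * (7 * (\<Sum>u\<in>UA. F u))"
    using p_gt_3 by (simp add: of_nat_diff)
  finally have "(int p - 1) * (int (card UA) * (\<Sum>j<7. F (g ^ j))) = (int p - 1) * (7 * (\<Sum>u\<in>UA. F u))" .
  thus ?thesis by (rule h2_mult)
qed

text \<open>x^4 \<open>th\<close> x = x^7 \<sigma>(x), and x^7 lies in \<open>inTh\<close>, so x^4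
  and \<sigma>(x) have the same coset, while \<open>M\<close> is invariant under \<sigma>.\<close>

lemma M_power_4: assumes g: "\<not> int p dvd nm g" shows "M (g ^ (4 * j)) = M (g ^ j)"
proof -
  define x where "x = g ^ j"
  have x: "\<not> int p dvd nm x" unfolding x_def nm_power by (rule not_dvd_pow[OF g])
  have x3: "\<not> int p dvd nm x ^ 3" by (rule not_dvd_pow[OF x])
  have "M (x ^ 4) = M (x ^ 4 * th x)" by (rule M_th[OF x, symmetric])
  also have "x ^ 4 * th x = x ^ 7 * sg x" unfolding th_def by (simp flip: power_add mult.assoc)
  also have "M \<dots> = M (of_int (nm x ^ 3) * (x ^ 7 * sg x))" by (rule M_of_int[OF x3, symmetric])
  also have "of_int (nm x ^ 3) * (x ^ 7 * sg x) = sg x * th (th' x)" by (simp add: th_th' mult_ac)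
  also have "M \<dots> = M (sg x)" by (rule M_th) (simp add: nm_th' not_dvd_pow[OF x])
  also have "\<dots> = M x" by (rule M_sg)
  finally show ?thesis by (simp add: x_def mult.commute flip: power_mult)
qed

lemma M_power_7: assumes g: "\<not> int p dvd nm g" shows "M (g ^ (j + 7)) = M (g ^ j)"
proof -
  have g3: "\<not> int p dvd nm g ^ 3" by (rule not_dvd_pow[OF g])
  have "M (g ^ (j + 7)) = M (of_int (nm g ^ 3) * (g ^ j * g ^ 7))" unfolding power_add by (rule M_of_int[OF g3, symmetric])
  also have "of_int (nm g ^ 3) * (g ^ j * g ^ 7) = g ^ j * th (th' g)" by (simp add: th_th' mult_ac)
  also have "M \<dots> = M (g ^ j)" by (rule M_th) (simp add: nm_th' not_dvd_pow[OF g])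
  finally show ?thesis .
qed

text \<open>Units modulo integers times values of \<^term>\<open>th\<close> form a group of order 7 on which \<^term>\<open>sg\<close> acts as the fourth power,
  with orbits \<open>{0}\<close>, \<open>{1, 2, 4}\<close>, \<open>{3, 5, 6}\<close>.\<close>

lemma class_numbers:
  assumes E1: "(\<Sum>g\<in>{g\<in>AE. int p dvd nm g}. M g) = E1"
    and E2: "(\<Sum>g\<in>{g\<in>AE. int p dvd nm g}. (M g)\<^sup>2) = E2" and h: "h = int (card UA)"
  obtains n0 n1 n3 where "M 1 = 7 * (int p - 1) * n0"
    "h * ((int p - 1) * (n0 + 3 * n1 + 3 * n3)) = h * (int p)\<^sup>2 - E1"
    "h * (7 * (int p - 1)\<^sup>2 * (n0\<^sup>2 + 3 * n1\<^sup>2 + 3 * n3\<^sup>2)) =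
       h * (h * int p + 7 * (int p - 1) * ((int p)\<^sup>2 - int p)) - E2"
proof -
  obtain g where g: "\<not> int p dvd nm g" "\<not> inTh g" using exists_nonTh by blast
  have split: "(\<Sum>x\<in>AE. f x) = (\<Sum>x\<in>UA. f x) + (\<Sum>x\<in>{g\<in>AE. int p dvd nm g}. (f x :: int))" for f
  proof -
    have "AE = UA \<union> {g\<in>AE. int p dvd nm g}" "UA \<inter> {g\<in>AE. int p dvd nm g} = {}" by (auto simp: UA_def)
    thus ?thesis using AE.fin by (metis (no_types, lifting) finite_Un sum.union_disjoint)
  qed
  \<comment> \<open>Multiplying exponents by 4 modulo 7: 1 -> 4, 4 -> 16 = 2 and 3 -> 12 = 5, 5 ->
    20 = 6.\<close>
  have c: "M (g ^ 4) = M (g ^ 1)" "M (g ^ 2) = M (g ^ 4)" "M (g ^ 5) = M (g ^ 3)" "M (g ^ 6) = M (g ^ 5)"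
  proof -
    show "M (g ^ 4) = M (g ^ 1)" using M_power_4[OF g(1), of 1] by simp
    have "M (g ^ 16) = M (g ^ 4)" using M_power_4[OF g(1), of 4] by simp
    moreover have "M (g ^ 16) = M (g ^ 9)" "M (g ^ 9) = M (g ^ 2)" using M_power_7[OF g(1), of 9] M_power_7[OF g(1), of 2] by simp_all
    ultimately show "M (g ^ 2) = M (g ^ 4)" by simp
    have "M (g ^ 12) = M (g ^ 3)" using M_power_4[OF g(1), of 3] by simp
    moreover have "M (g ^ 12) = M (g ^ 5)" using M_power_7[OF g(1), of 5] by simp
    ultimately show "M (g ^ 5) = M (g ^ 3)" by simp
    have "M (g ^ 20) = M (g ^ 5)" using M_power_4[OF g(1), of 5] by simp
    moreover have "M (g ^ 20) = M (g ^ 13)" "M (g ^ 13) = M (g ^ 6)" using M_power_7[OF g(1), of 13] M_power_7[OF g(1), of 6] by simp_all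
    ultimately show "M (g ^ 6) = M (g ^ 5)" by simp
  qed
  obtain n0 where n0: "M 1 = 7 * (int p - 1) * n0" using M_dvd[of 1] by blast
  obtain n1 where n1: "M (g ^ 1) = 7 * (int p - 1) * n1" using M_dvd[of "g ^ 1"] by blast
  obtain n3 where n3: "M (g ^ 3) = 7 * (int p - 1) * n3" using M_dvd[of "g ^ 3"] by blast
  have s7: "(\<Sum>j<7. f (g ^ j)) = f 1 + f (g ^ 1) + f (g ^ 2) + f (g ^ 3) + f (g ^ 4) + f (g ^ 5) + (f (g ^ 6) :: int)" for f
    by (simp add: eval_nat_numeral(2-))
  have Mth: "M (x * (of_int c * th h)) = M x" if "\<not> int p dvd c" "\<not> int p dvd nm h" for c h x
  proof -
    have e: "x * (of_int c * th h) = of_int c * (x * th h)" by (simp add: mult_ac)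
    show ?thesis unfolding e M_of_int[OF that(1)] by (rule M_th[OF that(2)])
  qed
  have "h * (\<Sum>j<7. M (g ^ j)) = 7 * (\<Sum>u\<in>UA. M u)"
    unfolding h by (rule theta_classes[OF g M_cong Mth])
  also have "(\<Sum>u\<in>UA. M u) = h * (int p)\<^sup>2 - E1" using first_moment split[of M] E1 h by simp
  finally have 1: "h * ((int p - 1) * (n0 + 3 * n1 + 3 * n3)) = h * (int p)\<^sup>2 - E1"
    unfolding s7 c(4,3,2,1) n0 n1 n3 by (simp add: algebra_simps)
  have "h * (\<Sum>j<7. (M (g ^ j))\<^sup>2) = 7 * (\<Sum>u\<in>UA. (M u)\<^sup>2)"
    unfolding h
  proof (rule theta_classes[OF g])
    show "(M x)\<^sup>2 = (M y)\<^sup>2" if "cg p x y" for x y using M_cong[OF that] by simp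
    show "(M (x * (of_int c * th y)))\<^sup>2 = (M x)\<^sup>2" if "\<not> int p dvd c" "\<not> int p dvd nm y" for c x y
      unfolding Mth[OF that] ..
  qed
  also have "(\<Sum>u\<in>UA. (M u)\<^sup>2) = h * (h * int p + 7 * (int p - 1) * ((int p)\<^sup>2 - int p)) - E2"
    using second_moment_M split[of "\<lambda>g. (M g)\<^sup>2"] E2 h by simp
  finally have "7 * (h * (7 * (int p - 1)\<^sup>2 * (n0\<^sup>2 + 3 * n1\<^sup>2 + 3 * n3\<^sup>2))) =
      7 * (h * (h * int p + 7 * (int p - 1) * ((int p)\<^sup>2 - int p)) - E2)"
    unfolding s7[of "\<lambda>x. (M x)\<^sup>2"] c(4,3,2,1) n0 n1 n3 by (simp add: power2_eq_square algebra_simps)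
  hence 2: "h * (7 * (int p - 1)\<^sup>2 * (n0\<^sup>2 + 3 * n1\<^sup>2 + 3 * n3\<^sup>2)) =
      h * (h * int p + 7 * (int p - 1) * ((int p)\<^sup>2 - int p)) - E2" by simp
  show ?thesis using that[OF n0 1 2] .
qed

end

subsection \<open>The Klein quartic as a quartic with octahedral symmetry\<close>

text \<open>The coefficients that arise when the circulant substitution with entries a, b, c is made
  in the Klein quartic. The entries are conjugate over \<int>[\<alpha>], and the mixed coefficients
  vanish. The last item is minus the determinant of the circulant with entries a, b, c.\<close>

lemma klein_coeffs:
  fixes al et a b c :: "'a::comm_ring_1"
  assumes al: "cg p (al\<^sup>2 + al + 2) 0" and et: "cg p (et ^ 3 + et\<^sup>2 - 2 * et - 1) 0"
    and a: "cg p a (- 1 - al * (et\<^sup>2 - 2))" and b: "cg p b (- 1 - al * et)" and c: "cg p c (- 1 - al * (1 - et - et\<^sup>2))"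
  shows "cg p (a ^ 3 * b + b ^ 3 * c + c ^ 3 * a) (- 49)"
    and "cg p (3 * (a\<^sup>2 * b\<^sup>2 + b\<^sup>2 * c\<^sup>2 + c\<^sup>2 * a\<^sup>2) + (a * b ^ 3 + b * c ^ 3 + c * a ^ 3)) (0)"
    and "cg p (a ^ 4 + b ^ 4 + c ^ 4 + 3 * (a * b * c * (a + b + c))) (0)"
    and "cg p (a * b * c * (a + b + c) + (a * b ^ 3 + b * c ^ 3 + c * a ^ 3)) (- 49 * al)"
    and "cg p (a ^ 3 * b + b ^ 3 * c + c ^ 3 * a + (a\<^sup>2 * b\<^sup>2 + b\<^sup>2 * c\<^sup>2 + c\<^sup>2 * a\<^sup>2) + 2 * (a * b * c * (a + b + c))) (0)"
    and "cg p (3 * a * b * c - a ^ 3 - b ^ 3 - c ^ 3) (- 14 * (al + 4))"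
proof -
  define a' b' c' where d: "a' = - 1 - al * (et\<^sup>2 - 2)" "b' = - 1 - al * et" "c' = - 1 - al * (1 - et - et\<^sup>2)"
  have abc: "cg p a a'" "cg p b b'" "cg p c c'" using a b c by (simp_all only: d)
  \<comment> \<open>Membership in the ideal of the two defining relations; the long polynomials
    below are the cofactors k and l.\<close>
  have *: "cg p x y" if "x = y + (al\<^sup>2 + al + 2) * k + (et ^ 3 + et\<^sup>2 - 2 * et - 1) * l" for x y k l
  proof -
    have "cg p (y + (al\<^sup>2 + al + 2) * k + (et ^ 3 + et\<^sup>2 - 2 * et - 1) * l) (y + 0 * k + 0 * l)"
      by (intro cg_add cg_mult cg_refl al et)
    thus ?thesis using that by simp
  qed
  have "cg p (a ^ 3 * b + b ^ 3 * c + c ^ 3 * a) (a' ^ 3 * b' + b' ^ 3 * c' + c' ^ 3 * a')" by (intro cg_add cg_diff cg_mult cg_power cg_refl abc)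
  moreover have "cg p (a' ^ 3 * b' + b' ^ 3 * c' + c' ^ 3 * a') (- 49)" unfolding d
    by (rule *[of _ _ "24 - 22 * et - 31 * et ^ 2 + 30 * et ^ 3 + 22 * et ^ 4 - 10 * et ^ 5 - 5 * et ^ 6 + 2 * et ^ 7 + et ^ 8 - 11 * al + 23 * al * et + 23 * al * et ^ 2 - 27 * al * et ^ 3 - 17 * al * et ^ 4 + 2 * al * et ^ 5 + al * et ^ 6 + 2 * al * et ^ 7 + al * et ^ 8 - 2 * al ^ 2 - 2 * al ^ 2 * et + al ^ 2 * et ^ 2 - al ^ 2 * et ^ 4 + 4 * al ^ 2 * et ^ 5 + 2 * al ^ 2 * et ^ 6 - 2 * al ^ 2 * et ^ 7 - al ^ 2 * et ^ 8"
      "- 4 - 36 * et + 6 * et ^ 2 + 8 * et ^ 3 - 2 * et ^ 4 - 2 * et ^ 5 + 6 * al + 12 * al * et - 3 * al * et ^ 2 - 3 * al * et ^ 4 - 3 * al * et ^ 5"])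
      (simp add: eval_nat_numeral algebra_simps)
  ultimately show "cg p (a ^ 3 * b + b ^ 3 * c + c ^ 3 * a) (- 49)" by (rule cg_trans)
  have "cg p (3 * (a\<^sup>2 * b\<^sup>2 + b\<^sup>2 * c\<^sup>2 + c\<^sup>2 * a\<^sup>2) + (a * b ^ 3 + b * c ^ 3 + c * a ^ 3)) (3 * (a'\<^sup>2 * b'\<^sup>2 + b'\<^sup>2 * c'\<^sup>2 + c'\<^sup>2 * a'\<^sup>2) + (a' * b' ^ 3 + b' * c' ^ 3 + c' * a' ^ 3))" by (intro cg_add cg_diff cg_mult cg_power cg_refl abc)
  moreover have "cg p (3 * (a'\<^sup>2 * b'\<^sup>2 + b'\<^sup>2 * c'\<^sup>2 + c'\<^sup>2 * a'\<^sup>2) + (a' * b' ^ 3 + b' * c' ^ 3 + c' * a' ^ 3)) (0)" unfolding d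
    by (rule *[of _ _ "- 6 - 6 * et + 58 * et ^ 2 + 8 * et ^ 3 - 38 * et ^ 4 + 2 * et ^ 5 + 8 * et ^ 6 - 4 * et ^ 7 - 2 * et ^ 8 + 13 * al + 33 * al * et - 80 * al * et ^ 2 - 61 * al * et ^ 3 + 43 * al * et ^ 4 + 32 * al * et ^ 5 + 2 * al * et ^ 6 - 4 * al * et ^ 7 - 2 * al * et ^ 8 + 4 * al ^ 2 - 15 * al ^ 2 * et + 8 * al ^ 2 * et ^ 2 + 28 * al ^ 2 * et ^ 3 - al ^ 2 * et ^ 4 - 17 * al ^ 2 * et ^ 5 - 5 * al ^ 2 * et ^ 6 + 4 * al ^ 2 * et ^ 7 + 2 * al ^ 2 * et ^ 8"
      "- 24 + 36 * et + 20 * et ^ 2 - 12 * et ^ 3 + 4 * et ^ 4 + 4 * et ^ 5 + 36 * al - 12 * al * et - 42 * al * et ^ 2 - 6 * al * et ^ 3 + 6 * al * et ^ 4 + 6 * al * et ^ 5"])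
      (simp add: eval_nat_numeral algebra_simps)
  ultimately show "cg p (3 * (a\<^sup>2 * b\<^sup>2 + b\<^sup>2 * c\<^sup>2 + c\<^sup>2 * a\<^sup>2) + (a * b ^ 3 + b * c ^ 3 + c * a ^ 3)) (0)" by (rule cg_trans)
  have "cg p (a ^ 4 + b ^ 4 + c ^ 4 + 3 * (a * b * c * (a + b + c))) (a' ^ 4 + b' ^ 4 + c' ^ 4 + 3 * (a' * b' * c' * (a' + b' + c')))" by (intro cg_add cg_diff cg_mult cg_power cg_refl abc)
  moreover have "cg p (a' ^ 4 + b' ^ 4 + c' ^ 4 + 3 * (a' * b' * c' * (a' + b' + c'))) (0)" unfolding d
    by (rule *[of _ _ "20 + 28 * et - 30 * et ^ 2 - 50 * et ^ 3 + 10 * et ^ 4 + 26 * et ^ 5 + 6 * et ^ 6 - 4 * et ^ 7 - 2 * et ^ 8 - 39 * al - 35 * al * et + 96 * al * et ^ 2 + 55 * al * et ^ 3 - 53 * al * et ^ 4 - 16 * al * et ^ 5 + 6 * al * et ^ 6 - 4 * al * et ^ 7 - 2 * al * et ^ 8 + 17 * al ^ 2 + 2 * al ^ 2 * et - 36 * al ^ 2 * et ^ 2 - al ^ 2 * et ^ 3 + 23 * al ^ 2 * et ^ 4 - 5 * al ^ 2 * et ^ 5 - 6 * al ^ 2 * et ^ 6 + 4 * al ^ 2 * et ^ 7 + 2 * al ^ 2 * et ^ 8"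
      "28 - 32 * et ^ 2 - 8 * et ^ 3 + 4 * et ^ 4 + 4 * et ^ 5 - 42 * al + 42 * al * et + 36 * al * et ^ 2 - 12 * al * et ^ 3 + 6 * al * et ^ 4 + 6 * al * et ^ 5"])
      (simp add: eval_nat_numeral algebra_simps)
  ultimately show "cg p (a ^ 4 + b ^ 4 + c ^ 4 + 3 * (a * b * c * (a + b + c))) (0)" by (rule cg_trans)
  have "cg p (a * b * c * (a + b + c) + (a * b ^ 3 + b * c ^ 3 + c * a ^ 3)) (a' * b' * c' * (a' + b' + c') + (a' * b' ^ 3 + b' * c' ^ 3 + c' * a' ^ 3))" by (intro cg_add cg_diff cg_mult cg_power cg_refl abc)
  moreover have "cg p (a' * b' * c' * (a' + b' + c') + (a' * b' ^ 3 + b' * c' ^ 3 + c' * a' ^ 3)) (- 49 * al)" unfolding d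
    by (rule *[of _ _ "5 + 8 * et + 5 * et ^ 2 - 8 * et ^ 3 - 4 * et ^ 4 - 2 * et ^ 5 - et ^ 6 + 2 * et ^ 7 + et ^ 8 + 15 * al - 30 * al * et - 35 * al * et ^ 2 + 42 * al * et ^ 3 + 28 * al * et ^ 4 - 14 * al * et ^ 5 - 7 * al * et ^ 6 + 2 * al * et ^ 7 + al * et ^ 8 - 8 * al ^ 2 + 11 * al ^ 2 * et + 15 * al ^ 2 * et ^ 2 - 17 * al ^ 2 * et ^ 3 - 12 * al ^ 2 * et ^ 4 + 8 * al ^ 2 * et ^ 5 + 4 * al ^ 2 * et ^ 6 - 2 * al ^ 2 * et ^ 7 - al ^ 2 * et ^ 8"
      "4 + 8 * et - 2 * et ^ 2 - 2 * et ^ 4 - 2 * et ^ 5 - 6 * al - 40 * al * et + 9 * al * et ^ 2 + 12 * al * et ^ 3 - 3 * al * et ^ 4 - 3 * al * et ^ 5"])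
      (simp add: eval_nat_numeral algebra_simps)
  ultimately show "cg p (a * b * c * (a + b + c) + (a * b ^ 3 + b * c ^ 3 + c * a ^ 3)) (- 49 * al)" by (rule cg_trans)
  have "cg p (a ^ 3 * b + b ^ 3 * c + c ^ 3 * a + (a\<^sup>2 * b\<^sup>2 + b\<^sup>2 * c\<^sup>2 + c\<^sup>2 * a\<^sup>2) + 2 * (a * b * c * (a + b + c))) (a' ^ 3 * b' + b' ^ 3 * c' + c' ^ 3 * a' + (a'\<^sup>2 * b'\<^sup>2 + b'\<^sup>2 * c'\<^sup>2 + c'\<^sup>2 * a'\<^sup>2) + 2 * (a' * b' * c' * (a' + b' + c')))" by (intro cg_add cg_diff cg_mult cg_power cg_refl abc)
  moreover have "cg p (a' ^ 3 * b' + b' ^ 3 * c' + c' ^ 3 * a' + (a'\<^sup>2 * b'\<^sup>2 + b'\<^sup>2 * c'\<^sup>2 + c'\<^sup>2 * a'\<^sup>2) + 2 * (a' * b' * c' * (a' + b' + c'))) (0)" unfolding d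
    by (rule *[of _ _ "4 - 8 * et - 4 * et ^ 2 + 12 * et ^ 3 + 6 * et ^ 4 - 4 * et ^ 5 - 2 * et ^ 6 - 7 * al + 23 * al * et + 22 * al * et ^ 2 - 31 * al * et ^ 3 - 19 * al * et ^ 4 + 8 * al * et ^ 5 + 4 * al * et ^ 6 + 2 * al ^ 2 - 6 * al ^ 2 * et - 6 * al ^ 2 * et ^ 2 + 8 * al ^ 2 * et ^ 3 + 5 * al ^ 2 * et ^ 4 - 2 * al ^ 2 * et ^ 5 - al ^ 2 * et ^ 6"
      "- 4 - 8 * et + 4 * et ^ 2 + 4 * et ^ 3 + 6 * al + 26 * al * et - 6 * al * et ^ 2 - 6 * al * et ^ 3"])
      (simp add: eval_nat_numeral algebra_simps)
  ultimately show "cg p (a ^ 3 * b + b ^ 3 * c + c ^ 3 * a + (a\<^sup>2 * b\<^sup>2 + b\<^sup>2 * c\<^sup>2 + c\<^sup>2 * a\<^sup>2) + 2 * (a * b * c * (a + b + c))) (0)" by (rule cg_trans)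
  have "cg p (3 * a * b * c - a ^ 3 - b ^ 3 - c ^ 3) (3 * a' * b' * c' - a' ^ 3 - b' ^ 3 - c' ^ 3)" by (intro cg_add cg_diff cg_mult cg_power cg_refl abc)
  moreover have "cg p (3 * a' * b' * c' - a' ^ 3 - b' ^ 3 - c' ^ 3) (- 14 * (al + 4))" unfolding d
    by (rule *[of _ _ "28 - 12 * et - 24 * et ^ 2 + 12 * et ^ 3 + 12 * et ^ 4 - 7 * al + 3 * al * et + 6 * al * et ^ 2 - 3 * al * et ^ 3 - 3 * al * et ^ 4"
      "- 24 * et - 6 * al * et"])
      (simp add: eval_nat_numeral algebra_simps)
  ultimately show "cg p (3 * a * b * c - a ^ 3 - b ^ 3 - c ^ 3) (- 14 * (al + 4))" by (rule cg_trans)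
qed

lemma klein_expand:
  fixes a b c X Y Z :: "'a::comm_ring_1"
  assumes "x = X * a + Y * b + Z * c" "y = X * b + Y * c + Z * a" "z = X * c + Y * a + Z * b"
  shows "x ^ 3 * y + y ^ 3 * z + z ^ 3 * x =
    (a ^ 3 * b + b ^ 3 * c + c ^ 3 * a) * (X ^ 4 + Y ^ 4 + Z ^ 4)
    + (3 * (a\<^sup>2 * b\<^sup>2 + b\<^sup>2 * c\<^sup>2 + c\<^sup>2 * a\<^sup>2) + (a * b ^ 3 + b * c ^ 3 + c * a ^ 3)) * (X ^ 3 * Y + Y ^ 3 * Z + Z ^ 3 * X)
    + (a ^ 4 + b ^ 4 + c ^ 4 + 3 * (a * b * c * (a + b + c))) * (X ^ 3 * Z + Y ^ 3 * X + Z ^ 3 * Y)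
    + 3 * ((a * b * c * (a + b + c) + (a * b ^ 3 + b * c ^ 3 + c * a ^ 3)) * (X\<^sup>2 * Y\<^sup>2 + Y\<^sup>2 * Z\<^sup>2 + Z\<^sup>2 * X\<^sup>2))
    + 3 * ((a ^ 3 * b + b ^ 3 * c + c ^ 3 * a + (a\<^sup>2 * b\<^sup>2 + b\<^sup>2 * c\<^sup>2 + c\<^sup>2 * a\<^sup>2) + 2 * (a * b * c * (a + b + c))) * (X * Y * Z * (X + Y + Z)))"
  unfolding assms by (simp add: eval_nat_numeral algebra_simps)

lemma (in big_prime) klein_quartic:
  fixes a b c X Y Z al et :: "'a::comm_ring_1"
  assumes xyz: "x = X * a + Y * b + Z * c" "y = X * b + Y * c + Z * a" "z = X * c + Y * a + Z * b"
    and al: "cg p (al\<^sup>2 + al + 2) 0" and et: "cg p (et ^ 3 + et\<^sup>2 - 2 * et - 1) 0"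
    and a: "cg p a (- 1 - al * (et\<^sup>2 - 2))" and b: "cg p b (- 1 - al * et)" and c: "cg p c (- 1 - al * (1 - et - et\<^sup>2))"
  shows "cg p (x ^ 3 * y + y ^ 3 * z + z ^ 3 * x) (- 49 * quartic al X Y Z)"
proof -
  note k = klein_coeffs[OF al et a b c]
  have "cg p (x ^ 3 * y + y ^ 3 * z + z ^ 3 * x) (- 49 * (X ^ 4 + Y ^ 4 + Z ^ 4)
    + 0 * (X ^ 3 * Y + Y ^ 3 * Z + Z ^ 3 * X) + 0 * (X ^ 3 * Z + Y ^ 3 * X + Z ^ 3 * Y)
    + 3 * ((- 49 * al) * (X\<^sup>2 * Y\<^sup>2 + Y\<^sup>2 * Z\<^sup>2 + Z\<^sup>2 * X\<^sup>2)) + 3 * (0 * (X * Y * Z * (X + Y + Z))))"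
    unfolding klein_expand[OF xyz]
    by (rule cg_add[OF cg_add[OF cg_add[OF cg_add[OF
      cg_mult[OF k(1) cg_refl] cg_mult[OF k(2) cg_refl]] cg_mult[OF k(3) cg_refl]]
      cg_mult[OF cg_refl cg_mult[OF k(4) cg_refl]]] cg_mult[OF cg_refl cg_mult[OF k(5) cg_refl]]])
  thus ?thesis by (simp add: quartic_def algebra_simps)
qed

text \<open>The multipliers b c - a^2, c a - b^2, a b - c^2 form a row of the adjugate of the
  circulant matrix.\<close>

lemma circulant_kernel:
  fixes a b c X Y Z :: "'a::comm_ring_1"
  assumes "cg p (X * a + Y * b + Z * c) 0" "cg p (X * b + Y * c + Z * a) 0" "cg p (X * c + Y * a + Z * b) 0"
  shows "cg p ((3 * a * b * c - a ^ 3 - b ^ 3 - c ^ 3) * X) 0"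
proof -
  have "(3 * a * b * c - a ^ 3 - b ^ 3 - c ^ 3) * X =
    (b * c - a\<^sup>2) * (X * a + Y * b + Z * c) + (c * a - b\<^sup>2) * (X * b + Y * c + Z * a) + (a * b - c\<^sup>2) * (X * c + Y * a + Z * b)"
    by (simp add: eval_nat_numeral algebra_simps)
  also have "cg p \<dots> ((b * c - a\<^sup>2) * 0 + (c * a - b\<^sup>2) * 0 + (a * b - c\<^sup>2) * 0)"
    by (intro cg_add cg_mult cg_refl assms)
  finally show ?thesis by simp
qed

section \<open>Discriminant -7: from point counts to the value of the sum\<close>

text \<open>Eliminating n0 and q gives S^2 + 7 (n1 - n3)^2 = 4p. Both terms odd would make p even,
  so S = 2a with a = u or a = -u. Modulo 7 the equation for S reads a = q, and q is a nonresidue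
  while u is a residue.\<close>

lemma (in big_prime) D7_sign:
  fixes S q u v n0 n1 n3 :: int
  assumes uv: "int p = u\<^sup>2 + 7 * v\<^sup>2" and u: "Legendre u 7 = 1" and q: "q mod 7 \<in> {3, 5, 6}"
    and S: "3 * S = 7 * n0 - q" and 1: "n0 + 3 * n1 + 3 * n3 = q"
    and 2: "7 * (n0\<^sup>2 + 3 * n1\<^sup>2 + 3 * n3\<^sup>2) = q\<^sup>2 + 6 * int p"
  shows "S = - 2 * u"
proof -
  define d where "d = n1 - n3"
  have n0: "n0 = q - 3 * (n1 + n3)" using 1 by simp
  have "9 * (S\<^sup>2 + 7 * d\<^sup>2) = (3 * S)\<^sup>2 + 63 * d\<^sup>2" by (simp add: power2_eq_square)
  also have "\<dots> = 6 * (7 * (n0\<^sup>2 + 3 * n1\<^sup>2 + 3 * n3\<^sup>2)) - 6 * q\<^sup>2"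
    unfolding S d_def n0 by (simp add: power2_eq_square algebra_simps)
  finally have e: "S\<^sup>2 + 7 * d\<^sup>2 = 4 * int p" unfolding 2 by simp
  have podd: "odd (int p)" using prime_p p_gt_3 prime_odd_nat[of p] by simp
  have par: "even S \<longleftrightarrow> even d"
  proof -
    have "even (S\<^sup>2 + 7 * d\<^sup>2)" unfolding e by simp
    thus ?thesis by simp
  qed
  have "even S"
  proof (rule ccontr)
    assume "odd S"
    then obtain x y where xy: "S = 2 * x + 1" "d = 2 * y + 1" using par by (meson oddE)
    have "even (x\<^sup>2 + x)" "even (y\<^sup>2 + y)" by simp_all
    then obtain x' y' where x': "x\<^sup>2 + x = 2 * x'" "y\<^sup>2 + y = 2 * y'" by (meson evenE)
    have "4 * int p = 4 * (x\<^sup>2 + x) + 28 * (y\<^sup>2 + y) + 8" unfolding e[symmetric] xy by (simp add: power2_eq_square algebra_simps)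
    hence "int p = 2 * (x' + 7 * y' + 1)" unfolding x' by simp
    thus False using podd by (metis dvd_triv_left)
  qed
  then obtain a b where ab: "S = 2 * a" "d = 2 * b" using par by (meson evenE)
  have "int p = a\<^sup>2 + 7 * b\<^sup>2" using e unfolding ab by (simp add: power2_eq_square)
  hence "a = u \<or> a = - u" using norm_form_unique[OF prime_p _ uv] by simp
  \<comment> \<open>If a = u then 6u = 7 n0 - q, so q = u modulo 7.\<close>
  moreover have "a \<noteq> u"
  proof
    assume "a = u"
    hence "q = u + 7 * (n0 - u)" using S ab by simp
    hence "u mod 7 = q mod 7" by (simp only: mod_mult_self2)
    moreover have "Legendre (u mod 7) 7 = 1" using Legendre_mod[of u 7] u by (rule trans[OF sym])
    ultimately show False using q Legendre_7 by auto
  qed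
  ultimately show ?thesis using ab by simp
qed

locale cubic_alg7 = cubic_alg p AE sg tr nm ze + prime_split_7 p al
  for p :: nat and AE :: "'a::comm_ring_1 set" and sg :: "'a \<Rightarrow> 'a" and tr nm :: "'a \<Rightarrow> int" and ze :: 'a and al :: int +
  fixes eta :: 'a
  assumes sg_add: "sg (x + y) = sg x + sg y"
    and tr_eq: "of_int (tr x) = x + sg x + sg (sg x)"
    and card_AE: "card AE = p ^ 3"
    and eta: "cg p (eta ^ 3 + eta\<^sup>2 - 2 * eta - 1) 0"
    and sg_eta: "cg p (sg eta) (1 - eta - eta\<^sup>2)"
    and sg_sg_eta: "cg p (sg (sg eta)) (eta\<^sup>2 - 2)"
begin

text \<open>Basis vectors for the octahedral coordinates. \<open>om\<close>, \<open>om1\<close>,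
  \<open>om2\<close> are conjugate, so x and its conjugates are a circulant substitution of the
  coordinates X, Y, Z.\<close>

definition om :: 'a where "om = - 1 - of_int al * sg (sg eta)"
definition om1 :: 'a where "om1 = - 1 - of_int al * eta"
definition om2 :: 'a where "om2 = - 1 - of_int al * sg eta"

lemma sg_om: "sg om = om1" "sg om1 = om2" "sg om2 = om"
proof -
  have *: "sg (- 1 - of_int al * x) = - 1 - of_int al * sg x" for x
  proof -
    have "sg (- 1 - of_int al * x) = sg (of_int (- 1) + of_int (- al) * x)" by simp
    also have "\<dots> = of_int (- 1) + of_int (- al) * sg x" unfolding sg_add sg_mult sg_of_int ..
    finally show ?thesis by simp
  qed
  show "sg om = om1" "sg om1 = om2" "sg om2 = om" unfolding om_def om1_def om2_def * sg3 by simp_all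
qed

definition pt :: "int \<Rightarrow> int \<Rightarrow> int \<Rightarrow> 'a" where "pt X Y Z = of_int X * om + of_int Y * om1 + of_int Z * om2"

lemma sg_pt: "sg (pt X Y Z) = of_int X * om1 + of_int Y * om2 + of_int Z * om"
  "sg (sg (pt X Y Z)) = of_int X * om2 + of_int Y * om + of_int Z * om1"
  unfolding pt_def sg_add sg_mult sg_of_int sg_om by simp_all

lemma al_cg: "cg p ((of_int al)\<^sup>2 + of_int al + 2 :: 'a) 0"
proof -
  have "cg p (of_int (al\<^sup>2 + al + 2) :: 'a) (of_int 0)" by (rule cg_of_int) (use al in \<open>simp add: cg_0_int\<close>)
  thus ?thesis by simp
qed

lemma om_cg: "cg p om (- 1 - of_int al * (eta\<^sup>2 - 2))" "cg p om1 (- 1 - of_int al * eta)"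
    "cg p om2 (- 1 - of_int al * (1 - eta - eta\<^sup>2))"
  unfolding om_def om1_def om2_def by (intro cg_diff cg_mult cg_refl sg_eta sg_sg_eta)+

lemma tr_th_pt: "cg p (tr (th (pt X Y Z))) (- 49 * quartic al X Y Z)"
proof (rule of_int_inj)
  have "of_int (tr (th (pt X Y Z))) = pt X Y Z ^ 3 * sg (pt X Y Z) + sg (pt X Y Z) ^ 3 * sg (sg (pt X Y Z)) + sg (sg (pt X Y Z)) ^ 3 * pt X Y Z"
    unfolding tr_eq th_def sg_mult sg_power sg3 ..
  also have "cg p \<dots> (- 49 * quartic (of_int al) (of_int X) (of_int Y) (of_int Z))"
    by (rule klein_quartic[OF pt_def sg_pt al_cg eta om_cg])
  finally show "cg p (of_int (tr (th (pt X Y Z))) :: 'a) (of_int (- 49 * quartic al X Y Z))"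
    by (simp add: quartic_def)
qed

lemma pt_kernel: assumes "cg p (pt X Y Z) 0" shows "int p dvd X" "int p dvd Y" "int p dvd Z"
proof -
  note D = klein_coeffs(6)[OF al_cg eta om_cg]
  have al4: "\<not> int p dvd - 14 * (al + 4)"
  proof -
    have 14: "\<not> int p dvd 14" using not_dvd_mult[OF not_dvd_2 not_dvd_7] by simp
    \<comment> \<open>(\<alpha> + 4)(3 - \<alpha>) = 14: the circulant determinant is a unit away
      from 2 and 7.\<close>
    have "\<not> int p dvd al + 4"
      by (rule not_dvd_cofactor[OF al, of _ "3 - al" "- 1" 14]) (simp_all add: 14 power2_eq_square algebra_simps)
    thus ?thesis using not_dvd_mult[of "- 14" "al + 4"] 14 by simp
  qed
  have fin: "int p dvd U" if "cg p ((3 * om * om1 * om2 - om ^ 3 - om1 ^ 3 - om2 ^ 3) * of_int U) 0" for U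
  proof -
    have "cg p ((3 * om * om1 * om2 - om ^ 3 - om1 ^ 3 - om2 ^ 3) * of_int U) (- 14 * (of_int al + 4) * of_int U)"
      by (intro cg_mult cg_refl D)
    from cg_trans[OF cg_sym[OF this] that] have "cg p (of_int (- 14 * (al + 4) * U) :: 'a) (of_int 0)" by simp
    hence "int p dvd - 14 * (al + 4) * U" using of_int_inj cg_0_int by blast
    thus ?thesis using al4 dvd_mult_iff by blast
  qed
  have z: "cg p (sg x) 0" if "cg p x 0" for x using cg_sg[OF that] sg_of_int[of 0] by simp
  have e: "cg p (of_int X * om + of_int Y * om1 + of_int Z * om2) 0"
    "cg p (of_int X * om1 + of_int Y * om2 + of_int Z * om) 0"
    "cg p (of_int X * om2 + of_int Y * om + of_int Z * om1) 0" 
    using assms z[OF assms] z[OF z[OF assms]] unfolding sg_pt(2) unfolding sg_pt(1) unfolding pt_def by simp_all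
  show "int p dvd X" by (rule fin[OF circulant_kernel[OF e]])
  have e2: "cg p (of_int Y * om + of_int Z * om1 + of_int X * om2) 0"
    "cg p (of_int Y * om1 + of_int Z * om2 + of_int X * om) 0"
    "cg p (of_int Y * om2 + of_int Z * om + of_int X * om1) 0"
    using e by (simp_all only: ac_simps)
  show "int p dvd Y" by (rule fin[OF circulant_kernel[OF e2]])
  have e3: "cg p (of_int Z * om + of_int X * om1 + of_int Y * om2) 0"
    "cg p (of_int Z * om1 + of_int X * om2 + of_int Y * om) 0"
    "cg p (of_int Z * om2 + of_int X * om + of_int Y * om1) 0"
    using e by (simp_all only: ac_simps)
  show "int p dvd Z" by (rule fin[OF circulant_kernel[OF e3]])
qed

lemma klein_count: "(\<Sum>x\<in>AE. of_bool (int p dvd tr (th x))) = (int p)\<^sup>2 + 3 * (int p - 1) * S 21 112"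
proof -
  define \<Phi> where "\<Phi> = (\<lambda>(X, Y, Z). AE.red (pt X Y Z))"
  have inj: "inj_on \<Phi> (R \<times> R \<times> R)"
  proof (rule inj_onI)
    fix a b assume ab: "a \<in> R \<times> R \<times> R" "b \<in> R \<times> R \<times> R" "\<Phi> a = \<Phi> b"
    obtain X Y Z X' Y' Z' where d: "a = (X, Y, Z)" "b = (X', Y', Z')" by (cases a; cases b) auto
    have "cg p (pt X Y Z) (pt X' Y' Z')" using ab(3) unfolding d \<Phi>_def by (simp add: AE.red_eq_iff)
    hence "cg p (pt (X - X') (Y - Y') (Z - Z')) 0" by (simp add: cg_def pt_def algebra_simps)
    hence "cg p X X'" "cg p Y Y'" "cg p Z Z'" using pt_kernel by (simp_all add: cg_def)
    thus "a = b" using ab(1,2) RS.uniq unfolding d by (simp del: atLeastLessThan_iff)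
  qed
  have "card (\<Phi> ` (R \<times> R \<times> R)) = card AE"
    unfolding card_image[OF inj] card_AE by (simp add: card_cartesian_product power3_eq_cube)
  moreover have "\<Phi> ` (R \<times> R \<times> R) \<subseteq> AE" using AE.red by (auto simp: \<Phi>_def)
  ultimately have im: "\<Phi> ` (R \<times> R \<times> R) = AE" using AE.fin by (metis card_subset_eq)
  have "(\<Sum>x\<in>AE. of_bool (int p dvd tr (th x))) = (\<Sum>x\<in>R \<times> R \<times> R. of_bool (int p dvd tr (th (\<Phi> x))) :: int)"
    unfolding im[symmetric] sum.reindex[OF inj] by simp
  also have "\<dots> = (\<Sum>(X, Y, Z)\<in>R \<times> R \<times> R. of_bool (cg p (quartic al X Y Z) 0))"
  proof (rule sum.cong[OF refl])
    fix x assume "x \<in> R \<times> R \<times> R"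
    obtain X Y Z where x: "x = (X, Y, Z)" by (cases x)
    have "int p dvd tr (th (AE.red (pt X Y Z))) \<longleftrightarrow> int p dvd tr (th (pt X Y Z))"
      by (rule tr_dvd_cong[OF th_cong[OF AE.red(3)]])
    also have "\<dots> \<longleftrightarrow> int p dvd - 49 * quartic al X Y Z" by (rule cg_cong_dvd[OF tr_th_pt])
    also have "\<dots> \<longleftrightarrow> cg p (quartic al X Y Z) 0"
      using not_dvd_mult[OF not_dvd_7 not_dvd_7] by (simp add: cg_0_int dvd_mult_iff)
    finally show "of_bool (int p dvd tr (th (\<Phi> x))) = (case x of (X, Y, Z) \<Rightarrow> of_bool (cg p (quartic al X Y Z) 0))"
      by (simp add: x \<Phi>_def)
  qed
  also have "\<dots> = (\<Sum>X\<in>R. \<Sum>Y\<in>R. \<Sum>Z\<in>R. of_bool (cg p (quartic al X Y Z) 0))" by (simp only: sum.cartesian_product)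
  finally show ?thesis by (simp only: quartic_count)
qed

text \<open>p + 1 - q is the number of projective points of the Klein quartic with norm 0, and E1,
  E2 come from the twists by g of norm 0. Writing all of them in q and h treats both kinds of
  splitting at once; dividing by h and powers of p - 1 gives exactly the equations of
  \<open>D7_sign\<close>.\<close>

lemma S_D7_from_counts:
  fixes u v q :: int
  assumes uv: "int p = u\<^sup>2 + 7 * v\<^sup>2" and u: "Legendre u 7 = 1" and q: "q mod 7 \<in> {3, 5, 6}"
    and E0: "(\<Sum>x\<in>{x\<in>AE. int p dvd nm x}. of_bool (int p dvd tr (th x))) = (int p + 1 - q) * (int p - 1) + 1"
    and E1: "(\<Sum>g\<in>{g\<in>AE. int p dvd nm g}. M g) = h * ((int p + 1 - q) * (int p - 1) + 1)"
    and E2: "(\<Sum>g\<in>{g\<in>AE. int p dvd nm g}. (M g)\<^sup>2) = (int p + 2 - q) * h\<^sup>2"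
    and h: "h = int (card UA)"
    and cases: "q = int p + 1 \<and> h = int p ^ 3 - 1 \<or> q = int p - 2 \<and> h = (int p - 1) ^ 3"
  shows "S 21 112 = - 2 * u"
proof -
  obtain n0 n1 n3 where n: "M 1 = 7 * (int p - 1) * n0"
    "h * ((int p - 1) * (n0 + 3 * n1 + 3 * n3)) = h * (int p)\<^sup>2 - h * ((int p + 1 - q) * (int p - 1) + 1)"
    "h * (7 * (int p - 1)\<^sup>2 * (n0\<^sup>2 + 3 * n1\<^sup>2 + 3 * n3\<^sup>2)) =
       h * (h * int p + 7 * (int p - 1) * ((int p)\<^sup>2 - int p)) - (int p + 2 - q) * h\<^sup>2"
    using class_numbers[OF E1 E2 h] by blast
  define r where "r = int p - 1"
  have r: "int p = r + 1" "r > 0" using p_gt_3 by (simp_all add: r_def)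
  have h0: "h \<noteq> 0" unfolding h using one_UA finite_UA by auto
  have "h * (r * (n0 + 3 * n1 + 3 * n3)) = h * (r * q)" using n(2) unfolding r(1) by (simp add: power2_eq_square algebra_simps)
  hence 1: "n0 + 3 * n1 + 3 * n3 = q" using h0 r(2) by simp
  have 2: "7 * (n0\<^sup>2 + 3 * n1\<^sup>2 + 3 * n3\<^sup>2) = q\<^sup>2 + 6 * int p"
  proof -
    have "h * (r\<^sup>2 * (7 * (n0\<^sup>2 + 3 * n1\<^sup>2 + 3 * n3\<^sup>2))) = h * (h * (q - 1 - r - 1) + h * r + 7 * r * (r * (r + 1)))"
      using n(3) unfolding r(1) by (simp add: power2_eq_square algebra_simps)
    hence "r\<^sup>2 * (7 * (n0\<^sup>2 + 3 * n1\<^sup>2 + 3 * n3\<^sup>2)) = h * (q - 2) + 7 * r * (r * (r + 1))"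
      unfolding mult_left_cancel[OF h0] by (simp add: algebra_simps)
    also have "\<dots> = r\<^sup>2 * (q\<^sup>2 + 6 * int p)"
      using cases
    proof (elim disjE conjE)
      assume "q = int p + 1" "h = int p ^ 3 - 1"
      hence "q = r + 2" "h = (r + 1) ^ 3 - 1" by (simp_all add: r(1))
      thus ?thesis unfolding r(1) by (simp only:) (simp add: eval_nat_numeral algebra_simps)
    next
      assume "q = int p - 2" "h = (int p - 1) ^ 3"
      hence "q = r - 1" "h = r ^ 3" by (simp_all add: r(1))
      thus ?thesis unfolding r(1) by (simp only:) (simp add: eval_nat_numeral algebra_simps)
    qed
    finally show ?thesis using r(2) by simp
  qed
  have split: "(\<Sum>x\<in>AE. f x) = (\<Sum>x\<in>UA. f x) + (\<Sum>x\<in>{g\<in>AE. int p dvd nm g}. (f x :: int))" for f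
  proof -
    have "AE = UA \<union> {g\<in>AE. int p dvd nm g}" "UA \<inter> {g\<in>AE. int p dvd nm g} = {}" by (auto simp: UA_def)
    thus ?thesis using AE.fin by (metis (no_types, lifting) finite_Un sum.union_disjoint)
  qed
  have "M 1 + ((int p + 1 - q) * (int p - 1) + 1) = (int p)\<^sup>2 + 3 * (int p - 1) * S 21 112"
    using klein_count split[of "\<lambda>x. of_bool (int p dvd tr (th x))"] E0 by (simp add: M_def)
  hence "r * (3 * S 21 112) = r * (7 * n0 - q)" unfolding n(1) r(1) by (simp add: power2_eq_square algebra_simps)
  hence 3: "3 * S 21 112 = 7 * n0 - q" using r(2) by simp
  show ?thesis by (rule D7_sign[OF uv u q 3 1 2])
qed

end

section \<open>Linear conditions over F_p\<close>

context big_prime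
begin

lemma count_linear:
  assumes a: "\<not> int p dvd a"
  shows "(\<Sum>x\<in>R. of_bool (int p dvd a * x + e)) = (1::int)"
proof -
  have "int p dvd a * x + e \<longleftrightarrow> cg p (- e * iv a) x" for x
  proof -
    have "cg p (a * iv a) 1" by (rule iv[OF a])
    hence "cg p (a * (- e * iv a)) (- e)" using cg_mult[OF cg_refl[of p "- e"]] by (fastforce simp: mult_ac)
    hence "cg p (a * x) (- e) \<longleftrightarrow> cg p (a * (- e * iv a)) (a * x)" by (metis cg_sym cg_trans)
    also have "\<dots> \<longleftrightarrow> cg p (- e * iv a) x" using cg_cancel[OF _ a] cg_mult[OF cg_refl] by blast
    finally show ?thesis by (simp add: cg_def)
  qed
  hence "(\<Sum>x\<in>R. of_bool (int p dvd a * x + e) * 1) = (1::int)" by (intro sum_of_bool_unique) auto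
  thus ?thesis by simp
qed

lemma count_linear_unit:
  assumes a: "\<not> int p dvd a" and e: "\<not> int p dvd e"
  shows "(\<Sum>x\<in>Rs. of_bool (int p dvd a * x + e)) = (1::int)"
  using count_linear[OF a, of e] e unfolding sum_R_Rs by simp

text \<open>The first form is solved for x; the second then becomes a form in y, z whose
  coefficients m, n are 2 x 2 minors. Only if both vanish is it no further condition.\<close>

lemma count_two_linear:
  assumes a: "\<not> int p dvd a"
  shows "(\<Sum>x\<in>R. \<Sum>y\<in>R. \<Sum>z\<in>R. of_bool (int p dvd a * x + b * y + c * z) * of_bool (int p dvd a' * x + b' * y + c' * z)) =
    (if int p dvd a * b' - a' * b \<and> int p dvd a * c' - a' * c then (int p)\<^sup>2 else int p)"
proof -
  define m n where "m = a * b' - a' * b" and "n = a * c' - a' * c"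
  have "(of_bool (int p dvd a * x + b * y + c * z) * of_bool (int p dvd a' * x + b' * y + c' * z) :: int) =
     of_bool (int p dvd a * x + (b * y + c * z)) * of_bool (int p dvd m * y + n * z)" for x y z
  proof (cases "int p dvd a * x + b * y + c * z")
    case True
    have e: "a * (a' * x + b' * y + c' * z) = a' * (a * x + b * y + c * z) + (m * y + n * z)"
      by (simp add: m_def n_def algebra_simps)
    have "int p dvd a' * x + b' * y + c' * z \<longleftrightarrow> int p dvd a * (a' * x + b' * y + c' * z)" using a dvd_mult_iff by blast
    also have "\<dots> \<longleftrightarrow> int p dvd m * y + n * z" unfolding e using True dvd_add_right_iff dvd_mult by blast
    finally show ?thesis using True by (simp add: add.assoc)
  qed (simp add: add.assoc)
  hence "(\<Sum>x\<in>R. \<Sum>y\<in>R. \<Sum>z\<in>R. of_bool (int p dvd a * x + b * y + c * z) * of_bool (int p dvd a' * x + b' * y + c' * z)) =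
    (\<Sum>x\<in>R. \<Sum>y\<in>R. \<Sum>z\<in>R. of_bool (int p dvd a * x + (b * y + c * z)) * (of_bool (int p dvd m * y + n * z) :: int))"
    by simp
  also have "\<dots> = (\<Sum>y\<in>R. \<Sum>x\<in>R. \<Sum>z\<in>R. of_bool (int p dvd a * x + (b * y + c * z)) * (of_bool (int p dvd m * y + n * z) :: int))"
    by (rule sum.swap)
  also have "\<dots> = (\<Sum>y\<in>R. \<Sum>z\<in>R. \<Sum>x\<in>R. of_bool (int p dvd a * x + (b * y + c * z)) * (of_bool (int p dvd m * y + n * z) :: int))"
    by (rule sum.cong[OF refl], rule sum.swap)
  also have "\<dots> = (\<Sum>y\<in>R. \<Sum>z\<in>R. of_bool (int p dvd m * y + n * z))"
    unfolding sum_distrib_right[symmetric] count_linear[OF a] by simp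
  also have "\<dots> = (if int p dvd m \<and> int p dvd n then (int p)\<^sup>2 else int p)"
  proof (cases "int p dvd n")
    case False
    have "(\<Sum>y\<in>R. \<Sum>z\<in>R. of_bool (int p dvd n * z + m * y)) = int p" unfolding count_linear[OF False] by simp
    thus ?thesis using False by (simp add: add.commute)
  next
    case True
    have e: "int p dvd m * y + n * z \<longleftrightarrow> int p dvd m * y + 0" for y z using True by (simp add: dvd_add_left_iff)
    have "(\<Sum>y\<in>R. of_bool (int p dvd m * y + 0)) = (if int p dvd m then int p else 1)"
      using count_linear[of m 0] by (cases "int p dvd m") auto
    thus ?thesis using True unfolding e by (simp add: power2_eq_square flip: sum_distrib_left)
  qed
  finally show ?thesis by (simp add: m_def n_def)
qed

end

subsection \<open>Primes congruent to 1 modulo 7\<close>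

text \<open>Triples with componentwise operations. For p = 1 modulo 7 the cubic algebra splits
  completely, and the Galois action is the cyclic shift.\<close>

datatype t3 = T3 int int int

instantiation t3 :: comm_ring_1
begin
definition "0 = T3 0 0 0"
definition "1 = T3 1 1 1"
fun plus_t3 where "T3 a b c + T3 a' b' c' = T3 (a + a') (b + b') (c + c')"
fun uminus_t3 where "- T3 a b c = T3 (- a) (- b) (- c)"
fun minus_t3 where "T3 a b c - T3 a' b' c' = T3 (a - a') (b - b') (c - c')"
fun times_t3 where "T3 a b c * T3 a' b' c' = T3 (a * a') (b * b') (c * c')"
instance
proof
  fix x y z :: t3
  show "x * y * z = x * (y * z)" by (cases x; cases y; cases z) simp
  show "(x + y) * z = x * z + y * z" by (cases x; cases y; cases z) (simp add: algebra_simps)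
  show "x * y = y * x" by (cases x; cases y) simp
  show "x + y + z = x + (y + z)" by (cases x; cases y; cases z) simp
  show "x + y = y + x" by (cases x; cases y) simp
  show "x - y = x + - y" by (cases x; cases y) simp
  show "0 + x = x" "- x + x = 0" "1 * x = x" by (cases x; simp add: zero_t3_def one_t3_def)+
  show "(0::t3) \<noteq> 1" by (simp add: zero_t3_def one_t3_def)
qed
end

lemma of_int_t3: "of_int c = T3 c c c"
proof -
  have n: "of_nat n = T3 (int n) (int n) (int n)" for n by (induction n) (auto simp: zero_t3_def one_t3_def)
  show ?thesis
  proof (cases c rule: int_cases2)
    case (nonneg n) thus ?thesis by (simp add: n)
  next
    case (nonpos n) thus ?thesis by (simp add: n)
  qed
qed

lemma t3_power: "T3 a b c ^ k = T3 (a ^ k) (b ^ k) (c ^ k)"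
  by (induction k) (auto simp: one_t3_def)

lemma cg_t3: "cg p (T3 a b c) (T3 a' b' c') \<longleftrightarrow> cg p a a' \<and> cg p b b' \<and> cg p c c'"
proof -
  have "T3 (int p) (int p) (int p) dvd T3 x y z \<longleftrightarrow> int p dvd x \<and> int p dvd y \<and> int p dvd z" for x y z
  proof
    assume "T3 (int p) (int p) (int p) dvd T3 x y z"
    then obtain w where w: "T3 x y z = T3 (int p) (int p) (int p) * w" by (elim dvdE)
    thus "int p dvd x \<and> int p dvd y \<and> int p dvd z" by (cases w) auto
  next
    assume "int p dvd x \<and> int p dvd y \<and> int p dvd z"
    then obtain x' y' z' where "x = int p * x'" "y = int p * y'" "z = int p * z'" by (elim conjE dvdE)
    hence "T3 x y z = T3 (int p) (int p) (int p) * T3 x' y' z'" by simp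
    thus "T3 (int p) (int p) (int p) dvd T3 x y z" by (rule dvdI)
  qed
  moreover have "of_nat p = T3 (int p) (int p) (int p)" using of_int_t3[of "int p"] by simp
  ultimately show ?thesis by (simp add: cg_def)
qed

fun t3sg :: "t3 \<Rightarrow> t3" where "t3sg (T3 a b c) = T3 b c a"
fun t3tr :: "t3 \<Rightarrow> int" where "t3tr (T3 a b c) = a + b + c"
fun t3nm :: "t3 \<Rightarrow> int" where "t3nm (T3 a b c) = a * b * c"

context big_prime
begin

definition A3 :: "t3 set" where "A3 = (\<lambda>(a, b, c). T3 a b c) ` (R \<times> R \<times> R)"

lemma ressys_A3: "ressys p A3"
proof
  show "finite A3" by (simp add: A3_def)
  show "\<exists>y\<in>A3. cg p x y" for x
  proof (cases x)
    case (T3 a b c)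
    show ?thesis
    proof (rule bexI)
      show "cg p x (T3 (RS.red a) (RS.red b) (RS.red c))" by (simp add: T3 cg_t3 RS.red)
      show "T3 (RS.red a) (RS.red b) (RS.red c) \<in> A3" unfolding A3_def using RS.red(1) by (intro rev_image_eqI[of "(_, _, _)"]) auto
    qed
  qed
  fix x y assume "x \<in> A3" "y \<in> A3" "cg p x y"
  thus "x = y" unfolding A3_def using RS.uniq by (auto simp: cg_t3 simp del: atLeastLessThan_iff)
qed

lemma sum_A3: "(\<Sum>x\<in>A3. f x) = (\<Sum>a\<in>R. \<Sum>b\<in>R. \<Sum>c\<in>R. (f (T3 a b c) :: int))"
proof -
  have "(\<Sum>x\<in>A3. f x) = (\<Sum>(a, b, c)\<in>R \<times> R \<times> R. f (T3 a b c))"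
    unfolding A3_def by (subst sum.reindex) (auto simp: inj_on_def case_prod_unfold)
  thus ?thesis by (simp only: sum.cartesian_product)
qed

definition U3 :: "t3 set" where "U3 = {x\<in>A3. \<not> int p dvd t3nm x}"

lemma U3_eq: "U3 = (\<lambda>(a, b, c). T3 a b c) ` (Rs \<times> Rs \<times> Rs)"
proof (intro equalityI subsetI)
  fix x assume "x \<in> U3"
  then obtain a b c where x: "x = T3 a b c" "a \<in> R" "b \<in> R" "c \<in> R" "\<not> int p dvd a * b * c" unfolding U3_def A3_def by auto
  hence "a \<in> Rs" "b \<in> Rs" "c \<in> Rs" unfolding Rs_iff by auto
  thus "x \<in> (\<lambda>(a, b, c). T3 a b c) ` (Rs \<times> Rs \<times> Rs)" using x(1) by force
next
  fix x assume "x \<in> (\<lambda>(a, b, c). T3 a b c) ` (Rs \<times> Rs \<times> Rs)"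
  then obtain a b c where x: "x = T3 a b c" "a \<in> Rs" "b \<in> Rs" "c \<in> Rs" by auto
  hence "\<not> int p dvd a * b * c" "a \<in> R" "b \<in> R" "c \<in> R" using not_dvd_mult[OF not_dvd_mult] unfolding Rs_iff by blast+
  thus "x \<in> U3" unfolding U3_def A3_def x(1) by force
qed

lemma sum_U3: "(\<Sum>x\<in>U3. f x) = (\<Sum>a\<in>Rs. \<Sum>b\<in>Rs. \<Sum>c\<in>Rs. (f (T3 a b c) :: int))"
proof -
  have "(\<Sum>x\<in>U3. f x) = (\<Sum>(a, b, c)\<in>Rs \<times> Rs \<times> Rs. f (T3 a b c))"
    unfolding U3_eq by (subst sum.reindex) (auto simp: inj_on_def case_prod_unfold)
  thus ?thesis by (simp only: sum.cartesian_product)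
qed

lemma int_card_Rs: "(\<Sum>x\<in>Rs. k) = (int p - 1) * (k::int)"
  using p_gt_3 by (simp add: of_nat_diff)

lemma card_U3: "int (card U3) = (int p - 1) ^ 3"
proof -
  have "int (card U3) = (\<Sum>x\<in>U3. 1)" by simp
  also have "\<dots> = (int p - 1) ^ 3" unfolding sum_U3 int_card_Rs by (simp add: power3_eq_cube)
  finally show ?thesis .
qed

lemma sum_nonunit_t3: "(\<Sum>x\<in>{x\<in>A3. int p dvd t3nm x}. f x) = f (T3 0 0 0) + (\<Sum>x\<in>Rs. f (T3 x 0 0) + f (T3 0 x 0) + f (T3 0 0 x))
    + (\<Sum>x\<in>Rs. \<Sum>y\<in>Rs. f (T3 x y 0) + f (T3 0 x y) + (f (T3 y 0 x) :: int))"
proof -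
  have fin: "finite A3" by (simp add: A3_def)
  have "A3 = U3 \<union> {x\<in>A3. int p dvd t3nm x}" "U3 \<inter> {x\<in>A3. int p dvd t3nm x} = {}" by (auto simp: U3_def)
  hence "(\<Sum>x\<in>A3. f x) = (\<Sum>x\<in>U3. f x) + (\<Sum>x\<in>{x\<in>A3. int p dvd t3nm x}. f x)"
    using fin by (metis (no_types, lifting) finite_Un sum.union_disjoint)
  moreover have "(\<Sum>x\<in>Rs. \<Sum>y\<in>Rs. f (T3 x 0 y)) = (\<Sum>x\<in>Rs. \<Sum>y\<in>Rs. f (T3 y 0 x))" by (rule sum.swap)
  ultimately show ?thesis unfolding sum_A3 sum_U3 by (simp add: sum_R_Rs sum.distrib)
qed

lemma prim_root_cong: "prim_root q w \<Longrightarrow> i mod q = j mod q \<Longrightarrow> cg p (w ^ i) (w ^ j)"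
  using prim_root_power_mod[of q w i] prim_root_power_mod[of q w j] cg_trans[OF _ cg_sym] by simp

text \<open>z + 1/z for a seventh root of unity z.\<close>

definition tt :: "int \<Rightarrow> int" where "tt z = z + z ^ 6"

lemma tt_cong: "cg p x y \<Longrightarrow> cg p (tt x) (tt y)"
  unfolding tt_def by (intro cg_add cg_power)

text \<open>The minimal polynomial of \<eta> and its conjugates under z -> z^4 and z -> z^2. Each is
  a combination of z^7 - 1 and 1 + z + ... + z^6 with the displayed cofactors.\<close>

lemma tt_relations:
  assumes z: "prim_root 7 z"
  shows "cg p (tt z ^ 3 + (tt z)\<^sup>2 - 2 * tt z - 1) 0"
    and "cg p (tt (z ^ 4)) (1 - tt z - (tt z)\<^sup>2)" and "cg p (tt (z\<^sup>2)) ((tt z)\<^sup>2 - 2)"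
proof -
  define F where "F = 1 + z + z\<^sup>2 + z ^ 3 + z ^ 4 + z ^ 5 + z ^ 6"
  have z7: "cg p (z ^ 7 - 1) 0" using z by (simp add: prim_root_def cg_def)
  have F: "cg p F 0"
  proof -
    have "\<not> cg p (z ^ 1) 1" using z unfolding prim_root_def by (meson one_less_numeral_iff semiring_norm(77) zero_less_one)
    hence n: "\<not> int p dvd z - 1" by (simp add: cg_def)
    have "(z - 1) * F = z ^ 7 - 1" by (simp add: F_def eval_nat_numeral algebra_simps)
    hence "cg p ((z - 1) * F) ((z - 1) * 0)" using z7 by simp
    thus ?thesis using n by (rule cg_cancel)
  qed
  have *: "cg p x y" if "x = y + (z ^ 7 - 1) * k + F * l" for x y k l
  proof -
    have "cg p (y + (z ^ 7 - 1) * k + F * l) (y + 0 * k + 0 * l)" by (intro cg_add cg_mult cg_refl z7 F)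
    thus ?thesis using that by simp
  qed
  show "cg p (tt z ^ 3 + (tt z)\<^sup>2 - 2 * tt z - 1) 0" unfolding F_def tt_def
    by (rule *[of _ _ "2 + 3 * z + z ^ 4 + z ^ 5 + 3 * z ^ 6 + z ^ 11" 1]) (simp add: F_def eval_nat_numeral algebra_simps)
  show "cg p (tt (z ^ 4)) (1 - tt z - (tt z)\<^sup>2)" unfolding F_def tt_def
    by (rule *[of _ _ "2 + z ^ 3 + z ^ 5 + z ^ 10 + z ^ 17" 1]) (simp add: F_def eval_nat_numeral algebra_simps)
  show "cg p (tt (z\<^sup>2)) ((tt z)\<^sup>2 - 2)" unfolding F_def tt_def
    by (rule *[of _ _ "-2" 0]) (simp add: F_def eval_nat_numeral algebra_simps)
qed

end

locale split7 = prime_split_7 p al for p :: nat and al :: int +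
  fixes w :: int
  assumes w: "prim_root 7 w"
begin

lemma w0: "\<not> int p dvd w" using w by (rule prim_root_not_dvd)

lemma wk0: "\<not> int p dvd w ^ k" using w0 by (rule not_dvd_pow)

lemma prim_root_w: "k mod 7 \<noteq> 0 \<Longrightarrow> prim_root 7 (w ^ k)"
proof (rule prim_root_prime)
  assume k: "k mod 7 \<noteq> 0"
  show "prime (7::nat)" by simp
  show "cg p ((w ^ k) ^ 7) 1" using prim_root_cong[OF w, of "k * 7" 0] by (simp flip: power_mult)
  show "\<not> cg p (w ^ k) 1"
  proof
    assume "cg p (w ^ k) 1"
    hence "cg p (w ^ (k mod 7)) (w ^ 0)" using prim_root_cong[OF w, of "k mod 7" k] cg_trans by fastforce
    hence "k mod 7 = 0" by (rule prim_root_inj[OF w, rotated 2]) auto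
    thus False using k by simp
  qed
qed

text \<open>If x^3 y, y^3 z and z^3 x all equal c, then x^28 (y^3 z)^3 = (x^3 y)^9 (z^3 x) yields
  c^7 = (x^4)^7, so c = w^k x^4. Hence y = w^k x and z = w^(5k) x, which is the scalar x w^(2k)
  times the 5k-th power of the root (w, w^4, w^2).\<close>

lemma t3_ker:
  assumes u: "\<not> int p dvd t3nm u" and c: "cg p (u ^ 3 * t3sg u) (of_int c)"
  shows "\<exists>d j. cg p u (of_int d * T3 w (w ^ 4) (w\<^sup>2) ^ j)"
proof (cases u)
  case (T3 x y z)
  have n: "\<not> int p dvd x" "\<not> int p dvd y" "\<not> int p dvd z" using u unfolding T3 by auto
  have e: "cg p (x ^ 3 * y) c" "cg p (y ^ 3 * z) c" "cg p (z ^ 3 * x) c"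
    using c unfolding T3 by (simp_all add: t3_power of_int_t3 cg_t3)
  have c0: "\<not> int p dvd c" using cg_cong_dvd[OF e(1)] not_dvd_mult[OF not_dvd_pow[OF n(1)] n(2)] by blast
  have "cg p (x ^ 28 * (y ^ 3 * z) ^ 3) (x ^ 28 * c ^ 3)" by (intro cg_mult cg_power cg_refl e)
  also have "x ^ 28 * (y ^ 3 * z) ^ 3 = (x ^ 3 * y) ^ 9 * (z ^ 3 * x)"
  proof -
    have "x ^ 28 = (x ^ 3) ^ 9 * x" by (simp flip: power_mult power_Suc2)
    thus ?thesis by (simp add: power_mult_distrib mult_ac flip: power_mult)
  qed
  finally have "cg p (x ^ 28 * c ^ 3) ((x ^ 3 * y) ^ 9 * (z ^ 3 * x))" by (rule cg_sym)
  also have "cg p \<dots> (c ^ 9 * c)" by (intro cg_mult cg_power e)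
  also have "c ^ 9 * c = c ^ 7 * c ^ 3" by (simp flip: power_add power_Suc2)
  finally have "cg p (x ^ 28) (c ^ 7)" using not_dvd_pow[OF c0] by (rule cg_cancel_right)
  hence "cg p (c ^ 7) ((x ^ 4) ^ 7)" by (simp add: cg_sym flip: power_mult)
  then obtain k where k: "cg p c (w ^ k * x ^ 4)" using power_roots[OF w not_dvd_pow[OF n(1)]] by blast
  have "cg p (x ^ 3 * y) (w ^ k * x ^ 4)" by (rule cg_trans[OF e(1) k])
  also have "w ^ k * x ^ 4 = x ^ 3 * (w ^ k * x)" by (simp add: eval_nat_numeral)
  finally have y: "cg p y (w ^ k * x)" by (rule cg_cancel[OF _ not_dvd_pow[OF n(1)]])
  have "cg p ((w ^ k * x) ^ 3 * z) (y ^ 3 * z)" by (intro cg_mult cg_power cg_refl cg_sym[OF y])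
  also have "cg p \<dots> (w ^ k * x ^ 4)" by (rule cg_trans[OF e(2) k])
  also have "w ^ k * x ^ 4 = w ^ k * (x ^ 3 * (1 * x))" by (simp add: eval_nat_numeral)
  also have "cg p \<dots> (w ^ k * (x ^ 3 * (w ^ (7 * k) * x)))"
    using prim_root_cong[OF w, of 0 "7 * k"] by (intro cg_mult cg_refl) simp
  also have "\<dots> = (w ^ k * x) ^ 3 * (w ^ (5 * k) * x)"
  proof -
    have "w ^ k * w ^ (7 * k) = (w ^ k) ^ 3 * w ^ (5 * k)" by (simp flip: power_mult power_add)
    thus ?thesis by (simp add: power_mult_distrib mult_ac)
  qed
  finally have z: "cg p z (w ^ (5 * k) * x)" by (rule cg_cancel) (intro not_dvd_pow not_dvd_mult w0 n)
  have "cg p (x * w ^ 0) (x * w ^ (2 * k + 5 * k))" by (intro cg_mult cg_refl prim_root_cong[OF w]) simp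
  hence "cg p x (x * w ^ (2 * k) * w ^ (5 * k))" by (simp only: power_add mult.assoc power_0 mult_1_right)
  moreover have "cg p y (x * w ^ (2 * k) * (w ^ 4) ^ (5 * k))"
  proof (rule cg_trans[OF y])
    have "cg p (w ^ k * x) (x * w ^ (k + 7 * (3 * k)))" unfolding mult.commute[of _ x]
      by (intro cg_mult cg_refl prim_root_cong[OF w]) (simp only: mod_mult_self2)
    also have "w ^ (k + 7 * (3 * k)) = w ^ (2 * k) * (w ^ 4) ^ (5 * k)" by (simp flip: power_mult power_add)
    finally show "cg p (w ^ k * x) (x * w ^ (2 * k) * (w ^ 4) ^ (5 * k))" by (simp only: mult.assoc)
  qed
  moreover have "cg p z (x * w ^ (2 * k) * (w\<^sup>2) ^ (5 * k))"
  proof (rule cg_trans[OF z])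
    have "cg p (w ^ (5 * k) * x) (x * w ^ (5 * k + 7 * k))" unfolding mult.commute[of _ x]
      by (intro cg_mult cg_refl prim_root_cong[OF w]) (simp only: mod_mult_self2)
    also have "w ^ (5 * k + 7 * k) = w ^ (2 * k) * (w\<^sup>2) ^ (5 * k)" by (simp flip: power_mult power_add)
    finally show "cg p (w ^ (5 * k) * x) (x * w ^ (2 * k) * (w\<^sup>2) ^ (5 * k))" by (simp only: mult.assoc)
  qed
  ultimately have "cg p u (of_int (x * w ^ (2 * k)) * T3 w (w ^ 4) (w\<^sup>2) ^ (5 * k))"
    unfolding T3 of_int_t3 t3_power times_t3.simps cg_t3 by blast
  thus ?thesis by blast
qed

text \<open>Comparing two coordinates eliminates the scalars and leaves i + 4j = j + 4i modulo
  7.\<close>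

lemma t3_indep:
  assumes c: "\<not> int p dvd c" and ij: "i < 7" "j < 7"
    and e: "cg p (of_int c * T3 w (w ^ 4) (w\<^sup>2) ^ i) (of_int d * T3 w (w ^ 4) (w\<^sup>2) ^ j)"
  shows "i = j"
proof -
  have e: "cg p (c * w ^ i) (d * w ^ j)" "cg p (c * (w ^ 4) ^ i) (d * (w ^ 4) ^ j)"
    using e by (simp_all add: of_int_t3 t3_power cg_t3)
  have d: "\<not> int p dvd d * w ^ j" using cg_cong_dvd[OF e(1)] not_dvd_mult[OF c wk0] by blast
  have "cg p (c * w ^ i * (d * (w ^ 4) ^ j)) (d * w ^ j * (c * (w ^ 4) ^ i))" by (intro cg_mult e(1) cg_sym[OF e(2)])
  hence "cg p ((c * d) * w ^ (i + 4 * j)) ((c * d) * w ^ (j + 4 * i))" by (simp add: power_add mult_ac flip: power_mult)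
  moreover have "\<not> int p dvd c * d" using c d by (simp add: dvd_mult_iff)
  ultimately have a: "cg p (w ^ (i + 4 * j)) (w ^ (j + 4 * i))" by (rule cg_cancel)
  have b: "cg p (w ^ ((i + 4 * j) mod 7)) (w ^ (i + 4 * j))" "cg p (w ^ (j + 4 * i)) (w ^ ((j + 4 * i) mod 7))"
    by (rule prim_root_cong[OF w], simp)+
  have "cg p (w ^ ((i + 4 * j) mod 7)) (w ^ ((j + 4 * i) mod 7))"
    by (rule cg_trans[OF cg_trans[OF b(1) a] b(2)])
  hence "(i + 4 * j) mod 7 = (j + 4 * i) mod 7" by (rule prim_root_inj[OF w, rotated 2]) auto
  hence "int (i + 4 * j) mod 7 = int (j + 4 * i) mod 7" by (metis of_nat_mod of_nat_numeral)
  hence "7 dvd int (i + 4 * j) - int (j + 4 * i)" by (simp only: mod_eq_dvd_iff)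
  then obtain k where "int (i + 4 * j) - int (j + 4 * i) = 7 * k" by (elim dvdE)
  hence k: "3 * (int j - int i) = 7 * k" by simp
  have "k = 3 * (int j - int i - 2 * k)" using k by simp
  then obtain l where l: "k = 3 * l" by blast
  hence "int j - int i = 7 * l" using k by simp
  thus ?thesis using ij by presburger
qed

text \<open>The shift takes (w, w^4, w^2) to its fourth power, as \<open>ze_theta\<close> requires.
  In \<open>eta\<close> the last exponent is written 16 rather than 2, so that each entry comes from
  the preceding one by z -> z^4.\<close>

sublocale T: cubic_alg7 p A3 t3sg t3tr t3nm "T3 w (w ^ 4) (w\<^sup>2)" al "T3 (tt w) (tt (w ^ 4)) (tt (w ^ 16))"
proof (intro cubic_alg7.intro cubic_alg.intro cubic_alg_axioms.intro cubic_alg7_axioms.intro)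
  show "big_prime p" by (rule big_prime_axioms)
  show "ressys p A3" by (rule ressys_A3)
  show "prime_split_7 p al" by (rule prime_split_7_axioms)
  fix x y :: t3 and c :: int
  show "t3sg (x * y) = t3sg x * t3sg y" by (cases x; cases y) simp
  show "t3sg (t3sg (t3sg x)) = x" by (cases x) simp
  show "t3sg (of_int c) = of_int c" by (simp add: of_int_t3)
  show "cg p (t3sg x) (t3sg y)" "cg p (t3tr x) (t3tr y)" "cg p (t3nm x) (t3nm y)" if "cg p x y"
    using that by (cases x; cases y; auto simp: cg_t3 intro!: cg_add cg_mult)+
  show "t3tr (of_int c * x) = c * t3tr x" by (cases x) (simp add: of_int_t3 algebra_simps)
  show "t3tr (t3sg x) = t3tr x" by (cases x) simp
  show "of_int (t3nm x) = x * t3sg x * t3sg (t3sg x)" by (cases x) (simp add: of_int_t3)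
  show "t3nm (x * y) = t3nm x * t3nm y" by (cases x; cases y) simp
  show "t3nm (t3sg x) = t3nm x" by (cases x) simp
  show "t3nm (of_int c) = c ^ 3" by (simp add: of_int_t3 power3_eq_cube)
  show "cg p c d" if "cg p (of_int c :: t3) (of_int d)" for d using that by (simp add: of_int_t3 cg_t3)
  show "cg p (T3 w (w ^ 4) (w\<^sup>2) ^ 7) 1"
    using prim_root_cong[OF w, of 7 0] prim_root_cong[OF w, of "4 * 7" 0] prim_root_cong[OF w, of "2 * 7" 0]
    by (simp add: t3_power one_t3_def cg_t3 flip: power_mult)
  show "cg p (T3 w (w ^ 4) (w\<^sup>2) ^ 3 * t3sg (T3 w (w ^ 4) (w\<^sup>2))) 1"
    using prim_root_cong[OF w, of "3 + 4" 0] prim_root_cong[OF w, of "12 + 2" 0] prim_root_cong[OF w, of "2 * 3 + 1" 0]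
    by (simp add: t3_power one_t3_def cg_t3 flip: power_mult power_add power_Suc2)
  show "t3sg (x + y) = t3sg x + t3sg y" by (cases x; cases y) simp
  show "of_int (t3tr x) = x + t3sg x + t3sg (t3sg x)" by (cases x) (simp add: of_int_t3)
  show "card A3 = p ^ 3"
    unfolding A3_def by (subst card_image) (auto simp: inj_on_def card_cartesian_product power3_eq_cube)
  have w4: "prim_root 7 (w ^ 4)" and w16: "prim_root 7 (w ^ 16)" by (rule prim_root_w; simp)+
  note rel = tt_relations[OF w] tt_relations[OF w4] tt_relations[OF w16]
  have cyc: "cg p (tt ((w ^ 16) ^ 4)) (tt w)" "cg p (tt (w\<^sup>2)) (tt (w ^ 16))" "cg p (tt ((w ^ 4)\<^sup>2)) (tt w)"
    "cg p (tt ((w ^ 16)\<^sup>2)) (tt (w ^ 4))" "cg p (tt ((w ^ 4) ^ 4)) (tt (w ^ 16))"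
    using prim_root_cong[OF w, of 64 1] prim_root_cong[OF w, of 2 16] prim_root_cong[OF w, of 8 1] prim_root_cong[OF w, of 32 4]
    by (auto intro!: tt_cong simp flip: power_mult)
  let ?eta = "T3 (tt w) (tt (w ^ 4)) (tt (w ^ 16))"
  have num: "2 = T3 2 2 2" using of_int_t3[of 2] by simp
  show "cg p (?eta ^ 3 + ?eta\<^sup>2 - 2 * ?eta - 1) 0"
    using rel(1,4,7) by (simp add: t3_power num one_t3_def zero_t3_def cg_t3)
  show "cg p (t3sg ?eta) (1 - ?eta - ?eta\<^sup>2)"
    using rel(2) cg_trans[OF cg_sym[OF cyc(5)] rel(5)] cg_trans[OF cg_sym[OF cyc(1)] rel(8)] by (simp add: t3_power one_t3_def cg_t3)
  show "cg p (t3sg (t3sg ?eta)) (?eta\<^sup>2 - 2)"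
    using cg_trans[OF cg_sym[OF cyc(2)] rel(3)] cg_trans[OF cg_sym[OF cyc(3)] rel(6)] cg_trans[OF cg_sym[OF cyc(4)] rel(9)]
    by (simp add: t3_power num cg_t3)
  fix z :: t3
  show "(\<Sum>g\<in>A3. of_bool (int p dvd t3tr g) * of_bool (int p dvd t3tr (g * z))) = (if \<exists>c. cg p z (of_int c) then (int p)\<^sup>2 else int p)"
  proof (cases z)
    case (T3 z1 z2 z3)
    have "(\<Sum>g\<in>A3. of_bool (int p dvd t3tr g) * (of_bool (int p dvd t3tr (g * z)) :: int)) =
       (if int p dvd 1 * z2 - z1 * 1 \<and> int p dvd 1 * z3 - z1 * 1 then (int p)\<^sup>2 else int p)"
      unfolding sum_A3 T3 count_two_linear[OF not_dvd_1, symmetric] by (simp add: mult.commute)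
    moreover have "(\<exists>c. cg p z (of_int c)) \<longleftrightarrow> int p dvd 1 * z2 - z1 * 1 \<and> int p dvd 1 * z3 - z1 * 1"
    proof
      assume "\<exists>c. cg p z (of_int c)"
      then obtain c where "cg p z1 c" "cg p z2 c" "cg p z3 c" unfolding T3 of_int_t3 cg_t3 by blast
      hence "cg p z2 z1" "cg p z3 z1" by (meson cg_sym cg_trans)+
      thus "int p dvd 1 * z2 - z1 * 1 \<and> int p dvd 1 * z3 - z1 * 1" by (simp add: cg_def)
    next
      assume "int p dvd 1 * z2 - z1 * 1 \<and> int p dvd 1 * z3 - z1 * 1"
      hence "cg p z (of_int z1)" unfolding T3 of_int_t3 cg_t3 by (simp add: cg_def)
      thus "\<exists>c. cg p z (of_int c)" ..
    qed
    ultimately show ?thesis by simp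
  qed
next
  show "\<exists>d j. cg p u (of_int d * T3 w (w ^ 4) (w\<^sup>2) ^ j)" if "\<not> int p dvd t3nm u" "cg p (u ^ 3 * t3sg u) (of_int c)" for u c
    using that by (rule t3_ker)
  show "i = j" if "\<not> int p dvd c" "i < 7" "j < 7" "cg p (of_int c * T3 w (w ^ 4) (w\<^sup>2) ^ i) (of_int d * T3 w (w ^ 4) (w\<^sup>2) ^ j)" for c i j d
    using that by (rule t3_indep)
qed

lemma T_UA: "T.UA = U3" by (simp add: T.UA_def U3_def)

lemma T_M: "T.M (T3 x y z) = (\<Sum>a\<in>Rs. \<Sum>b\<in>Rs. \<Sum>c\<in>Rs. of_bool (int p dvd x * (a ^ 3 * b) + y * (b ^ 3 * c) + z * (c ^ 3 * a)))"
  unfolding T.M_def T_UA sum_U3 by (simp add: T.th_def t3_power)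

lemma T_M_0: "T.M (T3 0 0 0) = (int p - 1) ^ 3"
  unfolding T_M by (simp only: mult_zero_left add_0 dvd_0_right of_bool_eq int_card_Rs) (simp add: power3_eq_cube)

lemma T_M_1: assumes "x \<in> Rs" shows "T.M (T3 x 0 0) = 0"
proof -
  have "\<not> int p dvd x * (a ^ 3 * b)" if "a \<in> Rs" "b \<in> Rs" for a b
    using assms that Rs_not_dvd by (intro not_dvd_mult not_dvd_pow) auto
  thus ?thesis unfolding T_M by (simp del: atLeastLessThan_iff)
qed

text \<open>The condition is linear in c with unit coefficient and unit constant term, so each pair
  (a, b) admits exactly one unit c.\<close>

lemma T_M_2: assumes "x \<in> Rs" "y \<in> Rs" shows "T.M (T3 x y 0) = (int p - 1)\<^sup>2"
proof -
  have "T.M (T3 x y 0) = (\<Sum>a\<in>Rs. \<Sum>b\<in>Rs. \<Sum>c\<in>Rs. of_bool (int p dvd y * b ^ 3 * c + x * (a ^ 3 * b)))"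
    unfolding T_M by (simp add: add.commute mult.assoc)
  also have "\<dots> = (\<Sum>a\<in>Rs. \<Sum>b\<in>Rs. 1)"
  proof (intro sum.cong refl count_linear_unit)
    fix a b assume ab: "a \<in> Rs" "b \<in> Rs"
    show "\<not> int p dvd y * b ^ 3" "\<not> int p dvd x * (a ^ 3 * b)"
      using assms ab Rs_not_dvd by (intro not_dvd_mult not_dvd_pow; blast)+
  qed
  also have "\<dots> = (int p - 1)\<^sup>2" unfolding int_card_Rs by (simp add: power2_eq_square)
  finally show ?thesis .
qed

lemma T_M_rot: "T.M (T3 x y z) = T.M (T3 y z x)"
  using T.M_sg[of "T3 x y z"] by simp

lemma T_M_values:
  assumes "x \<in> Rs"
  shows "T.M (T3 0 x 0) = 0" "T.M (T3 0 0 x) = 0"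
    and "y \<in> Rs \<Longrightarrow> T.M (T3 0 x y) = (int p - 1)\<^sup>2" "y \<in> Rs \<Longrightarrow> T.M (T3 y 0 x) = (int p - 1)\<^sup>2"
proof -
  show 1: "T.M (T3 0 x 0) = 0" unfolding T_M_rot[of 0 x 0] by (rule T_M_1[OF assms])
  show "T.M (T3 0 0 x) = 0" unfolding T_M_rot[of 0 0 x] by (rule 1)
  show 2: "T.M (T3 0 x y) = (int p - 1)\<^sup>2" if "y \<in> Rs" unfolding T_M_rot[of 0 x y] by (rule T_M_2[OF assms that])
  show "T.M (T3 y 0 x) = (int p - 1)\<^sup>2" if "y \<in> Rs" unfolding T_M_rot[of y 0 x] by (rule 2[OF that])
qed

text \<open>The points of the Klein quartic with a vanishing coordinate are the three coordinate
  points, so q = p - 2, which is 6 modulo 7. Among the g of norm 0, only g = 0 and those with two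
  nonzero entries have solutions.\<close>

lemma S_D7_split:
  fixes u v :: int
  assumes p7: "p mod 7 = 1" and uv: "int p = u\<^sup>2 + 7 * v\<^sup>2" and u: "Legendre u 7 = 1"
  shows "S 21 112 = - 2 * u"
proof (rule T.S_D7_from_counts[OF uv u])
  have "int p mod 7 = 1" using zmod_int[of p 7] p7 by simp
  hence "(int p - 2) mod 7 = 6" by presburger
  thus "(int p - 2) mod 7 \<in> {3, 5, 6}" by simp
  have a: "\<not> int p dvd x ^ 3 * y" if "x \<in> Rs" "y \<in> Rs" for x y
    using that Rs_not_dvd by (intro not_dvd_mult not_dvd_pow) auto
  have "(\<Sum>x\<in>{x\<in>A3. int p dvd t3nm x}. of_bool (int p dvd t3tr (T.th x))) = 1 + (\<Sum>x\<in>Rs. 3) + (\<Sum>x\<in>Rs. \<Sum>y\<in>Rs. 0 :: int)"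
    unfolding sum_nonunit_t3 by (intro arg_cong2[where f = "(+)"] sum.cong refl) (simp_all add: T.th_def t3_power a)
  also have "\<dots> = (int p + 1 - (int p - 2)) * (int p - 1) + 1" unfolding int_card_Rs by simp
  finally show "(\<Sum>x\<in>{x\<in>A3. int p dvd t3nm x}. of_bool (int p dvd t3tr (T.th x))) = (int p + 1 - (int p - 2)) * (int p - 1) + 1" .
  have "(\<Sum>x\<in>{x\<in>A3. int p dvd t3nm x}. T.M x) = (int p - 1) ^ 3 + (\<Sum>x\<in>Rs. 0) + (\<Sum>x\<in>Rs. \<Sum>y\<in>Rs. 3 * (int p - 1)\<^sup>2)"
    unfolding sum_nonunit_t3 T_M_0
    by (intro arg_cong2[where f = "(+)"] sum.cong refl) (simp_all add: T_M_1 T_M_2 T_M_values)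
  also have "\<dots> = (int p - 1) ^ 3 * ((int p + 1 - (int p - 2)) * (int p - 1) + 1)"
    unfolding int_card_Rs by (simp add: eval_nat_numeral algebra_simps)
  finally show "(\<Sum>x\<in>{x\<in>A3. int p dvd t3nm x}. T.M x) = (int p - 1) ^ 3 * ((int p + 1 - (int p - 2)) * (int p - 1) + 1)" .
  have "(\<Sum>x\<in>{x\<in>A3. int p dvd t3nm x}. (T.M x)\<^sup>2) = ((int p - 1) ^ 3)\<^sup>2 + (\<Sum>x\<in>Rs. 0) + (\<Sum>x\<in>Rs. \<Sum>y\<in>Rs. 3 * ((int p - 1)\<^sup>2)\<^sup>2)"
    unfolding sum_nonunit_t3 T_M_0
    by (intro arg_cong2[where f = "(+)"] sum.cong refl) (simp_all add: T_M_1 T_M_2 T_M_values)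
  also have "\<dots> = (int p + 2 - (int p - 2)) * ((int p - 1) ^ 3)\<^sup>2"
    unfolding int_card_Rs by (simp add: eval_nat_numeral algebra_simps)
  finally show "(\<Sum>x\<in>{x\<in>A3. int p dvd t3nm x}. (T.M x)\<^sup>2) = (int p + 2 - (int p - 2)) * ((int p - 1) ^ 3)\<^sup>2" .
  show "(int p - 1) ^ 3 = int (card T.UA)" unfolding T_UA card_U3 ..
qed simp

end

subsection \<open>Seventh roots of unity\<close>

text \<open>The hypothesis on z says t = z + 1/z; dividing 1 + z + ... + z^6 by z^3 gives t^3 + t^2
  - 2t - 1.\<close>

lemma cyclotomic_7:
  fixes z t :: "'a::comm_ring_1"
  assumes zt: "cg p (z\<^sup>2) (t * z - 1)" and t: "cg p (t ^ 3 + t\<^sup>2 - 2 * t - 1) 0"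
  shows "cg p (1 + z + z\<^sup>2 + z ^ 3 + z ^ 4 + z ^ 5 + z ^ 6) 0" "cg p (z ^ 7) 1"
proof -
  have *: "cg p (z\<^sup>2 + 1) (t * z)" using zt by (simp add: cg_def algebra_simps)
  have "1 + z + z\<^sup>2 + z ^ 3 + z ^ 4 + z ^ 5 + z ^ 6 = (z\<^sup>2 + 1) ^ 3 + (z\<^sup>2 + 1)\<^sup>2 * z - 2 * (z\<^sup>2 + 1) * z\<^sup>2 - z ^ 3"
    by (simp add: eval_nat_numeral algebra_simps)
  also have "cg p \<dots> ((t * z) ^ 3 + (t * z)\<^sup>2 * z - 2 * (t * z) * z\<^sup>2 - z ^ 3)"
    by (intro cg_add cg_diff cg_mult cg_power cg_refl *)
  also have "(t * z) ^ 3 + (t * z)\<^sup>2 * z - 2 * (t * z) * z\<^sup>2 - z ^ 3 = (t ^ 3 + t\<^sup>2 - 2 * t - 1) * z ^ 3"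
    by (simp add: eval_nat_numeral algebra_simps)
  also have "cg p \<dots> (0 * z ^ 3)" by (intro cg_mult cg_refl t)
  finally show F: "cg p (1 + z + z\<^sup>2 + z ^ 3 + z ^ 4 + z ^ 5 + z ^ 6) 0" by simp
  have "z ^ 7 = (z - 1) * (1 + z + z\<^sup>2 + z ^ 3 + z ^ 4 + z ^ 5 + z ^ 6) + 1" by (simp add: eval_nat_numeral algebra_simps)
  also have "cg p \<dots> ((z - 1) * 0 + 1)" by (intro cg_add cg_mult cg_refl F)
  finally show "cg p (z ^ 7) 1" by simp
qed

lemma power_7_trivial:
  fixes z :: "'a::comm_ring_1"
  assumes z: "cg p (z ^ 7) 1" "cg p (z ^ k) 1" "k mod 7 \<noteq> 0"
  shows "cg p z 1"
proof -
  have "k mod 7 = 1 \<or> k mod 7 = 2 \<or> k mod 7 = 3 \<or> k mod 7 = 4 \<or> k mod 7 = 5 \<or> k mod 7 = 6"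
    using z(3) mod_less_divisor[of 7 k] by linarith
  moreover have "(1::nat) * 1 = 7 * 0 + 1" "(2::nat) * 4 = 7 * 1 + 1" "(3::nat) * 5 = 7 * 2 + 1" "(4::nat) * 2 = 7 * 1 + 1"
    "(5::nat) * 3 = 7 * 2 + 1" "(6::nat) * 6 = 7 * 5 + 1" by simp_all
  ultimately obtain x y where xy: "k mod 7 * x = 7 * y + 1" by metis
  have "k * x = (7 * (k div 7) + k mod 7) * x" by simp
  also have "\<dots> = 7 * (k div 7 * x + y) + 1" using xy by (simp only: distrib_right) simp
  finally have e: "(z ^ k) ^ x = (z ^ 7) ^ (k div 7 * x + y) * z" by (simp flip: power_mult)
  have "z = 1 ^ (k div 7 * x + y) * z" by simp
  also have "cg p \<dots> ((z ^ 7) ^ (k div 7 * x + y) * z)" by (intro cg_mult cg_power cg_refl cg_sym[OF z(1)])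
  also have "\<dots> = (z ^ k) ^ x" by (rule e[symmetric])
  also have "cg p \<dots> (1 ^ x)" by (intro cg_power z)
  finally show ?thesis by simp
qed

text \<open>The factorisation of y^7 - x^7. Pairing z^k with z^(7-k) produces the three periods S,
  T, U, the roots of X^3 + X^2 - 2X - 1, so their elementary symmetric functions are -1, -2,
  1.\<close>

lemma prod_7_roots:
  fixes x y z :: "'a::comm_ring_1"
  assumes F: "cg p (1 + z + z\<^sup>2 + z ^ 3 + z ^ 4 + z ^ 5 + z ^ 6) 0" and z7: "cg p (z ^ 7) 1"
  shows "cg p ((y - x) * ((y - z * x) * (y - z ^ 6 * x)) * ((y - z\<^sup>2 * x) * (y - z ^ 5 * x)) * ((y - z ^ 3 * x) * (y - z ^ 4 * x))) (y ^ 7 - x ^ 7)"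
proof -
  define S T U where "S = z + z ^ 6" and "T = z\<^sup>2 + z ^ 5" and "U = z ^ 3 + z ^ 4"
  have z70: "cg p (z ^ 7 - 1) 0" using z7 by (simp add: cg_def)
  have *: "cg p x y" if "x = y + (z ^ 7 - 1) * k + (1 + z + z\<^sup>2 + z ^ 3 + z ^ 4 + z ^ 5 + z ^ 6) * l" for x y k l
  proof -
    have "cg p (y + (z ^ 7 - 1) * k + (1 + z + z\<^sup>2 + z ^ 3 + z ^ 4 + z ^ 5 + z ^ 6) * l) (y + 0 * k + 0 * l)"
      by (intro cg_add cg_mult cg_refl z70 F)
    thus ?thesis using that by simp
  qed
  have e1: "cg p (S + T + U) (- 1)" unfolding S_def T_def U_def
    by (rule *[of _ _ 0 1]) (simp add: algebra_simps)
  have e2: "cg p (S * T + T * U + U * S) (- 2)" unfolding S_def T_def U_def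
    by (rule *[of _ _ "2 * z + 2 * z\<^sup>2 + z ^ 3 + z ^ 4" 2]) (simp add: eval_nat_numeral algebra_simps)
  have e3: "cg p (S * T * U) 1" unfolding S_def T_def U_def
    by (rule *[of _ _ "2 + z + z\<^sup>2 + z ^ 3 + z ^ 4 + z ^ 5 + z ^ 7 + z ^ 8" 1]) (simp add: eval_nat_numeral algebra_simps)
  define N m where "N = y\<^sup>2 + x\<^sup>2" and "m = x * y"
  have pair: "cg p ((y - z ^ i * x) * (y - z ^ j * x)) (N - (z ^ i + z ^ j) * m)" if "i + j = 7" for i j
  proof -
    have "(y - z ^ i * x) * (y - z ^ j * x) = y\<^sup>2 + z ^ (i + j) * x\<^sup>2 - (z ^ i + z ^ j) * m"
      by (simp add: m_def power2_eq_square power_add algebra_simps)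
    also have "cg p \<dots> (y\<^sup>2 + 1 * x\<^sup>2 - (z ^ i + z ^ j) * m)" unfolding that by (intro cg_add cg_diff cg_mult cg_refl z7)
    finally show ?thesis by (simp add: N_def)
  qed
  have "cg p ((y - x) * ((y - z * x) * (y - z ^ 6 * x)) * ((y - z\<^sup>2 * x) * (y - z ^ 5 * x)) * ((y - z ^ 3 * x) * (y - z ^ 4 * x)))
    ((y - x) * (N - S * m) * (N - T * m) * (N - U * m))"
    unfolding S_def T_def U_def using pair[of 1 6] pair[of 2 5] pair[of 3 4] by (intro cg_mult cg_refl) simp_all
  also have "(y - x) * (N - S * m) * (N - T * m) * (N - U * m) =
    (y - x) * (N ^ 3 - (S + T + U) * (N\<^sup>2 * m) + (S * T + T * U + U * S) * (N * m\<^sup>2) - S * T * U * m ^ 3)"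
    by (simp add: eval_nat_numeral algebra_simps)
  also have "cg p \<dots> ((y - x) * (N ^ 3 - (- 1) * (N\<^sup>2 * m) + (- 2) * (N * m\<^sup>2) - 1 * m ^ 3))"
    by (intro cg_mult cg_add cg_diff cg_refl e1 e2 e3)
  also have "\<dots> = y ^ 7 - x ^ 7" unfolding N_def m_def by (simp add: eval_nat_numeral algebra_simps)
  finally show ?thesis .
qed

subsection \<open>The cubic subfield of the seventh cyclotomic field\<close>

text \<open>\<open>CE a b c\<close> is \<open>a + b \<eta> + c \<eta>\<^sup>2\<close> with \<open>\<eta>\<^sup>3 + \<eta>\<^sup>2 - 2 \<eta> - 1 = 0\<close>, so \<open>\<eta> = \<zeta> + \<zeta>\<^sup>-\<^sup>1\<close> for a seventh root of unity \<open>\<zeta>\<close>.\<close>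

datatype ce = CE (cf0: int) (cf1: int) (cf2: int)

instantiation ce :: comm_ring_1
begin
definition "0 = CE 0 0 0"
definition "1 = CE 1 0 0"
fun plus_ce where "CE a b c + CE a' b' c' = CE (a + a') (b + b') (c + c')"
fun uminus_ce where "- CE a b c = CE (- a) (- b) (- c)"
fun minus_ce where "CE a b c - CE a' b' c' = CE (a - a') (b - b') (c - c')"
fun times_ce where "CE a b c * CE a' b' c' =
  CE (a * a' + (b * c' + c * b') - c * c') (a * b' + b * a' + 2 * (b * c' + c * b') - c * c')
    (a * c' + b * b' + c * a' - (b * c' + c * b') + 3 * (c * c'))"
instance
proof
  fix x y z :: ce
  show "x * y * z = x * (y * z)" by (cases x; cases y; cases z) (simp add: algebra_simps)
  show "(x + y) * z = x * z + y * z" by (cases x; cases y; cases z) (simp add: algebra_simps)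
  show "x * y = y * x" by (cases x; cases y) (simp add: algebra_simps)
  show "x + y + z = x + (y + z)" by (cases x; cases y; cases z) simp
  show "x + y = y + x" by (cases x; cases y) simp
  show "x - y = x + - y" by (cases x; cases y) simp
  show "0 + x = x" "- x + x = 0" "1 * x = x" by (cases x; simp add: zero_ce_def one_ce_def)+
  show "(0::ce) \<noteq> 1" by (simp add: zero_ce_def one_ce_def)
qed
end

lemma of_int_ce: "of_int c = CE c 0 0"
proof -
  have n: "of_nat n = CE (int n) 0 0" for n by (induction n) (auto simp: zero_ce_def one_ce_def)
  show ?thesis
  proof (cases c rule: int_cases2)
    case (nonneg n) thus ?thesis by (simp add: n)
  next
    case (nonpos n) thus ?thesis by (simp add: n)
  qed
qed

lemma numeral_ce: "numeral n = CE (numeral n) 0 0"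
  using of_int_ce[of "numeral n"] by simp

lemma cg_ce: "cg p (CE a b c) (CE a' b' c') \<longleftrightarrow> cg p a a' \<and> cg p b b' \<and> cg p c c'"
proof -
  have "CE (int p) 0 0 dvd CE x y z \<longleftrightarrow> int p dvd x \<and> int p dvd y \<and> int p dvd z" for x y z
  proof
    assume "CE (int p) 0 0 dvd CE x y z"
    then obtain w where w: "CE x y z = CE (int p) 0 0 * w" by (elim dvdE)
    thus "int p dvd x \<and> int p dvd y \<and> int p dvd z" by (cases w) auto
  next
    assume "int p dvd x \<and> int p dvd y \<and> int p dvd z"
    then obtain x' y' z' where "x = int p * x'" "y = int p * y'" "z = int p * z'" by (elim conjE dvdE)
    hence "CE x y z = CE (int p) 0 0 * CE x' y' z'" by simp
    thus "CE (int p) 0 0 dvd CE x y z" by (rule dvdI)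
  qed
  moreover have "of_nat p = CE (int p) 0 0" using of_int_ce[of "int p"] by simp
  ultimately show ?thesis by (simp add: cg_def)
qed

text \<open>The automorphism sending \<eta> to 1 - \<eta> - \<eta>^2 = \<zeta>^4 + \<zeta>^(-4),
  induced by \<zeta> -> \<zeta>^4.\<close>

fun cesg :: "ce \<Rightarrow> ce" where "cesg (CE a b c) = CE (a + b + 2 * c) (c - b) (- b)"
fun cetr :: "ce \<Rightarrow> int" where "cetr (CE a b c) = 3 * a - b + 5 * c"
definition cenm :: "ce \<Rightarrow> int" where "cenm x = cf0 (x * cesg x * cesg (cesg x))"

lemma cesg_mult: "cesg (x * y) = cesg x * cesg y" by (cases x; cases y) (simp add: algebra_simps)
lemma cesg3: "cesg (cesg (cesg x)) = x" by (cases x) simp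
lemma cesg_of_int: "cesg (of_int c) = of_int c" by (simp add: of_int_ce)

lemma cesg_power: "cesg (x ^ k) = cesg x ^ k"
  using cesg_of_int[of 1] by (induction k) (auto simp: cesg_mult)

lemma cg_cesg: "cg p x y \<Longrightarrow> cg p (cesg x) (cesg y)"
  by (cases x; cases y) (auto simp: cg_ce intro!: cg_add cg_diff cg_mult cg_minus)

lemma cenm_eq: "of_int (cenm x) = x * cesg x * cesg (cesg x)"
  by (cases x) (simp add: cenm_def of_int_ce algebra_simps)

lemma of_int_ce_inj: "of_int a = (of_int b :: ce) \<Longrightarrow> a = b"
  by (simp add: of_int_ce)

lemma cenm_mult: "cenm (x * y) = cenm x * cenm y"
  by (rule of_int_ce_inj) (simp add: cenm_eq cesg_mult mult_ac)

lemma cenm_sg: "cenm (cesg x) = cenm x"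
  by (rule of_int_ce_inj) (simp add: cenm_eq cesg3 mult_ac)

lemma cenm_of_int: "cenm (of_int c) = c ^ 3"
  by (rule of_int_ce_inj) (simp add: cenm_eq cesg_of_int power3_eq_cube)

lemma cenm_power: "cenm (x ^ k) = cenm x ^ k"
  using cenm_of_int[of 1] by (induction k) (auto simp: cenm_mult)

lemma of_int_ce_cg: "cg p (of_int a :: ce) (of_int b) \<longleftrightarrow> cg p a b"
  by (simp add: of_int_ce cg_ce)

lemma cg_cenm: assumes "cg p x y" shows "cg p (cenm x) (cenm y)"
proof -
  have "cg p (of_int (cenm x) :: ce) (of_int (cenm y))" unfolding cenm_eq by (intro cg_mult cg_cesg assms)
  thus ?thesis by (simp only: of_int_ce_cg)
qed

lemma cenm_linear: "cenm (CE a b 0) = a ^ 3 - a\<^sup>2 * b - 2 * a * b\<^sup>2 + b ^ 3"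
  by (simp add: cenm_def eval_nat_numeral algebra_simps)

context big_prime
begin

definition A7 :: "ce set" where "A7 = (\<lambda>(a, b, c). CE a b c) ` (R \<times> R \<times> R)"

lemma ressys_A7: "ressys p A7"
proof
  show "finite A7" by (simp add: A7_def)
  show "\<exists>y\<in>A7. cg p x y" for x
  proof (cases x)
    case (CE a b c)
    show ?thesis
    proof (rule bexI)
      show "cg p x (CE (RS.red a) (RS.red b) (RS.red c))" by (simp add: CE cg_ce RS.red)
      show "CE (RS.red a) (RS.red b) (RS.red c) \<in> A7" unfolding A7_def using RS.red(1) by (intro rev_image_eqI[of "(_, _, _)"]) auto
    qed
  qed
  fix x y assume "x \<in> A7" "y \<in> A7" "cg p x y"
  thus "x = y" unfolding A7_def using RS.uniq by (auto simp: cg_ce simp del: atLeastLessThan_iff)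
qed

lemma card_A7: "card A7 = p ^ 3"
  unfolding A7_def by (subst card_image) (auto simp: inj_on_def card_cartesian_product power3_eq_cube)

lemma sum_A7: "(\<Sum>x\<in>A7. f x) = (\<Sum>a\<in>R. \<Sum>b\<in>R. \<Sum>c\<in>R. (f (CE a b c) :: int))"
proof -
  have "(\<Sum>x\<in>A7. f x) = (\<Sum>(a, b, c)\<in>R \<times> R \<times> R. f (CE a b c))"
    unfolding A7_def by (subst sum.reindex) (auto simp: inj_on_def case_prod_unfold)
  thus ?thesis by (simp only: sum.cartesian_product)
qed

lemma ce_cancel: assumes "cg p (u * x) (u * y)" "\<not> int p dvd cenm u" shows "cg p x (y::ce)"
proof -
  have e: "cesg u * cesg (cesg u) * (u * z) = of_int (cenm u) * z" for z by (simp add: cenm_eq mult_ac)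
  have "cg p (cesg u * cesg (cesg u) * (u * x)) (cesg u * cesg (cesg u) * (u * y))" by (intro cg_mult cg_refl assms(1))
  hence "cg p (of_int (cenm u) * x) (of_int (cenm u) * y)" unfolding e .
  thus ?thesis by (cases x; cases y) (auto simp: of_int_ce cg_ce intro: cg_cancel[OF _ assms(2)])
qed

end

section \<open>Primes congruent to 2 or 4 modulo 7\<close>

locale nonsplit7 = prime_split_7 p al for p :: nat and al :: int +
  assumes p7: "p mod 7 = 2 \<or> p mod 7 = 4"
begin

lemma al_sq: "cg p ((2 * al + 1)\<^sup>2) (- 7)"
proof -
  have e: "(2 * al + 1)\<^sup>2 - (- 7) = 4 * (al\<^sup>2 + al + 2)" by (simp add: power2_eq_square algebra_simps)
  show ?thesis unfolding cg_def e by (rule dvd_mult) (use al in simp)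
qed

text \<open>For a root \<open>t\<close>, \<open>(t\<^sup>2 - 4) s\<^sup>2 = -7\<close> is a square, so \<open>z + 1 / z = t\<close> has a solution \<open>z\<close> modulo \<open>p\<close>; it is a
  nontrivial seventh root of unity.\<close>

lemma no_root: "\<not> int p dvd t ^ 3 + t\<^sup>2 - 2 * t - 1"
proof
  assume "int p dvd t ^ 3 + t\<^sup>2 - 2 * t - 1"
  hence P: "cg p (t ^ 3 + t\<^sup>2 - 2 * t - 1) 0" by (simp add: cg_0_int)
  \<comment> \<open>For t = z + 1/z and d = z - 1/z the differences z^k - z^(-k), k = 1, 2, 4, are
    d, d t and d t (t^2 - 2). Their product d s squares to -7, and d^2 = t^2 - 4.\<close>
  define s where "s = (t\<^sup>2 - 4) * t\<^sup>2 * (t\<^sup>2 - 2)"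
  define q where "q = - 7 + 14 * t - 35 * t\<^sup>2 + 77 * t ^ 3 + 81 * t ^ 4 - 120 * t ^ 5
    - 50 * t ^ 6 + 61 * t ^ 7 + 12 * t ^ 8 - 13 * t ^ 9 - t ^ 10 + t ^ 11"
  have "(t\<^sup>2 - 4) * s\<^sup>2 = - 7 + (t ^ 3 + t\<^sup>2 - 2 * t - 1) * q"
    unfolding s_def q_def by (simp add: eval_nat_numeral algebra_simps)
  also have "cg p \<dots> (- 7 + 0 * q)" by (intro cg_add cg_mult cg_refl P)
  finally have D: "cg p ((t\<^sup>2 - 4) * s\<^sup>2) (- 7)" by simp
  have s0: "\<not> int p dvd s"
  proof
    assume "int p dvd s"
    hence "int p dvd (t\<^sup>2 - 4) * s\<^sup>2" by (simp add: power2_eq_square)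
    hence "int p dvd - 7" using cg_cong_dvd[OF D] by blast
    thus False using not_dvd_7 by simp
  qed
  define r where "r = (2 * al + 1) * iv s"
  have r: "cg p (r\<^sup>2) (t\<^sup>2 - 4)"
  proof -
    have "r\<^sup>2 = (2 * al + 1)\<^sup>2 * (iv s)\<^sup>2" by (simp add: r_def power_mult_distrib)
    also have "cg p \<dots> ((t\<^sup>2 - 4) * s\<^sup>2 * (iv s)\<^sup>2)" by (intro cg_mult cg_refl cg_trans[OF al_sq cg_sym[OF D]])
    also have "(t\<^sup>2 - 4) * s\<^sup>2 * (iv s)\<^sup>2 = (t\<^sup>2 - 4) * (s * iv s)\<^sup>2" by (simp add: power_mult_distrib)
    also have "cg p \<dots> ((t\<^sup>2 - 4) * 1\<^sup>2)" by (intro cg_mult cg_power cg_refl iv s0)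
    finally show ?thesis by simp
  qed
  define z where "z = (t + r) * iv 2"
  have i2: "cg p (2 * iv 2) 1" by (rule iv[OF not_dvd_2])
  have z2: "cg p (2 * z) (t + r)"
  proof -
    have "2 * z = (t + r) * (2 * iv 2)" by (simp add: z_def)
    also have "cg p \<dots> ((t + r) * 1)" by (intro cg_mult cg_refl i2)
    finally show ?thesis by simp
  qed
  have "cg p (4 * z\<^sup>2) (4 * (t * z - 1))"
  proof -
    have "4 * z\<^sup>2 = (2 * z)\<^sup>2" by (simp add: power_mult_distrib)
    also have "cg p \<dots> ((t + r)\<^sup>2)" by (intro cg_power z2)
    also have "(t + r)\<^sup>2 = t\<^sup>2 + 2 * t * r + r\<^sup>2" by (simp add: power2_eq_square algebra_simps)
    also have "cg p \<dots> (t\<^sup>2 + 2 * t * r + (t\<^sup>2 - 4))" by (intro cg_add cg_refl r)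
    also have "\<dots> = 2 * t * (t + r) - 4" by (simp add: power2_eq_square algebra_simps)
    also have "cg p \<dots> (2 * t * (2 * z) - 4)" by (intro cg_diff cg_mult cg_refl cg_sym[OF z2])
    finally show ?thesis by simp
  qed
  hence zt: "cg p (z\<^sup>2) (t * z - 1)" using not_dvd_4 by (rule cg_cancel)
  note c7 = cyclotomic_7[OF zt P]
  have z1: "\<not> cg p z 1"
  proof
    assume "cg p z 1"
    hence "cg p (1 + z + z\<^sup>2 + z ^ 3 + z ^ 4 + z ^ 5 + z ^ 6) (1 + 1 + 1\<^sup>2 + 1 ^ 3 + 1 ^ 4 + 1 ^ 5 + 1 ^ 6)"
      by (intro cg_add cg_power cg_refl)
    hence "cg p 7 (0::int)" using cg_trans[OF cg_sym c7(1)] by fastforce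
    thus False using not_dvd_7 by (simp add: cg_0_int)
  qed
  have "\<not> int p dvd z"
  proof
    assume "int p dvd z"
    hence "int p dvd z ^ 7" by (simp add: dvd_power_iff')
    thus False using cg_cong_dvd[OF c7(2)] not_dvd_1 by blast
  qed
  hence "cg p (z ^ (p - 1)) 1" by (rule fermat)
  \<comment> \<open>p - 1 is 1 or 3 modulo 7, so no nontrivial seventh root of unity satisfies
    Fermat's congruence in F_p.\<close>
  moreover have "(p - 1) mod 7 \<noteq> 0"
  proof -
    have "p = 7 * (p div 7) + p mod 7" by simp
    hence "p - 1 = 1 + 7 * (p div 7) \<or> p - 1 = 3 + 7 * (p div 7)" using p7 by linarith
    thus ?thesis by (elim disjE) (simp_all only: mod_mult_self2, simp_all)
  qed
  ultimately show False using power_7_trivial[OF c7(2)] z1 by blast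
qed

text \<open>If p does not divide b, the norm of a + b \<eta> is -b^3 times the cubic at -a/b, which
  has no root modulo p.\<close>

lemma cenm_linear_0: assumes "int p dvd cenm (CE a b 0)" shows "int p dvd a \<and> int p dvd b"
proof -
  have "int p dvd b"
  proof (rule ccontr)
    assume b: "\<not> int p dvd b"
    define t where "t = - a * iv b"
    have "cg p (b * iv b) 1" by (rule iv[OF b])
    hence "cg p ((b * iv b) * a) (1 * a)" by (intro cg_mult cg_refl)
    hence a: "cg p a (- (b * t))" by (simp add: t_def cg_sym mult_ac)
    have "cg p (cenm (CE a b 0)) ((- (b * t)) ^ 3 - (- (b * t))\<^sup>2 * b - 2 * (- (b * t)) * b\<^sup>2 + b ^ 3)"
      unfolding cenm_linear by (intro cg_add cg_diff cg_mult cg_power cg_refl a)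
    also have "(- (b * t)) ^ 3 - (- (b * t))\<^sup>2 * b - 2 * (- (b * t)) * b\<^sup>2 + b ^ 3 = (- (b ^ 3)) * (t ^ 3 + t\<^sup>2 - 2 * t - 1)"
      by (simp add: eval_nat_numeral algebra_simps)
    finally have "int p dvd (- (b ^ 3)) * (t ^ 3 + t\<^sup>2 - 2 * t - 1)" using cg_cong_dvd assms by blast
    moreover have "\<not> int p dvd - (b ^ 3)" using not_dvd_pow[OF b] by simp
    ultimately show False using no_root not_dvd_mult by blast
  qed
  moreover have "int p dvd a"
  proof -
    have "cenm (CE a b 0) = a ^ 3 + b * (- a\<^sup>2 - 2 * a * b + b\<^sup>2)" unfolding cenm_linear by (simp add: eval_nat_numeral algebra_simps)
    hence "int p dvd a ^ 3" using assms \<open>int p dvd b\<close> by (simp add: dvd_add_left_iff)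
    thus ?thesis using not_dvd_pow by blast
  qed
  ultimately show ?thesis by blast
qed

text \<open>This replaces the statement that \<int>[\<eta>] / p is a field. Multiplication by c - b
  + c \<eta> removes the coefficient of \<eta>^2 and reduces to the linear case.\<close>

lemma cenm_0: assumes x: "int p dvd cenm x" shows "cg p x 0"
proof (cases x)
  case (CE a b c)
  have c: "int p dvd c"
  proof (rule ccontr)
    assume c: "\<not> int p dvd c"
    define y where "y = CE (c - b) c 0"
    have xy: "x * y = CE (c * c + (c - b) * a) (c * (a + 2 * c) + (c - b) * b) 0"
      unfolding CE y_def by (simp add: algebra_simps)
    have "int p dvd cenm (x * y)" using x by (simp add: cenm_mult)
    from cenm_linear_0[OF this[unfolded xy]] have "cg p (x * y) 0" unfolding xy zero_ce_def cg_ce cg_0_int by blast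
    hence "cg p (y * x) (y * 0)" by (simp only: mult.commute[of y x] mult_zero_right)
    moreover have "\<not> int p dvd cenm y" using cenm_linear_0 c unfolding y_def by blast
    ultimately have "cg p x 0" by (rule ce_cancel)
    thus False using c unfolding CE zero_ce_def cg_ce cg_0_int by blast
  qed
  have "cg p x (CE a b 0)" using c unfolding CE cg_ce by (simp add: cg_0_int)
  hence "int p dvd cenm (CE a b 0)" using cg_cong_dvd[OF cg_cenm] x by blast
  thus ?thesis using cenm_linear_0 c unfolding CE zero_ce_def cg_ce cg_0_int by blast
qed

text \<open>Seven times a seventh root of unity, written in 1, \<eta>, \<eta>^2. It exists in this
  ring because 2\<alpha> + 1 is a square root of -7 modulo p; the choice is the root with \<zeta> +
  \<zeta>^2 + \<zeta>^4 = -1 - \<alpha>.\<close>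

definition z7 :: ce where "z7 = CE (- 3 - 6 * al) (3 - al) (1 + 2 * al)"
definition ze :: ce where "ze = of_int (iv 7) * z7"
definition et :: ce where "et = CE 0 1 0"

lemma i7: "cg p (7 * of_int (iv 7)) (1::ce)"
proof -
  have "cg p (of_int (7 * iv 7) :: ce) (of_int 1)" by (intro cg_of_int iv not_dvd_7)
  thus ?thesis by simp
qed

lemma et_eq: "et ^ 3 + et\<^sup>2 - 2 * et - 1 = 0"
  by (simp add: et_def eval_nat_numeral numeral_ce one_ce_def zero_ce_def)

lemma cesg_et: "cesg et = 1 - et - et\<^sup>2" "cesg (cesg et) = et\<^sup>2 - 2"
  by (simp_all add: et_def power2_eq_square one_ce_def numeral_ce)

lemma ze_sq: "cg p (ze\<^sup>2) (et * ze - 1)"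
proof -
  have "z7\<^sup>2 = 7 * et * z7 - 49 + of_int (al\<^sup>2 + al + 2) * CE 28 0 (- 7)"
    by (simp add: z7_def et_def power2_eq_square numeral_ce of_int_ce algebra_simps)
  also have "cg p \<dots> (7 * et * z7 - 49 + of_int 0 * CE 28 0 (- 7))"
    by (intro cg_add cg_mult cg_refl cg_of_int) (use al in \<open>simp add: cg_0_int\<close>)
  finally have z: "cg p (z7\<^sup>2) (7 * et * z7 - 49)" by simp
  have "ze\<^sup>2 = of_int (iv 7) * of_int (iv 7) * z7\<^sup>2" by (simp add: ze_def power2_eq_square mult_ac)
  also have "cg p \<dots> (of_int (iv 7) * of_int (iv 7) * (7 * et * z7 - 49))" by (intro cg_mult cg_refl z)
  also have "\<dots> = (7 * of_int (iv 7)) * (et * ze) - (7 * of_int (iv 7)) * (7 * of_int (iv 7))"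
    by (simp add: ze_def algebra_simps)
  also have "cg p \<dots> (1 * (et * ze) - 1 * 1)" by (intro cg_diff cg_mult cg_refl i7)
  finally show ?thesis by simp
qed

lemmas ze_cyclo = cyclotomic_7[OF ze_sq, unfolded et_eq, OF cg_refl]

text \<open>Both sides reduce to (1 - \<eta>^2)(\<zeta> + 1), the left one from the coordinates of
  \<open>z7\<close>, the right one from \<zeta>^2 = \<eta> \<zeta> - 1 applied twice.\<close>

lemma cesg_ze: "cg p (cesg ze) (ze ^ 4)"
proof -
  have z: "cesg z7 = (1 - et\<^sup>2) * (z7 + 7)"
    by (simp add: z7_def et_def power2_eq_square numeral_ce one_ce_def algebra_simps)
  have "cesg ze = (1 - et\<^sup>2) * (ze + 7 * of_int (iv 7))"
    unfolding ze_def cesg_mult cesg_of_int z by (simp add: algebra_simps)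
  also have "cg p \<dots> ((1 - et\<^sup>2) * (ze + 1))" by (intro cg_mult cg_add cg_refl i7)
  finally have 1: "cg p (cesg ze) ((1 - et\<^sup>2) * (ze + 1))" .
  have "ze ^ 4 = (ze\<^sup>2)\<^sup>2" by simp
  also have "cg p \<dots> ((et * ze - 1)\<^sup>2)" by (intro cg_power ze_sq)
  also have "(et * ze - 1)\<^sup>2 = et\<^sup>2 * ze\<^sup>2 - 2 * et * ze + 1" by (simp add: power2_eq_square algebra_simps)
  also have "cg p \<dots> (et\<^sup>2 * (et * ze - 1) - 2 * et * ze + 1)" by (intro cg_add cg_diff cg_mult cg_refl ze_sq)
  also have "et\<^sup>2 * (et * ze - 1) - 2 * et * ze + 1 = (et ^ 3 + et\<^sup>2 - 2 * et - 1) * ze + (1 - et\<^sup>2) * (ze + 1)"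
    by (simp add: eval_nat_numeral algebra_simps)
  also have "\<dots> = (1 - et\<^sup>2) * (ze + 1)" unfolding et_eq by simp
  finally show ?thesis using 1 cg_sym cg_trans by metis
qed

lemma ze_nontrivial: "\<not> cg p ze 1"
proof
  assume "cg p ze 1"
  hence "cg p (1 + ze + ze\<^sup>2 + ze ^ 3 + ze ^ 4 + ze ^ 5 + ze ^ 6) (1 + 1 + 1\<^sup>2 + 1 ^ 3 + 1 ^ 4 + 1 ^ 5 + 1 ^ 6)"
    by (intro cg_add cg_power cg_refl)
  hence "cg p (1 + 1 + 1\<^sup>2 + 1 ^ 3 + 1 ^ 4 + 1 ^ 5 + 1 ^ 6) (0::ce)" by (rule cg_trans[OF cg_sym ze_cyclo(1)])
  hence "cg p (of_int 7 :: ce) (of_int 0)" by simp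
  thus False using not_dvd_7 by (simp only: of_int_ce_cg cg_0_int)
qed

lemma cenm_ze: "\<not> int p dvd cenm (ze ^ k)"
proof -
  have "\<not> int p dvd cenm ze"
  proof
    assume "int p dvd cenm ze"
    hence "int p dvd cenm (ze ^ 7)" by (simp add: cenm_power dvd_power_iff')
    hence "int p dvd cenm (of_int 1)" using cg_cong_dvd[OF cg_cenm[OF ze_cyclo(2)]] by simp
    thus False using not_dvd_1 by (simp only: cenm_of_int) simp
  qed
  thus ?thesis unfolding cenm_power by (rule not_dvd_pow)
qed

lemma ze_power_7: "cg p (ze ^ (k + 7 * j)) (ze ^ k)"
proof -
  have "ze ^ (k + 7 * j) = ze ^ k * (ze ^ 7) ^ j" by (simp add: power_add power_mult)
  also have "cg p \<dots> (ze ^ k * 1 ^ j)" by (intro cg_mult cg_power cg_refl ze_cyclo)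
  finally show ?thesis by simp
qed

text \<open>Some factor of y^7 - x^7 has norm 0 modulo p, since the norm is multiplicative with
  values in a domain modulo p; \<open>cenm_0\<close> makes that factor vanish.\<close>

lemma seventh_roots:
  assumes "cg p (y ^ 7) (x ^ 7)" shows "\<exists>k. cg p y (ze ^ k * x)"
proof -
  have "cg p (y ^ 7 - x ^ 7) 0" using assms by (simp add: cg_def)
  from cg_trans[OF prod_7_roots[OF ze_cyclo] this]
  have "int p dvd cenm ((y - x) * ((y - ze * x) * (y - ze ^ 6 * x)) * ((y - ze\<^sup>2 * x) * (y - ze ^ 5 * x)) * ((y - ze ^ 3 * x) * (y - ze ^ 4 * x)))"
    using cg_cong_dvd[OF cg_cenm] cenm_of_int[of 0] by fastforce
  hence "int p dvd cenm (y - ze ^ 0 * x) \<or> int p dvd cenm (y - ze ^ 1 * x) \<or> int p dvd cenm (y - ze ^ 6 * x) \<or> int p dvd cenm (y - ze\<^sup>2 * x)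
     \<or> int p dvd cenm (y - ze ^ 5 * x) \<or> int p dvd cenm (y - ze ^ 3 * x) \<or> int p dvd cenm (y - ze ^ 4 * x)"
    unfolding cenm_mult dvd_mult_iff by auto
  then obtain k where "int p dvd cenm (y - ze ^ k * x)" by blast
  hence "cg p (y - ze ^ k * x) 0" by (rule cenm_0)
  thus ?thesis by (auto simp: cg_def)
qed

text \<open>As for triples, \<sigma>(x) = \<zeta>^k x up to congruence. Hence d = x \<zeta>^(2k) is
  fixed by \<sigma>, and a fixed element is an integer modulo p because 3 is invertible.\<close>

lemma ce_ker:
  assumes u: "\<not> int p dvd cenm x" and c: "cg p (x ^ 3 * cesg x) (of_int c)"
  shows "\<exists>d j. cg p x (of_int d * ze ^ j)"
proof -
  define y z where "y = cesg x" and "z = cesg (cesg x)"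
  have n: "\<not> int p dvd cenm x" "\<not> int p dvd cenm y" "\<not> int p dvd cenm z" using u by (simp_all add: y_def z_def cenm_sg)
  have nk: "\<not> int p dvd cenm (x ^ k)" "\<not> int p dvd cenm (of_int c :: ce)" for k
  proof -
    show "\<not> int p dvd cenm (x ^ k)" unfolding cenm_power by (rule not_dvd_pow[OF n(1)])
    have "\<not> int p dvd cenm (x ^ 3 * cesg x)"
      unfolding cenm_mult cenm_power cenm_sg by (intro not_dvd_mult not_dvd_pow n(1))
    thus "\<not> int p dvd cenm (of_int c :: ce)" using cg_cong_dvd[OF cg_cenm[OF c]] by blast
  qed
  have e1: "cg p (x ^ 3 * y) (of_int c)" using c by (simp only: y_def)
  have e2: "cg p (y ^ 3 * z) (of_int c)" using cg_cesg[OF e1] by (simp add: cesg_mult cesg_power cesg_of_int y_def z_def)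
  have e3: "cg p (z ^ 3 * x) (of_int c)" using cg_cesg[OF e2] by (simp add: cesg_mult cesg_power cesg_of_int cesg3 y_def z_def)
  have "cg p (x ^ 28 * (y ^ 3 * z) ^ 3) (x ^ 28 * of_int c ^ 3)" by (intro cg_mult cg_power cg_refl e2)
  also have "x ^ 28 * (y ^ 3 * z) ^ 3 = (x ^ 3 * y) ^ 9 * (z ^ 3 * x)"
  proof -
    have "x ^ 28 = (x ^ 3) ^ 9 * x" by (simp flip: power_mult power_Suc2)
    thus ?thesis by (simp add: power_mult_distrib mult_ac flip: power_mult)
  qed
  finally have "cg p (x ^ 28 * of_int c ^ 3) ((x ^ 3 * y) ^ 9 * (z ^ 3 * x))" by (rule cg_sym)
  also have "cg p \<dots> (of_int c ^ 9 * of_int c)" by (intro cg_mult cg_power e1 e3)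
  finally have "cg p (of_int c ^ 3 * x ^ 28) (of_int c ^ 3 * of_int c ^ 7)"
    by (simp add: mult.commute flip: power_add power_Suc2 power_Suc)
  moreover have "\<not> int p dvd cenm (of_int c ^ 3 :: ce)" unfolding cenm_power by (rule not_dvd_pow[OF nk(2)])
  ultimately have "cg p (x ^ 28) (of_int c ^ 7)" by (rule ce_cancel)
  hence "cg p (of_int c ^ 7) ((x ^ 4) ^ 7)" by (simp add: cg_sym flip: power_mult)
  then obtain k where k: "cg p (of_int c) (ze ^ k * x ^ 4)" using seventh_roots by blast
  have "cg p (x ^ 3 * y) (ze ^ k * x ^ 4)" by (rule cg_trans[OF e1 k])
  also have "ze ^ k * x ^ 4 = x ^ 3 * (ze ^ k * x)" by (simp add: eval_nat_numeral mult_ac)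
  finally have y: "cg p y (ze ^ k * x)" by (rule ce_cancel[OF _ nk(1)])
  define d where "d = x * ze ^ (2 * k)"
  have "cesg d = y * cesg ze ^ (2 * k)" by (simp add: d_def y_def cesg_mult cesg_power)
  also have "cg p \<dots> (ze ^ k * x * (ze ^ 4) ^ (2 * k))" by (intro cg_mult cg_power y cesg_ze)
  also have "ze ^ k * x * (ze ^ 4) ^ (2 * k) = x * ze ^ (2 * k + 7 * k)"
  proof -
    have "ze ^ k * (ze ^ 4) ^ (2 * k) = ze ^ (2 * k + 7 * k)" by (simp flip: power_mult power_add)
    thus ?thesis by (simp add: mult_ac)
  qed
  also have "cg p \<dots> d" unfolding d_def by (intro cg_mult cg_refl ze_power_7)
  finally have sd: "cg p (cesg d) d" .
  have "\<exists>e. cg p d (of_int e)"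
  proof (cases d)
    case (CE a b c)
    have bc: "cg p (c - b) b" "cg p (- b) c" using sd unfolding CE by (simp_all add: cg_ce)
    have "int p dvd (- b - c) + (c - b - b)" using bc unfolding cg_def by (intro dvd_add) simp_all
    hence "int p dvd 3 * - b" by simp
    hence b: "int p dvd b" using not_dvd_3 dvd_mult_iff[of 3 "- b"] by auto
    have "int p dvd c" using cg_cong_dvd[OF bc(2)] b by simp
    hence "cg p d (of_int a)" using b unfolding CE by (simp add: of_int_ce cg_ce cg_0_int)
    thus ?thesis ..
  qed
  then obtain e where e: "cg p d (of_int e)" by blast
  have "cg p (x * ze ^ (0 + 7 * k)) (x * ze ^ 0)" by (intro cg_mult cg_refl ze_power_7)
  hence "cg p x (x * ze ^ (7 * k))" by (simp add: cg_sym)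
  also have "x * ze ^ (7 * k) = d * ze ^ (5 * k)"
  proof -
    have "ze ^ (7 * k) = ze ^ (2 * k) * ze ^ (5 * k)" by (simp flip: power_add)
    thus ?thesis by (simp add: d_def mult_ac)
  qed
  also have "cg p \<dots> (of_int e * ze ^ (5 * k))" by (intro cg_mult cg_refl e)
  finally show ?thesis by blast
qed

text \<open>Applying \<sigma> gives a second relation with \<zeta>^4 in place of \<zeta>.
  Cross-multiplying eliminates c and d and leaves \<zeta>^(i + 4j) = \<zeta>^(j + 4i).\<close>

lemma ce_indep:
  assumes c: "\<not> int p dvd c" and ij: "i < 7" "j < 7" and e: "cg p (of_int c * ze ^ i) (of_int d * ze ^ j)"
  shows "i = j"
proof -
  have e2: "cg p (of_int c * (ze ^ 4) ^ i) (of_int d * (ze ^ 4) ^ j)"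
  proof -
    have s: "cg p (of_int a * (ze ^ 4) ^ k) (cesg (of_int a * ze ^ k))" for a k
      unfolding cesg_mult cesg_power cesg_of_int by (intro cg_mult cg_power cg_refl cg_sym[OF cesg_ze])
    show ?thesis by (rule cg_trans[OF cg_trans[OF s cg_cesg[OF e]] cg_sym[OF s]])
  qed
  have "\<not> int p dvd cenm (of_int c * ze ^ i)"
    unfolding cenm_mult cenm_of_int by (intro not_dvd_mult not_dvd_pow c cenm_ze)
  hence "\<not> int p dvd cenm (of_int d * ze ^ j)" using cg_cong_dvd[OF cg_cenm[OF e]] by blast
  hence d: "\<not> int p dvd d" by (auto simp: cenm_mult cenm_of_int dvd_power_iff')
  have "cg p (of_int c * ze ^ i * (of_int d * (ze ^ 4) ^ j)) (of_int d * ze ^ j * (of_int c * (ze ^ 4) ^ i))"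
    by (intro cg_mult e cg_sym[OF e2])
  hence "cg p (of_int (c * d) * ze ^ (i + 4 * j)) (of_int (c * d) * ze ^ (j + 4 * i))"
    by (simp add: power_add mult_ac flip: power_mult)
  moreover have "\<not> int p dvd cenm (of_int (c * d))" unfolding cenm_of_int by (intro not_dvd_pow not_dvd_mult c d)
  ultimately have "cg p (ze ^ (i + 4 * j)) (ze ^ (j + 4 * i))" by (rule ce_cancel)
  hence "cg p (ze ^ (i + 4 * j) * ze ^ (6 * (j + 4 * i))) (ze ^ (j + 4 * i) * ze ^ (6 * (j + 4 * i)))" by (intro cg_mult cg_refl)
  also have "ze ^ (j + 4 * i) * ze ^ (6 * (j + 4 * i)) = ze ^ (0 + 7 * (j + 4 * i))" by (simp flip: power_add)
  also have "cg p \<dots> (ze ^ 0)" by (rule ze_power_7)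
  also have "ze ^ (i + 4 * j) * ze ^ (6 * (j + 4 * i)) = ze ^ (25 * i + 10 * j)"
  proof -
    have "i + 4 * j + 6 * (j + 4 * i) = 25 * i + 10 * j" by simp
    thus ?thesis by (metis power_add)
  qed
  finally have "cg p (ze ^ (25 * i + 10 * j)) 1" by simp
  hence "(25 * i + 10 * j) mod 7 = 0" using power_7_trivial[OF ze_cyclo(2), of "25 * i + 10 * j"] ze_nontrivial by argo
  hence "7 dvd 25 * i + 10 * j" by (rule mod_0_imp_dvd)
  then obtain m where "25 * i + 10 * j = 7 * m" by (elim dvdE)
  hence "int i - int j = 7 * (2 * (int m - 3 * int i - 2 * int j) - int i + int j)" by simp
  then obtain l where "int i - int j = 7 * l" by blast
  thus ?thesis using ij by presburger
qed

sublocale C: cubic_alg7 p A7 cesg cetr cenm ze al et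
proof (intro cubic_alg7.intro cubic_alg.intro cubic_alg_axioms.intro cubic_alg7_axioms.intro)
  show "big_prime p" by (rule big_prime_axioms)
  show "ressys p A7" by (rule ressys_A7)
  show "prime_split_7 p al" by (rule prime_split_7_axioms)
  fix x y :: ce and c :: int
  show "cesg (x * y) = cesg x * cesg y" by (rule cesg_mult)
  show "cesg (cesg (cesg x)) = x" by (rule cesg3)
  show "cesg (of_int c) = of_int c" by (rule cesg_of_int)
  show "cg p (cesg x) (cesg y)" "cg p (cenm x) (cenm y)" if "cg p x y" using that by (rule cg_cesg cg_cenm)+
  show "cg p (cetr x) (cetr y)" if "cg p x y"
    using that by (cases x; cases y; auto simp: cg_ce intro!: cg_add cg_diff cg_mult)
  show "cetr (of_int c * x) = c * cetr x" by (cases x) (simp add: of_int_ce algebra_simps)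
  show "cetr (cesg x) = cetr x" by (cases x) simp
  show "of_int (cenm x) = x * cesg x * cesg (cesg x)" by (rule cenm_eq)
  show "cenm (x * y) = cenm x * cenm y" by (rule cenm_mult)
  show "cenm (cesg x) = cenm x" by (rule cenm_sg)
  show "cenm (of_int c) = c ^ 3" by (rule cenm_of_int)
  show "cg p c d" if "cg p (of_int c :: ce) (of_int d)" for d using that by (simp only: of_int_ce_cg)
  show "cg p (ze ^ 7) 1" by (rule ze_cyclo)
  have "cg p (ze ^ 3 * cesg ze) (ze ^ 3 * ze ^ 4)" by (intro cg_mult cg_refl cesg_ze)
  also have "ze ^ 3 * ze ^ 4 = ze ^ 7" by (simp flip: power_add)
  also have "cg p \<dots> 1" by (rule ze_cyclo)
  finally show "cg p (ze ^ 3 * cesg ze) 1" .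
  show "cesg (x + y) = cesg x + cesg y" by (cases x; cases y) simp
  show "of_int (cetr x) = x + cesg x + cesg (cesg x)" by (cases x) (simp add: of_int_ce)
  show "card A7 = p ^ 3" by (rule card_A7)
  show "cg p (et ^ 3 + et\<^sup>2 - 2 * et - 1) 0" unfolding et_eq by simp
  show "cg p (cesg et) (1 - et - et\<^sup>2)" "cg p (cesg (cesg et)) (et\<^sup>2 - 2)" unfolding cesg_et(2) by (simp_all add: cesg_et(1))
  fix z :: ce
  show "(\<Sum>g\<in>A7. of_bool (int p dvd cetr g) * of_bool (int p dvd cetr (g * z))) = (if \<exists>c. cg p z (of_int c) then (int p)\<^sup>2 else int p)"
  proof (cases z)
    case (CE z0 z1 z2)
    \<comment> \<open>The traces of z, \<eta> z and \<eta>^2 z, from the traces 3, -1, 5, -4, 13 of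
      the powers of \<eta>. The minors vanish together exactly when z1 and z2 do, as combining them
      gives 21 z1 and 21 z2.\<close>
    let ?t0 = "3 * z0 - z1 + 5 * z2" and ?t1 = "- z0 + 5 * z1 - 4 * z2" and ?t2 = "5 * z0 - 4 * z1 + 13 * z2"
    have t: "cetr (CE a b c * z) = ?t0 * a + ?t1 * b + ?t2 * c" for a b c unfolding CE by (simp add: algebra_simps)
    have t': "cetr (CE a b c) = 3 * a + (- 1) * b + 5 * c" for a b c by simp
    have "(\<Sum>g\<in>A7. of_bool (int p dvd cetr g) * (of_bool (int p dvd cetr (g * z)) :: int)) =
       (if int p dvd 3 * ?t1 - ?t0 * (- 1) \<and> int p dvd 3 * ?t2 - ?t0 * 5 then (int p)\<^sup>2 else int p)"
      unfolding sum_A7 t t' by (rule count_two_linear[OF not_dvd_3])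
    moreover have "(\<exists>c. cg p z (of_int c)) \<longleftrightarrow> int p dvd 3 * ?t1 - ?t0 * (- 1) \<and> int p dvd 3 * ?t2 - ?t0 * 5"
    proof
      assume "\<exists>c. cg p z (of_int c)"
      hence z: "int p dvd z1" "int p dvd z2" unfolding CE of_int_ce cg_ce cg_0_int by blast+
      have "3 * ?t1 - ?t0 * (- 1) = 14 * z1 - 7 * z2" "3 * ?t2 - ?t0 * 5 = - 7 * z1 + 14 * z2" by simp_all
      thus "int p dvd 3 * ?t1 - ?t0 * (- 1) \<and> int p dvd 3 * ?t2 - ?t0 * 5" using z by simp
    next
      assume d: "int p dvd 3 * ?t1 - ?t0 * (- 1) \<and> int p dvd 3 * ?t2 - ?t0 * 5"
      have 21: "\<not> int p dvd 3 * 7" by (intro not_dvd_mult not_dvd_3 not_dvd_7)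
      have "int p dvd (3 * ?t1 - ?t0 * (- 1)) * 2 + (3 * ?t2 - ?t0 * 5)" using d by (intro dvd_add dvd_mult2) auto
      also have "(3 * ?t1 - ?t0 * (- 1)) * 2 + (3 * ?t2 - ?t0 * 5) = (3 * 7) * z1" by simp
      finally have 1: "int p dvd z1" using 21 not_dvd_mult by blast
      have "int p dvd (3 * ?t1 - ?t0 * (- 1)) + (3 * ?t2 - ?t0 * 5) * 2" using d by (intro dvd_add dvd_mult2) auto
      also have "(3 * ?t1 - ?t0 * (- 1)) + (3 * ?t2 - ?t0 * 5) * 2 = (3 * 7) * z2" by simp
      finally have 2: "int p dvd z2" using 21 not_dvd_mult by blast
      have "cg p z (of_int z0)" using 1 2 unfolding CE of_int_ce cg_ce cg_0_int by simp
      thus "\<exists>c. cg p z (of_int c)" ..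
    qed
    ultimately show ?thesis by simp
  qed
next
  show "\<exists>d j. cg p u (of_int d * ze ^ j)" if "\<not> int p dvd cenm u" "cg p (u ^ 3 * cesg u) (of_int c)" for u c
    using that by (rule ce_ker)
  show "i = j" if "\<not> int p dvd c" "i < 7" "j < 7" "cg p (of_int c * ze ^ i) (of_int d * ze ^ j)" for c i j d
    using that by (rule ce_indep)
qed

lemma nonunits: "{x\<in>A7. int p dvd cenm x} = {0}"
proof -
  have 0: "0 \<in> A7" unfolding A7_def zero_ce_def using p_gt_3 by (intro rev_image_eqI[of "(0, 0, 0)"]) auto
  have "cenm 0 = 0" using cenm_of_int[of 0] by simp
  thus ?thesis using 0 cenm_0 ressys.uniq[OF ressys_A7 _ 0] by auto
qed

text \<open>In a field the only element of norm 0 is 0, so no projective point is lost and q = p +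
  1, which is 3 or 5 modulo 7.\<close>

lemma S_D7_nonsplit:
  fixes u v :: int
  assumes uv: "int p = u\<^sup>2 + 7 * v\<^sup>2" and u: "Legendre u 7 = 1"
  shows "S 21 112 = - 2 * u"
proof (rule C.S_D7_from_counts[OF uv u])
  have "int p mod 7 = 2 \<or> int p mod 7 = 4" using p7 zmod_int[of p 7] by auto
  hence "(int p + 1) mod 7 = 3 \<or> (int p + 1) mod 7 = 5" by presburger
  thus "(int p + 1) mod 7 \<in> {3, 5, 6}" by blast
  have t0: "cetr 0 = 0" by (simp add: zero_ce_def)
  have M0: "C.M 0 = int (card C.UA)" unfolding C.M_def by (simp add: t0)
  have th0: "C.th 0 = 0" by (simp add: C.th_def)
  show "(\<Sum>x\<in>{x\<in>A7. int p dvd cenm x}. of_bool (int p dvd cetr (C.th x))) = (int p + 1 - (int p + 1)) * (int p - 1) + 1"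
    unfolding nonunits by (simp add: th0 t0)
  show "(\<Sum>x\<in>{x\<in>A7. int p dvd cenm x}. C.M x) = int (card C.UA) * ((int p + 1 - (int p + 1)) * (int p - 1) + 1)"
    unfolding nonunits by (simp add: M0)
  show "(\<Sum>x\<in>{x\<in>A7. int p dvd cenm x}. (C.M x)\<^sup>2) = (int p + 2 - (int p + 1)) * (int (card C.UA))\<^sup>2"
    unfolding nonunits by (simp add: M0)
  have "C.UA = A7 - {x\<in>A7. int p dvd cenm x}" by (auto simp: C.UA_def)
  moreover have "0 \<in> A7" using nonunits by blast
  ultimately have "card C.UA = p ^ 3 - 1" unfolding nonunits using card_A7 by (simp only: card_Diff_singleton)
  hence "int (card C.UA) = int p ^ 3 - 1" using p_gt_3 by (simp add: of_nat_diff)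
  thus "int p + 1 = int p + 1 \<and> int (card C.UA) = int p ^ 3 - 1 \<or> int p + 1 = int p - 2 \<and> int (card C.UA) = (int p - 1) ^ 3" by simp
qed simp

end

section \<open>Matching each m with its cubic\<close>

context big_prime
begin

lemma G4_sum_S:
  assumes "b * (64 - m) = 16 * a\<^sup>2" "\<not> int p dvd m" "\<not> int p dvd a" "\<not> int p dvd b"
    and "cg p (c * (- \<chi> a * S a b)) r"
  shows "pcong p (of_int c * (\<Sum>n=0..p-1. rat_of_int (G4 n) / of_int m ^ n)) (of_int r)"
proof (rule pcong_G4_sum[OF assms(2)])
  have "cg p (W4 p m) (- \<chi> a * S a b)" using assms(1) by (intro W4_S assms(3,4)) simp
  from cg_trans[OF cg_mult[OF cg_refl this] assms(5)] show "cg p (c * W4 p m) r" .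
qed

lemma chi_square_mult: "\<not> int p dvd k \<Longrightarrow> a * b = k\<^sup>2 * d \<Longrightarrow> \<chi> a * \<chi> b = \<chi> d"
proof -
  assume k: "\<not> int p dvd k" and "a * b = k\<^sup>2 * d"
  hence "\<chi> a * \<chi> b = \<chi> (k * k * d)" using chi_mult[of a b] by (simp add: power2_eq_square)
  also have "\<dots> = \<chi> k * \<chi> k * \<chi> d" unfolding chi_mult ..
  finally show ?thesis using chi_sq[OF k] by simp
qed

lemma pcong_pair: "pcong p x (of_int r) \<Longrightarrow> pcong p y (of_int r) \<Longrightarrow> pcong p x y \<and> pcong p y (of_int r)"
  using pcong_trans[OF _ pcong_sym] by blast

lemma not_dvd_prime_powers:
  "\<not> int p dvd 2 ^ i" "\<not> int p dvd 3 ^ i"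
  using not_dvd_pow[OF not_dvd_2] not_dvd_pow[OF not_dvd_3] by blast+

lemma not_dvd_23: "\<not> int p dvd - (2 ^ i * 3 ^ j)" "\<not> int p dvd 2 ^ i * 3 ^ j"
  using not_dvd_mult[OF not_dvd_prime_powers] by simp_all

lemma S_D7:
  assumes p7: "p mod 7 \<in> {1, 2, 4}" and uv: "int p = u\<^sup>2 + 7 * v\<^sup>2" and u: "Legendre u 7 = 1"
  shows "S 21 112 = - 2 * u"
proof -
  have ne: "p \<noteq> 7" using p7 by auto
  have n7: "\<not> int p dvd 7" using ne prime_p primes_dvd_imp_eq[of p 7] int_dvd_int_iff[of p 7] by auto
  then obtain s :: int where s: "cg p (s\<^sup>2) (- 7)" using chi_m7(1)[OF p7] chi_eq_1_iff[of "- 7"] by auto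
  \<comment> \<open>A root of X^2 + X + 2 modulo p, obtained from a square root s of -7.\<close>
  define al where "al = (s - 1) * iv 2"
  have "cg p (2 * iv 2) 1" by (rule iv[OF not_dvd_2])
  hence "cg p ((s - 1) * (2 * iv 2)) ((s - 1) * 1)" by (intro cg_mult cg_refl)
  hence "cg p (2 * al) (s - 1)" by (simp add: al_def mult_ac)
  hence "cg p (2 * al + 1) (s - 1 + 1)" by (intro cg_add cg_refl)
  hence "cg p ((2 * al + 1)\<^sup>2) ((s - 1 + 1)\<^sup>2)" by (rule cg_power)
  hence "cg p ((2 * al + 1)\<^sup>2) (- 7)" using s cg_trans by fastforce
  moreover have e: "(2 * al + 1)\<^sup>2 - (- 7) = 4 * (al\<^sup>2 + al + 2)" by (simp add: power2_eq_square algebra_simps)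
  ultimately have "int p dvd 4 * (al\<^sup>2 + al + 2)" unfolding cg_def e by simp
  hence al: "int p dvd al\<^sup>2 + al + 2" using not_dvd_4 not_dvd_mult by blast
  interpret prime_split_7 p al using al ne by unfold_locales
  show ?thesis
  proof (cases "p mod 7 = 1")
    case True
    have "p - 1 = 7 * (p div 7)" using True mult_div_mod_eq[of 7 p] by linarith
    then obtain w where w: "prim_root 7 w" using exists_prim_root[of 7] by auto
    interpret split7 p al w using w by unfold_locales
    show ?thesis by (rule S_D7_split[OF True uv u])
  next
    case False
    interpret nonsplit7 p al using p7 False by unfold_locales auto
    show ?thesis by (rule S_D7_nonsplit[OF uv u])
  qed
qed

text \<open>m = 1: 112 * 63 = 16 * 21^2. m = 4096: (-7) * (-4032) = 16 * 42^2. The isogeny joins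
  (21, 112) to (-42, -7), and both Legendre factors combine with \<chi>(a) to \<chi>(-7).\<close>

lemma G4_sum_7:
  assumes p7: "p mod 7 \<noteq> 0" and r: "cg p (- (\<chi> (-7) * S 21 112)) r"
  shows "pcong p (of_int (\<chi> (-3)) * (\<Sum>n=0..p-1. rat_of_int (G4 n))) (of_int (\<chi> 6) * (\<Sum>n=0..p-1. rat_of_int (G4 n) / 4096 ^ n)) \<and>
    pcong p (of_int (\<chi> 6) * (\<Sum>n=0..p-1. rat_of_int (G4 n) / 4096 ^ n)) (of_int r)"
proof (rule pcong_pair)
  have "p \<noteq> 7" using p7 by auto
  hence n7: "\<not> int p dvd 7" using prime_p primes_dvd_imp_eq[of p 7] int_dvd_int_iff[of p 7] by auto
  have n: "\<not> int p dvd 21" "\<not> int p dvd 112" "\<not> int p dvd - 42" "\<not> int p dvd - 7"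
    using not_dvd_mult[OF n7 not_dvd_23(2)[of 0 1]] not_dvd_mult[OF n7 not_dvd_23(2)[of 4 0]]
      not_dvd_mult[OF n7 not_dvd_23(2)[of 1 1]] n7 by simp_all
  have e: "\<chi> (-3) * \<chi> 21 = \<chi> (-7)" "\<chi> 6 * \<chi> (-42) = \<chi> (-7)"
    using not_dvd_23(2)[of 1 1] by (intro chi_square_mult[OF not_dvd_3] chi_square_mult[of 6]; simp)+
  have "pcong p (of_int (\<chi> (-3)) * (\<Sum>n=0..p-1. rat_of_int (G4 n) / of_int 1 ^ n)) (of_int r)"
  proof (rule G4_sum_S[of 112 1 21, OF _ not_dvd_1 n(1,2)])
    have s: "\<chi> (-3) * (- \<chi> 21 * S 21 112) = - (\<chi> (-7) * S 21 112)" unfolding e(1)[symmetric] by simp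
    show "cg p (\<chi> (-3) * (- \<chi> 21 * S 21 112)) r" unfolding s by (rule r)
  qed simp
  thus "pcong p (of_int (\<chi> (-3)) * (\<Sum>n=0..p-1. rat_of_int (G4 n))) (of_int r)" by simp
  have "pcong p (of_int (\<chi> 6) * (\<Sum>n=0..p-1. rat_of_int (G4 n) / of_int 4096 ^ n)) (of_int r)"
  proof (rule G4_sum_S[of "-7" 4096 "-42", OF _ _ n(3,4)])
    show "\<not> int p dvd 4096" using not_dvd_23(2)[of 12 0] by simp
    have "S 21 112 = S (-42) (-7)" using S_isogeny[OF n(2), of 21] by simp
    hence s: "\<chi> 6 * (- \<chi> (-42) * S (-42) (-7)) = - (\<chi> (-7) * S 21 112)" unfolding e(2)[symmetric] by simp
    show "cg p (\<chi> 6 * (- \<chi> (-42) * S (-42) (-7))) r" unfolding s by (rule r)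
  qed simp
  thus "pcong p (of_int (\<chi> 6) * (\<Sum>n=0..p-1. rat_of_int (G4 n) / 4096 ^ n)) (of_int r)" by simp
qed

text \<open>m = -8: 32 * 72 = 16 * 12^2. m = -512: 1 * 576 = 16 * 6^2. Recentring (-12, 32) at its
  root 4 gives 4 times (0, -1). The two sums carry \<chi>(-2) and \<chi>(2), which differ only when
  p is 3 modulo 4, where S(0, -1) = 0; this is the second hypothesis.\<close>

lemma G4_sum_4:
  assumes r: "- (\<chi> 2 * S 0 (-1)) = r" and r': "\<chi> (-2) * S 0 (-1) = \<chi> 2 * S 0 (-1)"
  shows "pcong p (of_int (\<chi> 6) * (\<Sum>n=0..p-1. rat_of_int (G4 n) / (-8) ^ n)) (of_int (\<chi> 3) * (\<Sum>n=0..p-1. rat_of_int (G4 n) / (-512) ^ n)) \<and>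
    pcong p (of_int (\<chi> 3) * (\<Sum>n=0..p-1. rat_of_int (G4 n) / (-512) ^ n)) (of_int r)"
proof (rule pcong_pair)
  have n: "\<not> int p dvd - 8" "\<not> int p dvd - 12" "\<not> int p dvd 32" "\<not> int p dvd - 512" "\<not> int p dvd 6"
    using not_dvd_23(1)[of 3 0] not_dvd_23(1)[of 2 1] not_dvd_23(2)[of 5 0] not_dvd_23(1)[of 9 0] not_dvd_23(2)[of 1 1] by simp_all
  have e: "\<chi> 6 * \<chi> (-12) = \<chi> (-2)" "\<chi> 3 * \<chi> 6 = \<chi> 2"
    using n(5) by (intro chi_square_mult[of 6] chi_square_mult[OF not_dvd_3]; simp)+
  have "S (-12) 32 = S (3 * 4 + (-12)) (3 * 4\<^sup>2 + 2 * (-12) * 4 + 32)" by (rule S_shift) simp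
  also have "\<dots> = S (4 * 0) (4\<^sup>2 * (-1))" by simp
  also have "\<dots> = \<chi> 4 * S 0 (-1)" by (rule S_scale[OF not_dvd_4])
  also have "\<chi> 4 = 1" using chi_mult[of 2 2] chi_sq[OF not_dvd_2] by simp
  finally have 1: "S (-12) 32 = S 0 (-1)" by simp
  have 2: "S 6 1 = S 0 (-1)" using S_isogeny[OF not_dvd_1, of 6] 1 by simp
  have "pcong p (of_int (\<chi> 6) * (\<Sum>n=0..p-1. rat_of_int (G4 n) / of_int (-8) ^ n)) (of_int r)"
  proof (rule G4_sum_S[of 32 "-8" "-12", OF _ n(1-3)])
    have "\<chi> 6 * (- \<chi> (-12) * S (-12) 32) = - (\<chi> (-2) * S 0 (-1))" unfolding 1 e(1)[symmetric] by simp
    also have "\<dots> = r" unfolding r' by (rule r)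
    finally have "\<chi> 6 * (- \<chi> (-12) * S (-12) 32) = r" .
    thus "cg p (\<chi> 6 * (- \<chi> (-12) * S (-12) 32)) r" by simp
  qed simp
  thus "pcong p (of_int (\<chi> 6) * (\<Sum>n=0..p-1. rat_of_int (G4 n) / (-8) ^ n)) (of_int r)" by simp
  have "pcong p (of_int (\<chi> 3) * (\<Sum>n=0..p-1. rat_of_int (G4 n) / of_int (-512) ^ n)) (of_int r)"
  proof (rule G4_sum_S[of 1 "-512" 6, OF _ n(4,5) not_dvd_1])
    have "\<chi> 3 * (- \<chi> 6 * S 6 1) = r" using r unfolding 2 e(2)[symmetric] by simp
    thus "cg p (\<chi> 3 * (- \<chi> 6 * S 6 1)) r" by simp
  qed simp
  thus "pcong p (of_int (\<chi> 3) * (\<Sum>n=0..p-1. rat_of_int (G4 n) / (-512) ^ n)) (of_int r)" by simp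
qed

text \<open>m = 16: 3 * 48 = 16 * 3^2. m = 256: (-3) * (-192) = 16 * 6^2. The two cubics are
  isogenous.\<close>

lemma G4_sum_3:
  assumes r: "- (\<chi> 3 * S 3 3) = r"
  shows "pcong p ((\<Sum>n=0..p-1. rat_of_int (G4 n) / 16 ^ n)) (of_int (\<chi> (-2)) * (\<Sum>n=0..p-1. rat_of_int (G4 n) / 256 ^ n)) \<and>
    pcong p (of_int (\<chi> (-2)) * (\<Sum>n=0..p-1. rat_of_int (G4 n) / 256 ^ n)) (of_int r)"
proof (rule pcong_pair)
  have n: "\<not> int p dvd 16" "\<not> int p dvd 256" "\<not> int p dvd - 6" "\<not> int p dvd - 3"
    using not_dvd_23(2)[of 4 0] not_dvd_23(2)[of 8 0] not_dvd_23(1)[of 1 1] not_dvd_23(1)[of 0 1] by simp_all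
  have e: "\<chi> (-2) * \<chi> (-6) = \<chi> 3" by (rule chi_square_mult[OF not_dvd_2]) simp
  have 1: "S 3 3 = S (-6) (-3)" using S_isogeny[OF not_dvd_3, of 3] by simp
  have "pcong p (of_int 1 * (\<Sum>n=0..p-1. rat_of_int (G4 n) / of_int 16 ^ n)) (of_int r)"
  proof (rule G4_sum_S[of 3 16 3, OF _ n(1) not_dvd_3 not_dvd_3])
    show "cg p (1 * (- \<chi> 3 * S 3 3)) r" using r by simp
  qed simp
  thus "pcong p ((\<Sum>n=0..p-1. rat_of_int (G4 n) / 16 ^ n)) (of_int r)" by simp
  have "pcong p (of_int (\<chi> (-2)) * (\<Sum>n=0..p-1. rat_of_int (G4 n) / of_int 256 ^ n)) (of_int r)"
  proof (rule G4_sum_S[of "-3" 256 "-6", OF _ n(2-4)])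
    have "\<chi> (-2) * (- \<chi> (-6) * S (-6) (-3)) = r" using r unfolding 1 e[symmetric] by simp
    thus "cg p (\<chi> (-2) * (- \<chi> (-6) * S (-6) (-3))) r" by simp
  qed simp
  thus "pcong p (of_int (\<chi> (-2)) * (\<Sum>n=0..p-1. rat_of_int (G4 n) / 256 ^ n)) (of_int r)" by simp
qed

text \<open>2 * 128 = 16 * 4^2. Since m = -64 is its own partner under the isogeny, there is only
  one sum.\<close>

lemma G4_sum_8:
  assumes r: "- S 4 2 = r"
  shows "pcong p (\<Sum>n=0..p-1. rat_of_int (G4 n) / (-64) ^ n) (of_int r)"
proof -
  have n: "\<not> int p dvd - 64" using not_dvd_23(1)[of 6 0] by simp
  have c4: "\<chi> 4 = 1" using chi_mult[of 2 2] chi_sq[OF not_dvd_2] by simp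
  have "pcong p (of_int 1 * (\<Sum>n=0..p-1. rat_of_int (G4 n) / of_int (-64) ^ n)) (of_int r)"
  proof (rule G4_sum_S[of 2 "-64" 4, OF _ n not_dvd_4 not_dvd_2])
    show "cg p (1 * (- \<chi> 4 * S 4 2)) r" using r unfolding c4 by simp
  qed simp
  thus ?thesis by simp
qed

text \<open>The evaluations for p = 1 and p = 3 modulo 8 have opposite signs relative to (-1)^[p/8];
  the factor (-1)^((p-1)/2) accounts for this.\<close>

lemma S_D8:
  assumes p8: "p mod 8 \<in> {1, 3}" and uv: "int p = u\<^sup>2 + 2 * v\<^sup>2" and u: "4 dvd u - 1"
  shows "- S 4 2 = (-1) ^ (p div 8 + (p - 1) div 2) * 2 * u"
proof (cases "p mod 8 = 1")
  case True
  hence "p mod 4 = 1" by presburger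
  hence "even ((p - 1) div 2)" using h2_mod unfolding h2_def by blast
  thus ?thesis using S_D8_1[OF True uv u] by (simp add: power_add)
next
  case False
  hence p3: "p mod 8 = 3" using p8 by simp
  interpret prime_3_mod_8 p using p3 by unfold_locales
  have "p mod 4 = 3" using p3 by presburger
  hence "odd ((p - 1) div 2)" using h2_mod unfolding h2_def by blast
  thus ?thesis using S_D8_3[OF uv u] by (simp add: power_add)
qed

end

theorem theorem3p9:
  fixes p :: nat
  assumes "prime p" and "p > 3"
  shows "((\<forall>u v :: int. int p = u\<^sup>2 + 7 * v\<^sup>2 \<and> p mod 7 \<in> {1, 2, 4} \<and> Legendre u 7 = 1 \<longrightarrow>
          pcong p (of_int (Legendre (-3) (int p)) * (\<Sum>n=0..p-1. rat_of_int (G4 n)))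
                  (of_int (Legendre 6 (int p)) * (\<Sum>n=0..p-1. rat_of_int (G4 n) / 4096 ^ n)) \<and>
          pcong p (of_int (Legendre 6 (int p)) * (\<Sum>n=0..p-1. rat_of_int (G4 n) / 4096 ^ n)) (of_int (2 * u))) \<and>
        (p mod 7 \<in> {3, 5, 6} \<longrightarrow>
          pcong p (of_int (Legendre (-3) (int p)) * (\<Sum>n=0..p-1. rat_of_int (G4 n)))
                  (of_int (Legendre 6 (int p)) * (\<Sum>n=0..p-1. rat_of_int (G4 n) / 4096 ^ n)) \<and>
          pcong p (of_int (Legendre 6 (int p)) * (\<Sum>n=0..p-1. rat_of_int (G4 n) / 4096 ^ n)) 0)) \<and>
       ((\<forall>u v :: int. int p = u\<^sup>2 + 4 * v\<^sup>2 \<and> p mod 4 = 1 \<and> 4 dvd u - 1 \<longrightarrow>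
          pcong p (of_int (Legendre 6 (int p)) * (\<Sum>n=0..p-1. rat_of_int (G4 n) / (-8) ^ n))
                  (of_int (Legendre 3 (int p)) * (\<Sum>n=0..p-1. rat_of_int (G4 n) / (-512) ^ n)) \<and>
          pcong p (of_int (Legendre 3 (int p)) * (\<Sum>n=0..p-1. rat_of_int (G4 n) / (-512) ^ n)) (of_int (2 * u))) \<and>
        (p mod 4 = 3 \<longrightarrow>
          pcong p (of_int (Legendre 6 (int p)) * (\<Sum>n=0..p-1. rat_of_int (G4 n) / (-8) ^ n))
                  (of_int (Legendre 3 (int p)) * (\<Sum>n=0..p-1. rat_of_int (G4 n) / (-512) ^ n)) \<and>
          pcong p (of_int (Legendre 3 (int p)) * (\<Sum>n=0..p-1. rat_of_int (G4 n) / (-512) ^ n)) 0)) \<and>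
       ((\<forall>u v :: int. int p = u\<^sup>2 + 3 * v\<^sup>2 \<and> p mod 3 = 1 \<and> 3 dvd u - 1 \<longrightarrow>
          pcong p ((\<Sum>n=0..p-1. rat_of_int (G4 n) / 16 ^ n))
                  (of_int (Legendre (-2) (int p)) * (\<Sum>n=0..p-1. rat_of_int (G4 n) / 256 ^ n)) \<and>
          pcong p (of_int (Legendre (-2) (int p)) * (\<Sum>n=0..p-1. rat_of_int (G4 n) / 256 ^ n)) (of_int (2 * u))) \<and>
        (p mod 3 = 2 \<longrightarrow>
          pcong p ((\<Sum>n=0..p-1. rat_of_int (G4 n) / 16 ^ n))
                  (of_int (Legendre (-2) (int p)) * (\<Sum>n=0..p-1. rat_of_int (G4 n) / 256 ^ n)) \<and>
          pcong p (of_int (Legendre (-2) (int p)) * (\<Sum>n=0..p-1. rat_of_int (G4 n) / 256 ^ n)) 0)) \<and>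
       ((\<forall>u v :: int. int p = u\<^sup>2 + 2 * v\<^sup>2 \<and> p mod 8 \<in> {1, 3} \<and> 4 dvd u - 1 \<longrightarrow>
          pcong p (\<Sum>n=0..p-1. rat_of_int (G4 n) / (-64) ^ n) (of_int ((- 1) ^ (p div 8 + (p - 1) div 2) * 2 * u))) \<and>
        (p mod 8 \<in> {5, 7} \<longrightarrow>
          pcong p (\<Sum>n=0..p-1. rat_of_int (G4 n) / (-64) ^ n) 0))"
proof -
  interpret big_prime p using assms by unfold_locales
  show ?thesis
  proof (intro conjI[OF conjI conjI[OF conjI conjI[OF conjI conjI]]] allI impI; (elim conjE)?)
    fix u v :: int assume a: "int p = u\<^sup>2 + 7 * v\<^sup>2" "p mod 7 \<in> {1, 2, 4}" "Legendre u 7 = 1"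
    have "- (\<chi> (-7) * S 21 112) = 2 * u" using S_D7[OF a(2,1,3)] chi_m7(1)[OF a(2)] by simp
    thus "pcong p (of_int (\<chi> (-3)) * (\<Sum>n=0..p-1. rat_of_int (G4 n))) (of_int (\<chi> 6) * (\<Sum>n=0..p-1. rat_of_int (G4 n) / 4096 ^ n)) \<and>
      pcong p (of_int (\<chi> 6) * (\<Sum>n=0..p-1. rat_of_int (G4 n) / 4096 ^ n)) (of_int (2 * u))"
      using a(2) by (intro G4_sum_7) auto
  next
    assume a: "p mod 7 \<in> {3, 5, 6}"
    have "cg p ((- \<chi> (-7)) * S 21 112) ((- \<chi> (-7)) * 0)" by (intro cg_mult cg_refl S_D7_inert[OF a])
    hence "cg p (- (\<chi> (-7) * S 21 112)) 0" by simp
    from G4_sum_7[OF _ this] a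
    show "pcong p (of_int (\<chi> (-3)) * (\<Sum>n=0..p-1. rat_of_int (G4 n))) (of_int (\<chi> 6) * (\<Sum>n=0..p-1. rat_of_int (G4 n) / 4096 ^ n)) \<and>
      pcong p (of_int (\<chi> 6) * (\<Sum>n=0..p-1. rat_of_int (G4 n) / 4096 ^ n)) 0" by auto
  next
    fix u v :: int assume a: "int p = u\<^sup>2 + 4 * v\<^sup>2" "p mod 4 = 1" "4 dvd u - 1"
    show "pcong p (of_int (\<chi> 6) * (\<Sum>n=0..p-1. rat_of_int (G4 n) / (-8) ^ n)) (of_int (\<chi> 3) * (\<Sum>n=0..p-1. rat_of_int (G4 n) / (-512) ^ n)) \<and>
      pcong p (of_int (\<chi> 3) * (\<Sum>n=0..p-1. rat_of_int (G4 n) / (-512) ^ n)) (of_int (2 * u))"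
      using chi_uminus[of 2] chi_m1(1)[OF a(2)] by (intro G4_sum_4 S_D4[OF a(2,1,3)]) simp
  next
    assume "p mod 4 = 3"
    hence "S 0 (-1) = 0" by (rule S_D4_0)
    thus "pcong p (of_int (\<chi> 6) * (\<Sum>n=0..p-1. rat_of_int (G4 n) / (-8) ^ n)) (of_int (\<chi> 3) * (\<Sum>n=0..p-1. rat_of_int (G4 n) / (-512) ^ n)) \<and>
      pcong p (of_int (\<chi> 3) * (\<Sum>n=0..p-1. rat_of_int (G4 n) / (-512) ^ n)) 0"
      using G4_sum_4[of 0] by simp
  next
    fix u v :: int assume a: "int p = u\<^sup>2 + 3 * v\<^sup>2" "p mod 3 = 1" "3 dvd u - 1"
    have "\<chi> 3 * \<chi> (-1) = 1" using chi_uminus[of 3] chi_m3[OF a(2)] by (simp add: mult.commute)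
    hence "- (\<chi> 3 * S 3 3) = 2 * u" unfolding S_D3[OF a(2,1,3)] by (simp flip: mult.assoc)
    thus "pcong p ((\<Sum>n=0..p-1. rat_of_int (G4 n) / 16 ^ n)) (of_int (\<chi> (-2)) * (\<Sum>n=0..p-1. rat_of_int (G4 n) / 256 ^ n)) \<and>
      pcong p (of_int (\<chi> (-2)) * (\<Sum>n=0..p-1. rat_of_int (G4 n) / 256 ^ n)) (of_int (2 * u))" by (rule G4_sum_3)
  next
    assume "p mod 3 = 2"
    hence "S 3 3 = 0" by (rule S_D3_0)
    thus "pcong p ((\<Sum>n=0..p-1. rat_of_int (G4 n) / 16 ^ n)) (of_int (\<chi> (-2)) * (\<Sum>n=0..p-1. rat_of_int (G4 n) / 256 ^ n)) \<and>
      pcong p (of_int (\<chi> (-2)) * (\<Sum>n=0..p-1. rat_of_int (G4 n) / 256 ^ n)) 0" using G4_sum_3[of 0] by simp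
  next
    fix u v :: int assume a: "int p = u\<^sup>2 + 2 * v\<^sup>2" "p mod 8 \<in> {1, 3}" "4 dvd u - 1"
    show "pcong p (\<Sum>n=0..p-1. rat_of_int (G4 n) / (-64) ^ n) (of_int ((- 1) ^ (p div 8 + (p - 1) div 2) * 2 * u))"
      by (rule G4_sum_8[OF S_D8[OF a(2,1,3)]])
  next
    assume "p mod 8 \<in> {5, 7}"
    hence "S 4 2 = 0" by (intro S_D8_0) auto
    thus "pcong p (\<Sum>n=0..p-1. rat_of_int (G4 n) / (-64) ^ n) 0" using G4_sum_8[of 0] by simp
  qed
qed

end
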